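(* Let $T$ be a physical $N=6$ 3-algebra with zero center, and let $Lie\,T=Lie_{-1}T\oplus Lie_0T\oplus Lie_1T$ and $\sigma:Lie\,T\to Lie\,T$ be as constructed in the context. (a) $Lie\,T$ is a $\mathbb{Z}$-graded Lie superalgebra with a short consistent grading, satisfying the following two properties: (i) any non-zero $\mathbb{Z}$-graded ideal of $Lie\,T$ has a non-zero intersection with both $Lie_{-1}T$ and $Lie_1T$; (ii) $[Lie_{-1}T,Lie_1T]=Lie_0T$. (b) $\sigma$ is an anti-linear graded conjugation of the $\mathbb{Z}$-graded Lie superalgebra $Lie\,T$, and the 3-bracket on $T$ is recovered from the bracket on $Lie\,T$ by the formula $[x,y,z]=[[x,\sigma(y)],z]$. (c) The correspondence $T\mapsto(Lie\,T,\sigma)$ is bijective between the isomorphism classes of physical $N=6$ 3-algebras with zero center and the isomorphism classes of pairs $(\mathfrak{g},\sigma)$, where $\mathfrak{g}=\mathfrak{g}_{-1}\oplus\mathfrak{g}_0\oplus\mathfrak{g}_1$ is a $\mathbb{Z}$-graded Lie superalgebra with a short consistent grading satisfying properties (i) and (ii) (with $\mathfrak{g}_j$ in place of $Lie_jT$), and $\sigma$ is an anti-linear graded conjugation of $\mathfrak{g}$. (d) The 3-algebra $T$ is simple (resp. finite-dimensional, or linearly compact) if and only if $Lie\,T$ is.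
   Context: All vector spaces are over $\mathbb{C}$. A physical 3-algebra is a vector space $T$ with a 3-bracket $[a,b,c]\in T$ which is linear in $a$ and $c$ and anti-linear in $b$. It is a physical $N=6$ 3-algebra if for all elements $[a,b,c]=-[c,b,a]$ and $$[a,b,[x,y,z]]=[[a,b,x],y,z]-[x,[b,a,y],z]+[x,y,[a,b,z]].$$ An element $b\in T$ is central if $[a,b,c]=0$ for all $a,c\in T$; the center is the subspace of central elements. $T$ is simple if it has no nontrivial ideals and is not the one-dimensional 3-algebra with zero bracket (by definition simplicity means that the operators $L_{x,y}$ below have no common non-trivial invariant subspace). A topological (super)algebra or 3-algebra is linearly compact if its underlying topological space is linearly compact (a topological product of finite-dimensional discrete spaces) and its operations are continuous. A $\mathbb{Z}$-grading of a Lie superalgebra $\mathfrak{g}$ is consistent if $\mathfrak{g}_j$ is even for $j$ even and odd for $j$ odd; it is short if $\mathfrak{g}=\mathfrak{g}_{-1}\oplus\mathfrak{g}_0\oplus\mathfrak{g}_1$. An anti-linear graded conjugation of a consistently $\mathbb{Z}$-graded Lie superalgebra $\mathfrak{g}$ is an anti-linear Lie superalgebra automorphism $\varphi$ with $\varphi(\mathfrak{g}_j)=\mathfrak{g}_{-j}$ and $\varphi^2(x)=(-1)^kx$ for $x\in\mathfrak{g}_k$. Isomorphisms of pairs $(\mathfrak g,\sigma)$ are graded Lie superalgebra isomorphisms intertwining the conjugations. Construction of $Lie\,T$. $\Pi$ denotes parity reversal, so that $\Pi T$ is purely odd. For $x,y\in T$ let $L_{x,y}\in End(T)$, $L_{x,y}(z)=[x,y,z]$,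 and for $x\in T$ let $\varphi_x\in Hom(\Pi T\otimes\Pi T,\Pi T)$, $\varphi_x(y,z)=-[y,x,z]$. Put $Lie_{-1}T=\Pi T$ (odd), $Lie_0T=\langle L_{x,y}\mid x,y\in T\rangle$ (even), $Lie_1T=\langle\varphi_x\mid x\in T\rangle$ (odd), where $\langle\cdot\rangle$ denotes linear span. The bracket is: $[\Pi T,\Pi T]=0$; $[L_{x,y},z]=[x,y,z]$; $[\varphi_x,z]=-L_{z,x}$; on $Lie_0T$ the commutator of operators; $[L_{x,y},\varphi_z]=-\varphi_{[y,x,z]}$; $[\varphi_x,\varphi_y]=0$ ($x,y,z\in T$). The map $\sigma:Lie\,T\to Lie\,T$ is the anti-linear extension of $z\mapsto-\varphi_z$, $\varphi_z\mapsto z$, $L_{x,y}\mapsto-L_{y,x}$ (well defined because the center of $T$ is zero). In $(b)$, elements of $T$ are identified with elements of $Lie_{-1}T=\Pi T$.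
   Formalization: In (d), linearly compact case, Lie_0 T is the closure (pointwise convergence) of the span of the L_{x,y}, and Lie T has the topology induced from T; with the algebraic span "T ⇒ Lie T" fails, e.g. T=∏C^n (n≥2), [x,y,z]=⟨x,y⟩z−⟨z,y⟩x; only "Lie T ⇒ T" is kept for that span. *)

theory Defs
  imports "HOL-Analysis.Analysis" "HOL-Library.Function_Algebras" "HOL-Library.Z2"
begin

section \<open>Complex vector spaces on a carrier\<close>

text \<open>
  A complex vector space is a subspace \<open>V\<close> of a type that is a vector space under \<open>s\<close>.  Maps
  between two such spaces are total functions of which only the values on the carrier matter.
  For \<open>V = UNIV\<close> this covers every vector space structure on a type; proper
  subspaces are needed because \<open>\<g>\<^sub>-\<^sub>1\<close> has to be a 3-algebra again.
\<close>

definition cspace :: "(complex \<Rightarrow> 'a::ab_group_add \<Rightarrow> 'a) \<Rightarrow> 'a set \<Rightarrow> bool" where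
  "cspace s V \<longleftrightarrow> vector_space s \<and> module.subspace s V"

definition linear_map ::
  "'a set \<Rightarrow> (complex \<Rightarrow> 'a \<Rightarrow> 'a) \<Rightarrow> (complex \<Rightarrow> 'b \<Rightarrow> 'b)
    \<Rightarrow> ('a::ab_group_add \<Rightarrow> 'b::ab_group_add) \<Rightarrow> bool" where
  "linear_map V s s' f \<longleftrightarrow>
     (\<forall>x\<in>V. \<forall>y\<in>V. f (x + y) = f x + f y) \<and> (\<forall>c. \<forall>x\<in>V. f (s c x) = s' c (f x))"

definition antilinear_map ::
  "'a set \<Rightarrow> (complex \<Rightarrow> 'a \<Rightarrow> 'a) \<Rightarrow> (complex \<Rightarrow> 'b \<Rightarrow> 'b)
    \<Rightarrow> ('a::ab_group_add \<Rightarrow> 'b::ab_group_add) \<Rightarrow> bool" where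
  "antilinear_map V s s' f \<longleftrightarrow>
     (\<forall>x\<in>V. \<forall>y\<in>V. f (x + y) = f x + f y) \<and> (\<forall>c. \<forall>x\<in>V. f (s c x) = s' (cnj c) (f x))"

definition fin_dim :: "(complex \<Rightarrow> 'a::ab_group_add \<Rightarrow> 'a) \<Rightarrow> 'a set \<Rightarrow> bool" where
  "fin_dim s V \<longleftrightarrow> (\<exists>B. finite B \<and> B \<subseteq> V \<and> module.span s B = V)"


section \<open>Physical N = 6 3-algebras\<close>

record 'a alg3 =
  tcar :: "'a set"
  tscl :: "complex \<Rightarrow> 'a \<Rightarrow> 'a"
  tbr  :: "'a \<Rightarrow> 'a \<Rightarrow> 'a \<Rightarrow> 'a"

definition physical_alg3 :: "'a::ab_group_add alg3 \<Rightarrow> bool" where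
  "physical_alg3 T \<longleftrightarrow>
     cspace (tscl T) (tcar T) \<and>
     (\<forall>a\<in>tcar T. \<forall>b\<in>tcar T. \<forall>c\<in>tcar T. tbr T a b c \<in> tcar T) \<and>
     (\<forall>b\<in>tcar T. \<forall>c\<in>tcar T. linear_map (tcar T) (tscl T) (tscl T) (\<lambda>a. tbr T a b c)) \<and>
     (\<forall>a\<in>tcar T. \<forall>c\<in>tcar T. antilinear_map (tcar T) (tscl T) (tscl T) (\<lambda>b. tbr T a b c)) \<and>
     (\<forall>a\<in>tcar T. \<forall>b\<in>tcar T. linear_map (tcar T) (tscl T) (tscl T) (\<lambda>c. tbr T a b c))"

definition physical_N6 :: "'a::ab_group_add alg3 \<Rightarrow> bool" where
  "physical_N6 T \<longleftrightarrow>
     physical_alg3 T \<and>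
     (\<forall>a\<in>tcar T. \<forall>b\<in>tcar T. \<forall>c\<in>tcar T. tbr T a b c = - tbr T c b a) \<and>
     (\<forall>a\<in>tcar T. \<forall>b\<in>tcar T. \<forall>x\<in>tcar T. \<forall>y\<in>tcar T. \<forall>z\<in>tcar T.
        tbr T a b (tbr T x y z) =
          tbr T (tbr T a b x) y z - tbr T x (tbr T b a y) z + tbr T x y (tbr T a b z))"

definition center3 :: "'a::ab_group_add alg3 \<Rightarrow> 'a set" where
  "center3 T = {b \<in> tcar T. \<forall>a\<in>tcar T. \<forall>c\<in>tcar T. tbr T a b c = 0}"

text \<open>Ideals are the common invariant subspaces of the operators \<open>z \<mapsto> [x,y,z]\<close>.\<close>

definition ideal3 :: "'a::ab_group_add alg3 \<Rightarrow> 'a set \<Rightarrow> bool" where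
  "ideal3 T I \<longleftrightarrow>
     module.subspace (tscl T) I \<and> I \<subseteq> tcar T \<and>
     (\<forall>x\<in>tcar T. \<forall>y\<in>tcar T. \<forall>u\<in>I. tbr T x y u \<in> I)"

definition simple3 :: "'a::ab_group_add alg3 \<Rightarrow> bool" where
  "simple3 T \<longleftrightarrow>
     tcar T \<noteq> {0} \<and>
     (\<forall>I. ideal3 T I \<longrightarrow> I = {0} \<or> I = tcar T) \<and>
     \<not> ((\<exists>e. e \<noteq> 0 \<and> tcar T = module.span (tscl T) {e}) \<and>
        (\<forall>a\<in>tcar T. \<forall>b\<in>tcar T. \<forall>c\<in>tcar T. tbr T a b c = 0))"

definition iso3 :: "'a::ab_group_add alg3 \<Rightarrow> 'b::ab_group_add alg3 \<Rightarrow> bool" where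
  "iso3 T T' \<longleftrightarrow>
     (\<exists>f. bij_betw f (tcar T) (tcar T') \<and>
          linear_map (tcar T) (tscl T) (tscl T') f \<and>
          (\<forall>x\<in>tcar T. \<forall>y\<in>tcar T. \<forall>z\<in>tcar T. f (tbr T x y z) = tbr T' (f x) (f y) (f z)))"


section \<open>Graded Lie superalgebras\<close>

text \<open>\<open>lsd 0\<close> and \<open>lsd 1\<close> are the even and the odd part, \<open>lgr j\<close> is the component of degree \<open>j\<close>.\<close>

record 'b lsa =
  lcar :: "'b set"
  lscl :: "complex \<Rightarrow> 'b \<Rightarrow> 'b"
  lbr  :: "'b \<Rightarrow> 'b \<Rightarrow> 'b"
  lsd  :: "bit \<Rightarrow> 'b set"
  lgr  :: "int \<Rightarrow> 'b set"

definition psign :: "bit \<Rightarrow> bit \<Rightarrow> 'b::ab_group_add \<Rightarrow> 'b" where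
  "psign p q x = (if p * q = 1 then - x else x)"

definition lie_superalgebra :: "'b::ab_group_add lsa \<Rightarrow> bool" where
  "lie_superalgebra g \<longleftrightarrow>
     cspace (lscl g) (lcar g) \<and>
     (\<forall>p. module.subspace (lscl g) (lsd g p) \<and> lsd g p \<subseteq> lcar g) \<and>
     lsd g 0 \<inter> lsd g 1 = {0} \<and>
     (\<forall>x\<in>lcar g. \<exists>u\<in>lsd g 0. \<exists>v\<in>lsd g 1. x = u + v) \<and>
     (\<forall>x\<in>lcar g. \<forall>y\<in>lcar g. lbr g x y \<in> lcar g) \<and>
     (\<forall>y\<in>lcar g. linear_map (lcar g) (lscl g) (lscl g) (\<lambda>x. lbr g x y)) \<and>
     (\<forall>x\<in>lcar g. linear_map (lcar g) (lscl g) (lscl g) (\<lambda>y. lbr g x y)) \<and>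
     (\<forall>p q. \<forall>x\<in>lsd g p. \<forall>y\<in>lsd g q. lbr g x y \<in> lsd g (p + q)) \<and>
     (\<forall>p q. \<forall>x\<in>lsd g p. \<forall>y\<in>lsd g q. lbr g x y = - psign p q (lbr g y x)) \<and>
     (\<forall>p q. \<forall>x\<in>lsd g p. \<forall>y\<in>lsd g q. \<forall>z\<in>lcar g.
        lbr g x (lbr g y z) = lbr g (lbr g x y) z + psign p q (lbr g y (lbr g x z)))"

definition z_graded :: "'b::ab_group_add lsa \<Rightarrow> bool" where
  "z_graded g \<longleftrightarrow>
     (\<forall>j. module.subspace (lscl g) (lgr g j) \<and> lgr g j \<subseteq> lcar g) \<and>
     (\<forall>j. \<forall>x\<in>lgr g j. \<exists>u\<in>lgr g j \<inter> lsd g 0. \<exists>v\<in>lgr g j \<inter> lsd g 1. x = u + v) \<and>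
     (\<forall>x\<in>lcar g. \<exists>!f. (\<forall>j. f j \<in> lgr g j) \<and> finite {j. f j \<noteq> 0} \<and> x = (\<Sum>j | f j \<noteq> 0. f j)) \<and>
     (\<forall>i j. \<forall>x\<in>lgr g i. \<forall>y\<in>lgr g j. lbr g x y \<in> lgr g (i + j))"

definition z_graded_lie_superalgebra :: "'b::ab_group_add lsa \<Rightarrow> bool" where
  "z_graded_lie_superalgebra g \<longleftrightarrow> lie_superalgebra g \<and> z_graded g"

definition consistent_grading :: "'b::ab_group_add lsa \<Rightarrow> bool" where
  "consistent_grading g \<longleftrightarrow> (\<forall>j. lgr g j \<subseteq> lsd g (if even j then 0 else 1))"

definition short_grading :: "'b::ab_group_add lsa \<Rightarrow> bool" where
  "short_grading g \<longleftrightarrow> (\<forall>j. j \<notin> {-1, 0, 1} \<longrightarrow> lgr g j = {0})"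

text \<open>As usual for superalgebras, ideals are required to be graded by parity.\<close>

definition lsa_ideal :: "'b::ab_group_add lsa \<Rightarrow> 'b set \<Rightarrow> bool" where
  "lsa_ideal g I \<longleftrightarrow>
     module.subspace (lscl g) I \<and> I \<subseteq> lcar g \<and>
     (\<forall>x\<in>I. \<exists>u\<in>I \<inter> lsd g 0. \<exists>v\<in>I \<inter> lsd g 1. x = u + v) \<and>
     (\<forall>x\<in>lcar g. \<forall>y\<in>I. lbr g x y \<in> I)"

definition z_graded_ideal :: "'b::ab_group_add lsa \<Rightarrow> 'b set \<Rightarrow> bool" where
  "z_graded_ideal g I \<longleftrightarrow> lsa_ideal g I \<and> I = module.span (lscl g) (\<Union>j. I \<inter> lgr g j)"

definition simple_lsa :: "'b::ab_group_add lsa \<Rightarrow> bool" where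
  "simple_lsa g \<longleftrightarrow>
     (\<forall>I. lsa_ideal g I \<longrightarrow> I = {0} \<or> I = lcar g) \<and>
     (\<exists>x\<in>lcar g. \<exists>y\<in>lcar g. lbr g x y \<noteq> 0)"

definition ideals_meet_ends :: "'b::ab_group_add lsa \<Rightarrow> bool" where
  "ideals_meet_ends g \<longleftrightarrow>
     (\<forall>I. z_graded_ideal g I \<and> I \<noteq> {0} \<longrightarrow> I \<inter> lgr g (-1) \<noteq> {0} \<and> I \<inter> lgr g 1 \<noteq> {0})"

definition ends_generate :: "'b::ab_group_add lsa \<Rightarrow> bool" where
  "ends_generate g \<longleftrightarrow>
     module.span (lscl g) {lbr g x y | x y. x \<in> lgr g (-1) \<and> y \<in> lgr g 1} = lgr g 0"

definition graded_conjugation :: "'b::ab_group_add lsa \<Rightarrow> ('b \<Rightarrow> 'b) \<Rightarrow> bool" where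
  "graded_conjugation g \<phi> \<longleftrightarrow>
     bij_betw \<phi> (lcar g) (lcar g) \<and>
     antilinear_map (lcar g) (lscl g) (lscl g) \<phi> \<and>
     (\<forall>x\<in>lcar g. \<forall>y\<in>lcar g. \<phi> (lbr g x y) = lbr g (\<phi> x) (\<phi> y)) \<and>
     (\<forall>p. \<phi> ` lsd g p = lsd g p) \<and>
     (\<forall>j. \<phi> ` lgr g j = lgr g (- j)) \<and>
     (\<forall>k. \<forall>x\<in>lgr g k. \<phi> (\<phi> x) = (if even k then x else - x))"

definition iso_pair ::
  "'b::ab_group_add lsa \<Rightarrow> ('b \<Rightarrow> 'b) \<Rightarrow> 'c::ab_group_add lsa \<Rightarrow> ('c \<Rightarrow> 'c) \<Rightarrow> bool" where
  "iso_pair g \<sigma> g' \<sigma>' \<longleftrightarrow>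
     (\<exists>f. bij_betw f (lcar g) (lcar g') \<and>
          linear_map (lcar g) (lscl g) (lscl g') f \<and>
          (\<forall>x\<in>lcar g. \<forall>y\<in>lcar g. f (lbr g x y) = lbr g' (f x) (f y)) \<and>
          (\<forall>p. f ` lsd g p = lsd g' p) \<and>
          (\<forall>j. f ` lgr g j = lgr g' j) \<and>
          (\<forall>x\<in>lcar g. f (\<sigma> x) = \<sigma>' (f x)))"


section \<open>The Lie superalgebra of a 3-algebra\<close>

text \<open>
  Operators \<open>T \<rightarrow> T\<close> and \<open>\<Pi>T \<times> \<Pi>T \<rightarrow> \<Pi>T\<close> are represented by total functions that vanish outside
  the carrier, so that equality of functions is equality of operators on \<open>T\<close>.
\<close>

definition Lop :: "'a::ab_group_add alg3 \<Rightarrow> 'a \<Rightarrow> 'a \<Rightarrow> 'a \<Rightarrow> 'a" where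
  "Lop T x y = (\<lambda>z. if z \<in> tcar T then tbr T x y z else 0)"

definition phi :: "'a::ab_group_add alg3 \<Rightarrow> 'a \<Rightarrow> 'a \<Rightarrow> 'a \<Rightarrow> 'a" where
  "phi T x = (\<lambda>y z. if y \<in> tcar T \<and> z \<in> tcar T then - tbr T y x z else 0)"

definition Lspan :: "'a::ab_group_add alg3 \<Rightarrow> ('a \<Rightarrow> 'a) set" where
  "Lspan T = module.span (\<lambda>c A z. tscl T c (A z)) {Lop T x y | x y. x \<in> tcar T \<and> y \<in> tcar T}"

definition phi_span :: "'a::ab_group_add alg3 \<Rightarrow> ('a \<Rightarrow> 'a \<Rightarrow> 'a) set" where
  "phi_span T = module.span (\<lambda>c \<psi> y z. tscl T c (\<psi> y z)) {phi T x | x. x \<in> tcar T}"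

text \<open>
  An element of the Lie superalgebra is the triple of its components in degrees -1, 0, 1.
  The bracket uses the uniform formulas \<open>[A, z] = A z\<close>, \<open>[\<psi>, z] = [z, \<psi>] = \<psi>(z, \<cdot>)\<close> and
  \<open>[A, \<psi>] (v, w) = A \<psi>(v, w) - \<psi>(A v, w) - \<psi>(v, A w)\<close>, for which no choice of a representation of
  \<open>A\<close> or \<open>\<psi>\<close> by elements of \<open>T\<close> is needed.  The lemmas \<open>lie_bracket_generators\<close> below show that
  on the generators \<open>L\<^bsub>x,y\<^esub>\<close>, \<open>\<phi>\<^sub>x\<close> they are \<open>[L\<^bsub>x,y\<^esub>, z] = [x,y,z]\<close>, \<open>[\<phi>\<^sub>x, z] = - L\<^bsub>z,x\<^esub>\<close> and
  \<open>[L\<^bsub>x,y\<^esub>, \<phi>\<^sub>z] = - \<phi>\<^bsub>[y,x,z]\<^esub>\<close>.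
\<close>

type_synonym 'a lie_elem = "'a \<times> ('a \<Rightarrow> 'a) \<times> ('a \<Rightarrow> 'a \<Rightarrow> 'a)"

definition act01 :: "('a \<Rightarrow> 'a) \<Rightarrow> ('a \<Rightarrow> 'a \<Rightarrow> 'a) \<Rightarrow> ('a \<Rightarrow> 'a \<Rightarrow> 'a::ab_group_add)" where
  "act01 A \<psi> = (\<lambda>v w. A (\<psi> v w) - \<psi> (A v) w - \<psi> v (A w))"

definition lie_bracket :: "'a::ab_group_add lie_elem \<Rightarrow> 'a lie_elem \<Rightarrow> 'a lie_elem" where
  "lie_bracket = (\<lambda>(z, A, \<psi>) (z', A', \<psi>').
     (A z' - A' z,
      (A \<circ> A') - (A' \<circ> A) + \<psi> z' + \<psi>' z,
      act01 A \<psi>' - act01 A' \<psi>))"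

definition lie_scale :: "(complex \<Rightarrow> 'a \<Rightarrow> 'a) \<Rightarrow> complex \<Rightarrow> 'a lie_elem \<Rightarrow> 'a lie_elem" where
  "lie_scale s c = (\<lambda>(z, A, \<psi>). (s c z, (\<lambda>v. s c (A v)), (\<lambda>v w. s c (\<psi> v w))))"

text \<open>\<open>D\<close> is the space of operators put in degree 0.\<close>

definition lie_with :: "'a::ab_group_add alg3 \<Rightarrow> ('a \<Rightarrow> 'a) set \<Rightarrow> 'a lie_elem lsa" where
  "lie_with T D = \<lparr>
     lcar = {(z, A, \<psi>). z \<in> tcar T \<and> A \<in> D \<and> \<psi> \<in> phi_span T},
     lscl = lie_scale (tscl T),
     lbr = lie_bracket,
     lsd = (\<lambda>p. if p = 0 then {(0, A, 0) | A. A \<in> D}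
                else {(z, 0, \<psi>) | z \<psi>. z \<in> tcar T \<and> \<psi> \<in> phi_span T}),
     lgr = (\<lambda>j. if j = -1 then {(z, 0, 0) | z. z \<in> tcar T}
                else if j = 0 then {(0, A, 0) | A. A \<in> D}
                else if j = 1 then {(0, 0, \<psi>) | \<psi>. \<psi> \<in> phi_span T}
                else {0}) \<rparr>"

definition Lie :: "'a::ab_group_add alg3 \<Rightarrow> 'a lie_elem lsa" where
  "Lie T = lie_with T (Lspan T)"

definition in_m1 :: "'a::ab_group_add \<Rightarrow> 'a lie_elem" where
  "in_m1 z = (z, 0, 0)"

definition in_0 :: "('a \<Rightarrow> 'a) \<Rightarrow> 'a::ab_group_add lie_elem" where
  "in_0 A = (0, A, 0)"

definition in_1 :: "('a \<Rightarrow> 'a \<Rightarrow> 'a) \<Rightarrow> 'a::ab_group_add lie_elem" where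
  "in_1 \<psi> = (0, 0, \<psi>)"

text \<open>The value 0 off the carrier only serves to make the total function \<open>\<sigma>\<close> unique.\<close>

definition lie_sigma :: "'a::ab_group_add alg3 \<Rightarrow> 'a lie_elem \<Rightarrow> 'a lie_elem" where
  "lie_sigma T = (THE s.
     antilinear_map (lcar (Lie T)) (lscl (Lie T)) (lscl (Lie T)) s \<and>
     (\<forall>z\<in>tcar T. s (in_m1 z) = in_1 (- phi T z)) \<and>
     (\<forall>z\<in>tcar T. s (in_1 (phi T z)) = in_m1 z) \<and>
     (\<forall>x\<in>tcar T. \<forall>y\<in>tcar T. s (in_0 (Lop T x y)) = in_0 (- Lop T y x)) \<and>
     (\<forall>u. u \<notin> lcar (Lie T) \<longrightarrow> s u = 0))"

lemma lie_bracket_generators: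
  assumes "physical_N6 T" and "x \<in> tcar T" "y \<in> tcar T" "z \<in> tcar T"
  shows "lie_bracket (in_m1 x) (in_m1 y) = 0"
    and "lie_bracket (in_0 (Lop T x y)) (in_m1 z) = in_m1 (tbr T x y z)"
    and "lie_bracket (in_1 (phi T x)) (in_m1 z) = in_0 (- Lop T z x)"
    and "lie_bracket (in_m1 z) (in_1 (phi T x)) = in_0 (- Lop T z x)"
    and "lie_bracket (in_0 (Lop T x y)) (in_1 (phi T z)) = in_1 (- phi T (tbr T y x z))"
    and "lie_bracket (in_1 (phi T z)) (in_0 (Lop T x y)) = in_1 (phi T (tbr T y x z))"
    and "lie_bracket (in_1 (phi T x)) (in_1 (phi T y)) = 0"
proof -
  have sub: "module.subspace (tscl T) (tcar T)" and mod: "module (tscl T)"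
    using assms(1) unfolding physical_N6_def physical_alg3_def cspace_def vector_space_def module_def
    by (blast, simp)
  have zero: "(0::'a) \<in> tcar T"
    by (rule module.subspace_0[OF mod sub])
  have add0: "f 0 = 0" if "linear_map (tcar T) (tscl T) (tscl T) f" for f
  proof -
    have "f (0 + 0) = f 0 + f 0"
      using that zero unfolding linear_map_def by blast
    then show ?thesis by simp
  qed
  have cl: "tbr T a b c \<in> tcar T" if "a \<in> tcar T" "b \<in> tcar T" "c \<in> tcar T" for a b c
    using assms(1) that unfolding physical_N6_def physical_alg3_def by blast
  have z1: "tbr T 0 b c = 0" if "b \<in> tcar T" "c \<in> tcar T" for b c
    using assms(1) that add0[of "\<lambda>a. tbr T a b c"] unfolding physical_N6_def physical_alg3_def by blast
  have z3: "tbr T a b 0 = 0" if "a \<in> tcar T" "b \<in> tcar T" for a b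
    using assms(1) that add0[of "\<lambda>c. tbr T a b c"] unfolding physical_N6_def physical_alg3_def by blast
  have neg: "tbr T a b (- c) = - tbr T a b c" if "a \<in> tcar T" "b \<in> tcar T" "c \<in> tcar T" for a b c
  proof -
    have m: "- c \<in> tcar T"
      by (rule module.subspace_neg[OF mod sub that(3)])
    have "tbr T a b (c + (- c)) = tbr T a b c + tbr T a b (- c)"
      using assms(1) that m unfolding physical_N6_def physical_alg3_def linear_map_def by blast
    then show ?thesis
      using z3[OF that(1,2)] by (simp add: eq_neg_iff_add_eq_0 add.commute)
  qed
  have negm: "- c \<in> tcar T" if "c \<in> tcar T" for c
    by (rule module.subspace_neg[OF mod sub that])
  have fi: "tbr T a b (tbr T u v w) =
      tbr T (tbr T a b u) v w - tbr T u (tbr T b a v) w + tbr T u v (tbr T a b w)"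
    if "a \<in> tcar T" "b \<in> tcar T" "u \<in> tcar T" "v \<in> tcar T" "w \<in> tcar T" for a b u v w
    using assms(1) that unfolding physical_N6_def by blast
  have act: "act01 (Lop T x y) (phi T z) = - phi T (tbr T y x z)"
  proof (intro ext)
    fix v w
    show "act01 (Lop T x y) (phi T z) v w = (- phi T (tbr T y x z)) v w"
    proof (cases "v \<in> tcar T \<and> w \<in> tcar T")
      case True
      then have "tbr T x y (tbr T v z w) = tbr T (tbr T x y v) z w - tbr T v (tbr T y x z) w
          + tbr T v z (tbr T x y w)"
        using fi assms(2-4) by blast
      then show ?thesis
        using True assms(2-4) by (simp add: act01_def Lop_def phi_def cl neg negm)
    next
      case False
      then show ?thesis
        using assms(2-4) zero by (auto simp: act01_def Lop_def phi_def cl z1 z3)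
    qed
  qed
  note defs = lie_bracket_def in_m1_def in_0_def in_1_def
  have act': "act01 A 0 = 0" if "A 0 = 0" for A :: "'a \<Rightarrow> 'a"
    using that by (simp add: act01_def fun_eq_iff)
  have act0: "act01 0 \<psi> = 0" if "\<And>v. \<psi> 0 v = 0" "\<And>v. \<psi> v 0 = 0" for \<psi> :: "'a \<Rightarrow> 'a \<Rightarrow> 'a"
    using that by (simp add: act01_def fun_eq_iff)
  have L0: "Lop T a b 0 = 0" if "a \<in> tcar T" "b \<in> tcar T" for a b
    using that by (simp add: Lop_def z3)
  have phi0: "phi T a 0 v = 0" "phi T a v 0 = 0" if "a \<in> tcar T" for a v
    using that by (simp_all add: phi_def z1 z3)
  have phi0': "phi T a 0 = 0" if "a \<in> tcar T" for a
    using that phi0 by (simp add: fun_eq_iff)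
  have phiL: "phi T a b = - Lop T b a" if "b \<in> tcar T" for a b
    using that by (simp add: phi_def Lop_def fun_eq_iff)
  have comp0: "A \<circ> 0 = 0" "0 \<circ> A = 0" if "A 0 = 0" for A :: "'a \<Rightarrow> 'a"
    using that by (simp_all add: fun_eq_iff)
  note rules = act act' act0 L0 phi0 phi0' comp0 assms(2-4)
  show "lie_bracket (in_m1 x) (in_m1 y) = 0"
    by (simp add: defs rules zero_prod_def)
  show "lie_bracket (in_0 (Lop T x y)) (in_m1 z) = in_m1 (tbr T x y z)"
    by (simp add: defs rules) (simp add: Lop_def assms(2-4))
  show "lie_bracket (in_1 (phi T x)) (in_m1 z) = in_0 (- Lop T z x)"
    "lie_bracket (in_m1 z) (in_1 (phi T x)) = in_0 (- Lop T z x)"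
    by (simp_all add: defs rules phiL)
  show "lie_bracket (in_0 (Lop T x y)) (in_1 (phi T z)) = in_1 (- phi T (tbr T y x z))"
    "lie_bracket (in_1 (phi T z)) (in_0 (Lop T x y)) = in_1 (phi T (tbr T y x z))"
    by (simp_all add: defs rules)
  show "lie_bracket (in_1 (phi T x)) (in_1 (phi T y)) = 0"
    by (simp add: defs rules zero_prod_def)
qed


section \<open>Linear compactness\<close>

definition Cn :: "nat \<Rightarrow> (nat \<Rightarrow> complex) set" where
  "Cn n = {v. \<forall>k\<ge>n. v k = 0}"

text \<open>
  A product of finite-dimensional discrete spaces.  Non-zero factors contribute distinct vectors,
  so the index set can be taken in the type of the space itself.
\<close>

definition lin_compact ::
  "(complex \<Rightarrow> 'a \<Rightarrow> 'a) \<Rightarrow> 'a::ab_group_add set \<Rightarrow> 'a topology \<Rightarrow> bool" where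
  "lin_compact s V \<tau> \<longleftrightarrow>
     cspace s V \<and> topspace \<tau> = V \<and>
     (\<exists>(J :: 'a set) (d :: 'a \<Rightarrow> nat) (f :: 'a \<Rightarrow> 'a \<Rightarrow> nat \<Rightarrow> complex).
        homeomorphic_map \<tau> (product_topology (\<lambda>j. discrete_topology (Cn (d j))) J) f \<and>
        (\<forall>j\<in>J. linear_map V s (\<lambda>c v k. c * v k) (\<lambda>x. f x j)))"

definition lin_compact_alg3 :: "'a::ab_group_add alg3 \<Rightarrow> 'a topology \<Rightarrow> bool" where
  "lin_compact_alg3 T \<tau> \<longleftrightarrow>
     lin_compact (tscl T) (tcar T) \<tau> \<and>
     continuous_map (prod_topology \<tau> (prod_topology \<tau> \<tau>)) \<tau> (\<lambda>(x, y, z). tbr T x y z)"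

definition lin_compact_lsa :: "'b::ab_group_add lsa \<Rightarrow> 'b topology \<Rightarrow> bool" where
  "lin_compact_lsa g \<tau> \<longleftrightarrow>
     lie_superalgebra g \<and> lin_compact (lscl g) (lcar g) \<tau> \<and>
     continuous_map (prod_topology \<tau> \<tau>) \<tau> (\<lambda>(x, y). lbr g x y)"

text \<open>
  For a topology \<open>\<tau>\<close> on \<open>T\<close>, operators carry the topology of pointwise convergence.  In the
  topological setting the span in degree 0 is the closed one.  With the algebraic span, a linearly
  compact \<open>T\<close> need not have a linearly compact \<open>Lie T\<close>: for \<open>T = \<Prod>\<^sub>n \<complex>\<^sup>n\<close>, \<open>n \<ge> 2\<close>, with
  \<open>[x,y,z] = \<langle>x,y\<rangle> z - \<langle>z,y\<rangle> x\<close> in each factor, the algebraic span consists of the sequences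
  \<open>tr(M\<^sub>n) I - M\<^sub>n\<close> with \<open>M\<^sub>n\<close> of bounded rank, a proper dense subspace of \<open>\<Prod>\<^sub>n gl\<^sub>n\<close>.
\<close>

definition Lspan_closed :: "'a::ab_group_add alg3 \<Rightarrow> 'a topology \<Rightarrow> ('a \<Rightarrow> 'a) set" where
  "Lspan_closed T \<tau> =
     {A. (\<forall>z. z \<notin> tcar T \<longrightarrow> A z = 0) \<and>
         restrict A (tcar T) \<in>
           product_topology (\<lambda>_. \<tau>) (tcar T) closure_of ((\<lambda>A. restrict A (tcar T)) ` Lspan T)}"

definition Lie_closed :: "'a::ab_group_add alg3 \<Rightarrow> 'a topology \<Rightarrow> 'a lie_elem lsa" where
  "Lie_closed T \<tau> = lie_with T (Lspan_closed T \<tau>)"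

text \<open>
  The product of \<open>\<tau>\<close> on degree -1, pointwise convergence on degree 0 and, on degree 1, \<open>\<tau>\<close>
  transported by \<open>x \<mapsto> \<phi>\<^sub>x\<close> (injective on \<open>T\<close> when the center is zero).
\<close>

definition lie_topology ::
  "'a::ab_group_add alg3 \<Rightarrow> 'a topology \<Rightarrow> 'a lie_elem set \<Rightarrow> 'a lie_elem topology" where
  "lie_topology T \<tau> G =
     pullback_topology G
       (\<lambda>(z, A, \<psi>). (z, restrict A (tcar T), inv_into (tcar T) (phi T) \<psi>))
       (prod_topology \<tau> (prod_topology (product_topology (\<lambda>_. \<tau>) (tcar T)) \<tau>))"

end

theory Submission
  imports Defs
begin

text \<open>
  The Lie superalgebra of \<open>T\<close> consists of operators acting on \<open>T\<close>, and with zero center nothing is lost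
  in this picture.  An operator \<open>A\<close> that satisfies the fundamental identity together with some operator
  \<open>B\<close>, \<open>A[x,y,z] = [Ax,y,z] - [x,By,z] + [x,y,Az]\<close>, determines \<open>B\<close>, which is called its adjoint.  The adjoint of
  \<open>L\<^bsub>x,y\<^esub>\<close> is \<open>L\<^bsub>y,x\<^esub>\<close>, and \<open>[A, \<phi>\<^sub>x] = - \<phi>\<^bsub>adj A x\<^esub>\<close> (\<open>act01_phi\<close>).  The Jacobi identities are then
  identities between compositions of operators, except for those with two odd elements, which reflect the
  antisymmetry of the 3-bracket (\<open>act01_forms\<close>).  The conjugation is \<open>(z, A, \<phi>\<^sub>x) \<mapsto> (x, - adj A, - \<phi>\<^sub>z)\<close>; it
  is multiplicative because taking adjoints is an antilinear involution that reverses commutators.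

  An element of degree -1 also acts faithfully by brackets with degree 1 (\<open>left_kernel_trivial\<close>).  Hence
  non-zero elements of an ideal propagate from each degree to the neighbouring ones.  This gives property
  (i) and, together with an explicit extension of ideals of \<open>T\<close> to ideals of \<open>Lie T\<close> (\<open>ideal3_extends\<close>),
  the equivalence of the two notions of simplicity.

  Conversely, for a pair \<open>(g, \<sigma>)\<close> the formula \<open>[x,y,z] = [[x, \<sigma> y], z]\<close> defines a 3-algebra on the component
  of degree -1.  Property (i) says that the other components act faithfully on this one (\<open>transitive\<close>),
  property (ii) that degree 0 acts by combinations of the \<open>L\<^bsub>x,y\<^esub>\<close>, so the action identifies \<open>g\<close> with the
  Lie superalgebra of this 3-algebra (\<open>iso_pair_rep\<close>).  Both constructions are natural, hence bijective
  on isomorphism classes.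

  A space is linearly compact if and only if its topology is defined by linear functionals such that each
  finitely solvable system of equations is solvable.  This makes linear compactness usable without bases.
  \<open>T\<close> is a continuous linear retract of its Lie superalgebra, which gives one direction
  (\<open>lin_compact_descends\<close>).  For the other one, let \<open>E\<close> be the closure of the span of the \<open>L\<^bsub>x,y\<^esub>\<close>.  Small
  neighbourhoods of 0 in \<open>T\<close> contain subspaces of finite codimension, and this turns continuity of the
  3-bracket into equicontinuity of all \<open>L\<^bsub>x,y\<^esub>\<close> (\<open>equicontinuous_br\<close>) and hence of \<open>E\<close>.  So evaluation of
  operators in \<open>E\<close> is jointly continuous.  Adjoints exist in \<open>E\<close> as solutions of systems that the span
  solves finitely (\<open>E_adjoint_exists\<close>), and they depend continuously on the operator because the
  functionals \<open>u \<mapsto> cnj (l [x,u,z])\<close> already define the topology (\<open>compact_by_br\<close>, a consequence of the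
  zero center).  Therefore the bracket is continuous, and finitely solvable systems in the Lie superalgebra
  are solved component by component (\<open>compact_LG\<close>).
\<close>

section \<open>Linearly compact spaces and solvable systems of equations\<close>

text \<open>
  The coarsest topology on \<open>V\<close> for which every map in \<open>\<Lambda>\<close> is continuous into discrete \<open>\<complex>\<close>.  It is given
  by its open sets, because every later use compares finitely many functionals near a point.
\<close>

definition weak_topology :: "'x set \<Rightarrow> ('x \<Rightarrow> complex) set \<Rightarrow> 'x topology" where
  "weak_topology V \<Lambda> = topology (\<lambda>U. U \<subseteq> V \<and>
     (\<forall>x\<in>U. \<exists>F\<subseteq>\<Lambda>. finite F \<and> (\<forall>y\<in>V. (\<forall>l\<in>F. l y = l x) \<longrightarrow> y \<in> U)))"

lemma openin_weak_topology:
  "openin (weak_topology V \<Lambda>) U \<longleftrightarrow> U \<subseteq> V \<and>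
     (\<forall>x\<in>U. \<exists>F\<subseteq>\<Lambda>. finite F \<and> (\<forall>y\<in>V. (\<forall>l\<in>F. l y = l x) \<longrightarrow> y \<in> U))"
proof -
  let ?P = "\<lambda>U. U \<subseteq> V \<and>
     (\<forall>x\<in>U. \<exists>F\<subseteq>\<Lambda>. finite F \<and> (\<forall>y\<in>V. (\<forall>l\<in>F. l y = l x) \<longrightarrow> y \<in> U))"
  have "istopology ?P"
    unfolding istopology_def
  proof (intro conjI allI impI)
    fix S T assume S: "?P S" and T: "?P T"
    show "S \<inter> T \<subseteq> V" using S by blast
    show "\<forall>x\<in>S \<inter> T. \<exists>F\<subseteq>\<Lambda>. finite F \<and> (\<forall>y\<in>V. (\<forall>l\<in>F. l y = l x) \<longrightarrow> y \<in> S \<inter> T)"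
    proof
      fix x assume "x \<in> S \<inter> T"
      then obtain F G where "F \<subseteq> \<Lambda>" "finite F" "\<forall>y\<in>V. (\<forall>l\<in>F. l y = l x) \<longrightarrow> y \<in> S"
        "G \<subseteq> \<Lambda>" "finite G" "\<forall>y\<in>V. (\<forall>l\<in>G. l y = l x) \<longrightarrow> y \<in> T"
        using S T by blast
      then show "\<exists>F\<subseteq>\<Lambda>. finite F \<and> (\<forall>y\<in>V. (\<forall>l\<in>F. l y = l x) \<longrightarrow> y \<in> S \<inter> T)"
        by (intro exI[of _ "F \<union> G"]) auto
    qed
  next
    fix K assume "\<forall>U\<in>K. ?P U"
    then show "\<Union>K \<subseteq> V" by blast
  next
    fix K assume K: "\<forall>U\<in>K. ?P U"
    show "\<forall>x\<in>\<Union>K. \<exists>F\<subseteq>\<Lambda>. finite F \<and> (\<forall>y\<in>V. (\<forall>l\<in>F. l y = l x) \<longrightarrow> y \<in> \<Union>K)"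
    proof
      fix x assume "x \<in> \<Union>K"
      then obtain U where "U \<in> K" "x \<in> U" by blast
      have "?P U" by (rule bspec[OF K \<open>U \<in> K\<close>])
      then have "\<exists>F\<subseteq>\<Lambda>. finite F \<and> (\<forall>y\<in>V. (\<forall>l\<in>F. l y = l x) \<longrightarrow> y \<in> U)"
        using \<open>x \<in> U\<close> by (elim conjE) (rule bspec)
      then show "\<exists>F\<subseteq>\<Lambda>. finite F \<and> (\<forall>y\<in>V. (\<forall>l\<in>F. l y = l x) \<longrightarrow> y \<in> \<Union>K)"
        using \<open>U \<in> K\<close> by (elim exE conjE, intro exI conjI) auto
    qed
  qed
  then show ?thesis
    unfolding weak_topology_def by (simp add: topology_inverse')
qed

lemma topspace_weak_topology [simp]: "topspace (weak_topology V \<Lambda>) = V"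
  by (rule antisym) (auto simp: topspace_def openin_weak_topology)

abbreviation locally_constant :: "'x topology \<Rightarrow> ('x \<Rightarrow> 'y) \<Rightarrow> bool" where
  "locally_constant X a \<equiv> continuous_map X (discrete_topology UNIV) a"

lemma locally_constant_iff:
  "locally_constant X a \<longleftrightarrow>
     (\<forall>p\<in>topspace X. \<exists>U. openin X U \<and> p \<in> U \<and> (\<forall>q\<in>U. a p = a q))"
proof
  assume a: "locally_constant X a"
  show "\<forall>p\<in>topspace X. \<exists>U. openin X U \<and> p \<in> U \<and> (\<forall>q\<in>U. a p = a q)"
  proof
    fix p assume p: "p \<in> topspace X"
    have "openin X {q \<in> topspace X. a q \<in> {a p}}"
      by (rule openin_continuous_map_preimage[OF a]) simp
    then show "\<exists>U. openin X U \<and> p \<in> U \<and> (\<forall>q\<in>U. a p = a q)"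
      using p by (intro exI[of _ "{q \<in> topspace X. a q \<in> {a p}}"]) simp
  qed
next
  assume R: "\<forall>p\<in>topspace X. \<exists>U. openin X U \<and> p \<in> U \<and> (\<forall>q\<in>U. a p = a q)"
  have "openin X {q \<in> topspace X. a q \<in> W}" for W
  proof (subst openin_subopen, intro ballI)
    fix q assume q: "q \<in> {q \<in> topspace X. a q \<in> W}"
    then obtain U where U: "openin X U" "q \<in> U" "\<forall>r\<in>U. a q = a r" using R by blast
    moreover have "U \<subseteq> {q \<in> topspace X. a q \<in> W}"
    proof
      fix r assume "r \<in> U"
      then have "a q = a r" "r \<in> topspace X" using U openin_subset by blast+
      then show "r \<in> {q \<in> topspace X. a q \<in> W}" using q by simp
    qed
    ultimately show "\<exists>T. openin X T \<and> q \<in> T \<and> T \<subseteq> {q \<in> topspace X. a q \<in> W}"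
      by blast
  qed
  then show "locally_constant X a" by (auto simp: continuous_map)
qed

lemma locally_constant_combine:
  assumes "locally_constant X a" "locally_constant X b"
  shows "locally_constant X (\<lambda>p. f (a p) (b p))"
  unfolding locally_constant_iff
proof
  fix p assume "p \<in> topspace X"
  then obtain U W where "openin X U" "p \<in> U" "\<forall>q\<in>U. a p = a q"
    "openin X W" "p \<in> W" "\<forall>q\<in>W. b p = b q"
    using assms unfolding locally_constant_iff by meson
  then show "\<exists>U. openin X U \<and> p \<in> U \<and> (\<forall>q\<in>U. f (a p) (b p) = f (a q) (b q))"
    by (intro exI[of _ "U \<inter> W"] conjI ballI openin_Int arg_cong2[where f=f]) blast+
qed

lemma locally_constant_finite:
  assumes "finite F" "\<And>l. l \<in> F \<Longrightarrow> locally_constant X (\<lambda>q. l (f q))" "p \<in> topspace X"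
  shows "\<exists>U. openin X U \<and> p \<in> U \<and> (\<forall>q\<in>U. \<forall>l\<in>F. l (f p) = l (f q))"
  using assms(1,2)
proof (induction F rule: finite_induct)
  case empty
  then show ?case using assms(3) by auto
next
  case (insert l F)
  then obtain U where "openin X U" "p \<in> U" "\<forall>q\<in>U. \<forall>l\<in>F. l (f p) = l (f q)" by auto
  moreover obtain W where "openin X W" "p \<in> W" "\<forall>q\<in>W. l (f p) = l (f q)"
    using insert.prems[of l] assms(3) unfolding locally_constant_iff by auto
  ultimately show ?case
    by (intro exI[of _ "U \<inter> W"] conjI ballI openin_Int) blast+
qed

lemma continuous_map_weak_topology:
  "continuous_map X (weak_topology V \<Lambda>) f \<longleftrightarrow>
     f \<in> topspace X \<rightarrow> V \<and> (\<forall>l\<in>\<Lambda>. locally_constant X (\<lambda>p. l (f p)))"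
proof
  assume c: "continuous_map X (weak_topology V \<Lambda>) f"
  have "locally_constant (weak_topology V \<Lambda>) l" if "l \<in> \<Lambda>" for l
    unfolding locally_constant_iff
  proof
    fix p assume p: "p \<in> topspace (weak_topology V \<Lambda>)"
    have "openin (weak_topology V \<Lambda>) {q \<in> V. l q = l p}"
      unfolding openin_weak_topology using that by (auto intro!: exI[of _ "{l}"])
    then show "\<exists>U. openin (weak_topology V \<Lambda>) U \<and> p \<in> U \<and> (\<forall>q\<in>U. l p = l q)"
      using p by (intro exI[of _ "{q \<in> V. l q = l p}"]) auto
  qed
  then show "f \<in> topspace X \<rightarrow> V \<and> (\<forall>l\<in>\<Lambda>. locally_constant X (\<lambda>p. l (f p)))"
    using c continuous_map_compose[OF c, unfolded o_def] continuous_map_funspace[OF c] by auto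
next
  assume R: "f \<in> topspace X \<rightarrow> V \<and> (\<forall>l\<in>\<Lambda>. locally_constant X (\<lambda>p. l (f p)))"
  have "openin X {p \<in> topspace X. f p \<in> U}" if U: "openin (weak_topology V \<Lambda>) U" for U
  proof (subst openin_subopen, intro ballI)
    fix p assume p: "p \<in> {p \<in> topspace X. f p \<in> U}"
    then obtain F where F: "F \<subseteq> \<Lambda>" "finite F" "\<forall>y\<in>V. (\<forall>l\<in>F. l y = l (f p)) \<longrightarrow> y \<in> U"
      using U unfolding openin_weak_topology by auto
    obtain W where W: "openin X W" "p \<in> W" "\<forall>q\<in>W. \<forall>l\<in>F. l (f p) = l (f q)"
      using locally_constant_finite[of F X f p] F(1,2) R p by blast
    moreover have "W \<subseteq> {p \<in> topspace X. f p \<in> U}"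
    proof
      fix q assume "q \<in> W"
      then have q: "q \<in> topspace X" "\<forall>l\<in>F. l (f p) = l (f q)" using W openin_subset by blast+
      have "f q \<in> U" by (rule F(3)[rule_format]) (use q R in auto)
      then show "q \<in> {p \<in> topspace X. f p \<in> U}" using q by simp
    qed
    ultimately show "\<exists>T. openin X T \<and> p \<in> T \<and> T \<subseteq> {p \<in> topspace X. f p \<in> U}"
      by blast
  qed
  then show "continuous_map X (weak_topology V \<Lambda>) f"
    using R by (auto simp: continuous_map)
qed

lemma locally_constant_weak_topology:
  "l \<in> \<Lambda> \<Longrightarrow> locally_constant (weak_topology V \<Lambda>) l"
  using continuous_map_weak_topology[of "weak_topology V \<Lambda>" V \<Lambda> id] by simp

lemma topology_eqI:
  assumes "topspace X = topspace Y" "continuous_map X Y id" "continuous_map Y X id"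
  shows "X = Y"
  using assms topology_finer_continuous_id[of X Y] topology_finer_continuous_id[of Y X]
  by (auto simp: topology_eq)

lemma weak_topology_closure_of:
  assumes "S \<subseteq> V"
  shows "x \<in> weak_topology V \<Lambda> closure_of S \<longleftrightarrow>
     x \<in> V \<and> (\<forall>F\<subseteq>\<Lambda>. finite F \<longrightarrow> (\<exists>y\<in>S. \<forall>l\<in>F. l y = l x))"
proof
  assume x: "x \<in> weak_topology V \<Lambda> closure_of S"
  then have "x \<in> V" by (simp add: in_closure_of)
  moreover have "\<exists>y\<in>S. \<forall>l\<in>F. l y = l x" if "F \<subseteq> \<Lambda>" "finite F" for F
  proof -
    have "openin (weak_topology V \<Lambda>) {y \<in> V. \<forall>l\<in>F. l y = l x}"
      unfolding openin_weak_topology using that by (auto intro!: exI[of _ F])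
    then have "\<exists>y. y \<in> S \<and> y \<in> {y \<in> V. \<forall>l\<in>F. l y = l x}"
      using x[unfolded in_closure_of, THEN conjunct2, rule_format, of "{y \<in> V. \<forall>l\<in>F. l y = l x}"]
        \<open>x \<in> V\<close> by simp
    then show ?thesis by simp blast
  qed
  ultimately show "x \<in> V \<and> (\<forall>F\<subseteq>\<Lambda>. finite F \<longrightarrow> (\<exists>y\<in>S. \<forall>l\<in>F. l y = l x))" by blast
next
  assume R: "x \<in> V \<and> (\<forall>F\<subseteq>\<Lambda>. finite F \<longrightarrow> (\<exists>y\<in>S. \<forall>l\<in>F. l y = l x))"
  show "x \<in> weak_topology V \<Lambda> closure_of S"
    unfolding in_closure_of
  proof (intro conjI allI impI)
    show "x \<in> topspace (weak_topology V \<Lambda>)" using R by simp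
    fix U assume U: "x \<in> U \<and> openin (weak_topology V \<Lambda>) U"
    then obtain F where F: "F \<subseteq> \<Lambda>" "finite F" "\<forall>y\<in>V. (\<forall>l\<in>F. l y = l x) \<longrightarrow> y \<in> U"
      unfolding openin_weak_topology by blast
    obtain y where "y \<in> S" "\<forall>l\<in>F. l y = l x" using R F(1,2) by blast
    then show "\<exists>y. y \<in> S \<and> y \<in> U" using F(3) assms by blast
  qed
qed

abbreviation functional :: "(complex \<Rightarrow> 'a::ab_group_add \<Rightarrow> 'a) \<Rightarrow> 'a set \<Rightarrow> ('a \<Rightarrow> complex) \<Rightarrow> bool" where
  "functional s V l \<equiv> linear_map V s (*) l"

lemma cspaceD:
  assumes "cspace s V"
  shows "vector_space s" "module s" "module.subspace s V" "0 \<in> V" 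
    "x \<in> V \<Longrightarrow> s c x \<in> V" "x \<in> V \<Longrightarrow> y \<in> V \<Longrightarrow> x + y \<in> V"
    "x \<in> V \<Longrightarrow> y \<in> V \<Longrightarrow> x - y \<in> V" "x \<in> V \<Longrightarrow> - x \<in> V"
proof -
  show vs: "vector_space s" and sub: "module.subspace s V" using assms by (auto simp: cspace_def)
  then show m: "module s" by (simp add: vector_space_def module_def)
  note s = module.subspace_0[OF m sub] module.subspace_scale[OF m sub]
    module.subspace_add[OF m sub] module.subspace_diff[OF m sub] module.subspace_neg[OF m sub]
  from s show "0 \<in> V" "x \<in> V \<Longrightarrow> s c x \<in> V" "x \<in> V \<Longrightarrow> y \<in> V \<Longrightarrow> x + y \<in> V"
    "x \<in> V \<Longrightarrow> y \<in> V \<Longrightarrow> x - y \<in> V" "x \<in> V \<Longrightarrow> - x \<in> V" by blast+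
qed

lemma linear_mapD:
  assumes "linear_map V s s' f" "cspace s V"
  shows "x \<in> V \<Longrightarrow> y \<in> V \<Longrightarrow> f (x + y) = f x + f y" "x \<in> V \<Longrightarrow> f (s c x) = s' c (f x)"
    "f 0 = 0" "x \<in> V \<Longrightarrow> f (- x) = - f x" "x \<in> V \<Longrightarrow> y \<in> V \<Longrightarrow> f (x - y) = f x - f y"
proof -
  note c = cspaceD[OF assms(2)]
  show a: "f (x + y) = f x + f y" if "x \<in> V" "y \<in> V" for x y
    using assms(1) that by (simp add: linear_map_def)
  show "x \<in> V \<Longrightarrow> f (s c x) = s' c (f x)" using assms(1) by (simp add: linear_map_def)
  show 0: "f 0 = 0" using a[of 0 0] c(4) by simp
  show n: "f (- x) = - f x" if "x \<in> V" for x
    using a[of x "- x"] c(8)[OF that] that 0 by (simp add: eq_neg_iff_add_eq_0 add.commute)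
  show "f (x - y) = f x - f y" if "x \<in> V" "y \<in> V"
    using a[of x "- y"] n[of y] c(8)[of y] that by simp
qed

definition solves :: "'x \<Rightarrow> (('x \<Rightarrow> complex) \<times> complex) set \<Rightarrow> bool" where
  "solves x H \<longleftrightarrow> (\<forall>(l, c)\<in>H. l x = c)"

lemma solves_empty [simp]: "solves x {}"
  and solves_insert [simp]: "solves x (insert (l, c) H) \<longleftrightarrow> l x = c \<and> solves x H"
  and solves_Un [simp]: "solves x (G \<union> H) \<longleftrightarrow> solves x G \<and> solves x H"
  by (simp_all add: solves_def ball_Un)

lemma solves_subset: "solves x H \<Longrightarrow> G \<subseteq> H \<Longrightarrow> solves x G"
  by (auto simp: solves_def)

lemma solvesD: "solves x H \<Longrightarrow> (l, c) \<in> H \<Longrightarrow> l x = c"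
  by (auto simp: solves_def)

lemma solvesI: "(\<And>l c. (l, c) \<in> H \<Longrightarrow> l x = c) \<Longrightarrow> solves x H"
  by (auto simp: solves_def)

definition finitely_solvable :: "'x set \<Rightarrow> (('x \<Rightarrow> complex) \<times> complex) set \<Rightarrow> bool" where
  "finitely_solvable V H \<longleftrightarrow> (\<forall>F\<subseteq>H. finite F \<longrightarrow> (\<exists>x\<in>V. solves x F))"

text \<open>
  The algebraic form of linear compactness: \<open>V\<close> carries the weak topology of a separating family of
  functionals, and a system of linear equations \<open>l x = c\<close> with \<open>l \<in> \<Lambda>\<close> is solvable as soon as its finite
  subsystems are.  It is equivalent to being a product of finite-dimensional discrete spaces
  (\<open>lin_compact_imp_compact_by\<close>, \<open>compact_by_imp_lin_compact\<close>).  Points of \<open>T\<close>, operators and superalgebra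
  elements are all constructed below by solving such systems.
\<close>

definition compact_by ::
  "(complex \<Rightarrow> 'a::ab_group_add \<Rightarrow> 'a) \<Rightarrow> 'a set \<Rightarrow> 'a topology \<Rightarrow> ('a \<Rightarrow> complex) set \<Rightarrow> bool" where
  "compact_by s V \<tau> \<Lambda> \<longleftrightarrow>
     cspace s V \<and> (\<forall>l\<in>\<Lambda>. functional s V l) \<and> \<tau> = weak_topology V \<Lambda> \<and>
     (\<forall>x\<in>V. (\<forall>l\<in>\<Lambda>. l x = 0) \<longrightarrow> x = 0) \<and>
     (\<forall>H\<subseteq>\<Lambda> \<times> UNIV. finitely_solvable V H \<longrightarrow> (\<exists>x\<in>V. solves x H))"

lemma finitely_solvableD:
  assumes "finitely_solvable V H" "F \<subseteq> H" "finite F"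
  obtains x where "x \<in> V" "solves x F"
  using assms unfolding finitely_solvable_def by blast

lemma finitely_solvableI:
  "(\<And>F. F \<subseteq> H \<Longrightarrow> finite F \<Longrightarrow> \<exists>x\<in>V. solves x F) \<Longrightarrow> finitely_solvable V H"
  unfolding finitely_solvable_def by blast

text \<open>
  Either finitely many equations of \<open>H\<close> already force the value of \<open>l\<close>, and this value can be added, or
  the value of \<open>l\<close> is never forced; then by linearity it can be moved to 0 along a line of solutions.
\<close>

lemma finitely_solvable_insert:
  assumes V: "cspace s V" and H: "\<And>m d. (m, d) \<in> H \<Longrightarrow> functional s V m" and l: "functional s V l"
    and sol: "finitely_solvable V H"
  shows "\<exists>c. finitely_solvable V (insert (l, c) H)"
proof (cases "\<exists>F\<subseteq>H. finite F \<and> (\<forall>x\<in>V. \<forall>y\<in>V. solves x F \<longrightarrow> solves y F \<longrightarrow> l x = l y)")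
  case True
  then obtain F where F: "F \<subseteq> H" "finite F"
    and eq: "\<And>x y. x \<in> V \<Longrightarrow> y \<in> V \<Longrightarrow> solves x F \<Longrightarrow> solves y F \<Longrightarrow> l x = l y"
    by blast
  obtain x where x: "x \<in> V" "solves x F"
    using finitely_solvableD[OF sol F] .
  have "finitely_solvable V (insert (l, l x) H)"
  proof (rule finitely_solvableI)
    fix G assume G: "G \<subseteq> insert (l, l x) H" "finite G"
    have "G - {(l, l x)} \<union> F \<subseteq> H" "finite (G - {(l, l x)} \<union> F)" using G F by auto
    then obtain y where y: "y \<in> V" "solves y (G - {(l, l x)} \<union> F)"
      by (rule finitely_solvableD[OF sol])
    then have "l y = l x" using x by (intro eq) auto
    then have "solves y (insert (l, l x) (G - {(l, l x)} \<union> F))" using y(2) by simp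
    then have "solves y G" by (rule solves_subset) blast
    then show "\<exists>y\<in>V. solves y G" using y(1) by blast
  qed
  then show ?thesis by blast
next
  case False
  have "finitely_solvable V (insert (l, 0) H)"
  proof (rule finitely_solvableI)
    fix G assume G: "G \<subseteq> insert (l, 0) H" "finite G"
    let ?F = "G - {(l, 0)}"
    have F: "?F \<subseteq> H" "finite ?F" using G by auto
    then obtain x y where xy: "x \<in> V" "y \<in> V" "solves x ?F" "solves y ?F" "l x \<noteq> l y"
      using False by meson
    \<comment> \<open>the point where \<open>l\<close> vanishes on the line through the solutions \<open>x\<close> and \<open>y\<close>\<close>
    let ?z = "x + s (l x / (l y - l x)) (x - y)"
    note c = cspaceD[OF V]
    have z: "?z \<in> V" using xy c by blast
    have "solves ?z ?F"
    proof (rule solvesI)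
      fix m d assume md: "(m, d) \<in> ?F"
      have "functional s V m" by (rule H) (use F(1) md in blast)
      note m = linear_mapD[OF this V]
      have "m x = d" "m y = d" using solvesD[OF _ md] xy by auto
      then show "m ?z = d" using xy c by (simp add: m)
    qed
    moreover have "l ?z = 0"
    proof -
      have "l ?z = l x + l x / (l y - l x) * (l x - l y)"
        using xy(1,2) c(5,7) by (simp add: linear_mapD[OF l V])
      also have "\<dots> = 0" using xy(5) by (simp add: field_simps)
      finally show ?thesis .
    qed
    ultimately have "solves ?z (insert (l, 0) ?F)" by (intro solves_insert[THEN iffD2] conjI)
    then have "solves ?z G" by (rule solves_subset) blast
    then show "\<exists>y\<in>V. solves y G" using z by blast
  qed
  then show ?thesis by blast
qed

text \<open>
  By \<open>finitely_solvable_insert\<close> and Zorn's lemma: a maximal finitely solvable system prescribes the value of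
  every functional.  This plays the role that ultrafilters play for compact spaces.
\<close>

lemma finitely_solvable_extend:
  assumes V: "cspace s V" and L: "\<And>l. l \<in> L \<Longrightarrow> functional s V l"
    and H: "H \<subseteq> L \<times> UNIV" and sol: "finitely_solvable V H"
  shows "\<exists>K. H \<subseteq> K \<and> finitely_solvable V K \<and> L \<subseteq> fst ` K"
proof -
  let ?A = "{K. H \<subseteq> K \<and> K \<subseteq> L \<times> UNIV \<and> finitely_solvable V K}"
  have "\<exists>M\<in>?A. \<forall>X\<in>?A. M \<subseteq> X \<longrightarrow> X = M"
  proof (rule subset_Zorn_nonempty)
    show "?A \<noteq> {}" using H sol by blast
    fix C assume C: "C \<noteq> {}" "subset.chain ?A C"
    then have CA: "C \<subseteq> ?A" by (auto simp: subset.chain_def)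
    have "finitely_solvable V (\<Union>C)"
    proof (rule finitely_solvableI)
      fix F assume F: "F \<subseteq> \<Union>C" "finite F"
      obtain B where B: "B \<in> C" "F \<subseteq> B"
        using finite_subset_Union_chain[OF F(2,1) C(1,2)] by blast
      then have "finitely_solvable V B" using CA by blast
      then show "\<exists>x\<in>V. solves x F" using finitely_solvableD B(2) F(2) by metis
    qed
    moreover have "H \<subseteq> \<Union>C" using C(1) CA by blast
    moreover have "\<Union>C \<subseteq> L \<times> UNIV" using CA by blast
    ultimately show "\<Union>C \<in> ?A" by blast
  qed
  then obtain M where MA: "M \<in> ?A" and max: "\<forall>X\<in>?A. M \<subseteq> X \<longrightarrow> X = M"
    by (elim bexE)
  from MA have M: "H \<subseteq> M" "M \<subseteq> L \<times> UNIV" "finitely_solvable V M" by simp_all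
  have "l \<in> fst ` M" if l: "l \<in> L" for l
  proof -
    have "\<exists>c. finitely_solvable V (insert (l, c) M)"
      by (rule finitely_solvable_insert[OF V _ L[OF l] M(3)]) (use L M(2) in auto)
    then obtain c where c: "finitely_solvable V (insert (l, c) M)" ..
    have "insert (l, c) M = M" by (rule max[rule_format]) (use M l c in auto)
    then have "(l, c) \<in> M" by blast
    then show ?thesis by force
  qed
  then show ?thesis using M by blast
qed

definition determined_by :: "'x set \<Rightarrow> ('x \<Rightarrow> complex) set \<Rightarrow> ('x \<Rightarrow> complex) \<Rightarrow> bool" where
  "determined_by V F m \<longleftrightarrow> (\<forall>x\<in>V. \<forall>y\<in>V. (\<forall>l\<in>F. l x = l y) \<longrightarrow> m x = m y)"

lemma determined_byD:
  "determined_by V F m \<Longrightarrow> x \<in> V \<Longrightarrow> y \<in> V \<Longrightarrow> (\<And>l. l \<in> F \<Longrightarrow> l x = l y) \<Longrightarrow> m x = m y"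
  unfolding determined_by_def by (meson)

text \<open>
  A continuous functional is constant near 0, hence on the common kernel of finitely many \<open>l \<in> \<Lambda>\<close>.
\<close>

lemma weak_topology_functional_determined:
  assumes V: "cspace s V" and m: "functional s V m" and c: "locally_constant (weak_topology V \<Lambda>) m"
    and L: "\<And>l. l \<in> \<Lambda> \<Longrightarrow> functional s V l"
  obtains F where "F \<subseteq> \<Lambda>" "finite F" "determined_by V F m"
proof -
  note cs = cspaceD[OF V]
  obtain U where U: "openin (weak_topology V \<Lambda>) U" "0 \<in> U" "\<forall>q\<in>U. m 0 = m q"
    using c cs(4) unfolding locally_constant_iff by auto
  then obtain F where F: "F \<subseteq> \<Lambda>" "finite F" "\<forall>y\<in>V. (\<forall>l\<in>F. l y = l 0) \<longrightarrow> y \<in> U"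
    unfolding openin_weak_topology by blast
  have "m x = m y" if xy: "x \<in> V" "y \<in> V" "\<And>l. l \<in> F \<Longrightarrow> l x = l y" for x y
  proof -
    have "l (x - y) = l 0" if "l \<in> F" for l
      using linear_mapD(3,5)[OF L V, of l] that F(1) xy by auto
    then have "x - y \<in> U" using F(3) cs(7)[OF xy(1,2)] by simp
    then have "m 0 = m (x - y)" using U(3) by simp
    then show ?thesis using linear_mapD(3,5)[OF m V] xy by simp
  qed
  then have "determined_by V F m" unfolding determined_by_def by blast
  with F(1,2) show ?thesis by (rule that)
qed

text \<open>
  The defining family may be replaced by arbitrary continuous functionals: after extending the system to
  one that prescribes all of \<open>\<Lambda>\<close>, the solution \<open>x\<close> of the equations in \<open>\<Lambda>\<close> also solves the others,
  because a continuous functional depends on finitely many \<open>l \<in> \<Lambda>\<close>, on which \<open>x\<close> agrees with a solution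
  of a finite subsystem.
\<close>

lemma compact_by_solve:
  assumes co: "compact_by s V \<tau> \<Lambda>"
    and H: "\<And>m c. (m, c) \<in> H \<Longrightarrow> functional s V m" "\<And>m c. (m, c) \<in> H \<Longrightarrow> locally_constant \<tau> m"
    and sol: "finitely_solvable V H"
  obtains x where "x \<in> V" "solves x H"
proof -
  have V: "cspace s V" and L: "\<And>l. l \<in> \<Lambda> \<Longrightarrow> functional s V l" and \<tau>: "\<tau> = weak_topology V \<Lambda>"
    and C: "\<And>K. K \<subseteq> \<Lambda> \<times> UNIV \<Longrightarrow> finitely_solvable V K \<Longrightarrow> \<exists>x\<in>V. solves x K"
    using co by (auto simp: compact_by_def)
  have "functional s V l" if "l \<in> \<Lambda> \<union> fst ` H" for l using that L H by force
  moreover have "H \<subseteq> (\<Lambda> \<union> fst ` H) \<times> UNIV" by force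
  ultimately obtain K where K: "H \<subseteq> K" "finitely_solvable V K" "\<Lambda> \<union> fst ` H \<subseteq> fst ` K"
    using finitely_solvable_extend[OF V _ _ sol] by meson
  let ?K = "K \<inter> \<Lambda> \<times> UNIV"
  have "finitely_solvable V ?K"
    by (rule finitely_solvableI) (meson K(2) finitely_solvableD le_infE)
  then obtain x where x: "x \<in> V" "solves x ?K" using C[of ?K] by blast
  have "solves x H"
  proof (rule solvesI)
    fix m c assume mc: "(m, c) \<in> H"
    have m: "functional s V m" "locally_constant (weak_topology V \<Lambda>) m" using H mc \<tau> by auto
    obtain F where F: "F \<subseteq> \<Lambda>" "finite F" and eq: "determined_by V F m"
      using weak_topology_functional_determined[OF V m L] .
    have "F \<subseteq> fst ` ?K" using F(1) K(3) by force
    then obtain G where G: "G \<subseteq> ?K" "finite G" "F = fst ` G"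
      using F(2) by (meson finite_subset_image)
    have "insert (m, c) G \<subseteq> K" "finite (insert (m, c) G)" using G K(1) mc by auto
    then obtain y where y: "y \<in> V" "solves y (insert (m, c) G)"
      by (rule finitely_solvableD[OF K(2)])
    have "m x = m y"
    proof (rule determined_byD[OF eq x(1) y(1)])
      fix l assume "l \<in> F"
      then obtain d where "(l, d) \<in> G" using G(3) by auto
      then show "l x = l y" using solvesD[OF x(2)] solvesD[OF y(2)] G(1) by (metis insertI2 subsetD)
    qed
    then show "m x = c" using y(2) by simp
  qed
  then show ?thesis using x(1) that by blast
qed

text \<open>
  Minimality of linearly compact topologies: any separating family of continuous functionals defines the
  topology.  A functional \<open>l \<in> \<Lambda>\<close> that is not controlled by finitely many \<open>m \<in> M\<close> would make the system
  \<open>l = 1\<close>, \<open>m = 0\<close> for all \<open>m \<in> M\<close> finitely solvable, hence solvable by a vector that \<open>M\<close> does not separate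
  from 0.  Applied to the functionals built from the 3-bracket, this is where the zero center meets the
  topology.
\<close>

lemma compact_by_separating:
  assumes co: "compact_by s V \<tau> \<Lambda>"
    and M: "\<And>m. m \<in> M \<Longrightarrow> functional s V m" "\<And>m. m \<in> M \<Longrightarrow> locally_constant \<tau> m"
    and sep: "\<And>x. x \<in> V \<Longrightarrow> (\<And>m. m \<in> M \<Longrightarrow> m x = 0) \<Longrightarrow> x = 0"
  shows "compact_by s V \<tau> M"
proof -
  have V: "cspace s V" and L: "\<And>l. l \<in> \<Lambda> \<Longrightarrow> functional s V l" and \<tau>: "\<tau> = weak_topology V \<Lambda>"
    using co by (auto simp: compact_by_def)
  note cs = cspaceD[OF V]
  have solve: "\<exists>x\<in>V. solves x H" if "H \<subseteq> M \<times> UNIV" "finitely_solvable V H" for H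
    using compact_by_solve[OF co _ _ that(2)] that(1) M by (metis SigmaD1 subsetD)
  have "locally_constant (weak_topology V M) l" if l: "l \<in> \<Lambda>" for l
  proof -
    note lf = linear_mapD[OF L[OF l] V]
    have "\<exists>F\<subseteq>M. finite F \<and> (\<forall>x\<in>V. (\<forall>m\<in>F. m x = 0) \<longrightarrow> l x = 0)"
    proof (rule ccontr)
      assume no: "\<not> ?thesis"
      let ?H = "insert (l, 1::complex) (M \<times> {0})"
      have "finitely_solvable V ?H"
      proof (rule finitely_solvableI)
        fix F assume F: "F \<subseteq> ?H" "finite F"
        let ?G = "fst ` (F - {(l, 1)})"
        have G: "?G \<subseteq> M" "finite ?G" using F by auto
        then obtain x where x: "x \<in> V" "\<forall>m\<in>?G. m x = 0" "l x \<noteq> 0"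
          using no by meson
        let ?x = "s (1 / l x) x"
        have "solves ?x (insert (l, 1) (?G \<times> {0}))"
        proof (rule solvesI)
          fix m and c :: complex assume mc: "(m, c) \<in> insert (l, 1) (?G \<times> {0})"
          show "m ?x = c"
          proof (cases "(m, c) = (l, 1)")
            case True
            then show ?thesis using lf(2) x by simp
          next
            case False
            then have "m \<in> ?G" "c = 0" using mc by blast+
            then have "m ?x = (1 / l x) * m x" 
              using linear_mapD(2)[OF M(1) V x(1), of m "1 / l x"] G by blast
            then show ?thesis using x(2)[rule_format, OF \<open>m \<in> ?G\<close>] \<open>c = 0\<close> by simp
          qed
        qed
        then have "solves ?x F" by (rule solves_subset) (use F in force)
        then show "\<exists>x\<in>V. solves x F" using cs x(1) by blast
      qed
      then obtain x where x: "x \<in> V" "solves x ?H"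
        using compact_by_solve[OF co, of ?H] M L[OF l] l \<tau> locally_constant_weak_topology[of l \<Lambda> V]
        by (metis (no_types, lifting) SigmaD1 insertE prod.inject)
      then have "x = 0" by (intro sep) (auto intro: solvesD)
      then show False using x lf by simp
    qed
    then obtain F where F: "F \<subseteq> M" "finite F" "\<And>x. x \<in> V \<Longrightarrow> \<forall>m\<in>F. m x = 0 \<Longrightarrow> l x = 0" by blast
    show ?thesis
      unfolding locally_constant_iff
    proof
      fix p assume "p \<in> topspace (weak_topology V M)"
      then have p: "p \<in> V" by simp
      let ?U = "{y \<in> V. \<forall>m\<in>F. m y = m p}"
      have "l p = l y" if "y \<in> ?U" for y
      proof -
        have y: "y \<in> V" "\<And>m. m \<in> F \<Longrightarrow> m y = m p" using that by blast+
        have "m (p - y) = 0" if "m \<in> F" for m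
          using y(2)[OF that] linear_mapD(5)[OF M(1) V p y(1), of m] that F(1) by auto
        then have "l (p - y) = 0" by (intro F(3) cs(7)) (simp_all add: p y(1))
        then show ?thesis using lf y p by auto
      qed
      moreover have "openin (weak_topology V M) ?U"
        unfolding openin_weak_topology using F(1,2) by (auto intro!: exI[of _ F])
      ultimately show "\<exists>U. openin (weak_topology V M) U \<and> p \<in> U \<and> (\<forall>q\<in>U. l p = l q)"
        using p by (intro exI[of _ ?U]) auto
    qed
  qed
  then have "\<tau> = weak_topology V M"
    unfolding \<tau> using M(2) \<tau> by (intro topology_eqI) (auto simp: continuous_map_weak_topology)
  then show ?thesis using V M(1) sep solve unfolding compact_by_def by blast
qed

lemma compact_by_dual:
  assumes co: "compact_by s V \<tau> \<Lambda>"
  shows "compact_by s V \<tau> {l. functional s V l \<and> locally_constant \<tau> l}"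
proof (rule compact_by_separating[OF co])
  fix x assume x: "x \<in> V" "\<And>m. m \<in> {l. functional s V l \<and> locally_constant \<tau> l} \<Longrightarrow> m x = 0"
  have "l x = 0" if "l \<in> \<Lambda>" for l
    using co that locally_constant_weak_topology[OF that, of V]
    unfolding compact_by_def by (intro x(2)) auto
  then show "x = 0" using co x(1) unfolding compact_by_def by blast
qed auto

lemma compact_byI:
  assumes "cspace s V" "\<And>l. l \<in> \<Lambda> \<Longrightarrow> functional s V l" "\<tau> = weak_topology V \<Lambda>"
    "\<And>x. x \<in> V \<Longrightarrow> (\<And>l. l \<in> \<Lambda> \<Longrightarrow> l x = 0) \<Longrightarrow> x = 0"
    "\<And>H. H \<subseteq> \<Lambda> \<times> UNIV \<Longrightarrow> finitely_solvable V H \<Longrightarrow> \<exists>x\<in>V. solves x H"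
  shows "compact_by s V \<tau> \<Lambda>"
  unfolding compact_by_def by (intro conjI ballI allI impI assms) (auto dest: bspec)

text \<open>
  The family consists of the coordinates of the product.  A finitely solvable system prescribes each
  coordinate at most once and never a non-zero value beyond the dimension of a factor, so it can be
  read off as a point of the product.
\<close>

lemma lin_compact_imp_compact_by:
  assumes "lin_compact s V \<tau>"
  obtains \<Lambda> where "compact_by s V \<tau> \<Lambda>"
proof -
  from assms obtain J :: "'a set" and d :: "'a \<Rightarrow> nat" and f :: "'a \<Rightarrow> 'a \<Rightarrow> nat \<Rightarrow> complex" where
    V: "cspace s V" and top: "topspace \<tau> = V"
    and f: "homeomorphic_map \<tau> (product_topology (\<lambda>j. discrete_topology (Cn (d j))) J) f"
    and lin: "\<And>j. j \<in> J \<Longrightarrow> linear_map V s (\<lambda>c v k. c * v k) (\<lambda>x. f x j)"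
    unfolding lin_compact_def by blast
  let ?P = "product_topology (\<lambda>j. discrete_topology (Cn (d j))) J"
  define \<Lambda> where "\<Lambda> = (\<lambda>(j, k) x. f x j k) ` (J \<times> UNIV)"
  have \<Lambda>I: "(\<lambda>x. f x j k) \<in> \<Lambda>" if "j \<in> J" for j k
    using that unfolding \<Lambda>_def by force
  have \<Lambda>E: "\<exists>j\<in>J. \<exists>k. l = (\<lambda>x. f x j k)" if "l \<in> \<Lambda>" for l
    using that unfolding \<Lambda>_def by force
  have im: "f ` V = (\<Pi>\<^sub>E j\<in>J. Cn (d j))" and inj: "inj_on f V"
    using homeomorphic_imp_surjective_map[OF f] homeomorphic_imp_injective_map[OF f] top by auto
  have fC: "f x j \<in> Cn (d j)" if "x \<in> V" "j \<in> J" for x j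
  proof -
    have "f x \<in> (\<Pi>\<^sub>E j\<in>J. Cn (d j))" using that(1) im by blast
    then show ?thesis using that(2) by (rule PiE_mem)
  qed
  have fnl: "functional s V (\<lambda>x. f x j k)" if "j \<in> J" for j k
    using lin[OF that] unfolding linear_map_def by (simp add: plus_fun_def)
  have cont: "continuous_map \<tau> ?P f" using f by (rule homeomorphic_imp_continuous_map)
  have lc: "locally_constant \<tau> (\<lambda>x. f x j k)" if "j \<in> J" for j k
  proof -
    have "continuous_map \<tau> (discrete_topology (Cn (d j))) (\<lambda>x. f x j)"
      using cont that by (simp add: continuous_map_componentwise)
    then have "continuous_map \<tau> (discrete_topology UNIV) ((\<lambda>v. v k) \<circ> (\<lambda>x. f x j))"
      by (rule continuous_map_compose) simp
    then show ?thesis by (simp add: o_def)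
  qed
  have "continuous_map (weak_topology V \<Lambda>) ?P f"
    unfolding continuous_map_componentwise
  proof (intro conjI ballI)
    show "f ` topspace (weak_topology V \<Lambda>) \<subseteq> extensional J" using im by (auto simp: PiE_def)
    fix j assume j: "j \<in> J"
    have "\<exists>U. openin (weak_topology V \<Lambda>) U \<and> p \<in> U \<and> (\<forall>q\<in>U. f p j = f q j)" if p: "p \<in> V" for p
    proof -
      let ?F = "(\<lambda>k x. f x j k) ` {..<d j}"
      have "locally_constant (weak_topology V \<Lambda>) (\<lambda>x. l (id x))" if "l \<in> ?F" for l
        using that j \<Lambda>I locally_constant_weak_topology[of l \<Lambda> V] by auto
      then obtain U where U: "openin (weak_topology V \<Lambda>) U" "p \<in> U" "\<forall>q\<in>U. \<forall>l\<in>?F. l (id p) = l (id q)"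
        using locally_constant_finite[of ?F "weak_topology V \<Lambda>" id p] p by auto
      have "f p j = f q j" if q: "q \<in> U" for q
      proof
        fix k
        have "q \<in> V" using U(1) q openin_subset by fastforce
        then have "f p j \<in> Cn (d j)" "f q j \<in> Cn (d j)" using fC j p by blast+
        moreover have "f p j k = f q j k" if "k < d j" using U(3) q that by auto
        ultimately show "f p j k = f q j k" by (cases "k < d j") (auto simp: Cn_def)
      qed
      then show ?thesis using U by blast
    qed
    then have "locally_constant (weak_topology V \<Lambda>) (\<lambda>x. f x j)"
      unfolding locally_constant_iff by simp
    then show "continuous_map (weak_topology V \<Lambda>) (discrete_topology (Cn (d j))) (\<lambda>x. f x j)"
      using fC j by (auto simp: continuous_map)
  qed
  moreover obtain g where g: "homeomorphic_maps \<tau> ?P f g" using f homeomorphic_map_maps by blast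
  ultimately have "continuous_map (weak_topology V \<Lambda>) \<tau> (g \<circ> f)"
    by (intro continuous_map_compose) (auto simp: homeomorphic_maps_def)
  then have "continuous_map (weak_topology V \<Lambda>) \<tau> id"
    by (rule continuous_map_eq) (use g top in \<open>auto simp: homeomorphic_maps_def\<close>)
  moreover have "continuous_map \<tau> (weak_topology V \<Lambda>) id"
    unfolding continuous_map_weak_topology
  proof (intro conjI ballI)
    fix l assume "l \<in> \<Lambda>"
    then obtain j k where "j \<in> J" "l = (\<lambda>x. f x j k)" using \<Lambda>E by blast
    then show "locally_constant \<tau> (\<lambda>p. l (id p))" using lc by simp
  qed (simp add: top)
  ultimately have \<tau>: "\<tau> = weak_topology V \<Lambda>"
    using top by (intro topology_eqI) auto
  have sep: "x = 0" if x: "x \<in> V" "\<And>l. l \<in> \<Lambda> \<Longrightarrow> l x = 0" for x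
  proof -
    have "f x = f 0"
    proof (rule PiE_ext[of _ J "\<lambda>j. Cn (d j)"])
      fix j assume j: "j \<in> J"
      show "f x j = f 0 j"
        using x(2)[OF \<Lambda>I[OF j]] linear_mapD(3)[OF fnl[OF j] V] by auto
    qed (use im x(1) cspaceD(4)[OF V] in blast)+
    then show ?thesis using inj x(1) cspaceD(4)[OF V] by (auto simp: inj_on_def)
  qed
  have solve: "\<exists>x\<in>V. solves x H" if H: "H \<subseteq> \<Lambda> \<times> UNIV" "finitely_solvable V H" for H
  proof -
    define E where "E = (\<lambda>j k c. ((\<lambda>x. f x j k), c) \<in> H)"
    have E1: "c = c'" if E: "E j k c" "E j k c'" for j k c c'
    proof -
      have "{((\<lambda>x. f x j k), c), ((\<lambda>x. f x j k), c')} \<subseteq> H" using E unfolding E_def by simp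
      then obtain x where "solves x {((\<lambda>x. f x j k), c), ((\<lambda>x. f x j k), c')}"
        by (rule finitely_solvableD[OF H(2)]) simp
      then have "f x j k = c" "f x j k = c'" unfolding solves_insert by blast+
      then show ?thesis by blast
    qed
    have E2: "c = 0" if E: "E j k c" "j \<in> J" "\<not> k < d j" for j k c
    proof -
      have "{((\<lambda>x. f x j k), c)} \<subseteq> H" using E unfolding E_def by simp
      then obtain x where x: "x \<in> V" "solves x {((\<lambda>x. f x j k), c)}"
        by (rule finitely_solvableD[OF H(2)]) simp
      have "f x j \<in> Cn (d j)" using fC E(2) x(1) by blast
      then show ?thesis using x(2) E(3) by (simp add: Cn_def)
    qed
    define p where "p = (\<lambda>j\<in>J. \<lambda>k. if \<exists>c. E j k c then THE c. E j k c else 0)"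
    have pE: "p j k = c" if "E j k c" "j \<in> J" for j k c
    proof -
      have "(THE c. E j k c) = c" using that(1) E1 by blast
      then show ?thesis using that unfolding p_def by auto
    qed
    have "p j k = 0" if "j \<in> J" "\<not> k < d j" for j k
      by (cases "\<exists>c. E j k c") (use that E2 pE in \<open>auto simp: p_def\<close>)
    then have "p \<in> (\<Pi>\<^sub>E j\<in>J. Cn (d j))" by (auto simp: Cn_def p_def not_less)
    then have "p \<in> f ` V" unfolding im .
    then obtain x where x: "x \<in> V" "f x = p" by (elim imageE) simp
    have "solves x H"
    proof (rule solvesI)
      fix l c assume lc: "(l, c) \<in> H"
      then obtain j k where j: "j \<in> J" and l: "l = (\<lambda>x. f x j k)" using H(1) \<Lambda>E by blast
      show "l x = c" using pE[of j k c] lc j x(2) unfolding E_def l by simp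
    qed
    then show ?thesis using x(1) by blast
  qed
  have "compact_by s V \<tau> \<Lambda>"
  proof (rule compact_byI[OF V _ \<tau> sep solve])
    fix l assume "l \<in> \<Lambda>"
    then obtain j k where "j \<in> J" "l = (\<lambda>x. f x j k)" using \<Lambda>E by blast
    then show "functional s V l" using fnl by simp
  qed
  then show ?thesis by (rule that)
qed

lemma compact_by_eqI:
  assumes co: "compact_by s V \<tau> \<Lambda>" and x: "x \<in> V" and y: "y \<in> V" and eq: "\<And>l. l \<in> \<Lambda> \<Longrightarrow> l x = l y"
  shows "x = y"
proof -
  have V: "cspace s V" and L: "\<And>l. l \<in> \<Lambda> \<Longrightarrow> functional s V l"
    and sep: "\<forall>x\<in>V. (\<forall>l\<in>\<Lambda>. l x = 0) \<longrightarrow> x = 0"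
    using co by (auto simp: compact_by_def)
  have "l (x - y) = 0" if "l \<in> \<Lambda>" for l
    using linear_mapD(5)[OF L[OF that] V x y] eq[OF that] by simp
  then have "x - y = 0" using sep cspaceD(7)[OF V x y] by blast
  then show ?thesis by simp
qed

text \<open>
  Linear independence of the functionals, in the form of finite partial dual vectors.
\<close>

definition independent_on ::
  "'a::ab_group_add set \<Rightarrow> ('a \<Rightarrow> complex) set \<Rightarrow> bool" where
  "independent_on V B \<longleftrightarrow>
     (\<forall>b\<in>B. \<forall>F\<subseteq>B - {b}. finite F \<longrightarrow> (\<exists>x\<in>V. b x = 1 \<and> (\<forall>l\<in>F. l x = 0)))"

lemma independent_onD:
  assumes "independent_on V B" "b \<in> B" "F \<subseteq> B - {b}" "finite F"
  obtains x where "x \<in> V" "b x = 1" "\<forall>l\<in>F. l x = 0"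
proof -
  have "\<exists>x\<in>V. b x = 1 \<and> (\<forall>l\<in>F. l x = 0)"
    by (rule assms(1)[unfolded independent_on_def, rule_format, OF assms(2-4)])
  then show ?thesis by (elim bexE conjE) (rule that)
qed

lemma maximal_independent_on:
  obtains B where "B \<subseteq> \<Lambda>" "independent_on V B"
    "\<And>l. l \<in> \<Lambda> \<Longrightarrow> independent_on V (insert l B) \<Longrightarrow> l \<in> B"
proof -
  let ?A = "{B. B \<subseteq> \<Lambda> \<and> independent_on V B}"
  have "\<exists>M\<in>?A. \<forall>X\<in>?A. M \<subseteq> X \<longrightarrow> X = M"
  proof (rule subset_Zorn_nonempty)
    have "{} \<in> ?A" by (simp add: independent_on_def)
    then show "?A \<noteq> {}" by blast
    fix C assume C: "C \<noteq> {}" "subset.chain ?A C"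
    then have CA: "C \<subseteq> ?A" by (auto simp: subset.chain_def)
    have "independent_on V (\<Union>C)"
      unfolding independent_on_def
    proof (intro ballI allI impI)
      fix b F assume b: "b \<in> \<Union>C" and F: "F \<subseteq> \<Union>C - {b}" "finite F"
      obtain B where B: "B \<in> C" "insert b F \<subseteq> B"
        using finite_subset_Union_chain[OF _ _ C(1,2), of "insert b F"] b F by auto
      then have "independent_on V B" using CA by blast
      moreover have "b \<in> B" "F \<subseteq> B - {b}" using B(2) F(1) by auto
      ultimately show "\<exists>x\<in>V. b x = 1 \<and> (\<forall>l\<in>F. l x = 0)"
        unfolding independent_on_def using F(2) by simp
    qed
    then show "\<Union>C \<in> ?A" using CA by blast
  qed
  then obtain B where B: "B \<in> ?A" "\<forall>X\<in>?A. B \<subseteq> X \<longrightarrow> X = B" by (elim bexE)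
  show ?thesis
  proof (rule that)
    show "B \<subseteq> \<Lambda>" "independent_on V B" using B(1) by simp_all
    fix l assume "l \<in> \<Lambda>" "independent_on V (insert l B)"
    then have "insert l B = B" using B by (intro B(2)[rule_format]) auto
    then show "l \<in> B" by blast
  qed
qed

text \<open>
  If \<open>l y \<noteq> 0\<close> for some \<open>y\<close> killed by \<open>B\<close>, then subtracting multiples of \<open>y\<close> from the dual vectors of \<open>B\<close>
  shows that \<open>l\<close> is independent of \<open>B\<close>.
\<close>

lemma maximal_independent_separating:
  assumes V: "cspace s V" and L: "\<And>l. l \<in> \<Lambda> \<Longrightarrow> functional s V l"
    and B: "B \<subseteq> \<Lambda>" "independent_on V B"
    and max: "\<And>l. l \<in> \<Lambda> \<Longrightarrow> independent_on V (insert l B) \<Longrightarrow> l \<in> B"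
    and y: "y \<in> V" "\<forall>b\<in>B. b y = 0" and l: "l \<in> \<Lambda>"
  shows "l y = 0"
proof (rule ccontr)
  assume ly: "l y \<noteq> 0"
  note c = cspaceD[OF V] and lf = linear_mapD[OF L[OF l] V]
  have "independent_on V (insert l B)"
    unfolding independent_on_def
  proof (intro ballI allI impI)
    fix b F assume b: "b \<in> insert l B" and F: "F \<subseteq> insert l B - {b}" "finite F"
    show "\<exists>x\<in>V. b x = 1 \<and> (\<forall>m\<in>F. m x = 0)"
    proof (cases "b = l")
      case True
      have "m (s (1 / l y) y) = 0" if "m \<in> F" for m
      proof -
        have m: "m \<in> B" using F True that by blast
        have "functional s V m" using B(1) L m by blast
        then show ?thesis using linear_mapD(2)[OF \<open>functional s V m\<close> V y(1)] bspec[OF y(2) m] by simp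
      qed
      moreover have "l (s (1 / l y) y) = 1" using lf(2)[OF y(1)] ly by simp
      ultimately show ?thesis using True c(5)[OF y(1)] by (intro bexI[of _ "s (1 / l y) y"]) auto
    next
      case False
      then have bB: "b \<in> B" using b by blast
      have "F - {l} \<subseteq> B - {b}" "finite (F - {l})" using F by auto
      then obtain x where x: "x \<in> V" "b x = 1" "\<forall>m\<in>F - {l}. m x = 0"
        by (rule independent_onD[OF B(2) bB]) 
      let ?z = "x - s (l x / l y) y"
      have mz: "m ?z = m x" if m: "m \<in> B" for m
      proof -
        have "functional s V m" using B(1) L m by blast
        note m' = linear_mapD[OF this V]
        show ?thesis using m'(5)[OF x(1) c(5)[OF y(1)]] m'(2)[OF y(1)] bspec[OF y(2) m] by simp
      qed
      have "l ?z = 0" using lf(5)[OF x(1) c(5)[OF y(1)]] lf(2)[OF y(1)] ly by simp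
      moreover have "m ?z = 0" if "m \<in> F - {l}" for m
        using that F(1) mz[of m] bspec[OF x(3) that] by auto
      ultimately have "\<forall>m\<in>F. m ?z = 0" by blast
      moreover have "b ?z = 1" using mz[OF bB] x(2) by simp
      ultimately show ?thesis using c(7)[OF x(1) c(5)[OF y(1)]] by blast
    qed
  qed
  then have "l \<in> B" using max l by blast
  then show False using y(2) ly by blast
qed

lemma independent_on_finitely_solvable:
  assumes V: "cspace s V" and L: "\<And>l. l \<in> B \<Longrightarrow> functional s V l" and B: "independent_on V B"
  shows "finitely_solvable V ((\<lambda>b. (b, h b)) ` B)"
proof (rule finitely_solvableI)
  fix F assume F: "F \<subseteq> (\<lambda>b. (b, h b)) ` B" "finite F"
  then obtain G where G: "G \<subseteq> B" "finite G" "F = (\<lambda>b. (b, h b)) ` G"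
    by (meson finite_subset_image)
  note c = cspaceD[OF V]
  from G(2,1) have "\<exists>x\<in>V. solves x ((\<lambda>b. (b, h b)) ` G)"
  proof (induction G rule: finite_induct)
    case empty
    then show ?case using c(4) by auto
  next
    case (insert b G)
    then obtain x where x: "x \<in> V" "solves x ((\<lambda>b. (b, h b)) ` G)" by auto
    have "b \<in> B" "G \<subseteq> B - {b}" using insert by auto
    then obtain e where e: "e \<in> V" "b e = 1" "\<forall>l\<in>G. l e = 0"
      by (rule independent_onD[OF B _ _ insert.hyps(1)])
    let ?x = "x + s (h b - b x) e"
    have val: "m ?x = m x + (h b - b x) * m e" if m: "m \<in> B" for m
      using linear_mapD(1)[OF L[OF m] V x(1) c(5)[OF e(1)]] linear_mapD(2)[OF L[OF m] V e(1)] by simp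
    have "solves ?x ((\<lambda>b. (b, h b)) ` insert b G)"
    proof (rule solvesI)
      fix m d assume md: "(m, d) \<in> (\<lambda>b. (b, h b)) ` insert b G"
      show "m ?x = d"
      proof (cases "m = b")
        case True
        then show ?thesis using md val[OF \<open>b \<in> B\<close>] e(2) by auto
      next
        case False
        then have m: "m \<in> G" "(m, d) \<in> (\<lambda>b. (b, h b)) ` G" using md by auto
        then show ?thesis using val[of m] bspec[OF e(3) m(1)] solvesD[OF x(2) m(2)] \<open>G \<subseteq> B - {b}\<close> by auto
      qed
    qed
    then show ?case using c(6)[OF x(1) c(5)[OF e(1)]] by blast
  qed
  then show "\<exists>x\<in>V. solves x F" using G(3) by simp
qed

text \<open>
  A maximal independent subfamily \<open>B\<close> still separates points and can be prescribed freely, so evaluation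
  at \<open>B\<close> identifies \<open>V\<close> with \<open>\<complex>\<^sup>B\<close>.  Linear compactness asks for an index set in the type of \<open>V\<close>; the
  vectors \<open>e b\<close> of the basis dual to \<open>B\<close> serve as indices.
\<close>

lemma compact_by_imp_lin_compact:
  assumes co: "compact_by s V \<tau> \<Lambda>"
  shows "lin_compact s V \<tau>"
proof -
  have V: "cspace s V" and L: "\<And>l. l \<in> \<Lambda> \<Longrightarrow> functional s V l" and \<tau>: "\<tau> = weak_topology V \<Lambda>"
    and sep: "\<And>x. x \<in> V \<Longrightarrow> (\<And>l. l \<in> \<Lambda> \<Longrightarrow> l x = 0) \<Longrightarrow> x = 0"
    using co by (auto simp: compact_by_def)
  note c = cspaceD[OF V]
  obtain B where B: "B \<subseteq> \<Lambda>" "independent_on V B"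
    and max: "\<And>l. l \<in> \<Lambda> \<Longrightarrow> independent_on V (insert l B) \<Longrightarrow> l \<in> B"
    using maximal_independent_on[of \<Lambda> V] by blast
  have LB: "functional s V b" if "b \<in> B" for b using L B(1) that by blast
  have coB: "compact_by s V \<tau> B"
  proof (rule compact_by_separating[OF co LB])
    show "locally_constant \<tau> m" if "m \<in> B" for m
      using that B(1) \<tau> locally_constant_weak_topology by blast
    fix x assume x: "x \<in> V" and "\<And>m. m \<in> B \<Longrightarrow> m x = 0"
    then have xB: "\<forall>b\<in>B. b x = 0" by blast
    show "x = 0"
    proof (rule sep[OF x])
      show "l x = 0" if "l \<in> \<Lambda>" for l
        by (rule maximal_independent_separating[OF V L B max x xB that])
    qed
  qed
  then have \<tau>B: "\<tau> = weak_topology V B" 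
    and sepB: "\<And>x. x \<in> V \<Longrightarrow> (\<And>l. l \<in> B \<Longrightarrow> l x = 0) \<Longrightarrow> x = 0"
    by (auto simp: compact_by_def)
  note uniq = compact_by_eqI[OF coB]
  have "\<exists>x\<in>V. \<forall>b\<in>B. b x = h b" for h
  proof -
    have fH: "functional s V m" "locally_constant \<tau> m" if "(m, d) \<in> (\<lambda>b. (b, h b)) ` B" for m d
      using that LB \<tau>B locally_constant_weak_topology by auto
    obtain x where x: "x \<in> V" "solves x ((\<lambda>b. (b, h b)) ` B)"
      by (rule compact_by_solve[OF coB fH independent_on_finitely_solvable[OF V LB B(2), of h]])
    have "b x = h b" if "b \<in> B" for b by (rule solvesD[OF x(2)]) (use that in blast)
    then show ?thesis using x(1) by blast
  qed
  then obtain v where v: "\<And>h. v h \<in> V" "\<And>h b. b \<in> B \<Longrightarrow> b (v h) = h b" by metis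
  define e where "e b = v (\<lambda>b'. if b' = b then 1 else 0)" for b
  have e: "b' (e b) = (if b' = b then 1 else 0)" if "b' \<in> B" for b b'
    unfolding e_def using v(2)[OF that] by simp
  have inj: "inj_on e B"
  proof (rule inj_onI)
    fix b b' assume b: "b \<in> B" "b' \<in> B" "e b = e b'"
    then show "b = b'" using e[OF b(1), of b] e[OF b(1), of b'] by (auto split: if_splits)
  qed
  define u where "u = inv_into B e"
  have u: "u (e b) = b" if "b \<in> B" for b unfolding u_def using inj that by (rule inv_into_f_f)
  let ?J = "e ` B"
  let ?P = "product_topology (\<lambda>j. discrete_topology (Cn 1)) ?J"
  define f where "f x = (\<lambda>j\<in>?J. \<lambda>k::nat. if k = 0 then u j x else 0)" for x
  define g where "g p = v (\<lambda>b. p (e b) 0)" for p :: "'a \<Rightarrow> nat \<Rightarrow> complex"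
  have fe: "f x (e b) = (\<lambda>k. if k = 0 then b x else 0)" if "b \<in> B" for x b
    using that by (simp add: f_def u cong: if_cong)
  have gb: "b (g p) = p (e b) 0" if "b \<in> B" for p b
    unfolding g_def using v(2)[OF that] by simp
  have Cn1: "(\<lambda>k::nat. if k = 0 then z else 0) \<in> Cn 1" for z by (simp add: Cn_def)
  have "homeomorphic_maps \<tau> ?P f g"
    unfolding homeomorphic_maps_def
  proof (intro conjI ballI)
    show "continuous_map \<tau> ?P f"
      unfolding continuous_map_componentwise
    proof (intro conjI ballI)
      show "f ` topspace \<tau> \<subseteq> extensional ?J" unfolding f_def by auto
      fix j assume "j \<in> ?J"
      then obtain b where b: "b \<in> B" "j = e b" by blast
      have "locally_constant \<tau> b" using b(1) \<tau>B locally_constant_weak_topology by blast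
      then have "continuous_map \<tau> (discrete_topology (Cn 1)) ((\<lambda>z k. if k = 0 then z else 0) \<circ> b)"
        by (rule continuous_map_compose) (use Cn1 in simp)
      then show "continuous_map \<tau> (discrete_topology (Cn 1)) (\<lambda>x. f x j)"
        using fe[OF b(1)] b(2) by (simp add: o_def)
    qed
    show "continuous_map ?P \<tau> g"
      unfolding \<tau>B continuous_map_weak_topology
    proof (intro conjI ballI)
      show "g \<in> topspace ?P \<rightarrow> V" using v(1) unfolding g_def by blast
      fix b assume b: "b \<in> B"
      have "continuous_map ?P (discrete_topology (Cn 1)) (\<lambda>p. p (e b))"
        using b by (intro continuous_map_product_projection) auto
      then have "continuous_map ?P (discrete_topology UNIV) ((\<lambda>w. w 0) \<circ> (\<lambda>p. p (e b)))"
        by (rule continuous_map_compose) simp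
      then show "locally_constant ?P (\<lambda>p. b (g p))" using gb[OF b] by (simp add: o_def)
    qed
    show "g (f x) = x" if "x \<in> topspace \<tau>" for x
      using that v(1) \<tau>B by (intro uniq) (simp_all add: gb fe, simp add: g_def)
    show "f (g p) = p" if p: "p \<in> topspace ?P" for p
    proof
      fix j show "f (g p) j = p j"
      proof (cases "j \<in> ?J")
        case True
        then obtain b where b: "b \<in> B" "j = e b" by blast
        have "p j \<in> Cn 1" using p True by auto
        then show ?thesis unfolding b(2) fe[OF b(1)] gb[OF b(1)] by (auto simp: Cn_def)
      next
        case False
        then show ?thesis using p by (auto simp: f_def PiE_def extensional_def)
      qed
    qed
  qed
  then have "homeomorphic_map \<tau> ?P f" using homeomorphic_map_maps by blast
  moreover have "linear_map V s (\<lambda>c v k. c * v k) (\<lambda>x. f x j)" if "j \<in> ?J" for j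
  proof -
    obtain b where b: "b \<in> B" "j = e b" using \<open>j \<in> ?J\<close> by blast
    then have "(\<lambda>x. f x j) = (\<lambda>x k. if k = 0 then b x else 0)" using fe by (simp add: fun_eq_iff)
    then show ?thesis
      using linear_mapD[OF LB[OF b(1)] V] by (auto simp: linear_map_def fun_eq_iff)
  qed
  ultimately show ?thesis
    unfolding lin_compact_def using V \<tau>
    by (intro conjI exI[of _ ?J] exI[of _ "\<lambda>_. 1"] exI[of _ f]) auto
qed

text \<open>
  A system on \<open>W\<close>, extended to prescribe all pulled back functionals, is solved in \<open>V\<close> by some \<open>x\<close>.  Finite
  parts are solved by points \<open>i w\<close> arbitrarily close to \<open>x\<close>; as the continuous map \<open>i \<circ> p\<close> fixes these, it
  fixes \<open>x\<close>, so \<open>x\<close> comes from \<open>W\<close>.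
\<close>

lemma compact_by_retract:
  assumes co: "compact_by s V \<tau> \<Lambda>" and W: "cspace s' W" "topspace \<sigma> = W"
    and i: "linear_map W s' s i" "continuous_map \<sigma> \<tau> i"
    and p: "continuous_map \<tau> \<sigma> p" "\<And>w. w \<in> W \<Longrightarrow> p (i w) = w"
  shows "compact_by s' W \<sigma> ((\<lambda>l w. l (i w)) ` \<Lambda>)"
proof -
  let ?M = "(\<lambda>l w. l (i w)) ` \<Lambda>"
  have V: "cspace s V" and L: "\<And>l. l \<in> \<Lambda> \<Longrightarrow> functional s V l" and \<tau>: "\<tau> = weak_topology V \<Lambda>"
    and sep: "\<And>x. x \<in> V \<Longrightarrow> (\<And>l. l \<in> \<Lambda> \<Longrightarrow> l x = 0) \<Longrightarrow> x = 0"
    using co by (auto simp: compact_by_def)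
  note c = cspaceD[OF V]
  note uniq = compact_by_eqI[OF co]
  have iV: "i w \<in> V" if "w \<in> W" for w
    using continuous_map_funspace[OF i(2)] that W(2) \<tau> by auto
  have pW: "p v \<in> W" if "v \<in> V" for v
    using continuous_map_funspace[OF p(1)] that W(2) \<tau> by auto
  have M: "functional s' W (\<lambda>w. l (i w))" if "l \<in> \<Lambda>" for l
    using linear_mapD(1,2)[OF L[OF that] V] linear_mapD(1,2)[OF i(1) W(1)] iV
    unfolding linear_map_def by auto
  have M': "functional s' W m" if "m \<in> ?M" for m using M that by auto
  have lcl: "locally_constant \<tau> l" if "l \<in> \<Lambda>" for l
    using that \<tau> locally_constant_weak_topology by blast
  have i0: "i 0 = 0" by (rule linear_mapD(3)[OF i(1) W(1)])
  have "\<sigma> = weak_topology W ?M"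
  proof (rule topology_eqI)
    show "continuous_map \<sigma> (weak_topology W ?M) id"
      using continuous_map_compose[OF i(2) lcl] W(2)
      by (auto simp: continuous_map_weak_topology o_def)
    have "continuous_map (weak_topology W ?M) \<tau> i"
      unfolding \<tau> continuous_map_weak_topology
      using iV locally_constant_weak_topology[of _ ?M W] by auto
    then have "continuous_map (weak_topology W ?M) \<sigma> (p \<circ> i)"
      using p(1) by (rule continuous_map_compose)
    then show "continuous_map (weak_topology W ?M) \<sigma> id"
      by (rule continuous_map_eq) (simp add: p(2))
  qed (simp add: W)
  moreover have "w = 0" if w: "w \<in> W" "\<forall>m\<in>?M. m w = 0" for w
  proof -
    have "i w = 0" using sep[OF iV[OF w(1)]] w(2) by auto
    then show ?thesis using p(2)[OF w(1)] p(2)[OF cspaceD(4)[OF W(1)]] i0 by simp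
  qed
  moreover have "\<exists>w\<in>W. solves w H" if H: "H \<subseteq> ?M \<times> UNIV" "finitely_solvable W H" for H
  proof -
    obtain H' where H': "H \<subseteq> H'" "finitely_solvable W H'" "?M \<subseteq> fst ` H'"
      using finitely_solvable_extend[OF W(1) M' H] by blast
    define K where "K = {(l, d). l \<in> \<Lambda> \<and> ((\<lambda>w. l (i w)), d) \<in> H'}"
    have solK: "\<exists>w\<in>W. solves (i w) F" if F: "F \<subseteq> K" "finite F" for F
    proof -
      let ?F = "(\<lambda>(l, d). ((\<lambda>w. l (i w)), d)) ` F"
      have "?F \<subseteq> H'" "finite ?F" using F unfolding K_def by auto
      then obtain w where w: "w \<in> W" "solves w ?F" by (rule finitely_solvableD[OF H'(2)])
      have "solves (i w) F"
      proof (rule solvesI)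
        fix l d assume "(l, d) \<in> F"
        then have "((\<lambda>w. l (i w)), d) \<in> ?F" by force
        then show "l (i w) = d" using solvesD[OF w(2)] by blast
      qed
      then show ?thesis using w(1) by blast
    qed
    have sK: "finitely_solvable V K"
      by (rule finitely_solvableI) (use solK iV in meson)
    have fK: "functional s V m" "locally_constant \<tau> m" if "(m, d) \<in> K" for m d
      using that L lcl unfolding K_def by auto
    obtain x where x: "x \<in> V" "solves x K"
      by (rule compact_by_solve[OF co fK sK])
    have K: "\<exists>d. (l, d) \<in> K" if "l \<in> \<Lambda>" for l
    proof -
      have "(\<lambda>w. l (i w)) \<in> fst ` H'" using H'(3) that by blast
      then show ?thesis using that unfolding K_def by force
    qed
    have "i (p x) = x"
    proof (rule uniq)
      show "i (p x) \<in> V" using iV pW x(1) by blast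
      fix l assume l: "l \<in> \<Lambda>"
      have "locally_constant \<tau> (l \<circ> (i \<circ> p))"
        by (rule continuous_map_compose[OF continuous_map_compose[OF p(1) i(2)] lcl[OF l]])
      then obtain U where U: "openin \<tau> U" "x \<in> U" "\<forall>q\<in>U. (l \<circ> (i \<circ> p)) x = (l \<circ> (i \<circ> p)) q"
        unfolding locally_constant_iff using x(1) \<tau> by auto
      then obtain F where F: "F \<subseteq> \<Lambda>" "finite F" "\<forall>y\<in>V. (\<forall>l\<in>F. l y = l x) \<longrightarrow> y \<in> U"
        unfolding \<tau> openin_weak_topology by blast
      have "insert l F \<subseteq> fst ` K" using K F(1) l by force
      then obtain G where G: "G \<subseteq> K" "finite G" "insert l F = fst ` G"
        using F(2) by (meson finite_insert finite_subset_image)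
      obtain w where w: "w \<in> W" "solves (i w) G" using solK G by blast
      have eq: "m (i w) = m x" if m: "m \<in> insert l F" for m
      proof -
        obtain d where d: "(m, d) \<in> G" using m G(3) by auto
        then have "(m, d) \<in> K" using G(1) by blast
        then show ?thesis using solvesD[OF x(2), of m d] solvesD[OF w(2) d] by simp
      qed
      have "i w \<in> U" by (rule F(3)[rule_format]) (use iV w(1) eq in auto)
      then have "l (i (p x)) = l (i (p (i w)))" using U(3) by (metis comp_apply)
      then show "l (i (p x)) = l x" using eq[of l] p(2)[OF w(1)] by simp
    qed (rule x(1))
    have "solves (p x) H"
    proof (rule solvesI)
      fix m d assume md: "(m, d) \<in> H"
      then obtain l where l: "l \<in> \<Lambda>" "m = (\<lambda>w. l (i w))" using H(1) by auto
      then have "(l, d) \<in> K" using md H'(1) unfolding K_def by auto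
      then show "m (p x) = d" using solvesD[OF x(2)] l(2) \<open>i (p x) = x\<close> by simp
    qed
    then show ?thesis using pW x(1) by blast
  qed
  ultimately show ?thesis by (intro compact_byI[OF W(1) M']) auto
qed

section \<open>3-algebras with zero center\<close>

lemma antilinear_mapD:
  assumes "antilinear_map V s s' f" "cspace s V"
  shows "x \<in> V \<Longrightarrow> y \<in> V \<Longrightarrow> f (x + y) = f x + f y" "x \<in> V \<Longrightarrow> f (s c x) = s' (cnj c) (f x)"
    "f 0 = 0" "x \<in> V \<Longrightarrow> f (- x) = - f x" "x \<in> V \<Longrightarrow> y \<in> V \<Longrightarrow> f (x - y) = f x - f y"
proof -
  note c = cspaceD[OF assms(2)]
  show a: "f (x + y) = f x + f y" if "x \<in> V" "y \<in> V" for x y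
    using assms(1) that by (simp add: antilinear_map_def)
  show "x \<in> V \<Longrightarrow> f (s c x) = s' (cnj c) (f x)" using assms(1) by (simp add: antilinear_map_def)
  show 0: "f 0 = 0" using a[of 0 0] c(4) by simp
  show n: "f (- x) = - f x" if "x \<in> V" for x
    using a[of x "- x"] c(8)[OF that] that 0 by (simp add: eq_neg_iff_add_eq_0 add.commute)
  show "f (x - y) = f x - f y" if "x \<in> V" "y \<in> V"
    using a[of x "- y"] n[of y] c(8)[of y] that by simp
qed

locale zero_center_N6 =
  fixes T :: "'a::ab_group_add alg3"
  assumes N6: "physical_N6 T" and center: "center3 T = {0}"
begin

abbreviation "V \<equiv> tcar T"
abbreviation "s \<equiv> tscl T"
abbreviation "br \<equiv> tbr T"

lemma physical: "physical_alg3 T"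
  using N6 unfolding physical_N6_def by (rule conjunct1)

lemma cspace_V: "cspace s V"
  using physical unfolding physical_alg3_def by (rule conjunct1)

lemmas V_rules [simp] = cspaceD(4-8)[OF cspace_V]

sublocale vs: vector_space s
  by (rule cspaceD(1)[OF cspace_V])

sublocale vf: vector_space "\<lambda>c (A :: 'a \<Rightarrow> 'a) z. s c (A z)"
  by unfold_locales (simp_all add: fun_eq_iff vs.scale_right_distrib vs.scale_left_distrib)

sublocale vp: vector_space "\<lambda>c (\<psi> :: 'a \<Rightarrow> 'a \<Rightarrow> 'a) y z. s c (\<psi> y z)"
  by unfold_locales (simp_all add: fun_eq_iff vs.scale_right_distrib vs.scale_left_distrib)

sublocale vl: vector_space "lie_scale s"
  by unfold_locales
    (auto simp: lie_scale_def fun_eq_iff vs.scale_right_distrib vs.scale_left_distrib)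

lemma br_closed [simp]: "x \<in> V \<Longrightarrow> y \<in> V \<Longrightarrow> z \<in> V \<Longrightarrow> br x y z \<in> V"
  using physical unfolding physical_alg3_def by blast

lemma br_linear1: "y \<in> V \<Longrightarrow> z \<in> V \<Longrightarrow> linear_map V s s (\<lambda>x. br x y z)"
  and br_antilinear2: "x \<in> V \<Longrightarrow> z \<in> V \<Longrightarrow> antilinear_map V s s (\<lambda>y. br x y z)"
  and br_linear3: "x \<in> V \<Longrightarrow> y \<in> V \<Longrightarrow> linear_map V s s (\<lambda>z. br x y z)"
  using physical unfolding physical_alg3_def by blast+

lemmas br1 [simp] = linear_mapD[OF br_linear1 cspace_V]
lemmas br2 [simp] = antilinear_mapD[OF br_antilinear2 cspace_V]
lemmas br3 [simp] = linear_mapD[OF br_linear3 cspace_V]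

lemma br_antisym: "x \<in> V \<Longrightarrow> y \<in> V \<Longrightarrow> z \<in> V \<Longrightarrow> br x y z = - br z y x"
  using N6 unfolding physical_N6_def by blast

lemma fundamental_identity:
  "\<lbrakk>a \<in> V; b \<in> V; x \<in> V; y \<in> V; z \<in> V\<rbrakk> \<Longrightarrow>
     br a b (br x y z) = br (br a b x) y z - br x (br b a y) z + br x y (br a b z)"
  using N6 unfolding physical_N6_def by blast

text \<open>
  The form in which the zero center is used: an element is determined by its action as middle argument.
\<close>

lemma br_middle_eqI:
  assumes "u \<in> V" "v \<in> V" "\<And>x z. x \<in> V \<Longrightarrow> z \<in> V \<Longrightarrow> br x u z = br x v z"
  shows "u = v"
proof -
  have "u - v \<in> center3 T" using assms unfolding center3_def by simp
  then show ?thesis using center by simp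
qed

text \<open>
  The two ways of expanding the commutator of \<open>L\<^bsub>a,b\<^esub>\<close> and \<open>L\<^bsub>x,y\<^esub>\<close> by the fundamental identity.
\<close>

lemma commutator_identity:
  assumes "a \<in> V" "b \<in> V" "x \<in> V" "y \<in> V" "z \<in> V"
  shows "br (br a b x) y z - br x (br b a y) z = - br (br x y a) b z + br a (br y x b) z"
  using fundamental_identity[of a b x y z] fundamental_identity[of x y a b z] assms
  by (simp add: algebra_simps)

text \<open>
  The center is defined by the middle argument, but an element that acts trivially in the first position
  also vanishes: by antisymmetry it acts trivially in the third one, then by \<open>commutator_identity\<close> every
  \<open>[b,z,y]\<close> is central, so \<open>[b,z,y] = 0\<close>, and \<open>z\<close> itself is central.
\<close>

lemma left_kernel_trivial:
  assumes z: "z \<in> V" and 0: "\<And>x w. x \<in> V \<Longrightarrow> w \<in> V \<Longrightarrow> br z x w = 0"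
  shows "z = 0"
proof -
  have r0: "br w x z = 0" if "x \<in> V" "w \<in> V" for x w
    using br_antisym[of w x z] 0 that z by simp
  have inner: "br b z y = 0" if bv: "b \<in> V" "y \<in> V" for b y
  proof (rule br_middle_eqI)
    fix x w assume "x \<in> V" "w \<in> V"
    then show "br x (br b z y) w = br x 0 w"
      using commutator_identity[of z b x y w] bv z 0 r0 by simp
  qed (use bv z in simp_all)
  show ?thesis
    by (rule br_middle_eqI) (use z inner in simp_all)
qed

section \<open>Derivations and their adjoints\<close>

definition endo :: "('a \<Rightarrow> 'a) \<Rightarrow> bool" where
  "endo A \<longleftrightarrow> linear_map V s s A \<and> (\<forall>z\<in>V. A z \<in> V) \<and> (\<forall>z. z \<notin> V \<longrightarrow> A z = 0)"

text \<open>
  The fundamental identity says that \<open>L\<^bsub>a,b\<^esub>\<close> and \<open>L\<^bsub>b,a\<^esub>\<close> form such a pair.  Operators with an adjoint are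
  the natural degree 0 part of a Lie superalgebra: \<open>act01_phi\<close> shows that their action on the forms
  \<open>\<phi>\<^sub>x\<close> is through the adjoint, which the zero center makes unique.
\<close>

definition adjoint_pair :: "('a \<Rightarrow> 'a) \<Rightarrow> ('a \<Rightarrow> 'a) \<Rightarrow> bool" where
  "adjoint_pair A B \<longleftrightarrow> (\<forall>y\<in>V. B y \<in> V) \<and>
     (\<forall>x\<in>V. \<forall>y\<in>V. \<forall>z\<in>V. A (br x y z) = br (A x) y z - br x (B y) z + br x y (A z))"

definition Der :: "('a \<Rightarrow> 'a) set" where
  "Der = {A. endo A \<and> (\<exists>B. adjoint_pair A B)}"

definition adj :: "('a \<Rightarrow> 'a) \<Rightarrow> 'a \<Rightarrow> 'a" where
  "adj A = (\<lambda>y. if y \<in> V then (SOME B. adjoint_pair A B) y else 0)"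

lemma endoD:
  assumes "endo A"
  shows "x \<in> V \<Longrightarrow> y \<in> V \<Longrightarrow> A (x + y) = A x + A y" "x \<in> V \<Longrightarrow> A (s c x) = s c (A x)"
    "A 0 = 0" "x \<in> V \<Longrightarrow> A (- x) = - A x" "x \<in> V \<Longrightarrow> y \<in> V \<Longrightarrow> A (x - y) = A x - A y"
    "A z \<in> V" "z \<notin> V \<Longrightarrow> A z = 0"
proof -
  have l: "linear_map V s s A" and c: "\<And>z. z \<in> V \<Longrightarrow> A z \<in> V" and o: "\<And>z. z \<notin> V \<Longrightarrow> A z = 0"
    using assms by (auto simp: endo_def)
  show "x \<in> V \<Longrightarrow> y \<in> V \<Longrightarrow> A (x + y) = A x + A y" "x \<in> V \<Longrightarrow> A (s c x) = s c (A x)"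
    "A 0 = 0" "x \<in> V \<Longrightarrow> A (- x) = - A x" "x \<in> V \<Longrightarrow> y \<in> V \<Longrightarrow> A (x - y) = A x - A y"
    by (simp_all add: linear_mapD[OF l cspace_V])
  show "A z \<in> V" "z \<notin> V \<Longrightarrow> A z = 0" using c o by (cases "z \<in> V"; simp)+
qed

lemma adjointD:
  "adjoint_pair A B \<Longrightarrow> y \<in> V \<Longrightarrow> B y \<in> V"
  "adjoint_pair A B \<Longrightarrow> x \<in> V \<Longrightarrow> y \<in> V \<Longrightarrow> z \<in> V \<Longrightarrow>
     A (br x y z) = br (A x) y z - br x (B y) z + br x y (A z)"
  by (auto simp: adjoint_pair_def)

lemma adjoint_unique:
  assumes "adjoint_pair A B" "adjoint_pair A C" "y \<in> V"
  shows "B y = C y"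
proof (rule br_middle_eqI)
  fix x z assume "x \<in> V" "z \<in> V"
  then show "br x (B y) z = br x (C y) z"
    using adjointD(2)[OF assms(1)] adjointD(2)[OF assms(2)] assms(3)
    by (simp add: algebra_simps)
qed (use assms adjointD(1) in blast)+

lemma adj_eq:
  assumes "adjoint_pair A B" "y \<in> V"
  shows "adj A y = B y"
proof -
  have "adjoint_pair A (SOME B. adjoint_pair A B)" using assms(1) by (rule someI[where P = "adjoint_pair A"])
  from adjoint_unique[OF this assms] show ?thesis using assms(2) by (simp add: adj_def)
qed

lemma DerD:
  assumes "A \<in> Der"
  shows "endo A" "adjoint_pair A (adj A)" "adj A y \<in> V" "y \<notin> V \<Longrightarrow> adj A y = 0"
proof -
  from assms obtain B where B: "endo A" "adjoint_pair A B" by (auto simp: Der_def)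
  show "endo A" by fact
  show "adjoint_pair A (adj A)"
    using B(2) adj_eq[OF B(2)] unfolding adjoint_pair_def by auto
  then have "adj A y \<in> V" if "y \<in> V" using adjointD(1) that by blast
  moreover show 0: "y \<notin> V \<Longrightarrow> adj A y = 0" by (simp add: adj_def)
  ultimately show "adj A y \<in> V" by (cases "y \<in> V") simp_all
qed

lemma DerI: "endo A \<Longrightarrow> adjoint_pair A B \<Longrightarrow> A \<in> Der"
  by (auto simp: Der_def)

lemma adj_eqI:
  assumes "adjoint_pair A B" "\<And>y. y \<notin> V \<Longrightarrow> B y = 0"
  shows "adj A = B"
  using assms adj_eq[OF assms(1)] by (auto simp: fun_eq_iff adj_def)

lemma Lop_endo [simp]: "x \<in> V \<Longrightarrow> y \<in> V \<Longrightarrow> endo (Lop T x y)"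
  by (auto simp: endo_def linear_map_def Lop_def)

lemma Lop_apply [simp]: "z \<in> V \<Longrightarrow> Lop T x y z = br x y z"
  by (simp add: Lop_def)

lemma Lop_outside: "z \<notin> V \<Longrightarrow> Lop T x y z = 0"
  by (simp add: Lop_def)

lemma Lop_adjoint: "x \<in> V \<Longrightarrow> y \<in> V \<Longrightarrow> adjoint_pair (Lop T x y) (Lop T y x)"
  unfolding adjoint_pair_def using fundamental_identity[of x y] by simp

lemma Lop_Der: "x \<in> V \<Longrightarrow> y \<in> V \<Longrightarrow> Lop T x y \<in> Der"
  using Lop_adjoint DerI Lop_endo by blast

lemma adj_Lop: "x \<in> V \<Longrightarrow> y \<in> V \<Longrightarrow> adj (Lop T x y) = Lop T y x"
  by (intro adj_eqI Lop_adjoint) (simp_all add: Lop_def)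

lemma endo_add: "endo A \<Longrightarrow> endo B \<Longrightarrow> endo (A + B)"
  and endo_scale: "endo A \<Longrightarrow> endo (\<lambda>z. s c (A z))"
  and endo_0: "endo 0"
  by (auto simp: endo_def linear_map_def vs.scale_right_distrib vs.scale_left_commute)

lemma adjoint_add: "endo A \<Longrightarrow> endo A' \<Longrightarrow> adjoint_pair A B \<Longrightarrow> adjoint_pair A' B' \<Longrightarrow> adjoint_pair (A + A') (B + B')"
  by (simp add: adjoint_pair_def endoD)

lemma adjoint_scale: "endo A \<Longrightarrow> adjoint_pair A B \<Longrightarrow> adjoint_pair (\<lambda>z. s c (A z)) (\<lambda>z. s (cnj c) (B z))"
  by (simp add: adjoint_pair_def endoD vs.scale_right_distrib vs.scale_right_diff_distrib)

lemma adjoint_0: "adjoint_pair 0 0"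
  by (simp add: adjoint_pair_def)

lemma Der_add: "A \<in> Der \<Longrightarrow> B \<in> Der \<Longrightarrow> A + B \<in> Der"
  using DerD(1,2) endo_add adjoint_add DerI by meson

lemma Der_scale: "A \<in> Der \<Longrightarrow> (\<lambda>z. s c (A z)) \<in> Der"
  using DerD(1,2) endo_scale adjoint_scale DerI by meson

lemma adj_add: "A \<in> Der \<Longrightarrow> B \<in> Der \<Longrightarrow> adj (A + B) = adj A + adj B"
  by (intro adj_eqI adjoint_add) (simp_all add: DerD)

lemma adj_scale: "A \<in> Der \<Longrightarrow> adj (\<lambda>z. s c (A z)) = (\<lambda>z. s (cnj c) (adj A z))"
  by (intro adj_eqI adjoint_scale) (simp_all add: DerD)

lemma adj_0: "adj 0 = 0"
  by (intro adj_eqI adjoint_0) simp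

lemma Der_subspace: "vf.subspace Der"
  by (intro vf.subspaceI) (use DerI[OF endo_0 adjoint_0] Der_add Der_scale in auto)

text \<open>
  The adjoint identity for \<open>A\<close>, read as an identity of operators in the last argument.
\<close>

lemma Der_commutator_Lop:
  assumes "A \<in> Der" "x \<in> V" "y \<in> V"
  shows "(A \<circ> Lop T x y) - (Lop T x y \<circ> A) = Lop T (A x) y - Lop T x (adj A y)"
proof
  fix z
  note A = DerD[OF assms(1)]
  show "((A \<circ> Lop T x y) - (Lop T x y \<circ> A)) z = (Lop T (A x) y - Lop T x (adj A y)) z"
    using assms(2,3)
    by (cases "z \<in> V") (simp_all add: Lop_outside A(3,4) endoD(3,6,7)[OF A(1)] adjointD(2)[OF A(2)])
qed

section \<open>The operators in degree 1\<close>

lemma phi_apply [simp]: "y \<in> V \<Longrightarrow> z \<in> V \<Longrightarrow> phi T x y z = - br y x z"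
  by (simp add: phi_def)

lemma phi_outside: "\<not> (y \<in> V \<and> z \<in> V) \<Longrightarrow> phi T x y z = 0"
  by (auto simp: phi_def)

lemma phi_add: "x \<in> V \<Longrightarrow> y \<in> V \<Longrightarrow> phi T (x + y) = phi T x + phi T y"
  and phi_scale: "x \<in> V \<Longrightarrow> phi T (s c x) = (\<lambda>y z. s (cnj c) (phi T x y z))"
  and phi_uminus: "x \<in> V \<Longrightarrow> phi T (- x) = - phi T x"
  and phi_diff: "x \<in> V \<Longrightarrow> y \<in> V \<Longrightarrow> phi T (x - y) = phi T x - phi T y"
  and phi_0 [simp]: "phi T 0 = 0"
  by (auto simp: fun_eq_iff phi_def)

lemma phi_inj: "inj_on (phi T) V"
proof (rule inj_onI)
  fix x y assume xy: "x \<in> V" "y \<in> V" "phi T x = phi T y"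
  show "x = y"
  proof (rule br_middle_eqI[OF xy(1,2)])
    fix v w assume "v \<in> V" "w \<in> V"
    then show "br v x w = br v y w"
      using xy(3) phi_apply[of v w x] phi_apply[of v w y] by simp
  qed
qed

lemma phi_span_eq: "phi_span T = phi T ` V"
proof -
  have "vp.subspace (phi T ` V)"
  proof (rule vp.subspaceI)
    show "0 \<in> phi T ` V" by (rule image_eqI[of _ _ 0]) simp_all
    show "\<psi> + \<eta> \<in> phi T ` V" if pq: "\<psi> \<in> phi T ` V" "\<eta> \<in> phi T ` V" for \<psi> \<eta>
    proof -
      obtain x y where xy: "x \<in> V" "\<psi> = phi T x" "y \<in> V" "\<eta> = phi T y" using pq by blast
      then show ?thesis by (intro image_eqI[of _ _ "x + y"]) (simp_all add: phi_add)
    qed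
    show "(\<lambda>y z. s c (\<psi> y z)) \<in> phi T ` V" if \<psi>: "\<psi> \<in> phi T ` V" for c \<psi>
    proof -
      obtain x where "x \<in> V" "\<psi> = phi T x" using \<psi> by blast
      then show ?thesis by (intro image_eqI[of _ _ "s (cnj c) x"]) (simp_all add: phi_scale)
    qed
  qed
  moreover have "{phi T x | x. x \<in> V} = phi T ` V" by blast
  ultimately show ?thesis unfolding phi_span_def by (simp add: vp.span_eq_iff)
qed

definition unphi :: "('a \<Rightarrow> 'a \<Rightarrow> 'a) \<Rightarrow> 'a" where
  "unphi = inv_into V (phi T)"

lemma unphi_phi [simp]: "x \<in> V \<Longrightarrow> unphi (phi T x) = x"
  unfolding unphi_def by (rule inv_into_f_f[OF phi_inj])

lemma unphi_closed: "\<psi> \<in> phi_span T \<Longrightarrow> unphi \<psi> \<in> V"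
  and phi_unphi: "\<psi> \<in> phi_span T \<Longrightarrow> phi T (unphi \<psi>) = \<psi>"
  unfolding phi_span_eq by auto

text \<open>
  The maps \<open>\<phi>\<^sub>x\<close>.  They already form a subspace, so the span in degree 1 consists of them alone.
\<close>

definition form :: "('a \<Rightarrow> 'a \<Rightarrow> 'a) \<Rightarrow> bool" where
  "form \<psi> \<longleftrightarrow> (\<exists>x\<in>V. \<psi> = phi T x)"

lemma form_iff: "\<psi> \<in> phi_span T \<longleftrightarrow> form \<psi>"
  by (auto simp: form_def phi_span_eq)

lemma form_endo [simp]: "form \<psi> \<Longrightarrow> endo (\<psi> v)"
  by (cases "v \<in> V") (auto simp: form_def endo_def linear_map_def phi_def vs.scale_minus_right)

lemma form_simps:
  assumes "form \<psi>"
  shows "u \<in> V \<Longrightarrow> v \<in> V \<Longrightarrow> \<psi> (u + v) = \<psi> u + \<psi> v" "u \<in> V \<Longrightarrow> v \<in> V \<Longrightarrow> \<psi> (u - v) = \<psi> u - \<psi> v"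
    "u \<in> V \<Longrightarrow> \<psi> (- u) = - \<psi> u" "\<psi> 0 = 0" "u \<in> V \<Longrightarrow> \<psi> (s c u) = (\<lambda>w. s c (\<psi> u w))" 
    "v \<notin> V \<Longrightarrow> \<psi> v = 0"
  using assms by (auto simp: form_def fun_eq_iff phi_def)

lemma form_antisym: "form \<psi> \<Longrightarrow> \<psi> v w = - \<psi> w v"
  by (auto simp: form_def phi_def br_antisym[of v _ w])

lemma form_eq_Lop: "x \<in> V \<Longrightarrow> v \<in> V \<Longrightarrow> phi T x v = - Lop T v x"
  by (auto simp: fun_eq_iff Lop_def phi_def)

lemma act01_phi:
  assumes "A \<in> Der" "x \<in> V"
  shows "act01 A (phi T x) = - phi T (adj A x)"
proof (intro ext)
  fix v w
  note A = DerD[OF assms(1)]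
  show "act01 A (phi T x) v w = (- phi T (adj A x)) v w"
  proof (cases "v \<in> V \<and> w \<in> V")
    case True
    then show ?thesis using A(3,4) endoD[OF A(1)] assms(2) adjointD(2)[OF A(2)] by (simp add: act01_def)
  next
    case False
    then show ?thesis using A(3,4) endoD[OF A(1)] assms(2) by (auto simp: act01_def phi_outside phi_def)
  qed
qed

text \<open>
  The case of the Jacobi identity for two elements of degree 1 and one of degree -1.  Both sides are forms
  \<open>\<phi>\<close> with parameters \<open>[x,v,y]\<close> and \<open>-[y,v,x]\<close>, so it amounts to the antisymmetry of the 3-bracket.
\<close>

lemma act01_forms:
  assumes "form \<psi>" "form \<eta>"
  shows "act01 (\<psi> v) \<eta> = - act01 (\<eta> v) \<psi>"
proof (cases "v \<in> V")
  case True
  obtain x y where xy: "x \<in> V" "y \<in> V" "\<psi> = phi T x" "\<eta> = phi T y" using assms by (auto simp: form_def)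
  have "act01 (- Lop T v x) (phi T y) = phi T (br x v y)" if "x \<in> V" "y \<in> V" for x y
  proof -
    have "act01 (- Lop T v x) (phi T y) = - act01 (Lop T v x) (phi T y)"
      using that True by (auto simp: act01_def fun_eq_iff phi_def Lop_def)
    also have "\<dots> = phi T (br x v y)"
      using act01_phi[OF Lop_Der[OF True that(1)] that(2)] adj_Lop[OF True that(1)] that True by simp
    finally show ?thesis .
  qed
  then show ?thesis
    using xy True br_antisym[of x v y] by (simp add: form_eq_Lop phi_uminus)
next
  case False
  then show ?thesis
    using form_simps(4,6)[OF assms(1)] form_simps(4,6)[OF assms(2)]
      endoD(3)[OF form_endo[OF assms(1)]] endoD(3)[OF form_endo[OF assms(2)]] by (simp add: act01_def fun_eq_iff)
qed

end

section \<open>The Lie superalgebra of an algebra of derivations\<close>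

lemma psign_simps: "psign 0 q x = x" "psign p 0 x = x" "psign 1 1 x = - x"
  by (simp_all add: psign_def)

context zero_center_N6
begin

lemma form_add: "form \<psi> \<Longrightarrow> form \<eta> \<Longrightarrow> form (\<psi> + \<eta>)"
  and form_diff: "form \<psi> \<Longrightarrow> form \<eta> \<Longrightarrow> form (\<psi> - \<eta>)"
  and form_uminus: "form \<psi> \<Longrightarrow> form (- \<psi>)"
  and form_scale: "form \<psi> \<Longrightarrow> form (\<lambda>v w. s c (\<psi> v w))"
  and form_0: "form 0"
  and form_phi: "x \<in> V \<Longrightarrow> form (phi T x)"
  unfolding form_iff[symmetric] phi_span_def
  by (rule vp.span_add vp.span_diff vp.span_neg vp.span_scale vp.span_zero vp.span_base; auto)+

lemma formE:
  assumes "form \<psi>"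
  obtains x where "x \<in> V" "\<psi> = phi T x"
  using assms unfolding form_def by blast

end

text \<open>
  The span of the operators \<open>L\<^bsub>x,y\<^esub>\<close> and its closure for a linearly compact topology both occur in
  degree 0.  All algebraic statements hold for any Lie algebra of derivations that contains the \<open>L\<^bsub>x,y\<^esub>\<close>.
\<close>

locale derivation_algebra = zero_center_N6 T for T :: "'a::ab_group_add alg3" +
  fixes D :: "('a \<Rightarrow> 'a) set"
  assumes D_subspace: "vf.subspace D"
    and D_Der: "D \<subseteq> Der"
    and D_Lop: "x \<in> V \<Longrightarrow> y \<in> V \<Longrightarrow> Lop T x y \<in> D"
    and D_commutator: "A \<in> D \<Longrightarrow> B \<in> D \<Longrightarrow> (A \<circ> B) - (B \<circ> A) \<in> D"
begin

abbreviation "G \<equiv> lie_with T D"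

lemma D_endo: "A \<in> D \<Longrightarrow> endo A"
  using D_Der DerD(1) by blast

lemmas D_0 = vf.subspace_0[OF D_subspace]
  and D_add = vf.subspace_add[OF D_subspace]
  and D_diff = vf.subspace_diff[OF D_subspace]
  and D_uminus = vf.subspace_neg[OF D_subspace]
  and D_scale = vf.subspace_scale[OF D_subspace]

lemma lscl_G [simp]: "lscl G = lie_scale s"
  and lbr_G [simp]: "lbr G = lie_bracket"
  by (simp_all add: lie_with_def)

lemma lcar_G: "(z, A, \<psi>) \<in> lcar G \<longleftrightarrow> z \<in> V \<and> A \<in> D \<and> form \<psi>"
  by (simp add: lie_with_def form_iff)

lemma lcar_E:
  assumes "x \<in> lcar G"
  obtains z A \<psi> where "x = (z, A, \<psi>)" "z \<in> V" "A \<in> D" "form \<psi>"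
  using assms lcar_G by (cases x) auto

lemma lsd_G: "lsd G 0 = {(0, A, 0) | A. A \<in> D}" "lsd G 1 = {(z, 0, \<psi>) | z \<psi>. z \<in> V \<and> form \<psi>}"
  by (simp_all add: lie_with_def form_iff)

lemma lgr_G: "lgr G (-1) = {(z, 0, 0) | z. z \<in> V}" "lgr G 0 = {(0, A, 0) | A. A \<in> D}"
  "lgr G 1 = {(0, 0, \<psi>) | \<psi>. form \<psi>}" "j \<notin> {-1, 0, 1} \<Longrightarrow> lgr G j = {0}"
  by (simp_all add: lie_with_def form_iff)

lemma lie_bracket_simp: "lie_bracket (z, A, \<psi>) (z', A', \<psi>') =
   (A z' - A' z, (A \<circ> A') - (A' \<circ> A) + \<psi> z' + \<psi>' z, act01 A \<psi>' - act01 A' \<psi>)"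
  by (simp add: lie_bracket_def)

lemma form_apply_D:
  assumes "form \<psi>" "z \<in> V"
  shows "\<psi> z \<in> D"
proof -
  obtain x where x: "x \<in> V" "\<psi> = phi T x" using assms(1) by (rule formE)
  show ?thesis
    unfolding x(2) form_eq_Lop[OF x(1) assms(2)] by (rule D_uminus[OF D_Lop[OF assms(2) x(1)]])
qed

lemma act01_form:
  assumes "A \<in> D" "form \<psi>"
  shows "form (act01 A \<psi>)"
proof -
  obtain x where x: "x \<in> V" "\<psi> = phi T x" using assms(2) by (rule formE)
  have A: "A \<in> Der" using assms(1) D_Der by blast
  show ?thesis
    unfolding x(2) act01_phi[OF A x(1)] using DerD(3)[OF A] by (intro form_uminus form_phi)
qed

lemma bracket_closed:
  assumes "x \<in> lcar G" "y \<in> lcar G"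
  shows "lie_bracket x y \<in> lcar G"
proof -
  obtain z A \<psi> where x: "x = (z, A, \<psi>)" "z \<in> V" "A \<in> D" "form \<psi>" using assms(1) by (rule lcar_E)
  obtain z' A' \<psi>' where y: "y = (z', A', \<psi>')" "z' \<in> V" "A' \<in> D" "form \<psi>'" using assms(2) by (rule lcar_E)
  have "A z' - A' z \<in> V" using endoD(6)[OF D_endo] x(3) y(3) by simp
  moreover have "(A \<circ> A') - (A' \<circ> A) + \<psi> z' + \<psi>' z \<in> D"
    by (intro D_add D_commutator form_apply_D x y)
  moreover have "form (act01 A \<psi>' - act01 A' \<psi>)" by (intro form_diff act01_form x y)
  ultimately show ?thesis unfolding x(1) y(1) lie_bracket_simp lcar_G by blast
qed

lemma cspace_G: "cspace (lie_scale s) (lcar G)"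
proof -
  have "vl.subspace (lcar G)"
  proof (rule vl.subspaceI)
    show "0 \<in> lcar G" unfolding zero_prod_def lcar_G using D_0 form_0 by simp
    show "x + y \<in> lcar G" if "x \<in> lcar G" "y \<in> lcar G" for x y
      using that D_add form_add by (auto elim!: lcar_E simp: lcar_G)
    show "lie_scale s c x \<in> lcar G" if "x \<in> lcar G" for c x
      using that D_scale form_scale by (auto elim!: lcar_E simp: lcar_G lie_scale_def)
  qed
  then show ?thesis unfolding cspace_def using vl.vector_space_axioms by blast
qed

lemma bracket_linear_left:
  assumes y: "y \<in> lcar G"
  shows "linear_map (lcar G) (lie_scale s) (lie_scale s) (\<lambda>x. lie_bracket x y)"
proof -
  obtain z A \<psi> where y: "y = (z, A, \<psi>)" "z \<in> V" "A \<in> D" "form \<psi>" using y by (rule lcar_E)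
  note A = endoD[OF D_endo[OF y(3)]] and \<psi> = form_simps[OF y(4)]
  have "lie_bracket (u + v) y = lie_bracket u y + lie_bracket v y" if uv: "u \<in> lcar G" "v \<in> lcar G" for u v
  proof -
    obtain a B \<eta> where u: "u = (a, B, \<eta>)" "a \<in> V" "B \<in> D" "form \<eta>" using uv(1) by (rule lcar_E)
    obtain a' B' \<eta>' where v: "v = (a', B', \<eta>')" "a' \<in> V" "B' \<in> D" "form \<eta>'" using uv(2) by (rule lcar_E)
    note B = endoD[OF D_endo[OF u(3)]] and B' = endoD[OF D_endo[OF v(3)]]
      and \<eta> = endoD[OF form_endo[OF u(4)]] form_simps[OF u(4)]
      and \<eta>' = endoD[OF form_endo[OF v(4)]] form_simps[OF v(4)]
      and \<psi>e = endoD[OF form_endo[OF y(4)]]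
    have 3: "act01 (B + B') \<psi> = act01 B \<psi> + act01 B' \<psi>" "act01 A (\<eta> + \<eta>') = act01 A \<eta> + act01 A \<eta>'"
      by (simp_all add: act01_def fun_eq_iff A B B' \<psi> \<eta> \<eta>' \<psi>e algebra_simps)
    have 2: "A \<circ> (B + B') = (A \<circ> B) + (A \<circ> B')" by (simp add: fun_eq_iff A B B')
    show ?thesis
      unfolding u(1) v(1) y(1) add_Pair lie_bracket_simp 3 2 prod.inject
      by (simp add: A \<psi> u v y fun_eq_iff algebra_simps)
  qed
  moreover have "lie_bracket (lie_scale s c u) y = lie_scale s c (lie_bracket u y)" if u: "u \<in> lcar G" for c u
  proof -
    obtain a B \<eta> where u: "u = (a, B, \<eta>)" "a \<in> V" "B \<in> D" "form \<eta>" using u by (rule lcar_E)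
    note B = endoD[OF D_endo[OF u(3)]] 
      and \<eta> = endoD[OF form_endo[OF u(4)]] form_simps[OF u(4)]
      and \<psi>e = endoD[OF form_endo[OF y(4)]]
    show ?thesis
      unfolding u(1) y(1) lie_scale_def prod.case lie_bracket_simp prod.inject
      by (simp add: A B \<psi> \<eta> \<psi>e u y act01_def fun_eq_iff vs.scale_right_distrib vs.scale_right_diff_distrib)
  qed
  ultimately show ?thesis unfolding linear_map_def by blast
qed

lemma bracket_linear_right:
  assumes y: "y \<in> lcar G"
  shows "linear_map (lcar G) (lie_scale s) (lie_scale s) (\<lambda>x. lie_bracket y x)"
proof -
  obtain z A \<psi> where y: "y = (z, A, \<psi>)" "z \<in> V" "A \<in> D" "form \<psi>" using y by (rule lcar_E)
  note A = endoD[OF D_endo[OF y(3)]] and \<psi> = form_simps[OF y(4)]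
    and \<psi>e = endoD[OF form_endo[OF y(4)]]
  have "lie_bracket y (u + v) = lie_bracket y u + lie_bracket y v" if uv: "u \<in> lcar G" "v \<in> lcar G" for u v
  proof -
    obtain a B \<eta> where u: "u = (a, B, \<eta>)" "a \<in> V" "B \<in> D" "form \<eta>" using uv(1) by (rule lcar_E)
    obtain a' B' \<eta>' where v: "v = (a', B', \<eta>')" "a' \<in> V" "B' \<in> D" "form \<eta>'" using uv(2) by (rule lcar_E)
    note B = endoD[OF D_endo[OF u(3)]] and B' = endoD[OF D_endo[OF v(3)]]
      and \<eta> = endoD[OF form_endo[OF u(4)]] form_simps[OF u(4)]
      and \<eta>' = endoD[OF form_endo[OF v(4)]] form_simps[OF v(4)]
    have 3: "act01 (B + B') \<psi> = act01 B \<psi> + act01 B' \<psi>" "act01 A (\<eta> + \<eta>') = act01 A \<eta> + act01 A \<eta>'"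
      by (simp_all add: act01_def fun_eq_iff A B B' \<psi> \<eta> \<eta>' \<psi>e algebra_simps)
    have 2: "A \<circ> (B + B') = (A \<circ> B) + (A \<circ> B')" by (simp add: fun_eq_iff A B B')
    show ?thesis
      unfolding u(1) v(1) y(1) add_Pair lie_bracket_simp 3 2 prod.inject
      by (simp add: A \<psi> u v y fun_eq_iff algebra_simps)
  qed
  moreover have "lie_bracket y (lie_scale s c u) = lie_scale s c (lie_bracket y u)" if u: "u \<in> lcar G" for c u
  proof -
    obtain a B \<eta> where u: "u = (a, B, \<eta>)" "a \<in> V" "B \<in> D" "form \<eta>" using u by (rule lcar_E)
    note B = endoD[OF D_endo[OF u(3)]] 
      and \<eta> = endoD[OF form_endo[OF u(4)]] form_simps[OF u(4)]
    show ?thesis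
      unfolding u(1) y(1) lie_scale_def prod.case lie_bracket_simp prod.inject
      by (simp add: A B \<psi> \<eta> \<psi>e u y act01_def fun_eq_iff vs.scale_right_distrib vs.scale_right_diff_distrib)
  qed
  ultimately show ?thesis unfolding linear_map_def by blast
qed

lemma jacobi_even_even:
  assumes "A \<in> D" "B \<in> D" and w: "w \<in> lcar G"
  shows "lie_bracket (0, A, 0) (lie_bracket (0, B, 0) w) =
    lie_bracket (lie_bracket (0, A, 0) (0, B, 0)) w + lie_bracket (0, B, 0) (lie_bracket (0, A, 0) w)"
proof -
  obtain z C \<eta> where w: "w = (z, C, \<eta>)" "z \<in> V" "C \<in> D" "form \<eta>" using w by (rule lcar_E)
  note A = endoD[OF D_endo[OF assms(1)]] and B = endoD[OF D_endo[OF assms(2)]] and C = endoD[OF D_endo[OF w(3)]]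
  show ?thesis
    unfolding w(1) lie_bracket_simp add_Pair prod.inject
    by (simp add: A B C w(2) act01_def form_simps[OF w(4)] endoD[OF form_endo[OF w(4)]] fun_eq_iff algebra_simps)
qed

lemma jacobi_even_odd:
  assumes "A \<in> D" "x \<in> V" "form \<psi>" and w: "w \<in> lcar G"
  shows "lie_bracket (0, A, 0) (lie_bracket (x, 0, \<psi>) w) =
    lie_bracket (lie_bracket (0, A, 0) (x, 0, \<psi>)) w + lie_bracket (x, 0, \<psi>) (lie_bracket (0, A, 0) w)"
    "lie_bracket (x, 0, \<psi>) (lie_bracket (0, A, 0) w) =
    lie_bracket (lie_bracket (x, 0, \<psi>) (0, A, 0)) w + lie_bracket (0, A, 0) (lie_bracket (x, 0, \<psi>) w)"
proof -
  obtain z C \<eta> where w: "w = (z, C, \<eta>)" "z \<in> V" "C \<in> D" "form \<eta>" using w by (rule lcar_E)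
  note A = endoD[OF D_endo[OF assms(1)]] and C = endoD[OF D_endo[OF w(3)]]
    and \<psi> = endoD[OF form_endo[OF assms(3)]] form_simps[OF assms(3)]
    and \<eta> = endoD[OF form_endo[OF w(4)]] form_simps[OF w(4)]
  show "lie_bracket (0, A, 0) (lie_bracket (x, 0, \<psi>) w) =
    lie_bracket (lie_bracket (0, A, 0) (x, 0, \<psi>)) w + lie_bracket (x, 0, \<psi>) (lie_bracket (0, A, 0) w)"
    unfolding w(1) lie_bracket_simp add_Pair prod.inject
    by (simp add: A C w(2) assms(2) \<psi> \<eta> act01_def fun_eq_iff algebra_simps)
  show "lie_bracket (x, 0, \<psi>) (lie_bracket (0, A, 0) w) =
    lie_bracket (lie_bracket (x, 0, \<psi>) (0, A, 0)) w + lie_bracket (0, A, 0) (lie_bracket (x, 0, \<psi>) w)"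
    unfolding w(1) lie_bracket_simp add_Pair prod.inject
    by (simp add: A C w(2) assms(2) \<psi> \<eta> act01_def fun_eq_iff algebra_simps)
qed

text \<open>
  The component of degree -1 is the antisymmetry of forms, that of degree 1 is \<open>act01_forms\<close>.
\<close>

lemma jacobi_odd_odd:
  assumes xy: "x \<in> V" "form \<psi>" "y \<in> V" "form \<psi>'" and w: "w \<in> lcar G"
  shows "lie_bracket (x, 0, \<psi>) (lie_bracket (y, 0, \<psi>') w) =
    lie_bracket (lie_bracket (x, 0, \<psi>) (y, 0, \<psi>')) w - lie_bracket (y, 0, \<psi>') (lie_bracket (x, 0, \<psi>) w)"
proof -
  obtain z C \<eta> where w: "w = (z, C, \<eta>)" "z \<in> V" "C \<in> D" "form \<eta>" using w by (rule lcar_E)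
  note C = endoD[OF D_endo[OF w(3)]]
    and \<psi> = endoD[OF form_endo[OF xy(2)]] form_simps[OF xy(2)]
    and \<psi>' = endoD[OF form_endo[OF xy(4)]] form_simps[OF xy(4)]
    and \<eta> = endoD[OF form_endo[OF w(4)]] form_simps[OF w(4)]
  have 1: "- (\<psi>' z + \<eta> y) x = (\<psi> y + \<psi>' x) z - (- (\<psi> z + \<eta> x) y)"
    using form_antisym[OF xy(2), of z y] form_antisym[OF xy(4), of z x] form_antisym[OF w(4), of x y] by simp
  have add: "act01 (A + B) \<theta> = act01 A \<theta> + act01 B \<theta>" if "form \<theta>" "endo A" "endo B" for A B \<theta>
    by (simp add: act01_def fun_eq_iff form_simps[OF that(1)] endoD[OF form_endo[OF that(1)]]
        endoD[OF that(2)] endoD[OF that(3)])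
  have 3: "- act01 (\<psi>' z + \<eta> y) \<psi> = act01 (\<psi> y + \<psi>' x) \<eta> - (- act01 (\<psi> z + \<eta> x) \<psi>')"
    using act01_forms[OF xy(2,4), of z] act01_forms[OF xy(2) w(4), of y] act01_forms[OF xy(4) w(4), of x]
    by (simp add: add xy w form_endo)
  show ?thesis
    unfolding w(1) lie_bracket_simp diff_Pair prod.inject
    using 1 3
    by (simp add: C w(2) xy(1,3) \<psi> \<psi>' \<eta> act01_def fun_eq_iff algebra_simps)
qed

lemma lsd_subspace: "vl.subspace (lsd G p) \<and> lsd G p \<subseteq> lcar G"
proof (cases p)
  case zero
  have "vl.subspace {(0, A, 0) | A. A \<in> D}"
    by (rule vl.subspaceI) (use D_0 D_add D_scale in \<open>auto simp: zero_prod_def lie_scale_def zero_fun_def\<close>)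
  then show ?thesis using zero form_0 by (auto simp: lsd_G lcar_G)
next
  case one
  have "vl.subspace {(z, 0, \<psi>) | z \<psi>. z \<in> V \<and> form \<psi>}"
    by (rule vl.subspaceI)
      (use form_0 form_add form_scale in \<open>auto simp: zero_prod_def lie_scale_def zero_fun_def\<close>)
  then show ?thesis using one D_0 by (auto simp: lsd_G lcar_G)
qed

lemma lsdE:
  assumes "x \<in> lsd G p"
  obtains (even) A where "p = 0" "x = (0, A, 0)" "A \<in> D"
    | (odd) z \<psi> where "p = 1" "x = (z, 0, \<psi>)" "z \<in> V" "form \<psi>"
  using assms by (cases p) (auto simp: lsd_G)

text \<open>
  Since elements are triples of operators acting by uniform formulas, each Jacobi identity is an identity
  between compositions of linear maps; only \<open>jacobi_odd_odd\<close> uses the symmetry of the 3-bracket.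
\<close>

theorem lie_superalgebra_G: "lie_superalgebra G"
  unfolding lie_superalgebra_def lscl_G lbr_G
proof (intro conjI allI ballI)
  show "cspace (lie_scale s) (lcar G)" by (rule cspace_G)
  show "vl.subspace (lsd G p)" "lsd G p \<subseteq> lcar G" for p using lsd_subspace by auto
  show "lsd G 0 \<inter> lsd G 1 = {0}"
    using D_0 form_0 by (auto simp: lsd_G zero_prod_def)
  show "\<exists>u\<in>lsd G 0. \<exists>v\<in>lsd G 1. x = u + v" if x: "x \<in> lcar G" for x
  proof -
    obtain z A \<psi> where "x = (z, A, \<psi>)" "z \<in> V" "A \<in> D" "form \<psi>" using x by (rule lcar_E)
    then show ?thesis
      unfolding lsd_G by (intro bexI[of _ "(0, A, 0)"] bexI[of _ "(z, 0, \<psi>)"]) auto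
  qed
  show "lie_bracket x y \<in> lcar G" if "x \<in> lcar G" "y \<in> lcar G" for x y
    using that by (rule bracket_closed)
  show "linear_map (lcar G) (lie_scale s) (lie_scale s) (\<lambda>x. lie_bracket x y)" if "y \<in> lcar G" for y
    using that by (rule bracket_linear_left)
  show "linear_map (lcar G) (lie_scale s) (lie_scale s) (\<lambda>y. lie_bracket x y)" if "x \<in> lcar G" for x
    using that by (rule bracket_linear_right)
  show "lie_bracket x y \<in> lsd G (p + q)" if x: "x \<in> lsd G p" and y: "y \<in> lsd G q" for p q x y
  proof -
    have "lie_bracket x y \<in> lcar G" using x y lsd_subspace bracket_closed by blast
    moreover obtain z A \<psi> where b: "lie_bracket x y = (z, A, \<psi>)" by (cases "lie_bracket x y") auto
    ultimately have m: "z \<in> V" "A \<in> D" "form \<psi>" by (simp_all add: lcar_G)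
    from x show ?thesis
    proof (cases rule: lsdE)
      case x: (even A')
      from y show ?thesis
        by (cases rule: lsdE)
          (use x b m endoD(3)[OF D_endo[OF x(3)]] in \<open>auto simp: lsd_G lie_bracket_simp act01_def fun_eq_iff form_simps endoD(3) D_endo\<close>)
    next
      case x: (odd z' \<psi>')
      from y show ?thesis
        by (cases rule: lsdE)
          (use x b m in \<open>auto simp: lsd_G lie_bracket_simp act01_def fun_eq_iff form_simps
            endoD(3) D_endo endoD(3)[OF form_endo]\<close>)
    qed
  qed
  show "lie_bracket x y = - psign p q (lie_bracket y x)"
    if x: "x \<in> lsd G p" and y: "y \<in> lsd G q" for p q x y
    using x
  proof (cases rule: lsdE)
    case x: (even A')
    from y show ?thesis
      by (cases rule: lsdE)
        (use x in \<open>auto simp: psign_def lie_bracket_simp act01_def fun_eq_iff form_simps endoD(3) D_endo\<close>)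
  next
    case x: (odd z' \<psi>')
    from y show ?thesis
      by (cases rule: lsdE)
        (use x in \<open>auto simp: psign_def lie_bracket_simp act01_def fun_eq_iff form_simps endoD(3) D_endo\<close>)
  qed
  show "lie_bracket x (lie_bracket y z) = lie_bracket (lie_bracket x y) z + psign p q (lie_bracket y (lie_bracket x z))"
    if x: "x \<in> lsd G p" and y: "y \<in> lsd G q" and z: "z \<in> lcar G" for p q x y z
    using x
  proof (cases rule: lsdE)
    case x: (even A)
    from y show ?thesis
    proof (cases rule: lsdE)
      case y: (even B)
      show ?thesis unfolding x(1,2) y(1,2) psign_simps by (rule jacobi_even_even[OF x(3) y(3) z])
    next
      case y: (odd a \<psi>)
      show ?thesis unfolding x(1,2) y(1,2) psign_simps by (rule jacobi_even_odd(1)[OF x(3) y(3,4) z])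
    qed
  next
    case x: (odd a \<psi>)
    from y show ?thesis
    proof (cases rule: lsdE)
      case y: (even B)
      show ?thesis unfolding x(1,2) y(1,2) psign_simps by (rule jacobi_even_odd(2)[OF y(3) x(3,4) z])
    next
      case y: (odd b \<psi>')
      show ?thesis
        unfolding x(1,2) y(1,2) psign_simps jacobi_odd_odd[OF x(3,4) y(3,4) z] by (rule diff_conv_add_uminus)
    qed
  qed
qed

lemma consistent_G: "consistent_grading G"
  unfolding consistent_grading_def
proof
  fix j :: int
  consider "j = -1" | "j = 0" | "j = 1" | "j \<notin> {-1, 0, 1}" by auto
  then show "lgr G j \<subseteq> lsd G (if even j then 0 else 1)"
    by cases (use D_0 form_0 in \<open>auto simp: lgr_G lsd_G zero_prod_def\<close>)
qed

lemma short_G: "short_grading G"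
  unfolding short_grading_def using lgr_G by blast

lemma lgr_iff:
  "(z, A, \<psi>) \<in> lgr G j \<longleftrightarrow>
     z \<in> V \<and> A \<in> D \<and> form \<psi> \<and> (j \<noteq> -1 \<longrightarrow> z = 0) \<and> (j \<noteq> 0 \<longrightarrow> A = 0) \<and> (j \<noteq> 1 \<longrightarrow> \<psi> = 0)"
proof -
  consider "j = -1" | "j = 0" | "j = 1" | "j \<notin> {-1, 0, 1}" by auto
  then show ?thesis
    by cases (use D_0 form_0 in \<open>auto simp: lgr_G zero_prod_def\<close>)
qed

lemma lgr_subspace: "vl.subspace (lgr G j)" and lgr_subset: "lgr G j \<subseteq> lcar G"
proof -
  have m: "x \<in> lgr G j \<longleftrightarrow> x \<in> lcar G \<and> (j \<noteq> -1 \<longrightarrow> fst x = 0) \<and> (j \<noteq> 0 \<longrightarrow> fst (snd x) = 0)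
      \<and> (j \<noteq> 1 \<longrightarrow> snd (snd x) = 0)" for x
    by (cases x) (auto simp: lgr_iff lcar_G)
  show "lgr G j \<subseteq> lcar G" unfolding m subset_iff by blast
  note c = cspaceD(4-6)[OF cspace_G]
  show "vl.subspace (lgr G j)"
    by (rule vl.subspaceI)
      (use c in \<open>auto simp: m lie_scale_def zero_fun_def[symmetric] zero_prod_def split: prod.splits\<close>)
qed

lemma z_graded_G: "z_graded G"
  unfolding z_graded_def lscl_G lbr_G
proof (intro conjI allI ballI)
  note sub = lgr_subspace lgr_subset
  show "vl.subspace (lgr G j)" "lgr G j \<subseteq> lcar G" for j by (rule sub)+
  show "\<exists>u\<in>lgr G j \<inter> lsd G 0. \<exists>v\<in>lgr G j \<inter> lsd G 1. x = u + v" if x: "x \<in> lgr G j" for x j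
  proof -
    have 0: "0 \<in> lgr G j" "0 \<in> lsd G p" for p
      using sub vl.subspace_0 lsd_subspace by blast+
    have "x \<in> lsd G (if even j then 0 else 1)" using x consistent_G unfolding consistent_grading_def by blast
    then show ?thesis
      using x 0 by (cases "even j") (auto intro: bexI[of _ x] bexI[of _ 0])
  qed
  show "\<exists>!f. (\<forall>j. f j \<in> lgr G j) \<and> finite {j. f j \<noteq> 0} \<and> x = (\<Sum>j | f j \<noteq> 0. f j)" if x: "x \<in> lcar G" for x
  proof -
    obtain z A \<psi> where x: "x = (z, A, \<psi>)" "z \<in> V" "A \<in> D" "form \<psi>" using x by (rule lcar_E)
    define h :: "int \<Rightarrow> 'a lie_elem" where
      "h j = (if j = -1 then (z, 0, 0) else if j = 0 then (0, A, 0) else if j = 1 then (0, 0, \<psi>) else 0)" for j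
    have supp: "{j. f j \<noteq> 0} \<subseteq> {-1, 0, 1}" if "\<forall>j. f j \<in> lgr G j" for f
      using that lgr_G(4) by blast
    have sum: "(\<Sum>j | f j \<noteq> 0. f j) = f (-1) + f 0 + f 1" if "\<forall>j. f j \<in> lgr G j" for f
    proof -
      have "(\<Sum>j | f j \<noteq> 0. f j) = (\<Sum>j\<in>{-1, 0, 1}. f j)"
        by (rule sum.mono_neutral_left) (use supp[OF that] in auto)
      then show ?thesis by simp
    qed
    have h: "\<forall>j. h j \<in> lgr G j"
    proof
      fix j :: int
      consider "j = -1" | "j = 0" | "j = 1" | "j \<notin> {-1, 0, 1}" by auto
      then show "h j \<in> lgr G j" by cases (use x in \<open>auto simp: lgr_G h_def\<close>)
    qed
    show ?thesis
    proof (rule ex1I[of _ h])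
      show "(\<forall>j. h j \<in> lgr G j) \<and> finite {j. h j \<noteq> 0} \<and> x = (\<Sum>j | h j \<noteq> 0. h j)"
        using h finite_subset[OF supp[OF h]] by (simp add: sum[OF h] x(1)) (simp add: h_def)
      fix f assume f: "(\<forall>j. f j \<in> lgr G j) \<and> finite {j. f j \<noteq> 0} \<and> x = (\<Sum>j | f j \<noteq> 0. f j)"
      then have fj: "\<And>j. f j \<in> lgr G j" and fx: "x = f (-1) + f 0 + f 1" using sum by auto
      obtain z' where z': "f (-1) = (z', 0, 0)" using fj[of "-1"] lgr_G(1) by blast
      obtain A' where A': "f 0 = (0, A', 0)" using fj[of 0] lgr_G(2) by blast
      obtain \<psi>' where \<psi>': "f 1 = (0, 0, \<psi>')" using fj[of 1] lgr_G(3) by blast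
      have eq: "z' = z" "A' = A" "\<psi>' = \<psi>" using fx unfolding x(1) z' A' \<psi>' by simp_all
      show "f = h"
      proof
        fix j :: int
        consider "j = -1" | "j = 0" | "j = 1" | "j \<notin> {-1, 0, 1}" by auto
        then show "f j = h j"
          by cases (use z' A' \<psi>' eq fj[of j] lgr_G(4)[of j] in \<open>auto simp: h_def\<close>)
      qed
    qed
  qed
  show "lie_bracket x y \<in> lgr G (i + j)" if x: "x \<in> lgr G i" and y: "y \<in> lgr G j" for i j x y
  proof -
    have xy: "x \<in> lcar G" "y \<in> lcar G" using x y sub by blast+
    obtain z A \<psi> where x': "x = (z, A, \<psi>)" "z \<in> V" "A \<in> D" "form \<psi>" using xy(1) by (rule lcar_E)
    obtain z' A' \<psi>' where y': "y = (z', A', \<psi>')" "z' \<in> V" "A' \<in> D" "form \<psi>'" using xy(2) by (rule lcar_E)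
    note A = endoD(3)[OF D_endo[OF x'(3)]] and A' = endoD(3)[OF D_endo[OF y'(3)]]
      and \<psi> = form_simps(4)[OF x'(4)] endoD(3)[OF form_endo[OF x'(4)]]
      and \<psi>' = form_simps(4)[OF y'(4)] endoD(3)[OF form_endo[OF y'(4)]]
    have i: "i \<noteq> -1 \<Longrightarrow> z = 0" "i \<noteq> 0 \<Longrightarrow> A = 0" "i \<noteq> 1 \<Longrightarrow> \<psi> = 0"
      using x unfolding x'(1) lgr_iff by auto
    have j: "j \<noteq> -1 \<Longrightarrow> z' = 0" "j \<noteq> 0 \<Longrightarrow> A' = 0" "j \<noteq> 1 \<Longrightarrow> \<psi>' = 0"
      using y unfolding y'(1) lgr_iff by auto
    have 1: "A z' - A' z = 0" if "i + j \<noteq> -1"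
    proof -
      have "A = 0 \<or> z' = 0" "A' = 0 \<or> z = 0" using i(1,2) j(1,2) that by fastforce+
      then show ?thesis using A A' by auto
    qed
    have 2: "(A \<circ> A') - (A' \<circ> A) + \<psi> z' + \<psi>' z = 0" if "i + j \<noteq> 0"
    proof -
      have "A = 0 \<or> A' = 0" "\<psi> = 0 \<or> z' = 0" "\<psi>' = 0 \<or> z = 0" using i j that by fastforce+
      then have "(A \<circ> A') - (A' \<circ> A) = 0" "\<psi> z' = 0" "\<psi>' z = 0" using A A' \<psi> \<psi>' by (auto simp: fun_eq_iff)
      then show ?thesis by simp
    qed
    have 3: "act01 A \<psi>' - act01 A' \<psi> = 0" if "i + j \<noteq> 1"
    proof -
      have "A = 0 \<or> \<psi>' = 0" "A' = 0 \<or> \<psi> = 0" using i(2,3) j(2,3) that by fastforce+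
      then have "act01 A \<psi>' = 0" "act01 A' \<psi> = 0" using A A' \<psi> \<psi>' by (auto simp: act01_def fun_eq_iff)
      then show ?thesis by simp
    qed
    show ?thesis
      using bracket_closed[OF xy] 1 2 3 unfolding x'(1) y'(1) lie_bracket_simp lcar_G lgr_iff by blast
  qed
qed

end

section \<open>Inner derivations, generators and ideals\<close>

context zero_center_N6
begin

lemma Lspan_subspace: "vf.subspace (Lspan T)"
  unfolding Lspan_def by simp

lemma Lspan_Lop: "x \<in> V \<Longrightarrow> y \<in> V \<Longrightarrow> Lop T x y \<in> Lspan T"
  unfolding Lspan_def by (rule vf.span_base) blast

lemma Lspan_induct [consumes 1, case_names zero Lop add scale]:
  assumes "A \<in> Lspan T" "P 0" "\<And>x y. x \<in> V \<Longrightarrow> y \<in> V \<Longrightarrow> P (Lop T x y)"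
    "\<And>A B. A \<in> Lspan T \<Longrightarrow> B \<in> Lspan T \<Longrightarrow> P A \<Longrightarrow> P B \<Longrightarrow> P (A + B)"
    "\<And>c A. A \<in> Lspan T \<Longrightarrow> P A \<Longrightarrow> P (\<lambda>z. s c (A z))"
  shows "P A"
proof -
  note sub = vf.subspace_0[OF Lspan_subspace] vf.subspace_add[OF Lspan_subspace] vf.subspace_scale[OF Lspan_subspace]
  have "A \<in> Lspan T \<and> P A"
    using assms(1) unfolding Lspan_def
  proof (induction rule: vf.span_induct)
    case base
    show ?case
      unfolding Lspan_def[symmetric] mem_Collect_eq
      by (rule vf.subspaceI) (use assms(2,4,5) sub in auto)
  next
    case (step A)
    then show ?case using assms(3) Lspan_Lop unfolding Lspan_def[symmetric] by auto
  qed
  then show ?thesis ..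
qed

lemma Lspan_Der: "Lspan T \<subseteq> Der"
proof
  fix A assume "A \<in> Lspan T"
  then show "A \<in> Der"
    by (induction rule: Lspan_induct)
      (rule vf.subspace_0[OF Der_subspace] Lop_Der Der_add Der_scale; assumption)+
qed

text \<open>
  The inner derivations form an ideal in all derivations, by \<open>Der_commutator_Lop\<close>.  This gives more than
  a bracket on the span: the closure of the span inherits one as well.
\<close>

lemma Der_commutator_Lspan:
  assumes "A \<in> Der" "B \<in> Lspan T"
  shows "(A \<circ> B) - (B \<circ> A) \<in> Lspan T"
  using assms(2)
proof (induction rule: Lspan_induct)
  case zero
  have "(A \<circ> 0) - (0 \<circ> A) = 0" using endoD(3)[OF DerD(1)[OF assms(1)]] by (simp add: fun_eq_iff)
  then show ?case using vf.subspace_0[OF Lspan_subspace] by (simp only:)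
next
  case (Lop x y)
  note A = DerD[OF assms(1)]
  show ?case
    unfolding Der_commutator_Lop[OF assms(1) Lop]
    by (intro vf.subspace_diff[OF Lspan_subspace] Lspan_Lop Lop A(3) endoD(6)[OF A(1)])
next
  case (add B C)
  note e = DerD(1)[OF subsetD[OF Lspan_Der add(1)]] DerD(1)[OF subsetD[OF Lspan_Der add(2)]]
  have "(A \<circ> (B + C)) - ((B + C) \<circ> A) = ((A \<circ> B) - (B \<circ> A)) + ((A \<circ> C) - (C \<circ> A))"
    by (simp add: fun_eq_iff endoD(1)[OF DerD(1)[OF assms(1)]] endoD(6)[OF e(1)] endoD(6)[OF e(2)])
  then show ?case using vf.subspace_add[OF Lspan_subspace add(3,4)] by (simp only:)
next
  case (scale c B)
  note e = DerD(1)[OF subsetD[OF Lspan_Der scale(1)]]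
  have "(A \<circ> (\<lambda>z. s c (B z))) - ((\<lambda>z. s c (B z)) \<circ> A) = (\<lambda>z. s c (((A \<circ> B) - (B \<circ> A)) z))"
    by (simp add: fun_eq_iff endoD(2)[OF DerD(1)[OF assms(1)]] endoD(6)[OF e] vs.scale_right_diff_distrib)
  then show ?case using vf.subspace_scale[OF Lspan_subspace scale(2)] by (simp only:)
qed

sublocale Lie: derivation_algebra T "Lspan T"
  by unfold_locales (use Lspan_subspace Lspan_Der Lspan_Lop Der_commutator_Lspan in auto)

text \<open>
  The adjoint exchanges \<open>L\<^bsub>x,y\<^esub>\<close> and \<open>L\<^bsub>y,x\<^esub>\<close>, so it is an antilinear involution of the span; up to sign it
  is the conjugation in degree 0.
\<close>

lemma adj_Lspan:
  assumes "A \<in> Lspan T"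
  shows "adj A \<in> Lspan T" "adj (adj A) = A"
proof -
  have "adj A \<in> Lspan T \<and> adj (adj A) = A"
    using assms
  proof (induction rule: Lspan_induct)
    case zero
    show ?case using vf.subspace_0[OF Lspan_subspace] unfolding adj_0 by blast
  next
    case (Lop x y)
    then show ?case by (simp add: adj_Lop Lspan_Lop)
  next
    case (add A B)
    then have "adj (A + B) \<in> Lspan T \<and> adj (adj (A + B)) = A + B"
      using vf.subspace_add[OF Lspan_subspace, of "adj A" "adj B"] adj_add[of A B]
        adj_add[of "adj A" "adj B"] subsetD[OF Lspan_Der] by simp
    then show ?case .
  next
    case (scale c A)
    then show ?case
      using vf.subspace_scale[OF Lspan_subspace, of "adj A" "cnj c"] adj_scale[of A c]
        adj_scale[of "adj A" "cnj c"] subsetD[OF Lspan_Der] by simp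
  qed
  then show "adj A \<in> Lspan T" "adj (adj A) = A" by auto
qed

lemma adj_commutator:
  assumes "A \<in> Lspan T" "B \<in> Lspan T"
  shows "adj ((A \<circ> B) - (B \<circ> A)) = (adj B \<circ> adj A) - (adj A \<circ> adj B)"
proof (rule adj_eqI)
  have D: "A \<in> Der" "B \<in> Der" using assms Lspan_Der by auto
  note A = DerD[OF D(1)] and B = DerD[OF D(2)]
  note e = endoD[OF A(1)] endoD[OF B(1)] adjointD(2)[OF A(2)] adjointD(2)[OF B(2)] A(3) B(3)
  show "adjoint_pair ((A \<circ> B) - (B \<circ> A)) ((adj B \<circ> adj A) - (adj A \<circ> adj B))"
    unfolding adjoint_pair_def by (simp add: e algebra_simps)
  have "adj A 0 = 0" "adj B 0 = 0"
    using endoD(3)[OF DerD(1)] subsetD[OF Lspan_Der] adj_Lspan(1) assms by blast+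
  then show "((adj B \<circ> adj A) - (adj A \<circ> adj B)) y = 0" if "y \<notin> V" for y
    using A(4) B(4) that by simp
qed

lemma Lie_eq: "Lie T = lie_with T (Lspan T)"
  by (simp add: Lie_def)

lemma ends_generate_Lie: "ends_generate (Lie T)"
proof -
  let ?g = "Lie T"
  have sub: "vl.subspace (lgr ?g 0)"
    using Lie.z_graded_G unfolding z_graded_def Lie_eq by simp
  have 1: "{lbr ?g x y | x y. x \<in> lgr ?g (-1) \<and> y \<in> lgr ?g 1} \<subseteq> lgr ?g 0"
  proof
    fix w assume "w \<in> {lbr ?g x y | x y. x \<in> lgr ?g (-1) \<and> y \<in> lgr ?g 1}"
    then obtain x y where w: "w = lbr ?g x y" "x \<in> lgr ?g (-1)" "y \<in> lgr ?g 1" by blast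
    then have "w \<in> lgr ?g (- 1 + 1)"
      using Lie.z_graded_G unfolding z_graded_def Lie_eq by blast
    then show "w \<in> lgr ?g 0" by simp
  qed
  have "(0, A, 0) \<in> vl.span {lbr ?g x y | x y. x \<in> lgr ?g (-1) \<and> y \<in> lgr ?g 1}" if "A \<in> Lspan T" for A
    using that
  proof (induction rule: Lspan_induct)
    case zero
    have "(0, 0, 0) \<in> vl.span {lbr ?g x y | x y. x \<in> lgr ?g (-1) \<and> y \<in> lgr ?g 1}"
      unfolding zero_prod_def[symmetric] by (rule vl.span_zero)
    then show ?case .
  next
    case (Lop x y)
    have "lie_bracket (x, 0, 0) (0, 0, - phi T y) = (0, Lop T x y, 0)"
      unfolding Lie.lie_bracket_simp
      by (auto simp: act01_def fun_eq_iff phi_def Lop_def Lop)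
    then have "(0, Lop T x y, 0) = lbr ?g (x, 0, 0) (0, 0, - phi T y)" unfolding Lie_eq by simp
    moreover have "(x, 0, 0) \<in> lgr ?g (-1)" "(0, 0, - phi T y) \<in> lgr ?g 1"
      unfolding Lie_eq Lie.lgr_G using Lop form_uminus form_phi by auto
    ultimately show ?case by (intro vl.span_base) blast
  next
    case (add A B)
    have "(0, A, 0) + (0, B, 0) = (0 :: 'a, A + B, 0 :: 'a \<Rightarrow> 'a \<Rightarrow> 'a)" by simp
    then show ?case using vl.span_add[OF add(3,4)] by (simp only:)
  next
    case (scale c A)
    have "lie_scale s c (0, A, 0) = (0, (\<lambda>z. s c (A z)), 0)" by (simp add: lie_scale_def zero_fun_def)
    then show ?case using vl.span_scale[OF scale(2), of c] by (simp only:)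
  qed
  then have "lgr ?g 0 \<subseteq> vl.span {lbr ?g x y | x y. x \<in> lgr ?g (-1) \<and> y \<in> lgr ?g 1}"
    unfolding Lie_eq Lie.lgr_G(2) by auto
  then show ?thesis
    unfolding ends_generate_def using vl.span_minimal[OF 1 sub]
    by (simp add: Lie_eq subset_antisym)
qed

lemma Lspan_eq_0_iff:
  assumes "A \<in> Lspan T"
  shows "A = 0 \<longleftrightarrow> (\<forall>z\<in>V. A z = 0)"
  using endoD(7)[OF Lie.D_endo[OF assms]] by (auto simp: fun_eq_iff)

text \<open>
  Non-zero elements of such a set propagate between neighbouring degrees: from degree -1 to 0 by
  \<open>left_kernel_trivial\<close>, from degree 1 to 0 by the zero center, from degree 0 to -1 because operators act
  faithfully, and from degree 0 to 1 because the adjoint is injective.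
\<close>

definition bracket_stable :: "'a lie_elem set \<Rightarrow> bool" where
  "bracket_stable I \<longleftrightarrow> (\<forall>x\<in>lcar (Lie T). \<forall>y\<in>I. lie_bracket x y \<in> I)"

lemma bracket_stableD:
  "bracket_stable I \<Longrightarrow> y \<in> I \<Longrightarrow> z \<in> V \<Longrightarrow> A \<in> Lspan T \<Longrightarrow> form \<psi> \<Longrightarrow> lie_bracket (z, A, \<psi>) y \<in> I"
  unfolding bracket_stable_def Lie_eq by (simp add: Lie.lcar_G)

lemmas zero_mems = V_rules(1) Lie.D_0 form_0

lemma stable_m1_imp_0:
  assumes I: "bracket_stable I" and z: "(z, 0, 0) \<in> I" "z \<in> V" "z \<noteq> 0"
  shows "\<exists>A\<in>Lspan T. A \<noteq> 0 \<and> (0, A, 0) \<in> I"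
proof -
  obtain x w where xw: "x \<in> V" "w \<in> V" "br z x w \<noteq> 0" using left_kernel_trivial[OF z(2)] z(3) by blast
  have "lie_bracket (0, 0, phi T x) (z, 0, 0) \<in> I"
    by (rule bracket_stableD[OF I z(1) zero_mems(1,2) form_phi[OF xw(1)]])
  moreover have "lie_bracket (0, 0, phi T x) (z, 0, 0) = (0, phi T x z, 0)"
    unfolding Lie.lie_bracket_simp by (simp add: act01_def fun_eq_iff endoD(3)[OF form_endo[OF form_phi[OF xw(1)]]]
        form_simps(4)[OF form_phi[OF xw(1)]])
  moreover have "phi T x z w \<noteq> 0" using xw z(2) by simp
  then have "phi T x z \<noteq> 0" by (auto simp: fun_eq_iff)
  ultimately show ?thesis using Lie.form_apply_D[OF form_phi[OF xw(1)] z(2)] by auto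
qed

lemma stable_0_imp_m1:
  assumes I: "bracket_stable I" and A: "(0, A, 0) \<in> I" "A \<in> Lspan T" "A \<noteq> 0"
  shows "\<exists>z\<in>V. z \<noteq> 0 \<and> (z, 0, 0) \<in> I"
proof -
  obtain w where w: "w \<in> V" "A w \<noteq> 0" using Lspan_eq_0_iff[OF A(2)] A(3) by blast
  note e = endoD[OF Lie.D_endo[OF A(2)]]
  have "lie_bracket (w, 0, 0) (0, A, 0) \<in> I"
    by (rule bracket_stableD[OF I A(1) w(1) zero_mems(2,3)])
  moreover have "lie_bracket (w, 0, 0) (0, A, 0) = (- A w, 0, 0)"
    unfolding Lie.lie_bracket_simp by (simp add: act01_def fun_eq_iff e)
  ultimately show ?thesis using w e(6) by (intro bexI[of _ "- A w"]) auto
qed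

lemma stable_0_imp_1:
  assumes I: "bracket_stable I" and A: "(0, A, 0) \<in> I" "A \<in> Lspan T" "w \<in> V"
  shows "(0, 0, phi T (adj A w)) \<in> I"
proof -
  note e = endoD[OF Lie.D_endo[OF A(2)]] and p = form_simps[OF form_phi[OF A(3)]]
  have "lie_bracket (0, 0, phi T w) (0, A, 0) \<in> I"
    by (rule bracket_stableD[OF I A(1) zero_mems(1,2) form_phi[OF A(3)]])
  moreover have "lie_bracket (0, 0, phi T w) (0, A, 0) = (0, 0, - act01 A (phi T w))"
    unfolding Lie.lie_bracket_simp by (auto simp: e p fun_eq_iff act01_def)
  ultimately show ?thesis using act01_phi[OF subsetD[OF Lspan_Der A(2)] A(3)] by simp
qed

lemma adj_nonzero:
  assumes "A \<in> Lspan T" "A \<noteq> 0"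
  shows "\<exists>w\<in>V. adj A w \<noteq> 0"
proof -
  have "adj A \<noteq> 0" using adj_Lspan(2)[OF assms(1)] adj_0 assms(2) by metis
  then show ?thesis using Lspan_eq_0_iff[OF adj_Lspan(1)[OF assms(1)]] by blast
qed

lemma phi_eq_0_iff: "x \<in> V \<Longrightarrow> phi T x = 0 \<longleftrightarrow> x = 0"
  using inj_onD[OF phi_inj, of x 0] by auto

lemma stable_1_imp_0:
  assumes I: "bracket_stable I" and x: "(0, 0, phi T x) \<in> I" "x \<in> V" "x \<noteq> 0"
  shows "\<exists>A\<in>Lspan T. A \<noteq> 0 \<and> (0, A, 0) \<in> I"
proof -
  obtain a c where ac: "a \<in> V" "c \<in> V" "br a x c \<noteq> 0"
    using br_middle_eqI[OF x(2) V_rules(1)] x(3) by auto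
  have "lie_bracket (a, 0, 0) (0, 0, phi T x) \<in> I"
    by (rule bracket_stableD[OF I x(1) ac(1) zero_mems(2,3)])
  moreover have "lie_bracket (a, 0, 0) (0, 0, phi T x) = (0, phi T x a, 0)"
    unfolding Lie.lie_bracket_simp by (simp add: act01_def fun_eq_iff form_simps[OF form_phi[OF x(2)]]
        endoD(3)[OF form_endo[OF form_phi[OF x(2)]]])
  moreover have "phi T x a c \<noteq> 0" using ac x(2) by simp
  then have "phi T x a \<noteq> 0" by (auto simp: fun_eq_iff)
  ultimately show ?thesis using Lie.form_apply_D[OF form_phi[OF x(2)] ac(1)] by auto
qed

lemma ideal_stable: "lsa_ideal (Lie T) I \<Longrightarrow> bracket_stable I"
  unfolding lsa_ideal_def bracket_stable_def Lie_eq by simp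

text \<open>
  A non-zero homogeneous element of the ideal yields a non-zero operator in degree 0, which in turn yields
  non-zero elements of both ends.
\<close>

lemma ideals_meet_ends_Lie: "ideals_meet_ends (Lie T)"
  unfolding ideals_meet_ends_def
proof (intro allI impI)
  let ?g = "Lie T"
  fix I assume "z_graded_ideal ?g I \<and> I \<noteq> {0}"
  then have id: "lsa_ideal ?g I" and span: "I = vl.span (\<Union>j. I \<inter> lgr ?g j)" and nz: "I \<noteq> {0}"
    unfolding z_graded_ideal_def Lie_eq by auto
  note st = ideal_stable[OF id]
  have "\<exists>j. \<exists>u\<in>I \<inter> lgr ?g j. u \<noteq> 0"
  proof (rule ccontr)
    assume "\<not> ?thesis"
    then have "(\<Union>j. I \<inter> lgr ?g j) \<subseteq> {0}" by blast
    then have "I \<subseteq> {0}" using span vl.span_minimal[OF _ vl.subspace_single_0] by blast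
    moreover have "0 \<in> I" by (subst span) (rule vl.span_zero)
    ultimately show False using nz by blast
  qed
  then obtain j u where u: "u \<in> I" "u \<in> lgr ?g j" "u \<noteq> 0" by blast
  have "\<exists>A\<in>Lspan T. A \<noteq> 0 \<and> (0, A, 0) \<in> I"
  proof -
    consider "j = -1" | "j = 0" | "j = 1" | "j \<notin> {-1, 0, 1}" by auto
    then show ?thesis
    proof cases
      case 1
      then obtain z where "u = (z, 0, 0)" "z \<in> V" using u(2) unfolding 1 Lie_eq Lie.lgr_G by blast
      then show ?thesis using stable_m1_imp_0[OF st] u by (auto simp: zero_prod_def)
    next
      case 2
      then show ?thesis using u unfolding Lie_eq by (auto simp: zero_prod_def Lie.lgr_G)
    next
      case 3
      then obtain \<psi> where \<psi>: "u = (0, 0, \<psi>)" "form \<psi>" using u(2) unfolding 3 Lie_eq Lie.lgr_G by blast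
      obtain x where x: "x \<in> V" "\<psi> = phi T x" using \<psi>(2) by (rule formE)
      have "x \<noteq> 0" using u(3) \<psi>(1) x by (auto simp: zero_prod_def)
      then show ?thesis using stable_1_imp_0[OF st] u(1) \<psi> x by blast
    next
      case 4
      then show ?thesis using u Lie.lgr_G(4)[OF 4] unfolding Lie_eq by auto
    qed
  qed
  then obtain A where A: "A \<in> Lspan T" "A \<noteq> 0" "(0, A, 0) \<in> I" by blast
  obtain z where "z \<in> V" "z \<noteq> 0" "(z, 0, 0) \<in> I" using stable_0_imp_m1[OF st A(3,1,2)] by blast
  then have "(z, 0, 0) \<in> I \<inter> lgr ?g (-1)" "(z, 0, 0) \<noteq> 0"
    unfolding Lie_eq Lie.lgr_G zero_prod_def by blast+
  then have "I \<inter> lgr ?g (-1) \<noteq> {0}" by blast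
  moreover obtain w where w: "w \<in> V" "adj A w \<noteq> 0" using adj_nonzero[OF A(1,2)] by blast
  have "adj A w \<in> V" using DerD(3)[OF subsetD[OF Lspan_Der A(1)]] .
  then have "phi T (adj A w) \<noteq> 0" "form (phi T (adj A w))" using phi_eq_0_iff w(2) form_phi by auto
  then have "(0, 0, phi T (adj A w)) \<in> I \<inter> lgr ?g 1" "(0, 0, phi T (adj A w)) \<noteq> 0"
    using stable_0_imp_1[OF st A(3,1) w(1)] unfolding Lie_eq Lie.lgr_G zero_prod_def by blast+
  then have "I \<inter> lgr ?g 1 \<noteq> {0}" by blast
  ultimately show "I \<inter> lgr ?g (-1) \<noteq> {0} \<and> I \<inter> lgr ?g 1 \<noteq> {0}" ..
qed

section \<open>The conjugation\<close>

text \<open>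
  The conjugation by a formula in the three components, where no presentation of an operator as a sum of
  \<open>L\<^bsub>x,y\<^esub>\<close> is chosen; its values on generators identify it with \<open>\<sigma>\<close> (\<open>lie_sigma_eq\<close>).
\<close>

definition conj :: "'a lie_elem \<Rightarrow> 'a lie_elem" where
  "conj u = (if u \<in> lcar (Lie T) then (case u of (z, A, \<psi>) \<Rightarrow> (unphi \<psi>, - adj A, - phi T z)) else 0)"

lemma Lie_cases:
  assumes "u \<in> lcar (Lie T)"
  obtains z A x where "u = (z, A, phi T x)" "z \<in> V" "A \<in> Lspan T" "x \<in> V"
  using assms Lie.lcar_E formE unfolding Lie_eq by metis

lemma Lie_mem: "z \<in> V \<Longrightarrow> A \<in> Lspan T \<Longrightarrow> x \<in> V \<Longrightarrow> (z, A, phi T x) \<in> lcar (Lie T)"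
  unfolding Lie_eq using form_phi by (simp add: Lie.lcar_G)

lemma conj_simp:
  "z \<in> V \<Longrightarrow> A \<in> Lspan T \<Longrightarrow> x \<in> V \<Longrightarrow> conj (z, A, phi T x) = (x, - adj A, - phi T z)"
  unfolding conj_def by (simp add: Lie_mem)

lemma adj_uminus:
  assumes "A \<in> Der"
  shows "adj (- A) = - adj A"
proof -
  have "- A = (\<lambda>z. s (- 1) (A z))" "- adj A = (\<lambda>z. s (cnj (- 1)) (adj A z))" by (simp_all add: fun_eq_iff)
  then show ?thesis using adj_scale[OF assms, of "- 1"] by simp
qed

lemma adj_diff: "A \<in> Der \<Longrightarrow> B \<in> Der \<Longrightarrow> adj (A - B) = adj A - adj B"
  using adj_add[of A "- B"] adj_uminus[of B] vf.subspace_neg[OF Der_subspace, of B] by simp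

lemma conj_mem: "u \<in> lcar (Lie T) \<Longrightarrow> conj u \<in> lcar (Lie T)"
  by (erule Lie_cases)
    (simp add: conj_simp phi_uminus[symmetric] Lie_mem Lie.D_uminus adj_Lspan)

lemma conj_conj:
  assumes "z \<in> V" "A \<in> Lspan T" "x \<in> V"
  shows "conj (conj (z, A, phi T x)) = (- z, A, - phi T x)"
proof -
  have "conj (z, A, phi T x) = (x, - adj A, phi T (- z))" using assms by (simp add: conj_simp phi_uminus)
  then show ?thesis
    using assms adj_uminus[of "adj A"] adj_Lspan[OF assms(2)] subsetD[OF Lspan_Der]
    by (simp add: conj_simp Lie.D_uminus)
qed

lemma conj_antilinear: "antilinear_map (lcar (Lie T)) (lscl (Lie T)) (lscl (Lie T)) conj"
  unfolding antilinear_map_def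
proof (intro conjI ballI allI)
  fix u v assume uv: "u \<in> lcar (Lie T)" "v \<in> lcar (Lie T)"
  obtain z A x where u: "u = (z, A, phi T x)" "z \<in> V" "A \<in> Lspan T" "x \<in> V" using uv(1) by (rule Lie_cases)
  obtain z' A' x' where v: "v = (z', A', phi T x')" "z' \<in> V" "A' \<in> Lspan T" "x' \<in> V" using uv(2) by (rule Lie_cases)
  have "u + v = (z + z', A + A', phi T (x + x'))" using u v by (simp add: phi_add)
  then have "conj (u + v) = (x + x', - adj (A + A'), - phi T (z + z'))"
    using conj_simp[OF _ Lie.D_add[OF u(3) v(3)], of "z + z'" "x + x'"] u v by simp
  then show "conj (u + v) = conj u + conj v"
    using u v subsetD[OF Lspan_Der] by (simp add: conj_simp adj_add phi_add)
next
  fix c u assume "u \<in> lcar (Lie T)"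
  then obtain z A x where u: "u = (z, A, phi T x)" "z \<in> V" "A \<in> Lspan T" "x \<in> V" by (rule Lie_cases)
  have "lscl (Lie T) c u = (s c z, (\<lambda>v. s c (A v)), phi T (s (cnj c) x))"
    using u by (simp add: Lie_eq lie_scale_def phi_scale)
  then have "conj (lscl (Lie T) c u) = (s (cnj c) x, - adj (\<lambda>v. s c (A v)), - phi T (s c z))"
    using conj_simp[OF _ Lie.D_scale[OF u(3)], of "s c z" "s (cnj c) x"] u by simp
  then show "conj (lscl (Lie T) c u) = lscl (Lie T) (cnj c) (conj u)"
    using u adj_scale[OF subsetD[OF Lspan_Der u(3)]] phi_scale[OF u(2)]
    by (simp add: conj_simp Lie_eq lie_scale_def fun_eq_iff)
qed

lemma conj_generators:
  "z \<in> V \<Longrightarrow> conj (in_m1 z) = in_1 (- phi T z)"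
  "z \<in> V \<Longrightarrow> conj (in_1 (phi T z)) = in_m1 z"
  "x \<in> V \<Longrightarrow> y \<in> V \<Longrightarrow> conj (in_0 (Lop T x y)) = in_0 (- Lop T y x)"
  using conj_simp[of z 0 0] conj_simp[of 0 0 z] conj_simp[of 0 "Lop T x y" 0] adj_0 adj_Lop Lie.D_0 Lspan_Lop
  by (simp_all add: in_m1_def in_0_def in_1_def)

text \<open>
  The generators span \<open>Lie T\<close>, so at most one antilinear map has the prescribed values.
\<close>

lemma antilinear_determined:
  assumes s': "antilinear_map (lcar (Lie T)) (lscl (Lie T)) (lscl (Lie T)) s'"
    and m1: "\<And>z. z \<in> V \<Longrightarrow> s' (in_m1 z) = in_1 (- phi T z)"
    and 1: "\<And>z. z \<in> V \<Longrightarrow> s' (in_1 (phi T z)) = in_m1 z"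
    and 0: "\<And>x y. x \<in> V \<Longrightarrow> y \<in> V \<Longrightarrow> s' (in_0 (Lop T x y)) = in_0 (- Lop T y x)"
    and u: "u \<in> lcar (Lie T)"
  shows "s' u = conj u"
proof -
  have cs: "cspace (lscl (Lie T)) (lcar (Lie T))" unfolding Lie_eq using Lie.cspace_G by simp
  note r = antilinear_mapD[OF s' cs] and rc = antilinear_mapD[OF conj_antilinear cs]
  obtain z A x where u: "u = (z, A, phi T x)" "z \<in> V" "A \<in> Lspan T" "x \<in> V" using u by (rule Lie_cases)
  have i0: "in_0 B \<in> lcar (Lie T)" if "B \<in> Lspan T" for B
    using Lie_mem[of 0 B 0] that by (simp add: in_0_def)
  have im1: "in_m1 z \<in> lcar (Lie T)" "in_1 (phi T x) \<in> lcar (Lie T)"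
    using Lie_mem[of z 0 0] Lie_mem[of 0 0 x] u Lie.D_0 by (simp_all add: in_m1_def in_1_def)
  have A: "s' (in_0 A) = conj (in_0 A)"
    using u(3)
  proof (induction rule: Lspan_induct)
    case zero
    have "in_0 (0 :: 'a \<Rightarrow> 'a) = 0" by (simp add: in_0_def zero_prod_def)
    then have "s' (in_0 0) = conj (in_0 0)" using r(3) rc(3) by simp
    then show ?case .
  next
    case (Lop x y)
    then show ?case using 0 conj_generators(3) by simp
  next
    case (add A B)
    have "in_0 (A + B) = in_0 A + in_0 B" by (simp add: in_0_def)
    then have "s' (in_0 (A + B)) = conj (in_0 (A + B))" using r(1)[OF i0 i0] rc(1)[OF i0 i0] add by simp
    then show ?case .
  next
    case (scale c A)
    have "in_0 (\<lambda>z. s c (A z)) = lscl (Lie T) c (in_0 A)"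
      by (simp add: in_0_def Lie_eq lie_scale_def fun_eq_iff)
    then show ?case using r(2)[OF i0] rc(2)[OF i0] scale by simp
  qed
  have "u = in_m1 z + (in_0 A + in_1 (phi T x))" by (simp add: u(1) in_m1_def in_0_def in_1_def)
  then show ?thesis
    using A m1[OF u(2)] 1[OF u(4)] conj_generators(1)[OF u(2)] conj_generators(2)[OF u(4)] im1 i0[OF u(3)]
      cspaceD(6)[OF cs] by (simp add: r(1) rc(1))
qed

lemma lie_sigma_eq: "lie_sigma T = conj"
  unfolding lie_sigma_def
proof (rule the_equality)
  show "antilinear_map (lcar (Lie T)) (lscl (Lie T)) (lscl (Lie T)) conj \<and>
     (\<forall>z\<in>tcar T. conj (in_m1 z) = in_1 (- phi T z)) \<and>
     (\<forall>z\<in>tcar T. conj (in_1 (phi T z)) = in_m1 z) \<and>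
     (\<forall>x\<in>tcar T. \<forall>y\<in>tcar T. conj (in_0 (Lop T x y)) = in_0 (- Lop T y x)) \<and>
     (\<forall>u. u \<notin> lcar (Lie T) \<longrightarrow> conj u = 0)"
    using conj_antilinear conj_generators by (simp add: conj_def)
next
  fix s' assume s': "antilinear_map (lcar (Lie T)) (lscl (Lie T)) (lscl (Lie T)) s' \<and>
     (\<forall>z\<in>tcar T. s' (in_m1 z) = in_1 (- phi T z)) \<and>
     (\<forall>z\<in>tcar T. s' (in_1 (phi T z)) = in_m1 z) \<and>
     (\<forall>x\<in>tcar T. \<forall>y\<in>tcar T. s' (in_0 (Lop T x y)) = in_0 (- Lop T y x)) \<and>
     (\<forall>u. u \<notin> lcar (Lie T) \<longrightarrow> s' u = 0)"
  show "s' = conj"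
  proof
    fix u show "s' u = conj u"
    proof (cases "u \<in> lcar (Lie T)")
      case True
      then show ?thesis using s' by (intro antilinear_determined) auto
    next
      case False
      then have "s' u = 0" using s' by blast
      then show ?thesis using False by (simp add: conj_def)
    qed
  qed
qed

text \<open>
  In degree 0 the adjoint reverses commutators and exchanges \<open>L\<^bsub>x,y\<^esub>\<close> with \<open>L\<^bsub>y,x\<^esub>\<close>, which the sign in
  \<open>- adj A\<close> compensates; in degrees -1 and 1 operators act on \<open>z\<close> by themselves and on \<open>\<phi>\<^sub>z\<close> by their
  adjoints, and the conjugation exchanges the two actions.
\<close>

lemma conj_bracket:
  assumes uv: "u \<in> lcar (Lie T)" "v \<in> lcar (Lie T)"
  shows "conj (lie_bracket u v) = lie_bracket (conj u) (conj v)"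
proof -
  obtain z A x where u: "u = (z, A, phi T x)" "z \<in> V" "A \<in> Lspan T" "x \<in> V" using uv(1) by (rule Lie_cases)
  obtain z' A' x' where v: "v = (z', A', phi T x')" "z' \<in> V" "A' \<in> Lspan T" "x' \<in> V" using uv(2) by (rule Lie_cases)
  have D: "A \<in> Der" "A' \<in> Der" "adj A \<in> Der" "adj A' \<in> Der"
    using u v adj_Lspan(1) Lspan_Der by blast+
  note m = DerD(3)[OF D(1)] DerD(3)[OF D(2)] endoD(6)[OF DerD(1)[OF D(1)]] endoD(6)[OF DerD(1)[OF D(2)]]
  let ?C = "(A \<circ> A') - (A' \<circ> A)"
  have C: "?C \<in> Lspan T" by (rule Lie.D_commutator[OF u(3) v(3)])
  have L: "Lop T z' x \<in> Lspan T" "Lop T z x' \<in> Lspan T" using u v Lspan_Lop by blast+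
  have B: "?C - Lop T z' x - Lop T z x' \<in> Lspan T" by (intro Lie.D_diff C L)
  have adjB: "adj (?C - Lop T z' x - Lop T z x') = ((adj A' \<circ> adj A) - (adj A \<circ> adj A')) - Lop T x z' - Lop T x' z"
  proof -
    have "?C \<in> Der" "?C - Lop T z' x \<in> Der" "Lop T z' x \<in> Der" "Lop T z x' \<in> Der"
      using C L Lie.D_diff[OF C L(1)] Lspan_Der by blast+
    then show ?thesis
      using adj_commutator[OF u(3) v(3)] adj_Lop u v by (simp add: adj_diff)
  qed
  have "lie_bracket u v = (A z' - A' z, ?C - Lop T z' x - Lop T z x', phi T (adj A' x - adj A x'))"
    unfolding u(1) v(1) Lie.lie_bracket_simp
    using act01_phi[OF D(1) v(4)] act01_phi[OF D(2) u(4)] form_eq_Lop u v m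
    by (simp add: phi_diff)
  then have 1: "conj (lie_bracket u v) =
      (adj A' x - adj A x', - (((adj A' \<circ> adj A) - (adj A \<circ> adj A')) - Lop T x z' - Lop T x' z), - phi T (A z' - A' z))"
    using conj_simp[OF _ B, of "A z' - A' z" "adj A' x - adj A x'"] m adjB by simp
  have act: "act01 (- B) (- \<psi>) = act01 B \<psi>" if "endo B" "form \<psi>" for B \<psi>
    by (simp add: act01_def fun_eq_iff endoD[OF that(1)] form_simps[OF that(2)] endoD[OF form_endo[OF that(2)]])
  have fe: "form (phi T z)" "form (phi T z')" using u v form_phi by blast+
  have a: "act01 (- adj A) (- phi T z') = - phi T (A z')" "act01 (- adj A') (- phi T z) = - phi T (A' z)"
    using act[OF DerD(1)[OF D(3)] fe(2)] act[OF DerD(1)[OF D(4)] fe(1)]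
      act01_phi[OF D(3) v(2)] act01_phi[OF D(4) u(2)] adj_Lspan(2)[OF u(3)] adj_Lspan(2)[OF v(3)] by simp_all
  have e: "endo (adj A)" "endo (adj A')" using D DerD(1) by blast+
  have c: "(- adj A \<circ> - adj A') - (- adj A' \<circ> - adj A) = (adj A \<circ> adj A') - (adj A' \<circ> adj A)"
    by (simp add: fun_eq_iff endoD[OF e(1)] endoD[OF e(2)])
  have p: "- phi T z x' = Lop T x' z" "- phi T z' x = Lop T x z'" using form_eq_Lop u v by simp_all
  have "lie_bracket (conj u) (conj v) =
      (- adj A x' + adj A' x, ((adj A \<circ> adj A') - (adj A' \<circ> adj A)) + Lop T x' z + Lop T x z', - phi T (A z') + phi T (A' z))"
    unfolding u(1) v(1) conj_simp[OF u(2-4)] conj_simp[OF v(2-4)] Lie.lie_bracket_simp a c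
    by (simp add: p)
  then show ?thesis unfolding 1 using m by (simp add: phi_diff)
qed

theorem graded_conjugation_Lie: "graded_conjugation (Lie T) (lie_sigma T)"
proof -
  let ?G = "lcar (Lie T)"
  have c4: "conj (conj (conj (conj u))) = u" if u: "u \<in> ?G" for u
  proof -
    obtain z A x where u: "u = (z, A, phi T x)" "z \<in> V" "A \<in> Lspan T" "x \<in> V" using u by (rule Lie_cases)
    have "conj (conj u) = (- z, A, phi T (- x))" using u by (simp add: conj_conj phi_uminus)
    then have "conj (conj (conj (conj u))) = conj (conj (- z, A, phi T (- x)))" by (simp only:)
    then show ?thesis using u conj_conj[of "- z" A "- x"] by (simp add: phi_uminus)
  qed
  have deg: "conj u \<in> lgr (Lie T) (- j)" if u: "u \<in> lgr (Lie T) j" for u j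
  proof -
    have "u \<in> ?G" using u Lie.lgr_subset unfolding Lie_eq by blast
    then obtain z A x where u': "u = (z, A, phi T x)" "z \<in> V" "A \<in> Lspan T" "x \<in> V" by (rule Lie_cases)
    have "conj u \<in> ?G" by (rule conj_mem) fact
    then show ?thesis
      using u unfolding u'(1) conj_simp[OF u'(2-4)] unfolding Lie_eq Lie.lgr_iff Lie.lcar_G
      using phi_eq_0_iff[OF u'(4)] adj_0 by auto
  qed
  have par: "conj u \<in> lsd (Lie T) p" if u: "u \<in> lsd (Lie T) p" for u p
  proof -
    have "u \<in> ?G" using u Lie.lsd_subspace unfolding Lie_eq by blast
    then obtain z A x where u': "u = (z, A, phi T x)" "z \<in> V" "A \<in> Lspan T" "x \<in> V" by (rule Lie_cases)
    have "conj u \<in> ?G" by (rule conj_mem) fact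
    then show ?thesis
      using u unfolding u'(1) conj_simp[OF u'(2-4)] unfolding Lie_eq Lie.lcar_G
      using phi_eq_0_iff[OF u'(4)] adj_0 by (cases p) (auto simp: Lie.lsd_G)
  qed
  have sub: "lgr (Lie T) j \<subseteq> ?G" "lsd (Lie T) p \<subseteq> ?G" for j p
    using Lie.lgr_subset Lie.lsd_subspace unfolding Lie_eq by blast+
  show ?thesis
    unfolding graded_conjugation_def lie_sigma_eq
  proof (intro conjI allI ballI)
    show "bij_betw conj ?G ?G"
    proof (rule bij_betw_byWitness[where f' = "\<lambda>u. conj (conj (conj u))"])
      show "conj ` ?G \<subseteq> ?G" using conj_mem by (rule image_subsetI)
      show "(\<lambda>u. conj (conj (conj u))) ` ?G \<subseteq> ?G" by (rule image_subsetI) (intro conj_mem)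
    qed (intro ballI c4; assumption)+
    show "antilinear_map ?G (lscl (Lie T)) (lscl (Lie T)) conj" by (rule conj_antilinear)
    show "conj (lbr (Lie T) u v) = lbr (Lie T) (conj u) (conj v)" if "u \<in> ?G" "v \<in> ?G" for u v
      using conj_bracket[OF that] by (simp add: Lie_eq)
    show "conj ` lsd (Lie T) p = lsd (Lie T) p" for p
    proof (rule antisym)
      show "conj ` lsd (Lie T) p \<subseteq> lsd (Lie T) p" using par by blast
      show "lsd (Lie T) p \<subseteq> conj ` lsd (Lie T) p"
      proof
        fix u assume u: "u \<in> lsd (Lie T) p"
        then have "u = conj (conj (conj (conj u)))" using c4[OF subsetD[OF sub(2)]] by simp
        moreover have "conj (conj (conj u)) \<in> lsd (Lie T) p" by (intro par u)
        ultimately show "u \<in> conj ` lsd (Lie T) p" by (rule image_eqI)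
      qed
    qed
    show "conj ` lgr (Lie T) j = lgr (Lie T) (- j)" for j
    proof (rule antisym)
      show "conj ` lgr (Lie T) j \<subseteq> lgr (Lie T) (- j)" using deg by blast
      show "lgr (Lie T) (- j) \<subseteq> conj ` lgr (Lie T) j"
      proof
        fix u assume u: "u \<in> lgr (Lie T) (- j)"
        then have "u = conj (conj (conj (conj u)))" using c4[OF subsetD[OF sub(1)]] by simp
        moreover have "conj (conj (conj u)) \<in> lgr (Lie T) j" using deg[OF deg[OF deg[OF u]]] by simp
        ultimately show "u \<in> conj ` lgr (Lie T) j" by (rule image_eqI)
      qed
    qed
    show "conj (conj u) = (if even k then u else - u)" if u: "u \<in> lgr (Lie T) k" for k u
    proof -
      have "u \<in> ?G" using u sub by blast
      then obtain z A x where u': "u = (z, A, phi T x)" "z \<in> V" "A \<in> Lspan T" "x \<in> V" by (rule Lie_cases)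
      consider "k = -1" | "k = 0" | "k = 1" | "k \<notin> {-1, 0, 1}" by auto
      then show ?thesis
        using u unfolding u'(1) conj_conj[OF u'(2-4)] unfolding Lie_eq Lie.lgr_iff
        by cases auto
    qed
  qed
qed

lemma recover_bracket:
  assumes "x \<in> V" "y \<in> V" "z \<in> V"
  shows "in_m1 (tbr T x y z) =
         lbr (Lie T) (lbr (Lie T) (in_m1 x) (lie_sigma T (in_m1 y))) (in_m1 z)"
proof -
  have "lie_bracket (in_m1 x) (in_1 (- phi T y)) = in_0 (Lop T x y)"
    using lie_bracket_generators(4)[OF N6 assms(2) V_rules(1), of x] assms
    unfolding in_m1_def in_0_def in_1_def Lie.lie_bracket_simp by (auto simp: fun_eq_iff act01_def
        form_simps(4)[OF form_phi[OF assms(2)]] endoD(3)[OF form_endo[OF form_phi[OF assms(2)]]])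
  then show ?thesis
    using lie_bracket_generators(2)[OF N6 assms] 
    by (simp add: lie_sigma_eq conj_generators assms Lie_eq)
qed

end

section \<open>Isomorphic 3-algebras have isomorphic pairs, and conversely\<close>

locale alg3_iso = A: zero_center_N6 T + B: zero_center_N6 T'
  for T :: "'a::ab_group_add alg3" and T' :: "'b::ab_group_add alg3" +
  fixes f :: "'a \<Rightarrow> 'b"
  assumes f_bij: "bij_betw f (tcar T) (tcar T')"
    and f_linear: "linear_map (tcar T) (tscl T) (tscl T') f"
    and f_br: "\<lbrakk>x \<in> tcar T; y \<in> tcar T; z \<in> tcar T\<rbrakk> \<Longrightarrow> f (tbr T x y z) = tbr T' (f x) (f y) (f z)"
begin

abbreviation "f' \<equiv> inv_into (tcar T) f"

lemma f_mem [simp]: "x \<in> tcar T \<Longrightarrow> f x \<in> tcar T'"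
  using f_bij bij_betwE by blast

lemma f'_mem [simp]: "w \<in> tcar T' \<Longrightarrow> f' w \<in> tcar T"
  using f_bij by (metis bij_betw_def inv_into_into)

lemma f'_f [simp]: "x \<in> tcar T \<Longrightarrow> f' (f x) = x"
  using f_bij by (simp add: bij_betw_def)

lemma f_f' [simp]: "w \<in> tcar T' \<Longrightarrow> f (f' w) = w"
  using f_bij by (simp add: bij_betw_def f_inv_into_f)

lemmas f_simps [simp] = linear_mapD[OF f_linear A.cspace_V]

lemma f'_0 [simp]: "f' 0 = 0"
  using f'_f[OF A.V_rules(1)] by simp

lemma inverse_iso: "alg3_iso T' T f'"
proof unfold_locales
  show "bij_betw f' (tcar T') (tcar T)" by (rule bij_betw_inv_into[OF f_bij])
  have e: "f' w = x" if "w = f x" "x \<in> tcar T" for w x using that by simp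
  show "linear_map (tcar T') (tscl T') (tscl T) f'"
    unfolding linear_map_def by (intro conjI ballI allI e) simp_all
  show "f' (tbr T' x y z) = tbr T (f' x) (f' y) (f' z)"
    if "x \<in> tcar T'" "y \<in> tcar T'" "z \<in> tcar T'" for x y z
    by (rule e) (use that in \<open>simp_all add: f_br\<close>)
qed

text \<open>
  Transport of operators along \<open>f\<close>.  Since the bracket is given by compositions of operators, transport
  is compatible with it.
\<close>

definition push1 :: "('a \<Rightarrow> 'a) \<Rightarrow> 'b \<Rightarrow> 'b" where
  "push1 A = (\<lambda>w. if w \<in> tcar T' then f (A (f' w)) else 0)"

definition push2 :: "('a \<Rightarrow> 'a \<Rightarrow> 'a) \<Rightarrow> 'b \<Rightarrow> 'b \<Rightarrow> 'b" where
  "push2 \<psi> = (\<lambda>v w. if v \<in> tcar T' \<and> w \<in> tcar T' then f (\<psi> (f' v) (f' w)) else 0)"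

definition push :: "'a lie_elem \<Rightarrow> 'b lie_elem" where
  "push = (\<lambda>(z, A, \<psi>). (f z, push1 A, push2 \<psi>))"

lemma push1_add: "A.endo A \<Longrightarrow> A.endo B \<Longrightarrow> push1 (A + B) = push1 A + push1 B"
  and push1_scale: "A.endo A \<Longrightarrow> push1 (\<lambda>z. tscl T c (A z)) = (\<lambda>z. tscl T' c (push1 A z))"
  and push1_0: "push1 0 = 0"
  by (simp_all add: push1_def fun_eq_iff A.endoD(6))

lemma push1_Lop: "x \<in> tcar T \<Longrightarrow> y \<in> tcar T \<Longrightarrow> push1 (Lop T x y) = Lop T' (f x) (f y)"
  by (simp add: push1_def Lop_def fun_eq_iff f_br)

lemma push2_phi: "x \<in> tcar T \<Longrightarrow> push2 (phi T x) = phi T' (f x)"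
  by (simp add: push2_def phi_def fun_eq_iff f_br)

lemma push1_uminus: "A.endo A \<Longrightarrow> push1 (- A) = - push1 A"
  by (simp add: push1_def fun_eq_iff A.endoD(6))

lemma push2_0: "push2 0 = 0"
  by (simp add: push2_def fun_eq_iff)

lemma push1_Lspan:
  assumes "A \<in> Lspan T"
  shows "push1 A \<in> Lspan T'"
  using assms
proof (induction rule: A.Lspan_induct)
  case zero
  then have "push1 0 \<in> Lspan T'" unfolding push1_0 by (rule B.Lie.D_0)
  then show ?case .
next
  case (Lop x y)
  then show ?case by (simp add: push1_Lop B.Lspan_Lop)
next
  case (add A B)
  then have "push1 (A + B) \<in> Lspan T'"
    using push1_add[OF A.Lie.D_endo A.Lie.D_endo] B.Lie.D_add by simp
  then show ?case .
next
  case (scale c A)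
  then show ?case using push1_scale[OF A.Lie.D_endo] B.Lie.D_scale by simp
qed

lemma push_mem:
  assumes "u \<in> lcar (Lie T)"
  shows "push u \<in> lcar (Lie T')"
proof -
  obtain z A x where u: "u = (z, A, phi T x)" "z \<in> tcar T" "A \<in> Lspan T" "x \<in> tcar T"
    using assms by (rule A.Lie_cases)
  show ?thesis unfolding u push_def prod.case push2_phi[OF u(4)]
    by (intro B.Lie_mem push1_Lspan u f_mem)
qed

lemma push_inverse:
  assumes "u \<in> lcar (Lie T)"
  shows "alg3_iso.push T' T f' (push u) = u"
proof -
  interpret I: alg3_iso T' T f' by (rule inverse_iso)
  obtain z A x where u: "u = (z, A, phi T x)" "z \<in> tcar T" "A \<in> Lspan T" "x \<in> tcar T"
    using assms by (rule A.Lie_cases)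
  have inv: "inv_into (tcar T') f' v = f v" if "v \<in> tcar T" for v
    using I.f'_f[of "f v"] that by simp
  have "I.push1 (push1 A) = A"
    using A.endoD[OF A.Lie.D_endo[OF u(3)]] by (auto simp: I.push1_def push1_def fun_eq_iff inv)
  moreover have "I.push2 (push2 (phi T x)) = phi T x"
    using u by (simp add: push2_phi I.push2_phi)
  ultimately show ?thesis using u by (simp add: push_def I.push_def)
qed

lemma push1_apply: "z \<in> tcar T \<Longrightarrow> push1 A (f z) = f (A z)"
  by (simp add: push1_def)

lemma push2_apply: "y \<in> tcar T \<Longrightarrow> z \<in> tcar T \<Longrightarrow> push2 \<psi> (f y) (f z) = f (\<psi> y z)"
  by (simp add: push2_def)

lemma ext_on:
  assumes "\<And>z. z \<in> tcar T \<Longrightarrow> h (f z) = k (f z)" "\<And>w. w \<notin> tcar T' \<Longrightarrow> h w = k w"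
  shows "h = k"
proof
  fix w show "h w = k w"
    using assms(1)[of "f' w"] assms(2)[of w] by (cases "w \<in> tcar T'") simp_all
qed

lemma push_bracket:
  assumes uv: "u \<in> lcar (Lie T)" "v \<in> lcar (Lie T)"
  shows "push (lie_bracket u v) = lie_bracket (push u) (push v)"
proof -
  obtain z A \<psi> where u: "u = (z, A, \<psi>)" "z \<in> tcar T" "A \<in> Lspan T" "A.form \<psi>"
    using uv(1) A.Lie.lcar_E unfolding A.Lie_eq by metis
  obtain z' A' \<psi>' where v: "v = (z', A', \<psi>')" "z' \<in> tcar T" "A' \<in> Lspan T" "A.form \<psi>'"
    using uv(2) A.Lie.lcar_E unfolding A.Lie_eq by metis
  note e = A.endoD(3,6)[OF A.Lie.D_endo[OF u(3)]] A.endoD(3,6)[OF A.Lie.D_endo[OF v(3)]]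
    and p = A.endoD(3,6)[OF A.form_endo[OF u(4)]] A.endoD(3,6)[OF A.form_endo[OF v(4)]]
      A.form_simps(4)[OF u(4)] A.form_simps(4)[OF v(4)]
  have p1: "push1 B w = 0" if "w \<notin> tcar T'" for B w using that by (simp add: push1_def)
  have p2: "push2 B w = 0" if "w \<notin> tcar T'" for B w using that by (simp add: push2_def fun_eq_iff)
  have p2': "push2 B y w = 0" if "w \<notin> tcar T'" for B y w using that by (simp add: push2_def)
  have z1: "push1 A 0 = 0" "push1 A' 0 = 0" using e by (simp_all add: push1_def)
  have z2: "push2 \<psi> 0 = 0" "push2 \<psi>' 0 = 0" "push2 \<psi> y 0 = 0" "push2 \<psi>' y 0 = 0" for y
    using p by (simp_all add: push2_def fun_eq_iff)
  have 1: "f (A z' - A' z) = push1 A (f z') - push1 A' (f z)"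
    using u v e by (simp add: push1_apply)
  have 2: "push1 ((A \<circ> A') - (A' \<circ> A) + \<psi> z' + \<psi>' z) =
      (push1 A \<circ> push1 A') - (push1 A' \<circ> push1 A) + push2 \<psi> (f z') + push2 \<psi>' (f z)"
    by (rule ext_on) (use u(2) v(2) e p in \<open>simp_all add: push1_apply push2_apply p1 p2' z1\<close>)
  have 3: "push2 (act01 A \<psi>' - act01 A' \<psi>) = act01 (push1 A) (push2 \<psi>') - act01 (push1 A') (push2 \<psi>)"
  proof (rule ext_on)
    fix y assume y: "y \<in> tcar T"
    show "push2 (act01 A \<psi>' - act01 A' \<psi>) (f y) =
        (act01 (push1 A) (push2 \<psi>') - act01 (push1 A') (push2 \<psi>)) (f y)"
      by (rule ext_on) (use y e p in \<open>simp_all add: act01_def push1_apply push2_apply p1 p2' z1 z2\<close>)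
  next
    fix w assume "w \<notin> tcar T'"
    then show "push2 (act01 A \<psi>' - act01 A' \<psi>) w =
        (act01 (push1 A) (push2 \<psi>') - act01 (push1 A') (push2 \<psi>)) w"
      by (simp add: fun_eq_iff act01_def p1 p2 z1 z2)
  qed
  show ?thesis
    unfolding u(1) v(1) push_def prod.case A.Lie.lie_bracket_simp B.Lie.lie_bracket_simp 1 2 3 ..
qed

lemma push_linear: "linear_map (lcar (Lie T)) (lscl (Lie T)) (lscl (Lie T')) push"
  unfolding linear_map_def
proof (intro conjI ballI allI)
  fix u v assume uv: "u \<in> lcar (Lie T)" "v \<in> lcar (Lie T)"
  obtain z A x where u: "u = (z, A, phi T x)" "z \<in> tcar T" "A \<in> Lspan T" "x \<in> tcar T" using uv(1) by (rule A.Lie_cases)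
  obtain z' A' x' where v: "v = (z', A', phi T x')" "z' \<in> tcar T" "A' \<in> Lspan T" "x' \<in> tcar T" using uv(2) by (rule A.Lie_cases)
  have "u + v = (z + z', A + A', phi T (x + x'))" using u v by (simp add: A.phi_add)
  then have "push (u + v) = (f z + f z', push1 A + push1 A', phi T' (f x + f x'))"
    using u v push1_add[OF A.Lie.D_endo[OF u(3)] A.Lie.D_endo[OF v(3)]] by (simp add: push_def push2_phi del: A.phi_add)
  then show "push (u + v) = push u + push v"
    using u v by (simp add: push_def push2_phi B.phi_add)
next
  fix c u assume "u \<in> lcar (Lie T)"
  then obtain z A x where u: "u = (z, A, phi T x)" "z \<in> tcar T" "A \<in> Lspan T" "x \<in> tcar T" by (rule A.Lie_cases)
  have "lscl (Lie T) c u = (tscl T c z, (\<lambda>v. tscl T c (A v)), phi T (tscl T (cnj c) x))"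
    using u by (simp add: A.Lie_eq lie_scale_def A.phi_scale)
  then have "push (lscl (Lie T) c u) = (tscl T' c (f z), (\<lambda>v. tscl T' c (push1 A v)), phi T' (tscl T' (cnj c) (f x)))"
    using u push1_scale[OF A.Lie.D_endo[OF u(3)]] by (simp add: push_def push2_phi)
  then show "push (lscl (Lie T) c u) = lscl (Lie T') c (push u)"
    using u by (simp add: push_def push2_phi B.phi_scale B.Lie_eq lie_scale_def)
qed

lemma push_conj:
  assumes "u \<in> lcar (Lie T)"
  shows "push (A.conj u) = B.conj (push u)"
proof -
  obtain z A x where u: "u = (z, A, phi T x)" "z \<in> tcar T" "A \<in> Lspan T" "x \<in> tcar T"
    using assms by (rule A.Lie_cases)
  note A = A.DerD[OF subsetD[OF A.Lspan_Der u(3)]]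
  have ea: "A.endo (adj A)" if "adj A \<in> Lspan T" for adj using A.Lie.D_endo that .
  have "B.adj (push1 A) = push1 (A.adj A)"
  proof (rule B.adj_eqI)
    show "B.adjoint_pair (push1 A) (push1 (A.adj A))"
      unfolding B.adjoint_pair_def
    proof (intro conjI ballI)
      show "push1 (A.adj A) y \<in> tcar T'" if "y \<in> tcar T'" for y
        using that A(3) by (simp add: push1_def)
      fix x y z assume "x \<in> tcar T'" "y \<in> tcar T'" "z \<in> tcar T'"
      then obtain a b c where x: "a \<in> tcar T" "x = f a" and y: "b \<in> tcar T" "y = f b"
        and z: "c \<in> tcar T" "z = f c"
        using f'_mem f_f' by metis
      show "push1 A (tbr T' x y z) =
          tbr T' (push1 A x) y z - tbr T' x (push1 (A.adj A) y) z + tbr T' x y (push1 A z)"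
      proof -
        have "push1 A (tbr T' x y z) = f (A (tbr T a b c))"
          unfolding x(2) y(2) z(2) f_br[OF x(1) y(1) z(1), symmetric]
          by (rule push1_apply) (simp add: x(1) y(1) z(1))
        then show ?thesis
          unfolding x(2) y(2) z(2) A.adjointD(2)[OF A(2) x(1) y(1) z(1)]
          using x(1) y(1) z(1) A.endoD(6)[OF A(1)] A(3) by (simp add: push1_apply f_br)
      qed
    qed
  qed (simp add: push1_def)
  then show ?thesis
    using u push1_uminus[OF A.Lie.D_endo[OF A.adj_Lspan(1)[OF u(3)]]]
    by (simp add: A.conj_simp B.conj_simp push_def push2_phi A.phi_uminus[symmetric] B.phi_uminus[symmetric] push1_Lspan)
qed

lemma push_lgr: "push ` lgr (Lie T) j \<subseteq> lgr (Lie T') j"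
  and push_lsd: "push ` lsd (Lie T) p \<subseteq> lsd (Lie T') p"
proof -
  show "push ` lgr (Lie T) j \<subseteq> lgr (Lie T') j"
  proof (rule image_subsetI)
    fix u assume u: "u \<in> lgr (Lie T) j"
    then have "u \<in> lcar (Lie T)" using A.Lie.lgr_subset unfolding A.Lie_eq by blast
    moreover then have "push u \<in> lcar (Lie T')" by (rule push_mem)
    moreover obtain z A \<psi> where "u = (z, A, \<psi>)" by (cases u) auto
    ultimately show "push u \<in> lgr (Lie T') j"
      using u push1_0 push2_0 unfolding A.Lie_eq B.Lie_eq
      by (auto simp: push_def A.Lie.lgr_iff B.Lie.lgr_iff B.Lie.lcar_G)
  qed
  show "push ` lsd (Lie T) p \<subseteq> lsd (Lie T') p"
  proof (rule image_subsetI)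
    fix u assume u: "u \<in> lsd (Lie T) p"
    then have "u \<in> lcar (Lie T)" using A.Lie.lsd_subspace unfolding A.Lie_eq by blast
    moreover then have "push u \<in> lcar (Lie T')" by (rule push_mem)
    moreover obtain z A \<psi> where "u = (z, A, \<psi>)" by (cases u) auto
    ultimately show "push u \<in> lsd (Lie T') p"
      using u push1_0 push2_0 unfolding A.Lie_eq B.Lie_eq
      by (cases p) (auto simp: push_def A.Lie.lsd_G B.Lie.lsd_G B.Lie.lcar_G)
  qed
qed

theorem iso_pair_Lie: "iso_pair (Lie T) (lie_sigma T) (Lie T') (lie_sigma T')"
proof -
  interpret I: alg3_iso T' T f' by (rule inverse_iso)
  have ff: "inv_into (tcar T') f' v = f v" if "v \<in> tcar T" for v
    using I.f'_f[of "f v"] that by simp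
  have inv_push: "push (I.push u) = u" if u: "u \<in> lcar (Lie T')" for u
  proof -
    obtain z A x where u: "u = (z, A, phi T' x)" "z \<in> tcar T'" "A \<in> Lspan T'" "x \<in> tcar T'"
      using u by (rule B.Lie_cases)
    have "push1 (I.push1 A) = A"
      using B.endoD[OF B.Lie.D_endo[OF u(3)]] by (auto simp: I.push1_def push1_def fun_eq_iff ff)
    moreover have "push2 (I.push2 (phi T' x)) = phi T' x"
      using u by (simp add: push2_phi I.push2_phi)
    ultimately show ?thesis using u by (simp add: push_def I.push_def)
  qed
  have sub: "lgr (Lie T') j \<subseteq> lcar (Lie T')" "lsd (Lie T') p \<subseteq> lcar (Lie T')" for j p
    using B.Lie.lgr_subset B.Lie.lsd_subspace unfolding B.Lie_eq by blast+
  show ?thesis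
    unfolding iso_pair_def
  proof (intro exI[of _ push] conjI allI ballI)
    show "bij_betw push (lcar (Lie T)) (lcar (Lie T'))"
    proof (rule bij_betw_byWitness[where f' = I.push])
      show "\<forall>u\<in>lcar (Lie T). I.push (push u) = u" using push_inverse by blast
      show "\<forall>u\<in>lcar (Lie T'). push (I.push u) = u" using inv_push by blast
      show "push ` lcar (Lie T) \<subseteq> lcar (Lie T')" using push_mem by (rule image_subsetI)
      show "I.push ` lcar (Lie T') \<subseteq> lcar (Lie T)" using I.push_mem by (rule image_subsetI)
    qed
    show "linear_map (lcar (Lie T)) (lscl (Lie T)) (lscl (Lie T')) push" by (rule push_linear)
    show "push (lbr (Lie T) u v) = lbr (Lie T') (push u) (push v)"
      if "u \<in> lcar (Lie T)" "v \<in> lcar (Lie T)" for u v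
      using push_bracket[OF that] by (simp add: A.Lie_eq B.Lie_eq)
    show "push (lie_sigma T u) = lie_sigma T' (push u)" if "u \<in> lcar (Lie T)" for u
      using push_conj[OF that] by (simp add: A.lie_sigma_eq B.lie_sigma_eq)
    show "push ` lsd (Lie T) p = lsd (Lie T') p" for p
    proof (rule antisym[OF push_lsd subsetI])
      fix u assume u: "u \<in> lsd (Lie T') p"
      then have "u = push (I.push u)" using inv_push[OF subsetD[OF sub(2)]] by simp
      moreover have "I.push u \<in> lsd (Lie T) p" using I.push_lsd[of p] imageI[OF u, of I.push] by (rule subsetD)
      ultimately show "u \<in> push ` lsd (Lie T) p" by (rule image_eqI)
    qed
    show "push ` lgr (Lie T) j = lgr (Lie T') j" for j
    proof (rule antisym[OF push_lgr subsetI])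
      fix u assume u: "u \<in> lgr (Lie T') j"
      then have "u = push (I.push u)" using inv_push[OF subsetD[OF sub(1)]] by simp
      moreover have "I.push u \<in> lgr (Lie T) j" using I.push_lgr[of j] imageI[OF u, of I.push] by (rule subsetD)
      ultimately show "u \<in> push ` lgr (Lie T) j" by (rule image_eqI)
    qed
  qed
qed

end

text \<open>
  An isomorphism of pairs restricts to degree -1, and there it preserves the 3-bracket because
  \<open>recover_bracket\<close> expresses the latter by the superbracket and the conjugation.
\<close>

lemma iso_pair_imp_iso3:
  fixes T :: "'a::ab_group_add alg3" and T' :: "'b::ab_group_add alg3"
  assumes "zero_center_N6 T" "zero_center_N6 T'"
    and iso: "iso_pair (Lie T) (lie_sigma T) (Lie T') (lie_sigma T')"
  shows "iso3 T T'"
proof -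
  interpret A: zero_center_N6 T by fact
  interpret B: zero_center_N6 T' by fact
  from iso obtain F where F: "bij_betw F (lcar (Lie T)) (lcar (Lie T')) \<and>
      linear_map (lcar (Lie T)) (lscl (Lie T)) (lscl (Lie T')) F \<and>
      (\<forall>u\<in>lcar (Lie T). \<forall>v\<in>lcar (Lie T). F (lbr (Lie T) u v) = lbr (Lie T') (F u) (F v)) \<and>
      (\<forall>p. F ` lsd (Lie T) p = lsd (Lie T') p) \<and>
      (\<forall>j. F ` lgr (Lie T) j = lgr (Lie T') j) \<and>
      (\<forall>u\<in>lcar (Lie T). F (lie_sigma T u) = lie_sigma T' (F u))"
    unfolding iso_pair_def by (elim exE)
  note bij = F[THEN conjunct1] and lin = F[THEN conjunct2, THEN conjunct1]
    and hom = F[THEN conjunct2, THEN conjunct2, THEN conjunct1, rule_format]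
    and gr = F[THEN conjunct2, THEN conjunct2, THEN conjunct2, THEN conjunct2, THEN conjunct1, rule_format]
    and sig = F[THEN conjunct2, THEN conjunct2, THEN conjunct2, THEN conjunct2, THEN conjunct2, rule_format]
  define f where "f z = fst (F (in_m1 z))" for z
  have mem: "in_m1 z \<in> lcar (Lie T)" if "z \<in> tcar T" for z
    using A.Lie_mem[of z 0 0] A.Lie.D_0 that by (simp add: in_m1_def)
  have F: "F (in_m1 z) = in_m1 (f z)" "f z \<in> tcar T'" if "z \<in> tcar T" for z
  proof -
    have "in_m1 z \<in> lgr (Lie T) (-1)" using that unfolding A.Lie_eq A.Lie.lgr_G in_m1_def by blast
    then have "F (in_m1 z) \<in> lgr (Lie T') (-1)" using gr by blast
    then show "F (in_m1 z) = in_m1 (f z)" "f z \<in> tcar T'"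
      unfolding B.Lie_eq B.Lie.lgr_G in_m1_def f_def by auto
  qed
  have csA: "cspace (lscl (Lie T)) (lcar (Lie T))" unfolding A.Lie_eq using A.Lie.cspace_G by simp
  have "bij_betw f (tcar T) (tcar T')"
    unfolding bij_betw_def
  proof
    show "inj_on f (tcar T)"
    proof (rule inj_onI)
      fix x y assume xy: "x \<in> tcar T" "y \<in> tcar T" "f x = f y"
      then have "F (in_m1 x) = F (in_m1 y)" using F(1) by simp
      then have "in_m1 x = in_m1 y" using bij mem xy by (meson bij_betw_def inj_onD)
      then show "x = y" by (simp add: in_m1_def)
    qed
    show "f ` tcar T = tcar T'"
    proof
      show "f ` tcar T \<subseteq> tcar T'" using F(2) by blast
      show "tcar T' \<subseteq> f ` tcar T"
      proof
        fix w assume "w \<in> tcar T'"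
        then have "in_m1 w \<in> lgr (Lie T') (-1)" unfolding B.Lie_eq B.Lie.lgr_G in_m1_def by blast
        then obtain u where u: "u \<in> lgr (Lie T) (-1)" "in_m1 w = F u" unfolding gr[symmetric] by blast
        then obtain z where z: "z \<in> tcar T" "u = in_m1 z" unfolding A.Lie_eq A.Lie.lgr_G in_m1_def by blast
        have "w = f z" using u(2) unfolding z(2) f_def by (metis fst_conv in_m1_def)
        then show "w \<in> f ` tcar T" using z(1) by blast
      qed
    qed
  qed
  moreover have "linear_map (tcar T) (tscl T) (tscl T') f"
    unfolding linear_map_def
  proof (intro conjI ballI allI)
    fix x y assume xy: "x \<in> tcar T" "y \<in> tcar T"
    have "in_m1 (x + y) = in_m1 x + in_m1 y" by (simp add: in_m1_def)
    then show "f (x + y) = f x + f y"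
      using linear_mapD(1)[OF lin csA mem[OF xy(1)] mem[OF xy(2)]] by (simp add: f_def)
  next
    fix c x assume x: "x \<in> tcar T"
    have "in_m1 (tscl T c x) = lscl (Lie T) c (in_m1 x)" by (simp add: in_m1_def A.Lie_eq lie_scale_def fun_eq_iff)
    moreover have "fst (lscl (Lie T') c u) = tscl T' c (fst u)" for u
      by (cases u) (simp add: B.Lie_eq lie_scale_def)
    ultimately show "f (tscl T c x) = tscl T' c (f x)"
      using linear_mapD(2)[OF lin csA mem[OF x]] by (simp add: f_def)
  qed
  moreover have "f (tbr T x y z) = tbr T' (f x) (f y) (f z)" if x: "x \<in> tcar T" "y \<in> tcar T" "z \<in> tcar T" for x y z
  proof -
    let ?s = "lie_sigma T (in_m1 y)"
    have s: "?s \<in> lcar (Lie T)" using A.conj_mem mem[OF x(2)] by (simp add: A.lie_sigma_eq)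
    have b: "lbr (Lie T) (in_m1 x) ?s \<in> lcar (Lie T)"
      using A.Lie.bracket_closed mem[OF x(1)] s by (simp add: A.Lie_eq)
    have "F (in_m1 (tbr T x y z)) = lbr (Lie T') (lbr (Lie T') (F (in_m1 x)) (F ?s)) (F (in_m1 z))"
      unfolding A.recover_bracket[OF x] using hom b s mem x by simp
    also have "\<dots> = lbr (Lie T') (lbr (Lie T') (in_m1 (f x)) (lie_sigma T' (in_m1 (f y)))) (in_m1 (f z))"
      using F sig[OF mem[OF x(2)]] x by simp
    also have "\<dots> = in_m1 (tbr T' (f x) (f y) (f z))"
      using B.recover_bracket F(2) x by simp
    finally show ?thesis unfolding f_def in_m1_def by simp
  qed
  ultimately show ?thesis unfolding iso3_def by blast
qed

section \<open>Simplicity and finite dimension\<close>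

context zero_center_N6
begin

lemma Lop_add1: "x \<in> V \<Longrightarrow> x' \<in> V \<Longrightarrow> y \<in> V \<Longrightarrow> Lop T (x + x') y = Lop T x y + Lop T x' y"
  and Lop_scale1: "x \<in> V \<Longrightarrow> y \<in> V \<Longrightarrow> Lop T (s c x) y = (\<lambda>z. s c (Lop T x y z))"
  and Lop_add2: "x \<in> V \<Longrightarrow> y \<in> V \<Longrightarrow> y' \<in> V \<Longrightarrow> Lop T x (y + y') = Lop T x y + Lop T x y'"
  and Lop_scale2: "x \<in> V \<Longrightarrow> y \<in> V \<Longrightarrow> Lop T x (s c y) = (\<lambda>z. s (cnj c) (Lop T x y z))"
  and Lop_01: "y \<in> V \<Longrightarrow> Lop T 0 y = 0"
  and Lop_02: "x \<in> V \<Longrightarrow> Lop T x 0 = 0"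
  by (auto simp: Lop_def fun_eq_iff)

lemma scale_m1: "lie_scale s c (z, 0, 0) = (s c z, 0, 0)"
  and scale_0: "lie_scale s c (0, A, 0) = (0, \<lambda>v. s c (A v), 0)"
  and scale_1: "lie_scale s c (0, 0, \<psi>) = (0, 0, \<lambda>v w. s c (\<psi> v w))"
  by (simp_all add: lie_scale_def fun_eq_iff)

lemma degree_subspaces:
  assumes S: "vl.subspace S"
  shows "vs.subspace {z \<in> V. (z, 0, 0) \<in> S}" "vs.subspace {x \<in> V. (0, 0, phi T x) \<in> S}"
    "y \<in> V \<Longrightarrow> vs.subspace {x \<in> V. (0, Lop T x y, 0) \<in> S}"
    "x \<in> V \<Longrightarrow> vs.subspace {y \<in> V. (0, Lop T x y, 0) \<in> S}"
proof -
  have 0: "(0, 0, 0) \<in> S" using vl.subspace_0[OF S] by (simp add: zero_prod_def)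
  note a = vl.subspace_add[OF S] and c = vl.subspace_scale[OF S]
  show "vs.subspace {z \<in> V. (z, 0, 0) \<in> S}"
  proof (rule vs.subspaceI)
    show "x + y \<in> {z \<in> V. (z, 0, 0) \<in> S}" if "x \<in> {z \<in> V. (z, 0, 0) \<in> S}" "y \<in> {z \<in> V. (z, 0, 0) \<in> S}" for x y
      using a[of "(x, 0, 0)" "(y, 0, 0)"] that by simp
    show "s k x \<in> {z \<in> V. (z, 0, 0) \<in> S}" if "x \<in> {z \<in> V. (z, 0, 0) \<in> S}" for k x
      using c[of "(x, 0, 0)" k] that by (simp add: scale_m1)
  qed (use 0 in simp)
  show "vs.subspace {x \<in> V. (0, 0, phi T x) \<in> S}"
  proof (rule vs.subspaceI)
    show "x + y \<in> {x \<in> V. (0, 0, phi T x) \<in> S}"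
      if "x \<in> {x \<in> V. (0, 0, phi T x) \<in> S}" "y \<in> {x \<in> V. (0, 0, phi T x) \<in> S}" for x y
      using a[of "(0, 0, phi T x)" "(0, 0, phi T y)"] that by (simp add: phi_add)
    show "s k x \<in> {x \<in> V. (0, 0, phi T x) \<in> S}" if "x \<in> {x \<in> V. (0, 0, phi T x) \<in> S}" for k x
      using c[of "(0, 0, phi T x)" "cnj k"] that by (simp add: scale_1 phi_scale)
  qed (use 0 in simp)
  show "vs.subspace {x \<in> V. (0, Lop T x y, 0) \<in> S}" if y: "y \<in> V"
  proof (rule vs.subspaceI)
    show "u + v \<in> {x \<in> V. (0, Lop T x y, 0) \<in> S}"
      if "u \<in> {x \<in> V. (0, Lop T x y, 0) \<in> S}" "v \<in> {x \<in> V. (0, Lop T x y, 0) \<in> S}" for u v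
      using a[of "(0, Lop T u y, 0)" "(0, Lop T v y, 0)"] that y by (simp add: Lop_add1)
    show "s k u \<in> {x \<in> V. (0, Lop T x y, 0) \<in> S}" if "u \<in> {x \<in> V. (0, Lop T x y, 0) \<in> S}" for k u
      using c[of "(0, Lop T u y, 0)" k] that y by (simp add: scale_0 Lop_scale1)
  qed (use 0 y in \<open>simp add: Lop_01\<close>)
  show "vs.subspace {y \<in> V. (0, Lop T x y, 0) \<in> S}" if x: "x \<in> V"
  proof (rule vs.subspaceI)
    show "u + v \<in> {y \<in> V. (0, Lop T x y, 0) \<in> S}"
      if "u \<in> {y \<in> V. (0, Lop T x y, 0) \<in> S}" "v \<in> {y \<in> V. (0, Lop T x y, 0) \<in> S}" for u v
      using a[of "(0, Lop T x u, 0)" "(0, Lop T x v, 0)"] that x by (simp add: Lop_add2)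
    show "s k u \<in> {y \<in> V. (0, Lop T x y, 0) \<in> S}" if "u \<in> {y \<in> V. (0, Lop T x y, 0) \<in> S}" for k u
      using c[of "(0, Lop T x u, 0)" "cnj k"] that x by (simp add: scale_0 Lop_scale2)
  qed (use 0 x in \<open>simp add: Lop_02\<close>)
qed

lemma subspace_contains_Lie:
  assumes S: "vl.subspace S" and m1: "\<And>z. z \<in> V \<Longrightarrow> (z, 0, 0) \<in> S"
    and 0: "\<And>x y. x \<in> V \<Longrightarrow> y \<in> V \<Longrightarrow> (0, Lop T x y, 0) \<in> S"
    and 1: "\<And>x. x \<in> V \<Longrightarrow> (0, 0, phi T x) \<in> S"
  shows "lcar (Lie T) \<subseteq> S"
proof
  fix u assume "u \<in> lcar (Lie T)"
  then obtain z A x where u: "u = (z, A, phi T x)" "z \<in> V" "A \<in> Lspan T" "x \<in> V" by (rule Lie_cases)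
  have "(0, A, 0) \<in> S"
    using u(3)
  proof (induction rule: Lspan_induct)
    case zero
    have "(0, 0, 0) \<in> S" using vl.subspace_0[OF S] by (simp add: zero_prod_def)
    then show ?case .
  next
    case (Lop x y)
    then show ?case by (rule 0)
  next
    case (add A B)
    have "(0, A, 0) + (0, B, 0) = (0 :: 'a, A + B, 0 :: 'a \<Rightarrow> 'a \<Rightarrow> 'a)" by simp
    then show ?case using vl.subspace_add[OF S add(3,4)] by (simp only:)
  next
    case (scale c A)
    show ?case by (rule vl.subspace_scale[OF S scale(2), of c, unfolded scale_0])
  qed
  then have "(z, 0, 0) + ((0, A, 0) + (0, 0, phi T x)) \<in> S"
    by (intro vl.subspace_add[OF S] m1 1 u)
  then show "u \<in> S" by (simp add: u(1))
qed

lemma nonzero_bracket: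
  assumes "x \<in> V" "x \<noteq> 0"
  obtains a c where "a \<in> V" "c \<in> V" "br a x c \<noteq> 0"
  using br_middle_eqI[OF assms(1) V_rules(1)] assms(2) by auto

text \<open>
  The components of the ideal in degrees -1 and 1 are ideals of \<open>T\<close>.  The first is non-zero by propagation,
  so it is everything; then the brackets with degree 1 give all \<open>L\<^bsub>x,y\<^esub>\<close>, and the brackets of these with
  degree 1 make the second component non-zero, so it is everything too.
\<close>

lemma simple3_imp_ideal:
  assumes simp: "simple3 T" and id: "lsa_ideal (Lie T) I" and nz: "I \<noteq> {0}"
  shows "I = lcar (Lie T)"
proof -
  have only: "J = {0} \<or> J = V" if "ideal3 T J" for J
    by (rule simp[unfolded simple3_def, THEN conjunct2, THEN conjunct1, rule_format, OF that])
  note id' = id[unfolded lsa_ideal_def]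
  have sub: "vl.subspace I" using id'[THEN conjunct1] unfolding Lie_eq Lie.lscl_G .
  note car = id'[THEN conjunct2, THEN conjunct1]
    and par = id'[THEN conjunct2, THEN conjunct2, THEN conjunct1, rule_format]
  note st = ideal_stable[OF id]
  obtain u where u: "u \<in> I" "u \<noteq> 0" using nz vl.subspace_0[OF sub] by blast
  obtain e d where ed: "e \<in> I" "e \<in> lsd (Lie T) 0" "d \<in> I" "d \<in> lsd (Lie T) 1" "u = e + d"
    using par[OF u(1)] by blast
  have "\<exists>A\<in>Lspan T. A \<noteq> 0 \<and> (0, A, 0) \<in> I"
  proof (cases "e = 0")
    case False
    obtain A where A: "e = (0, A, 0)" "A \<in> Lspan T" using ed(2) unfolding Lie_eq Lie.lsd_G by blast
    then show ?thesis using ed(1) False by (intro bexI[of _ A]) (auto simp: zero_prod_def)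
  next
    case True
    obtain z \<psi> where d: "d = (z, 0, \<psi>)" "z \<in> V" "form \<psi>" using ed(4) unfolding Lie_eq Lie.lsd_G by blast
    obtain x where x: "x \<in> V" "\<psi> = phi T x" using d(3) by (rule formE)
    show ?thesis
    proof (cases "x = 0")
      case x0: True
      then have "(z, 0, 0) \<in> I" "z \<noteq> 0" using ed d x u(2) True by (auto simp: zero_prod_def)
      then show ?thesis using stable_m1_imp_0[OF st _ d(2)] by blast
    next
      case False
      obtain a c where ac: "a \<in> V" "c \<in> V" "br a x c \<noteq> 0" using nonzero_bracket[OF x(1) False] .
      have "lie_bracket (a, 0, 0) (z, 0, phi T x) \<in> I"
        using bracket_stableD[OF st _ ac(1) zero_mems(2,3)] ed(3) d x by simp
      moreover have "lie_bracket (a, 0, 0) (z, 0, phi T x) = (0, phi T x a, 0)"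
        unfolding Lie.lie_bracket_simp
        by (simp add: act01_def fun_eq_iff form_simps(4)[OF form_phi[OF x(1)]] endoD(3)[OF form_endo[OF form_phi[OF x(1)]]])
      moreover have "phi T x a c \<noteq> 0" using ac x(1) by simp
      then have "phi T x a \<noteq> 0" by (auto simp: fun_eq_iff)
      ultimately show ?thesis using Lie.form_apply_D[OF form_phi[OF x(1)] ac(1)] by auto
    qed
  qed
  then obtain z0 where z0: "z0 \<in> V" "z0 \<noteq> 0" "(z0, 0, 0) \<in> I" using stable_0_imp_m1[OF st] by blast
  let ?J = "{z \<in> V. (z, 0, 0) \<in> I}"
  have "ideal3 T ?J"
    unfolding ideal3_def
  proof (intro conjI ballI degree_subspaces(1) sub)
    fix x y z assume xy: "x \<in> V" "y \<in> V" and z: "z \<in> ?J"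
    have "lie_bracket (0, Lop T x y, 0) (z, 0, 0) \<in> I"
      using bracket_stableD[OF st _ zero_mems(1) Lspan_Lop[OF xy] zero_mems(3)] z by blast
    then show "br x y z \<in> ?J"
      using lie_bracket_generators(2)[OF N6 xy, of z] xy z by (simp add: in_m1_def in_0_def)
  qed blast
  then have J: "(z, 0, 0) \<in> I" if "z \<in> V" for z using only[of ?J] z0 that by blast
  have L: "(0, Lop T x y, 0) \<in> I" if xy: "x \<in> V" "y \<in> V" for x y
  proof -
    have "lie_bracket (0, 0, phi T y) (x, 0, 0) \<in> I"
      by (rule bracket_stableD[OF st J[OF xy(1)] zero_mems(1,2) form_phi[OF xy(2)]])
    then have "(0, - Lop T x y, 0) \<in> I"
      using lie_bracket_generators(3)[OF N6 xy(2,1) xy(1)] by (simp add: in_m1_def in_0_def in_1_def)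
    then show ?thesis using vl.subspace_neg[OF sub] by fastforce
  qed
  have J1: "(0, 0, phi T (br x y w)) \<in> I" if "x \<in> V" "y \<in> V" "w \<in> V" for x y w
    using stable_0_imp_1[OF st L[OF that(2,1)] Lspan_Lop[OF that(2,1)] that(3)] that by (simp add: adj_Lop)
  let ?J = "{z \<in> V. (0, 0, phi T z) \<in> I}"
  have "ideal3 T ?J"
    unfolding ideal3_def using J1 by (intro conjI ballI degree_subspaces(2) sub) auto
  moreover obtain a c where ac: "a \<in> V" "c \<in> V" "br a z0 c \<noteq> 0" using nonzero_bracket[OF z0(1,2)] .
  then have "br a z0 c \<in> ?J" using J1 z0(1) by simp
  then have "?J \<noteq> {0}" using ac(3) by blast
  ultimately have "(0, 0, phi T z) \<in> I" if "z \<in> V" for z using only[of ?J] that by blast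
  then show ?thesis using subspace_contains_Lie[OF sub J L] car by blast
qed

text \<open>
  The ideal is given by \<open>J\<close> in degree -1 and by the operators with values in \<open>J\<close> in degrees 0 and 1.
  This choice is convenient because such operators are stable under composition with arbitrary elements
  of \<open>Lie T\<close>.
\<close>

lemma ideal3_extends:
  assumes J: "ideal3 T J"
  shows "\<exists>I. lsa_ideal (Lie T) I \<and> {z. (z, 0, 0) \<in> I} = J"
proof -
  have sub: "vs.subspace J" and JV: "J \<subseteq> V" and st: "\<And>x y u. x \<in> V \<Longrightarrow> y \<in> V \<Longrightarrow> u \<in> J \<Longrightarrow> br x y u \<in> J"
    using J unfolding ideal3_def by auto
  note r = vs.subspace_0[OF sub] vs.subspace_add[OF sub] vs.subspace_diff[OF sub] vs.subspace_neg[OF sub]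
    vs.subspace_scale[OF sub]
  have AJ: "A u \<in> J" if "A \<in> Lspan T" "u \<in> J" for A u
    using that(1)
  proof (induction rule: Lspan_induct)
    case (Lop x y)
    have "u \<in> V" using that(2) JV by blast
    then show ?case using st[OF Lop that(2)] by simp
  qed (simp_all add: r)
  define I where "I = {(z, A, \<psi>) | z A \<psi>. z \<in> J \<and> A \<in> Lspan T \<and> form \<psi> \<and> (\<forall>v. A v \<in> J) \<and> (\<forall>v w. \<psi> v w \<in> J)}"
  have I_iff: "(z, A, \<psi>) \<in> I \<longleftrightarrow> z \<in> J \<and> A \<in> Lspan T \<and> form \<psi> \<and> (\<forall>v. A v \<in> J) \<and> (\<forall>v w. \<psi> v w \<in> J)" for z A \<psi>
    unfolding I_def by blast
  have "lsa_ideal (Lie T) I"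
    unfolding lsa_ideal_def
  proof (intro conjI ballI)
    have "vl.subspace I"
      by (rule vl.subspaceI)
        (use r Lie.D_0 Lie.D_add Lie.D_scale form_0 form_add form_scale in
          \<open>auto simp: I_def zero_prod_def lie_scale_def\<close>)
    then show "module.subspace (lscl (Lie T)) I" by (simp add: Lie_eq)
    show "I \<subseteq> lcar (Lie T)" using JV by (auto simp: I_def Lie_eq Lie.lcar_G)
    show "\<exists>e\<in>I \<inter> lsd (Lie T) 0. \<exists>d\<in>I \<inter> lsd (Lie T) 1. u = e + d" if "u \<in> I" for u
    proof -
      obtain z A \<psi> where u: "u = (z, A, \<psi>)" by (cases u) auto
      have "(0, A, 0) \<in> I" "(z, 0, \<psi>) \<in> I" using that r(1) Lie.D_0 form_0 unfolding u I_iff by simp_all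
      moreover have "(0, A, 0) \<in> lsd (Lie T) 0" "(z, 0, \<psi>) \<in> lsd (Lie T) 1"
        using that JV unfolding u I_iff Lie_eq Lie.lsd_G by auto
      ultimately show ?thesis using u by (intro bexI[of _ "(0, A, 0)"] bexI[of _ "(z, 0, \<psi>)"]) auto
    qed
    show "lbr (Lie T) u v \<in> I" if u: "u \<in> lcar (Lie T)" and v: "v \<in> I" for u v
    proof -
      obtain z A \<psi> where u': "u = (z, A, \<psi>)" "z \<in> V" "A \<in> Lspan T" "form \<psi>"
        using u Lie.lcar_E unfolding Lie_eq by metis
      obtain z' A' \<psi>' where v': "v = (z', A', \<psi>')" by (cases v) auto
      have v'': "z' \<in> J" "z' \<in> V" "A' \<in> Lspan T" "form \<psi>'" and A': "\<And>v. A' v \<in> J" and \<psi>': "\<And>v w. \<psi>' v w \<in> J"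
        using v JV unfolding v' I_iff by auto
      have \<psi>: "\<psi> v w \<in> J" if "w \<in> J" for v w
        by (cases "v \<in> V") (use AJ[OF Lie.form_apply_D[OF u'(4)] that] form_simps(6)[OF u'(4)] r(1) in auto)
      have \<psi>2: "\<psi> v w \<in> J" if "v \<in> J" for v w
        using \<psi>[OF that, of w] r(4) form_antisym[OF u'(4), of v w] by simp
      have "lie_bracket u v \<in> lcar (Lie T)"
        using Lie.bracket_closed u v'' unfolding Lie_eq v' by (simp add: Lie.lcar_G)
      moreover have "A z' - A' z \<in> J" using AJ[OF u'(3) v''(1)] A' r(3) by simp
      moreover have "((A \<circ> A') - (A' \<circ> A) + \<psi> z' + \<psi>' z) y \<in> J" for y
        using AJ[OF u'(3) A'] A' \<psi>2[OF v''(1)] \<psi>' r(2,3) by simp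
      moreover have "(act01 A \<psi>' - act01 A' \<psi>) y w \<in> J" for y w
        using AJ[OF u'(3) \<psi>'] \<psi>' A' \<psi>[OF A'] \<psi>2[OF A'] r(3) by (simp add: act01_def)
      ultimately show ?thesis
        unfolding u' v' Lie_eq Lie.lbr_G Lie.lie_bracket_simp I_iff Lie.lcar_G by blast
    qed
  qed
  moreover have "{z. (z, 0, 0) \<in> I} = J"
    using Lie.D_0 form_0 r(1) by (auto simp: I_iff)
  ultimately show ?thesis by blast
qed

theorem simple_iff: "simple3 T \<longleftrightarrow> simple_lsa (Lie T)"
proof
  assume simp: "simple3 T"
  then obtain x where x: "x \<in> V" "x \<noteq> 0" unfolding simple3_def using V_rules(1) by blast
  obtain a c where ac: "a \<in> V" "c \<in> V" "br a x c \<noteq> 0" using nonzero_bracket[OF x] .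
  have "lbr (Lie T) (in_0 (Lop T a x)) (in_m1 c) \<noteq> 0"
    using lie_bracket_generators(2)[OF N6 ac(1) x(1) ac(2)] ac(3)
    by (simp add: Lie_eq in_m1_def zero_prod_def)
  moreover have "in_0 (Lop T a x) \<in> lcar (Lie T)" "in_m1 c \<in> lcar (Lie T)"
    using ac x Lspan_Lop Lie.D_0 form_0 unfolding in_0_def in_m1_def Lie_eq Lie.lcar_G by auto
  ultimately show "simple_lsa (Lie T)"
    unfolding simple_lsa_def using simple3_imp_ideal[OF simp] by blast
next
  assume simp: "simple_lsa (Lie T)"
  then obtain u v where uv: "u \<in> lcar (Lie T)" "v \<in> lcar (Lie T)" "lie_bracket u v \<noteq> 0"
    unfolding simple_lsa_def Lie_eq by auto
  have nz: "V \<noteq> {0}"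
  proof
    assume V: "V = {0}"
    have "w = 0" if w: "w \<in> lcar (Lie T)" for w
    proof -
      obtain z A x where w: "w = (z, A, phi T x)" "z \<in> V" "A \<in> Lspan T" "x \<in> V" using w by (rule Lie_cases)
      then have "A = 0" using Lspan_eq_0_iff[OF w(3)] V endoD(3)[OF Lie.D_endo[OF w(3)]] by simp
      then show ?thesis using w V by (simp add: zero_prod_def)
    qed
    then show False using Lie.bracket_closed uv unfolding Lie_eq by blast
  qed
  moreover have "J = {0} \<or> J = V" if J: "ideal3 T J" for J
  proof -
    obtain I where I: "lsa_ideal (Lie T) I" "{z. (z, 0, 0) \<in> I} = J" using ideal3_extends[OF J] by blast
    have "I = {0} \<or> I = lcar (Lie T)" using simp I(1) unfolding simple_lsa_def by blast
    then show ?thesis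
      using I(2) Lie.D_0 form_0 by (auto simp: Lie_eq Lie.lcar_G zero_prod_def)
  qed
  moreover have "\<not> (\<forall>a\<in>V. \<forall>b\<in>V. \<forall>c\<in>V. br a b c = 0)"
  proof
    assume "\<forall>a\<in>V. \<forall>b\<in>V. \<forall>c\<in>V. br a b c = 0"
    then have "V \<subseteq> center3 T" unfolding center3_def by blast
    then show False using center nz V_rules(1) by blast
  qed
  ultimately show "simple3 T" unfolding simple3_def by blast
qed

text \<open>
  If a finite set spans \<open>T\<close>, then the \<open>L\<^bsub>x,y\<^esub>\<close> and \<open>\<phi>\<^sub>x\<close> with \<open>x\<close>, \<open>y\<close> in this set span degrees 0 and 1, by
  sesquilinearity.  Conversely, \<open>T\<close> is the image of \<open>Lie T\<close> under projection to degree -1.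
\<close>

theorem fin_dim_iff: "fin_dim s V \<longleftrightarrow> fin_dim (lscl (Lie T)) (lcar (Lie T))"
proof
  assume "fin_dim s V"
  then obtain B where B: "finite B" "B \<subseteq> V" "vs.span B = V" unfolding fin_dim_def by blast
  let ?S = "(\<lambda>z. (z, 0, 0)) ` B \<union> (\<lambda>(x, y). (0, Lop T x y, 0)) ` (B \<times> B) \<union> (\<lambda>x. (0, 0, phi T x)) ` B"
  have fin: "finite ?S" using B(1) by simp
  have sub: "?S \<subseteq> lcar (Lie T)"
    using Lspan_Lop[OF subsetD[OF B(2)] subsetD[OF B(2)]] Lie.D_0 form_0 form_phi subsetD[OF B(2)]
    by (auto simp: Lie_eq Lie.lcar_G)
  note sp = vl.subspace_span[of ?S]
  note deg = degree_subspaces[OF sp]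
  have ext: "V \<subseteq> W" if "vs.subspace W" "B \<subseteq> W" for W
    using vs.span_minimal[OF that(2,1)] B(3) by simp
  have m1: "(z, 0, 0) \<in> vl.span ?S" if "z \<in> V" for z
  proof -
    have "B \<subseteq> {z \<in> V. (z, 0, 0) \<in> vl.span ?S}" using B(2) by (auto intro!: vl.span_base)
    then show ?thesis using ext[OF deg(1)] that by blast
  qed
  have 1: "(0, 0, phi T x) \<in> vl.span ?S" if "x \<in> V" for x
  proof -
    have "B \<subseteq> {z \<in> V. (0, 0, phi T z) \<in> vl.span ?S}" using B(2) by (auto intro!: vl.span_base)
    then show ?thesis using ext[OF deg(2)] that by blast
  qed
  have 0: "(0, Lop T x y, 0) \<in> vl.span ?S" if xy: "x \<in> V" "y \<in> V" for x y
  proof -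
    have "B \<subseteq> {x \<in> V. (0, Lop T x b, 0) \<in> vl.span ?S}" if "b \<in> B" for b
      using B(2) that by (auto intro!: vl.span_base)
    then have "(0, Lop T x b, 0) \<in> vl.span ?S" if "b \<in> B" for b
      using ext[OF deg(3), of b] that B(2) xy(1) by blast
    then have "B \<subseteq> {y \<in> V. (0, Lop T x y, 0) \<in> vl.span ?S}" using B(2) by blast
    then show ?thesis using ext[OF deg(4)[OF xy(1)]] xy(2) by blast
  qed
  have "lcar (Lie T) \<subseteq> vl.span ?S" by (rule subspace_contains_Lie[OF sp m1 0 1])
  moreover have "vl.span ?S \<subseteq> lcar (Lie T)"
    using vl.span_minimal[OF sub] Lie.cspace_G unfolding Lie_eq cspace_def by blast
  ultimately show "fin_dim (lscl (Lie T)) (lcar (Lie T))"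
    unfolding fin_dim_def using fin sub by (intro exI[of _ ?S]) (auto simp: Lie_eq)
next
  assume "fin_dim (lscl (Lie T)) (lcar (Lie T))"
  then obtain B where B: "finite B" "B \<subseteq> lcar (Lie T)" "vl.span B = lcar (Lie T)"
    unfolding fin_dim_def by (auto simp: Lie_eq)
  have fstV: "fst u \<in> V" if "u \<in> lcar (Lie T)" for u
    using that by (rule Lie_cases) simp
  have "fst u \<in> vs.span (fst ` B)" if "u \<in> vl.span B" for u
    using that
  proof (induction rule: vl.span_induct)
    case base
    have "fst (lie_scale s c u) = s c (fst u)" for c u by (cases u) (simp add: lie_scale_def)
    then show ?case
      by (intro vl.subspaceI) (auto simp: zero_prod_def vs.span_zero intro: vs.span_add vs.span_scale)
  next
    case (step u)
    then show ?case by (intro vs.span_base) blast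
  qed
  then have "V \<subseteq> vs.span (fst ` B)"
    using Lie_mem[OF _ Lie.D_0 V_rules(1)] B(3) by fastforce
  moreover have "fst ` B \<subseteq> V" using B(2) fstV by blast
  moreover then have "vs.span (fst ` B) \<subseteq> V"
    using vs.span_minimal cspaceD(3)[OF cspace_V] by blast
  ultimately show "fin_dim s V" unfolding fin_dim_def using B(1) by (intro exI[of _ "fst ` B"]) auto
qed

end

section \<open>The 3-algebra of a Lie superalgebra with conjugation\<close>

text \<open>
  In this section \<open>m\<close>, \<open>e\<close>, \<open>p\<close> are the components of degrees -1, 0, 1 and \<open>b\<close> is the superbracket.
\<close>

locale conjugate_lsa =
  fixes g :: "'c::ab_group_add lsa" and \<sigma> :: "'c \<Rightarrow> 'c"
  assumes lsa: "lie_superalgebra g" and grd: "z_graded g" and cons: "consistent_grading g"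
    and shrt: "short_grading g" and meet: "ideals_meet_ends g" and gen: "ends_generate g"
    and conjugation: "graded_conjugation g \<sigma>"
begin

abbreviation "C \<equiv> lcar g"
abbreviation "s \<equiv> lscl g"
abbreviation "b \<equiv> lbr g"
abbreviation "m \<equiv> lgr g (-1)"
abbreviation "e \<equiv> lgr g 0"
abbreviation "p \<equiv> lgr g 1"

lemmas lsa_conj = lsa[unfolded lie_superalgebra_def]
lemmas lsa_conj5 = lsa_conj[THEN conjunct2, THEN conjunct2, THEN conjunct2, THEN conjunct2]
lemmas lsa_conj8 = lsa_conj5[THEN conjunct2, THEN conjunct2, THEN conjunct2]

lemmas cspace_C = lsa_conj[THEN conjunct1]
  and b_closed [simp] = lsa_conj5[THEN conjunct1, rule_format]
  and supersymmetry = lsa_conj8[THEN conjunct2, THEN conjunct1, rule_format]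
  and jacobi = lsa_conj8[THEN conjunct2, THEN conjunct2, rule_format]

lemma b_lin1: "y \<in> C \<Longrightarrow> linear_map C s s (\<lambda>x. b x y)"
  by (rule lsa_conj5[THEN conjunct2, THEN conjunct1, rule_format])

lemma b_lin2: "x \<in> C \<Longrightarrow> linear_map C s s (\<lambda>y. b x y)"
  by (rule lsa_conj5[THEN conjunct2, THEN conjunct2, THEN conjunct1, rule_format])

lemmas b_left [simp] = linear_mapD[OF b_lin1 cspace_C]
lemmas b_right [simp] = linear_mapD[OF b_lin2 cspace_C]

sublocale vs: vector_space s
  by (rule cspaceD(1)[OF cspace_C])

lemmas C_rules [simp] = cspaceD(4-8)[OF cspace_C]

lemmas grd_conj = grd[unfolded z_graded_def]

lemma gr_subspace: "vs.subspace (lgr g j)" and gr_subset: "lgr g j \<subseteq> C"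
  using grd_conj[THEN conjunct1] by blast+

lemma gr_C [simp]: "x \<in> m \<Longrightarrow> x \<in> C" "x \<in> e \<Longrightarrow> x \<in> C" "x \<in> p \<Longrightarrow> x \<in> C"
  using gr_subset by blast+

lemmas gr_rules [simp] = vs.subspace_0[OF gr_subspace] vs.subspace_add[OF gr_subspace]
  vs.subspace_diff[OF gr_subspace] vs.subspace_neg[OF gr_subspace] vs.subspace_scale[OF gr_subspace]

lemma gr_bracket: "x \<in> lgr g i \<Longrightarrow> y \<in> lgr g j \<Longrightarrow> b x y \<in> lgr g (i + j)"
  by (rule grd_conj[THEN conjunct2, THEN conjunct2, THEN conjunct2, rule_format])

lemma gr_outside: "j \<notin> {-1, 0, 1} \<Longrightarrow> lgr g j = {0}"
  using shrt unfolding short_grading_def by blast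

lemma b_degree [simp]:
  "A \<in> e \<Longrightarrow> x \<in> m \<Longrightarrow> b A x \<in> m" "x \<in> m \<Longrightarrow> A \<in> e \<Longrightarrow> b x A \<in> m"
  "A \<in> e \<Longrightarrow> B \<in> e \<Longrightarrow> b A B \<in> e" "x \<in> m \<Longrightarrow> w \<in> p \<Longrightarrow> b x w \<in> e" "w \<in> p \<Longrightarrow> x \<in> m \<Longrightarrow> b w x \<in> e"
  "A \<in> e \<Longrightarrow> w \<in> p \<Longrightarrow> b A w \<in> p" "w \<in> p \<Longrightarrow> A \<in> e \<Longrightarrow> b w A \<in> p"
  "x \<in> m \<Longrightarrow> y \<in> m \<Longrightarrow> b x y = 0" "w \<in> p \<Longrightarrow> v \<in> p \<Longrightarrow> b w v = 0"
  using gr_bracket[of _ 0 _ "-1"] gr_bracket[of _ "-1" _ 0] gr_bracket[of _ 0 _ 0] gr_bracket[of _ "-1" _ 1]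
    gr_bracket[of _ 1 _ "-1"] gr_bracket[of _ 0 _ 1] gr_bracket[of _ 1 _ 0] gr_bracket[of _ "-1" _ "-1"]
    gr_bracket[of _ 1 _ 1] gr_outside[of "-2"] gr_outside[of 2]
  by simp_all

lemma gr_sd: "x \<in> m \<Longrightarrow> x \<in> lsd g 1" "x \<in> e \<Longrightarrow> x \<in> lsd g 0" "x \<in> p \<Longrightarrow> x \<in> lsd g 1"
  using cons[unfolded consistent_grading_def, rule_format, of "-1"]
    cons[unfolded consistent_grading_def, rule_format, of 0]
    cons[unfolded consistent_grading_def, rule_format, of 1] by auto

lemma b_swap:
  "A \<in> e \<Longrightarrow> x \<in> m \<Longrightarrow> b x A = - b A x" "A \<in> e \<Longrightarrow> w \<in> p \<Longrightarrow> b w A = - b A w"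
  "x \<in> m \<Longrightarrow> w \<in> p \<Longrightarrow> b x w = b w x"
  using supersymmetry[of x 1 A 0] supersymmetry[of w 1 A 0] supersymmetry[of x 1 w 1]
  by (simp_all add: gr_sd psign_def)

lemma jacobi_e:
  "A \<in> e \<Longrightarrow> B \<in> e \<Longrightarrow> x \<in> C \<Longrightarrow> b (b A B) x = b A (b B x) - b B (b A x)"
  "A \<in> e \<Longrightarrow> w \<in> p \<Longrightarrow> x \<in> C \<Longrightarrow> b (b A w) x = b A (b w x) - b w (b A x)"
  "A \<in> e \<Longrightarrow> y \<in> m \<Longrightarrow> x \<in> C \<Longrightarrow> b (b A y) x = b A (b y x) - b y (b A x)"
  using jacobi[of A 0 B 0 x] jacobi[of A 0 w 1 x] jacobi[of A 0 y 1 x]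
  by (simp_all add: gr_sd psign_def)

lemma jacobi_p:
  assumes "w \<in> p" "y \<in> m" "z \<in> m"
  shows "b (b w y) z = - b (b w z) y"
  using jacobi[of w 1 y 1 z] b_swap(1)[of "b w z" y] assms
  by (simp add: gr_sd psign_def eq_neg_iff_add_eq_0)

lemma decompose:
  assumes "u \<in> C"
  obtains a A w where "a \<in> m" "A \<in> e" "w \<in> p" "u = a + A + w"
proof -
  obtain f where f: "\<forall>j. f j \<in> lgr g j" "u = (\<Sum>j | f j \<noteq> 0. f j)"
    using grd_conj[THEN conjunct2, THEN conjunct2, THEN conjunct1, rule_format, OF assms] by blast
  have "{j. f j \<noteq> 0} \<subseteq> {-1, 0, 1}" using f(1) gr_outside by blast
  then have "u = (\<Sum>j\<in>{-1, 0, 1}. f j)" unfolding f(2) by (intro sum.mono_neutral_left) auto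
  then have "u = f (-1) + f 0 + f 1" by simp
  then show ?thesis using that f(1) by blast
qed

lemma decompose_0:
  assumes u: "a \<in> m" "A \<in> e" "w \<in> p" "a + A + w = 0"
  shows "a = 0" "A = 0" "w = 0"
proof -
  define f :: "int \<Rightarrow> 'c" where "f j = (if j = -1 then a else if j = 0 then A else if j = 1 then w else 0)" for j
  have supp: "{j. f j \<noteq> 0} \<subseteq> {-1, 0, 1}" by (auto simp: f_def)
  have "(\<Sum>j | f j \<noteq> 0. f j) = (\<Sum>j\<in>{-1, 0, 1}. f j)"
    by (rule sum.mono_neutral_left) (use supp in auto)
  then have "0 = (\<Sum>j | f j \<noteq> 0. f j)" using u(4) by (simp add: f_def add.assoc)
  moreover have "\<forall>j. f j \<in> lgr g j" using u by (simp add: f_def)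
  moreover have "finite {j. f j \<noteq> 0}" using supp finite_subset by blast
  ultimately have "f = (\<lambda>_. 0)"
    using grd_conj[THEN conjunct2, THEN conjunct2, THEN conjunct1, rule_format, OF C_rules(1)]
    by (elim ex1E) (metis (mono_tags, lifting) gr_rules(1) Collect_empty_eq finite.emptyI sum.empty)
  then have "f (-1) = 0" "f 0 = 0" "f 1 = 0" by simp_all
  then show "a = 0" "A = 0" "w = 0" by (simp_all add: f_def)
qed

lemma decompose_unique:
  assumes "a \<in> m" "A \<in> e" "w \<in> p" "a' \<in> m" "A' \<in> e" "w' \<in> p" "a + A + w = a' + A' + w'"
  shows "a = a'" "A = A'" "w = w'"
proof -
  have "(a - a') + (A - A') + (w - w') = 0" using assms(7) by (simp add: algebra_simps)
  from decompose_0[OF _ _ _ this] assms show "a = a'" "A = A'" "w = w'" by simp_all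
qed

lemmas conj_conj = conjugation[unfolded graded_conjugation_def]
lemmas conj_conj3 = conj_conj[THEN conjunct2, THEN conjunct2]

lemma \<sigma>_antilinear: "antilinear_map C s s \<sigma>"
  by (rule conj_conj[THEN conjunct2, THEN conjunct1])

lemmas \<sigma>_simps [simp] = antilinear_mapD[OF \<sigma>_antilinear cspace_C]

lemma \<sigma>_b [simp]: "x \<in> C \<Longrightarrow> y \<in> C \<Longrightarrow> \<sigma> (b x y) = b (\<sigma> x) (\<sigma> y)"
  by (rule conj_conj3[THEN conjunct1, rule_format])

lemma \<sigma>_gr: "\<sigma> ` lgr g j = lgr g (- j)"
  by (rule conj_conj3[THEN conjunct2, THEN conjunct2, THEN conjunct1, rule_format])

lemma \<sigma>_mem [simp]: "x \<in> m \<Longrightarrow> \<sigma> x \<in> p" "A \<in> e \<Longrightarrow> \<sigma> A \<in> e" "w \<in> p \<Longrightarrow> \<sigma> w \<in> m"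
  using \<sigma>_gr[of "-1"] \<sigma>_gr[of 0] \<sigma>_gr[of 1] by auto

lemma \<sigma>_\<sigma> [simp]: "x \<in> m \<Longrightarrow> \<sigma> (\<sigma> x) = - x" "A \<in> e \<Longrightarrow> \<sigma> (\<sigma> A) = A" "w \<in> p \<Longrightarrow> \<sigma> (\<sigma> w) = - w"
  using conj_conj3[THEN conjunct2, THEN conjunct2, THEN conjunct2, rule_format, of x "-1"]
    conj_conj3[THEN conjunct2, THEN conjunct2, THEN conjunct2, rule_format, of A 0]
    conj_conj3[THEN conjunct2, THEN conjunct2, THEN conjunct2, rule_format, of w 1] by simp_all

lemma \<sigma>_C: "x \<in> C \<Longrightarrow> \<sigma> x \<in> C"
  using conj_conj[THEN conjunct1] by (rule bij_betw_apply)

text \<open>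
  Degrees 0 and 1 act faithfully on degree -1.  The elements acting trivially form a graded ideal with zero
  component in degree -1, so property (i) makes this ideal zero.
\<close>

lemma transitive:
  shows "A \<in> e \<Longrightarrow> (\<And>x. x \<in> m \<Longrightarrow> b A x = 0) \<Longrightarrow> A = 0"
    and "w \<in> p \<Longrightarrow> (\<And>x y. x \<in> m \<Longrightarrow> y \<in> m \<Longrightarrow> b (b w x) y = 0) \<Longrightarrow> w = 0"
proof -
  define I0 where "I0 = {A \<in> e. \<forall>x\<in>m. b A x = 0}"
  define I1 where "I1 = {w \<in> p. \<forall>x\<in>m. b w x \<in> I0}"
  define I where "I = {A + w | A w. A \<in> I0 \<and> w \<in> I1}"
  have sub0: "vs.subspace I0"
    by (rule vs.subspaceI) (auto simp: I0_def)
  note r0 = vs.subspace_0[OF sub0] vs.subspace_add[OF sub0] vs.subspace_diff[OF sub0]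
    vs.subspace_neg[OF sub0] vs.subspace_scale[OF sub0]
  have sub1: "vs.subspace I1"
    by (rule vs.subspaceI) (auto simp: I1_def r0)
  note r1 = vs.subspace_0[OF sub1] vs.subspace_add[OF sub1] vs.subspace_diff[OF sub1]
    vs.subspace_neg[OF sub1] vs.subspace_scale[OF sub1]
  have I0D: "A \<in> e" "x \<in> m \<Longrightarrow> b A x = 0" if "A \<in> I0" for A x using that unfolding I0_def by auto
  have I1D: "w \<in> p" "x \<in> m \<Longrightarrow> b w x \<in> I0" if "w \<in> I1" for w x using that unfolding I1_def by auto
  have 00: "b B A \<in> I0" if "B \<in> e" "A \<in> I0" for A B
    using that I0D[OF that(2)] unfolding I0_def by (simp add: jacobi_e)
  have 10: "b w A \<in> I1" if "w \<in> p" "A \<in> I0" for w A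
  proof -
    have "b (b A w) x \<in> I0" if x: "x \<in> m" for x
    proof -
      have "b A (b w x) = - b (b w x) A"
        using supersymmetry[of A 0 "b w x" 0] I0D(1)[OF \<open>A \<in> I0\<close>] \<open>w \<in> p\<close> x by (simp add: gr_sd psign_def)
      moreover have "b (b w x) A \<in> I0" using 00 \<open>w \<in> p\<close> \<open>A \<in> I0\<close> x by simp
      ultimately show ?thesis
        using jacobi_e(2)[OF I0D(1)[OF \<open>A \<in> I0\<close>] \<open>w \<in> p\<close>, of x] I0D(2)[OF \<open>A \<in> I0\<close> x] x \<open>w \<in> p\<close> r0 by simp
    qed
    then have "b A w \<in> I1" using that I0D(1)[OF that(2)] unfolding I1_def by simp
    then show ?thesis using b_swap(2)[OF I0D(1)[OF that(2)] that(1)] r1 by simp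
  qed
  have 01: "b A w \<in> I1" if "A \<in> e" "w \<in> I1" for A w
    unfolding I1_def
  proof (intro CollectI conjI ballI)
    show "b A w \<in> p" using that I1D by simp
    show "b (b A w) x \<in> I0" if x: "x \<in> m" for x
      using jacobi_e(2)[OF \<open>A \<in> e\<close> I1D(1)[OF \<open>w \<in> I1\<close>], of x] 00[OF \<open>A \<in> e\<close> I1D(2)[OF \<open>w \<in> I1\<close> x]]
        I1D(2)[OF \<open>w \<in> I1\<close>, of "b A x"] x \<open>A \<in> e\<close> r0 by simp
  qed
  have I_iff: "A + w \<in> I \<longleftrightarrow> A \<in> I0 \<and> w \<in> I1" if Aw: "A \<in> e" "w \<in> p" for A w
  proof
    assume "A + w \<in> I"
    then obtain A' w' where A': "A' \<in> I0" "w' \<in> I1" "A + w = A' + w'" unfolding I_def by blast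
    have "0 + A + w = 0 + A' + w'" using A'(3) by simp
    then show "A \<in> I0 \<and> w \<in> I1"
      using decompose_unique(2,3)[OF gr_rules(1) Aw gr_rules(1) I0D(1)[OF A'(1)] I1D(1)[OF A'(2)]] A' by simp
  qed (auto simp: I_def)
  have I0I: "A \<in> I" if "A \<in> I0" for A using I_iff[of A 0] I0D(1)[OF that] r1(1) that by simp
  have I1I: "w \<in> I" if "w \<in> I1" for w using I_iff[of 0 w] I1D(1)[OF that] r0(1) that by simp
  have I_add: "u + v \<in> I" if uv: "u \<in> I" "v \<in> I" for u v
  proof -
    obtain A w A' w' where "u = A + w" "A \<in> I0" "w \<in> I1" "v = A' + w'" "A' \<in> I0" "w' \<in> I1"
      using uv unfolding I_def by blast
    then have "u + v = (A + A') + (w + w')" "A + A' \<in> I0" "w + w' \<in> I1" using r0 r1 by simp_all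
    then show ?thesis unfolding I_def by blast
  qed
  have I_scale: "s c u \<in> I" if u: "u \<in> I" for c u
  proof -
    obtain A w where "u = A + w" "A \<in> I0" "w \<in> I1" using u unfolding I_def by blast
    then have "s c u = s c A + s c w" "s c A \<in> I0" "s c w \<in> I1"
      using r0 r1 by (simp_all add: vs.scale_right_distrib)
    then show ?thesis unfolding I_def by blast
  qed
  have I_sub: "vs.subspace I"
    using I0I[OF r0(1)] I_add I_scale by (intro vs.subspaceI)
  have "lsa_ideal g I"
    unfolding lsa_ideal_def
  proof (intro conjI ballI I_sub)
    show "I \<subseteq> C" using I0D(1) I1D(1) unfolding I_def by auto
    show "\<exists>d\<in>I \<inter> lsd g 0. \<exists>o'\<in>I \<inter> lsd g 1. u = d + o'" if "u \<in> I" for u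
    proof -
      obtain A w where "u = A + w" "A \<in> I0" "w \<in> I1" using \<open>u \<in> I\<close> unfolding I_def by blast
      then show ?thesis using I0I I1I I0D(1) I1D(1) gr_sd by (intro bexI[of _ A] bexI[of _ w]) auto
    qed
    show "b u v \<in> I" if u: "u \<in> C" and v: "v \<in> I" for u v
    proof -
      obtain a B x where u: "a \<in> m" "B \<in> e" "x \<in> p" "u = a + B + x" using u by (rule decompose)
      obtain A w where v: "v = A + w" "A \<in> I0" "w \<in> I1" using v unfolding I_def by blast
      note d = I0D(1)[OF v(2)] I1D(1)[OF v(3)]
      have "b a A = 0" using b_swap(1)[OF d(1) u(1)] I0D(2)[OF v(2) u(1)] by simp
      moreover have "b a w \<in> I0" using b_swap(3)[OF u(1) d(2)] I1D(2)[OF v(3) u(1)] by simp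
      moreover have "b u v = (b a A + b a w) + (b B A + b B w) + (b x A + b x w)"
        using u d v(1) by simp
      moreover have "b x w = 0" using u(3) d(2) by simp
      ultimately show ?thesis
        using I0I I1I 00[OF u(2) v(2)] 01[OF u(2) v(3)] 10[OF u(3) v(2)] by (simp add: I_add)
    qed
  qed
  moreover have "I = vs.span (\<Union>j. I \<inter> lgr g j)"
  proof
    show "I \<subseteq> vs.span (\<Union>j. I \<inter> lgr g j)"
    proof
      fix u assume "u \<in> I"
      then obtain A w where u: "u = A + w" "A \<in> I0" "w \<in> I1" unfolding I_def by blast
      have "A \<in> (\<Union>j. I \<inter> lgr g j)" "w \<in> (\<Union>j. I \<inter> lgr g j)"
        using I0I[OF u(2)] I1I[OF u(3)] I0D(1)[OF u(2)] I1D(1)[OF u(3)] by blast+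
      then show "u \<in> vs.span (\<Union>j. I \<inter> lgr g j)" unfolding u(1) by (intro vs.span_add vs.span_base)
    qed
    show "vs.span (\<Union>j. I \<inter> lgr g j) \<subseteq> I" by (rule vs.span_minimal[OF _ I_sub]) blast
  qed
  ultimately have zi: "z_graded_ideal g I" unfolding z_graded_ideal_def ..
  have "I \<inter> m = {0}"
  proof
    show "I \<inter> m \<subseteq> {0}"
    proof
      fix u assume u: "u \<in> I \<inter> m"
      then obtain A w where A: "u = A + w" "A \<in> I0" "w \<in> I1" unfolding I_def by blast
      have "u + 0 + 0 = 0 + A + w" using A(1) by simp
      then have "u = 0"
        using decompose_unique(1)[of u 0 0 0 A w] u I0D(1)[OF A(2)] I1D(1)[OF A(3)] by simp
      then show "u \<in> {0}" by simp
    qed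
  qed (use I0I[OF r0(1)] in simp)
  then have I_0: "I = {0}" using meet zi unfolding ideals_meet_ends_def by blast
  show "A = 0" if "A \<in> e" "\<And>x. x \<in> m \<Longrightarrow> b A x = 0" for A
  proof -
    have "A \<in> I" using that by (intro I0I) (simp add: I0_def)
    then show ?thesis using I_0 by simp
  qed
  show "w = 0" if "w \<in> p" "\<And>x y. x \<in> m \<Longrightarrow> y \<in> m \<Longrightarrow> b (b w x) y = 0" for w
  proof -
    have "w \<in> I" using that by (intro I1I) (simp add: I0_def I1_def)
    then show ?thesis using I_0 by simp
  qed
qed

text \<open>
  The formula of (b) turned into a definition.
\<close>

definition N :: "'c alg3" where
  "N = \<lparr>tcar = m, tscl = s, tbr = (\<lambda>x y z. b (b x (\<sigma> y)) z)\<rparr>"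

lemma N_simps [simp]: "tcar N = m" "tscl N = s" "tbr N x y z = b (b x (\<sigma> y)) z"
  by (simp_all add: N_def)

text \<open>
  Antisymmetry is the Jacobi identity for one element of degree 1 and two of degree -1 (\<open>jacobi_p\<close>).  The
  fundamental identity is the one for \<open>[a, \<sigma> b]\<close> and \<open>[[x, \<sigma> y], z]\<close>; the sign and the exchange of \<open>a\<close> and
  \<open>b\<close> in its middle term come from \<open>\<sigma> [a, \<sigma> b] = - [b, \<sigma> a]\<close>.
\<close>

lemma N_physical_N6: "physical_N6 N"
  unfolding physical_N6_def physical_alg3_def N_simps
proof (intro conjI ballI)
  show "cspace s m" using cspace_C gr_subspace by (simp add: cspace_def)
  show "b (b x (\<sigma> y)) z \<in> m" if "x \<in> m" "y \<in> m" "z \<in> m" for x y z using that by simp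
  show "linear_map m s s (\<lambda>x. b (b x (\<sigma> y)) z)" if "y \<in> m" "z \<in> m" for y z
    using that by (simp add: linear_map_def)
  show "antilinear_map m s s (\<lambda>y. b (b x (\<sigma> y)) z)" if "x \<in> m" "z \<in> m" for x z
    using that by (simp add: antilinear_map_def)
  show "linear_map m s s (\<lambda>z. b (b x (\<sigma> y)) z)" if "x \<in> m" "y \<in> m" for x y
    using that by (simp add: linear_map_def)
  show "b (b x (\<sigma> y)) z = - b (b z (\<sigma> y)) x" if "x \<in> m" "y \<in> m" "z \<in> m" for x y z
    using that jacobi_p[of "\<sigma> y" x z] b_swap(3)[of x "\<sigma> y"] b_swap(3)[of z "\<sigma> y"] by simp
  show "b (b a (\<sigma> d)) (b (b x (\<sigma> y)) z) =
      b (b (b (b a (\<sigma> d)) x) (\<sigma> y)) z - b (b x (\<sigma> (b (b d (\<sigma> a)) y))) z + b (b x (\<sigma> y)) (b (b a (\<sigma> d)) z)"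
    if "a \<in> m" "d \<in> m" "x \<in> m" "y \<in> m" "z \<in> m" for a d x y z
  proof -
    let ?A = "b a (\<sigma> d)"
    have A: "?A \<in> e" using that by simp
    have "\<sigma> (b (b d (\<sigma> a)) y) = b (b (\<sigma> d) (- a)) (\<sigma> y)" using that by simp
    also have "\<dots> = - b ?A (\<sigma> y)" using that b_swap(3)[of a "\<sigma> d"] by simp
    finally have 1: "\<sigma> (b (b d (\<sigma> a)) y) = - b ?A (\<sigma> y)" .
    have "b (b (b ?A x) (\<sigma> y)) z + b (b x (b ?A (\<sigma> y))) z = b (b ?A (b x (\<sigma> y))) z"
      using jacobi_e(3)[OF A that(3), of "\<sigma> y"] that A by simp
    moreover have "b (b ?A (b x (\<sigma> y))) z = b ?A (b (b x (\<sigma> y)) z) - b (b x (\<sigma> y)) (b ?A z)"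
      using jacobi_e(1)[OF A _ , of "b x (\<sigma> y)" z] that by simp
    ultimately show ?thesis unfolding 1 using that A by (simp add: algebra_simps)
  qed
qed

text \<open>
  A central \<open>y\<close> gives an element \<open>\<sigma> y\<close> of degree 1 that acts trivially on degree -1.
\<close>

lemma N_center: "center3 N = {0}"
proof
  show "center3 N \<subseteq> {0}"
  proof
    fix y assume "y \<in> center3 N"
    then have y: "y \<in> m" "\<And>x z. x \<in> m \<Longrightarrow> z \<in> m \<Longrightarrow> b (b x (\<sigma> y)) z = 0"
      unfolding center3_def by auto
    have "\<sigma> y = 0"
      by (rule transitive(2)) (use y b_swap(3)[of _ "\<sigma> y"] in auto)
    then have "\<sigma> (\<sigma> y) = 0" by simp
    then show "y \<in> {0}" using y(1) by simp
  qed
qed (simp add: center3_def)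

sublocale N: zero_center_N6 N
  using N_physical_N6 N_center by unfold_locales

text \<open>
  The action of degrees 0 and 1 on degree -1, by which \<open>g\<close> is represented in \<open>Lie N\<close>.  It is faithful by
  \<open>transitive\<close>, and property (ii) makes it surjective in degree 0.
\<close>

definition ad :: "'c \<Rightarrow> 'c \<Rightarrow> 'c" where
  "ad A = (\<lambda>z. if z \<in> m then b A z else 0)"

definition ad2 :: "'c \<Rightarrow> 'c \<Rightarrow> 'c \<Rightarrow> 'c" where
  "ad2 w = (\<lambda>y z. if y \<in> m \<and> z \<in> m then b (b w y) z else 0)"

lemma ad_apply [simp]: "z \<in> m \<Longrightarrow> ad A z = b A z"
  by (simp add: ad_def)

lemma ad2_phi: "w \<in> p \<Longrightarrow> ad2 w = phi N (\<sigma> w)"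
  using b_swap(3)[of _ w] by (auto simp: ad2_def phi_def fun_eq_iff)

lemma ad_Lop: "x \<in> m \<Longrightarrow> y \<in> m \<Longrightarrow> ad (b x (\<sigma> y)) = Lop N x y"
  by (simp add: ad_def Lop_def fun_eq_iff)

lemma ad_add: "A \<in> e \<Longrightarrow> B \<in> e \<Longrightarrow> ad (A + B) = ad A + ad B"
  and ad_scale: "A \<in> e \<Longrightarrow> ad (s c A) = (\<lambda>z. s c (ad A z))"
  and ad_0: "ad 0 = 0"
  by (simp_all add: ad_def fun_eq_iff)

text \<open>
  Property (ii) together with \<open>\<sigma> m = p\<close> says that degree 0 is spanned by the \<open>[x, \<sigma> y]\<close>, and these act as
  \<open>L\<^bsub>x,y\<^esub>\<close>.
\<close>

lemma ad_Lspan_iff: "B \<in> Lspan N \<longleftrightarrow> (\<exists>A\<in>e. B = ad A)"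
proof
  assume "B \<in> Lspan N"
  then show "\<exists>A\<in>e. B = ad A"
  proof (induction rule: N.Lspan_induct)
    case zero
    have "\<exists>A\<in>e. 0 = ad A" using ad_0 by (intro bexI[of _ 0]) simp_all
    then show ?case .
  next
    case (Lop x y)
    then show ?case using ad_Lop by (intro bexI[of _ "b x (\<sigma> y)"]) simp_all
  next
    case (add A B)
    then obtain A' B' where "A' \<in> e" "A = ad A'" "B' \<in> e" "B = ad B'" by blast
    then have "A + B = ad (A' + B')" "A' + B' \<in> e" using ad_add by simp_all
    then have "\<exists>D\<in>e. A + B = ad D" by blast
    then show ?case .
  next
    case (scale c A)
    then obtain A' where "A' \<in> e" "A = ad A'" by blast
    then show ?case using ad_scale by (intro bexI[of _ "s c A'"]) simp_all
  qed
next
  let ?S = "{x. x \<in> e \<and> ad x \<in> Lspan N}"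
  have sub: "vs.subspace ?S"
    using N.Lie.D_0 N.Lie.D_add N.Lie.D_scale
    by (intro vs.subspaceI) (auto simp: ad_0 ad_add ad_scale)
  have "{b x y | x y. x \<in> m \<and> y \<in> p} \<subseteq> ?S"
  proof
    fix u assume "u \<in> {b x y | x y. x \<in> m \<and> y \<in> p}"
    then obtain x y where xy: "x \<in> m" "y \<in> p" "u = b x y" by blast
    then have "u = b x (\<sigma> (- \<sigma> y))" by simp
    then have "ad u = Lop N x (- \<sigma> y)" using ad_Lop[of x "- \<sigma> y"] xy by simp
    then show "u \<in> ?S" using xy N.Lspan_Lop[of x "- \<sigma> y"] by simp
  qed
  then have "e \<subseteq> ?S"
    using vs.span_minimal[OF _ sub] gen unfolding ends_generate_def by blast
  then show "\<exists>A\<in>e. B = ad A \<Longrightarrow> B \<in> Lspan N" by blast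
qed

definition dec :: "'c \<Rightarrow> 'c \<times> 'c \<times> 'c" where
  "dec u = (SOME (a, A, w). a \<in> m \<and> A \<in> e \<and> w \<in> p \<and> u = a + A + w)"

lemma dec_eq: 
  assumes "a \<in> m" "A \<in> e" "w \<in> p"
  shows "dec (a + A + w) = (a, A, w)"
  unfolding dec_def
proof (rule some_equality)
  fix t assume t: "case t of (a', A', w') \<Rightarrow> a' \<in> m \<and> A' \<in> e \<and> w' \<in> p \<and> a + A + w = a' + A' + w'"
  obtain a' A' w' where t': "t = (a', A', w')" by (cases t) auto
  show "t = (a, A, w)"
    using decompose_unique[of a A w a' A' w'] t assms unfolding t' by auto
qed (use assms in simp)

definition rep :: "'c \<Rightarrow> 'c lie_elem" where
  "rep u = (case dec u of (a, A, w) \<Rightarrow> (a, ad A, ad2 w))"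

lemma rep_eq: "a \<in> m \<Longrightarrow> A \<in> e \<Longrightarrow> w \<in> p \<Longrightarrow> rep (a + A + w) = (a, ad A, phi N (\<sigma> w))"
  unfolding rep_def by (simp add: dec_eq ad2_phi)

lemma rep_inj: "inj_on rep C"
proof (rule inj_onI)
  fix u v assume uv: "u \<in> C" "v \<in> C" "rep u = rep v"
  obtain a A w where u: "a \<in> m" "A \<in> e" "w \<in> p" "u = a + A + w" using uv(1) by (rule decompose)
  obtain a' A' w' where v: "a' \<in> m" "A' \<in> e" "w' \<in> p" "v = a' + A' + w'" using uv(2) by (rule decompose)
  have eq: "a = a'" "ad A = ad A'" "phi N (\<sigma> w) = phi N (\<sigma> w')"
    using uv(3) unfolding u(4) v(4) rep_eq[OF u(1-3)] rep_eq[OF v(1-3)] by auto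
  have "A - A' = 0"
  proof (rule transitive(1))
    show "A - A' \<in> e" using u v by simp
    fix x assume x: "x \<in> m"
    have "ad A x = ad A' x" using eq(2) by simp
    then show "b (A - A') x = 0" using u(2) v(2) x by simp
  qed
  moreover have "\<sigma> w = \<sigma> w'" using N.phi_inj eq(3) u v by (simp add: inj_on_def)
  then have "\<sigma> (\<sigma> w) = \<sigma> (\<sigma> w')" by simp
  then have "w = w'" using u(3) v(3) by simp
  ultimately show "u = v" using u v eq(1) by simp
qed

lemma rep_linear: "linear_map C s (lscl (Lie N)) rep"
  unfolding linear_map_def
proof (intro conjI ballI allI)
  fix u v assume uv: "u \<in> C" "v \<in> C"
  obtain a A w where u: "a \<in> m" "A \<in> e" "w \<in> p" "u = a + A + w" using uv(1) by (rule decompose)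
  obtain a' A' w' where v: "a' \<in> m" "A' \<in> e" "w' \<in> p" "v = a' + A' + w'" using uv(2) by (rule decompose)
  have eq: "u + v = (a + a') + (A + A') + (w + w')" using u(4) v(4) by (simp add: algebra_simps)
  have "rep (u + v) = (a + a', ad (A + A'), phi N (\<sigma> (w + w')))"
    unfolding eq by (rule rep_eq) (use u(1-3) v(1-3) in simp_all)
  then have 1: "rep (u + v) = (a + a', ad A + ad A', phi N (\<sigma> w) + phi N (\<sigma> w'))"
    using u(1-3) v(1-3) N.phi_add[of "\<sigma> w" "\<sigma> w'"] by (simp add: ad_add)
  show "rep (u + v) = rep u + rep v"
    unfolding 1 unfolding u(4) v(4) rep_eq[OF u(1-3)] rep_eq[OF v(1-3)] by simp
next
  fix c u assume u: "u \<in> C"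
  obtain a A w where u: "a \<in> m" "A \<in> e" "w \<in> p" "u = a + A + w" using u by (rule decompose)
  have eq: "s c u = s c a + s c A + s c w" using u(4) by (simp add: vs.scale_right_distrib)
  have "rep (s c u) = (s c a, ad (s c A), phi N (\<sigma> (s c w)))"
    unfolding eq by (rule rep_eq) (use u(1-3) in simp_all)
  then have 1: "rep (s c u) = (s c a, (\<lambda>z. s c (ad A z)), (\<lambda>y z. s c (phi N (\<sigma> w) y z)))"
    using u(1-3) N.phi_scale[of "\<sigma> w" "cnj c"] by (simp add: ad_scale)
  show "rep (s c u) = lscl (Lie N) c (rep u)"
    unfolding 1 unfolding u(4) rep_eq[OF u(1-3)] by (simp add: N.Lie_eq lie_scale_def)
qed

lemma rep_image: "rep ` C = lcar (Lie N)"
proof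
  show "rep ` C \<subseteq> lcar (Lie N)"
  proof (rule image_subsetI)
    fix u assume u: "u \<in> C"
    obtain a A w where u: "a \<in> m" "A \<in> e" "w \<in> p" "u = a + A + w" using u by (rule decompose)
    show "rep u \<in> lcar (Lie N)"
      unfolding u(4) rep_eq[OF u(1-3)] by (rule N.Lie_mem) (use u ad_Lspan_iff in auto)
  qed
  show "lcar (Lie N) \<subseteq> rep ` C"
  proof
    fix v assume "v \<in> lcar (Lie N)"
    then obtain z B x where v: "v = (z, B, phi N x)" "z \<in> tcar N" "B \<in> Lspan N" "x \<in> tcar N"
      by (rule N.Lie_cases)
    obtain A where A: "A \<in> e" "B = ad A" using v(3) ad_Lspan_iff by blast
    have "v = rep (z + A + - \<sigma> x)" using rep_eq[of z A "- \<sigma> x"] v A by simp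
    moreover have "z + A + - \<sigma> x \<in> C" using v A by (intro C_rules) simp_all
    ultimately show "v \<in> rep ` C" by (rule image_eqI)
  qed
qed

lemma ad_bracket:
  assumes "A \<in> e" "B \<in> e"
  shows "ad (b A B) = (ad A \<circ> ad B) - (ad B \<circ> ad A)"
  using assms by (auto simp: ad_def fun_eq_iff jacobi_e(1))

lemma act01_ad:
  assumes "A \<in> e" "w \<in> p"
  shows "act01 (ad A) (ad2 w) = ad2 (b A w)"
  using assms by (auto simp: ad_def ad2_def act01_def fun_eq_iff jacobi_e)

lemma rep_bracket:
  assumes uv: "u \<in> C" "v \<in> C"
  shows "rep (b u v) = lie_bracket (rep u) (rep v)"
proof -
  obtain a A w where u: "a \<in> m" "A \<in> e" "w \<in> p" "u = a + A + w" using uv(1) by (rule decompose)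
  obtain a' A' w' where v: "a' \<in> m" "A' \<in> e" "w' \<in> p" "v = a' + A' + w'" using uv(2) by (rule decompose)
  have "b u v = (b A a' - b A' a) + (b A A' + b w a' + b w' a) + (b A w' - b A' w)"
    using u v b_swap(1)[of A' a] b_swap(2)[of A' w] b_swap(3)[of a w'] by simp
  then have 1: "rep (b u v) = (b A a' - b A' a, ad (b A A' + b w a' + b w' a), ad2 (b A w' - b A' w))"
    using rep_eq[of "b A a' - b A' a" "b A A' + b w a' + b w' a" "b A w' - b A' w"] u(1-3) v(1-3)
      ad2_phi[of "b A w' - b A' w"] by simp
  have "ad (b w a') = ad2 w a'" if "w \<in> p" "a' \<in> m" for w a'
    using that by (simp add: ad_def ad2_def fun_eq_iff)
  then have 2: "ad (b A A' + b w a' + b w' a) = (ad A \<circ> ad A') - (ad A' \<circ> ad A) + ad2 w a' + ad2 w' a"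
    using u v by (simp add: ad_add ad_bracket)
  have "ad2 (x - y) = ad2 x - ad2 y" if "x \<in> p" "y \<in> p" for x y
    using that by (auto simp: ad2_def fun_eq_iff)
  then have 3: "ad2 (b A w' - b A' w) = act01 (ad A) (ad2 w') - act01 (ad A') (ad2 w)"
    using u v by (simp add: act01_ad)
  show ?thesis
    unfolding 1 2 3 unfolding u(4) v(4) rep_eq[OF u(1-3)] rep_eq[OF v(1-3)] N.Lie.lie_bracket_simp
    using u v by (simp add: ad2_phi)
qed

lemma rep_\<sigma>:
  assumes u: "u \<in> C"
  shows "rep (\<sigma> u) = N.conj (rep u)"
proof -
  obtain a A w where u: "a \<in> m" "A \<in> e" "w \<in> p" "u = a + A + w" using u by (rule decompose)
  have eq: "\<sigma> u = \<sigma> w + \<sigma> A + \<sigma> a" using u by (simp add: algebra_simps)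
  have 1: "rep (\<sigma> u) = (\<sigma> w, ad (\<sigma> A), phi N (- a))"
    unfolding eq using rep_eq[of "\<sigma> w" "\<sigma> A" "\<sigma> a"] u(1-3) by simp
  have "N.adj (ad A) = ad (- \<sigma> A)"
  proof (rule N.adj_eqI)
    show "N.adjoint_pair (ad A) (ad (- \<sigma> A))"
      unfolding N.adjoint_pair_def N_simps
    proof (intro conjI ballI)
      show "ad (- \<sigma> A) y \<in> m" if "y \<in> m" for y using that u(2) by simp
      fix x y z assume m: "x \<in> m" "y \<in> m" "z \<in> m"
      have "b (b (b A x) (\<sigma> y)) z + b (b x (b A (\<sigma> y))) z = b (b A (b x (\<sigma> y))) z"
        using jacobi_e(3)[OF u(2) m(1), of "\<sigma> y"] m u(2) by simp
      moreover have "b (b A (b x (\<sigma> y))) z = b A (b (b x (\<sigma> y)) z) - b (b x (\<sigma> y)) (b A z)"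
        using jacobi_e(1)[OF u(2) _ , of "b x (\<sigma> y)" z] m by simp
      ultimately show "ad A (b (b x (\<sigma> y)) z) =
          b (b (ad A x) (\<sigma> y)) z - b (b x (\<sigma> (ad (- \<sigma> A) y))) z + b (b x (\<sigma> y)) (ad A z)"
        using m u(2) by (simp add: algebra_simps)
    qed
  qed (simp add: ad_def)
  moreover have "- ad (- \<sigma> A) = ad (\<sigma> A)" using u(2) by (simp add: ad_def fun_eq_iff)
  moreover have "ad A \<in> Lspan N" using ad_Lspan_iff u(2) by blast
  ultimately show ?thesis
    unfolding 1 unfolding u(4) rep_eq[OF u(1-3)]
    using N.conj_simp[of a "ad A" "\<sigma> w"] u N.phi_uminus[of a] by simp
qed

lemma rep_gr: "rep ` lgr g j = lgr (Lie N) j"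
proof -
  have key: "rep u \<in> lgr (Lie N) j \<longleftrightarrow> u \<in> lgr g j" if uC: "u \<in> C" for u
  proof -
    obtain a A w where u: "a \<in> m" "A \<in> e" "w \<in> p" "u = a + A + w" using uC by (rule decompose)
    have "ad A = 0 \<longleftrightarrow> A = 0"
    proof
      assume 0: "ad A = 0"
      have "b A x = 0" if "x \<in> m" for x using fun_cong[OF 0, of x] that by simp
      then show "A = 0" using transitive(1) u(2) by blast
    qed (simp add: ad_0)
    moreover have "phi N (\<sigma> w) = 0 \<longleftrightarrow> w = 0"
    proof
      assume "phi N (\<sigma> w) = 0"
      then have "\<sigma> w = 0" using N.phi_eq_0_iff[of "\<sigma> w"] u(3) by simp
      then have "\<sigma> (\<sigma> w) = 0" by simp
      then show "w = 0" using u(3) by simp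
    qed simp
    moreover have "ad A \<in> Lspan N" "N.form (phi N (\<sigma> w))" using ad_Lspan_iff u N.form_phi by auto
    ultimately have 1: "rep u \<in> lgr (Lie N) j \<longleftrightarrow>
        (j \<noteq> -1 \<longrightarrow> a = 0) \<and> (j \<noteq> 0 \<longrightarrow> A = 0) \<and> (j \<noteq> 1 \<longrightarrow> w = 0)"
      unfolding u(4) rep_eq[OF u(1-3)] unfolding N.Lie_eq N.Lie.lgr_iff using u(1) by simp
    have deg: "a + A + w \<in> m \<longleftrightarrow> A = 0 \<and> w = 0" "a + A + w \<in> e \<longleftrightarrow> a = 0 \<and> w = 0"
      "a + A + w \<in> p \<longleftrightarrow> a = 0 \<and> A = 0"
    proof -
      show "a + A + w \<in> m \<longleftrightarrow> A = 0 \<and> w = 0"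
        using decompose_unique(2,3)[OF u(1-3), of "a + A + w" 0 0] u(1) by auto
      show "a + A + w \<in> e \<longleftrightarrow> a = 0 \<and> w = 0"
        using decompose_unique(1,3)[OF u(1-3), of 0 "a + A + w" 0] u(2) by auto
      show "a + A + w \<in> p \<longleftrightarrow> a = 0 \<and> A = 0"
        using decompose_unique(1,2)[OF u(1-3), of 0 0 "a + A + w"] u(3) by auto
    qed
    consider "j = -1" | "j = 0" | "j = 1" | "j \<notin> {-1, 0, 1}" by auto
    then have "u \<in> lgr g j \<longleftrightarrow> (j \<noteq> -1 \<longrightarrow> a = 0) \<and> (j \<noteq> 0 \<longrightarrow> A = 0) \<and> (j \<noteq> 1 \<longrightarrow> w = 0)"
    proof cases
      case 4
      have "a + A + w = 0 \<longleftrightarrow> a = 0 \<and> A = 0 \<and> w = 0" using decompose_0[OF u(1-3)] by auto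
      then show ?thesis unfolding u(4) gr_outside[OF 4] using 4 by simp
    qed (simp_all only: u(4) deg, simp_all)
    then show ?thesis using 1 by simp
  qed
  show ?thesis
  proof
    show "rep ` lgr g j \<subseteq> lgr (Lie N) j"
      using key[OF subsetD[OF gr_subset]] by (intro image_subsetI) simp
    show "lgr (Lie N) j \<subseteq> rep ` lgr g j"
    proof
      fix v assume v: "v \<in> lgr (Lie N) j"
      then have "v \<in> lcar (Lie N)" using N.Lie.lgr_subset[of j] unfolding N.Lie_eq by (rule subsetD[rotated])
      then obtain u where u: "u \<in> C" "v = rep u" unfolding rep_image[symmetric] by (elim imageE)
      then have "u \<in> lgr g j" using v key by simp
      then show "v \<in> rep ` lgr g j" using u(2) by (rule image_eqI[rotated])
    qed
  qed
qed

text \<open>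
  A consistent grading determines the parity decomposition.
\<close>

lemma sd_eq: "lsd g 0 = e" "lsd g 1 = {a + w | a w. a \<in> m \<and> w \<in> p}"
proof -
  note sd = lsa_conj[THEN conjunct2, THEN conjunct1, rule_format]
  have sub: "vs.subspace (lsd g q)" "lsd g q \<subseteq> C" for q using sd by blast+
  have int: "u = 0" if "u \<in> lsd g 0" "u \<in> lsd g 1" for u
    using lsa_conj[THEN conjunct2, THEN conjunct2, THEN conjunct1] that by blast
  note d = vs.subspace_diff[OF sub(1)] vs.subspace_add[OF sub(1)]
  show "lsd g 0 = e"
  proof
    show "lsd g 0 \<subseteq> e"
    proof
      fix u assume u: "u \<in> lsd g 0"
      then have "u \<in> C" using sub(2) by blast
      then obtain a A w where A: "a \<in> m" "A \<in> e" "w \<in> p" "u = a + A + w" by (rule decompose)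
      have "u - A = 0"
      proof (rule int)
        show "u - A \<in> lsd g 0" using d(1) u gr_sd(2)[OF A(2)] by blast
        have "u - A = a + w" using A by simp
        then show "u - A \<in> lsd g 1" using d(2) gr_sd(1)[OF A(1)] gr_sd(3)[OF A(3)] by simp
      qed
      then show "u \<in> e" using A(2) by simp
    qed
    show "e \<subseteq> lsd g 0" using gr_sd(2) by blast
  qed
  show "lsd g 1 = {a + w | a w. a \<in> m \<and> w \<in> p}"
  proof
    show "lsd g 1 \<subseteq> {a + w | a w. a \<in> m \<and> w \<in> p}"
    proof
      fix u assume u: "u \<in> lsd g 1"
      then have "u \<in> C" using sub(2) by blast
      then obtain a A w where A: "a \<in> m" "A \<in> e" "w \<in> p" "u = a + A + w" by (rule decompose)
      have "A = u - (a + w)" using A by simp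
      then have "A \<in> lsd g 1" using d u gr_sd(1)[OF A(1)] gr_sd(3)[OF A(3)] by simp
      then have "A = 0" using int gr_sd(2)[OF A(2)] by blast
      then show "u \<in> {a + w | a w. a \<in> m \<and> w \<in> p}" using A by auto
    qed
    show "{a + w | a w. a \<in> m \<and> w \<in> p} \<subseteq> lsd g 1" using d(2) gr_sd(1,3) by blast
  qed
qed

lemma rep_sd: "rep ` lsd g q = lsd (Lie N) q"
proof (cases q)
  case zero
  have "lsd (Lie N) 0 = lgr (Lie N) 0" unfolding N.Lie_eq N.Lie.lsd_G N.Lie.lgr_G ..
  then show ?thesis using rep_gr[of 0] zero by (simp add: sd_eq)
next
  case one
  have add: "rep (a + w) = rep a + rep w" if "a \<in> m" "w \<in> p" for a w
    using linear_mapD(1)[OF rep_linear cspace_C, of a w] that by simp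
  have "lsd (Lie N) 1 = {a + w | a w. a \<in> lgr (Lie N) (-1) \<and> w \<in> lgr (Lie N) 1}"
    unfolding N.Lie_eq N.Lie.lsd_G N.Lie.lgr_G by force
  also have "\<dots> = {rep a + rep w | a w. a \<in> m \<and> w \<in> p}"
    unfolding rep_gr[symmetric] by blast
  also have "\<dots> = rep ` lsd g 1"
    unfolding sd_eq(2) using add by (auto simp: image_iff) (metis add)+
  finally show ?thesis using one by simp
qed

theorem iso_pair_rep: "iso_pair g \<sigma> (Lie N) (lie_sigma N)"
  unfolding iso_pair_def
proof (intro exI[of _ rep] conjI ballI allI)
  show "bij_betw rep C (lcar (Lie N))" using rep_inj rep_image by (simp add: bij_betw_def)
  show "rep (b u v) = lbr (Lie N) (rep u) (rep v)" if "u \<in> C" "v \<in> C" for u v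
    using rep_bracket[OF that] by (simp add: N.Lie_eq)
  show "rep (\<sigma> u) = lie_sigma N (rep u)" if "u \<in> C" for u
    using rep_\<sigma>[OF that] by (simp add: N.lie_sigma_eq)
qed (rule rep_linear rep_sd rep_gr)+

end

lemma iso_pair_sym:
  assumes iso: "iso_pair g \<sigma> g' \<sigma>'"
    and g: "cspace (lscl g) (lcar g)" "\<And>x y. x \<in> lcar g \<Longrightarrow> y \<in> lcar g \<Longrightarrow> lbr g x y \<in> lcar g"
      "\<And>x. x \<in> lcar g \<Longrightarrow> \<sigma> x \<in> lcar g" "\<And>p. lsd g p \<subseteq> lcar g" "\<And>j. lgr g j \<subseteq> lcar g"
  shows "iso_pair g' \<sigma>' g \<sigma>"
proof -
  from iso obtain F where F: "bij_betw F (lcar g) (lcar g') \<and>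
      linear_map (lcar g) (lscl g) (lscl g') F \<and>
      (\<forall>u\<in>lcar g. \<forall>v\<in>lcar g. F (lbr g u v) = lbr g' (F u) (F v)) \<and>
      (\<forall>p. F ` lsd g p = lsd g' p) \<and>
      (\<forall>j. F ` lgr g j = lgr g' j) \<and>
      (\<forall>u\<in>lcar g. F (\<sigma> u) = \<sigma>' (F u))"
    unfolding iso_pair_def by (elim exE)
  note bij = F[THEN conjunct1] and lin = F[THEN conjunct2, THEN conjunct1]
    and hom = F[THEN conjunct2, THEN conjunct2, THEN conjunct1, rule_format]
    and sd = F[THEN conjunct2, THEN conjunct2, THEN conjunct2, THEN conjunct1, rule_format]
    and gr = F[THEN conjunct2, THEN conjunct2, THEN conjunct2, THEN conjunct2, THEN conjunct1, rule_format]
    and sig = F[THEN conjunct2, THEN conjunct2, THEN conjunct2, THEN conjunct2, THEN conjunct2, rule_format]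
  let ?H = "inv_into (lcar g) F"
  have inj: "inj_on F (lcar g)" and im: "F ` lcar g = lcar g'" using bij by (auto simp: bij_betw_def)
  have HF: "?H (F u) = u" if "u \<in> lcar g" for u using inj that by (rule inv_into_f_f)
  have FH: "\<exists>u\<in>lcar g. x = F u" if "x \<in> lcar g'" for x using that unfolding im[symmetric] by blast
  have Him: "?H ` F ` S = S" if "S \<subseteq> lcar g" for S using inv_into_image_cancel[OF inj that] .
  note c = cspaceD[OF g(1)] and l = linear_mapD[OF lin g(1)]
  show ?thesis
    unfolding iso_pair_def
  proof (intro exI[of _ ?H] conjI ballI allI)
    show "bij_betw ?H (lcar g') (lcar g)" by (rule bij_betw_inv_into[OF bij])
    show "linear_map (lcar g') (lscl g') (lscl g) ?H"
      unfolding linear_map_def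
    proof (intro conjI ballI allI)
      fix x y assume "x \<in> lcar g'" "y \<in> lcar g'"
      then obtain u v where u: "u \<in> lcar g" "x = F u" "v \<in> lcar g" "y = F v" using FH by meson
      show "?H (x + y) = ?H x + ?H y"
        unfolding u(2,4) l(1)[OF u(1,3), symmetric] by (simp add: HF u c(6))
    next
      fix c x assume "x \<in> lcar g'"
      then obtain u where u: "u \<in> lcar g" "x = F u" using FH by meson
      show "?H (lscl g' c x) = lscl g c (?H x)"
        unfolding u(2) l(2)[OF u(1), symmetric] by (simp add: HF u cspaceD(5)[OF g(1)])
    qed
    fix x y assume "x \<in> lcar g'" "y \<in> lcar g'"
    then obtain u v where u: "u \<in> lcar g" "x = F u" "v \<in> lcar g" "y = F v" using FH by meson
    show "?H (lbr g' x y) = lbr g (?H x) (?H y)"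
      unfolding u(2,4) hom[OF u(1,3), symmetric] by (simp add: HF u g(2))
  next
    show "?H ` lsd g' p = lsd g p" for p unfolding sd[symmetric] by (rule Him[OF g(4)])
    show "?H ` lgr g' j = lgr g j" for j unfolding gr[symmetric] by (rule Him[OF g(5)])
    fix x assume "x \<in> lcar g'"
    then obtain u where u: "u \<in> lcar g" "x = F u" using FH by meson
    show "?H (\<sigma>' x) = \<sigma> (?H x)"
      unfolding u(2) sig[OF u(1), symmetric] by (simp add: HF u g(3))
  qed
qed

theorem every_pair_is_Lie:
  fixes g :: "'c::ab_group_add lsa"
  assumes "conjugate_lsa g \<sigma>"
  shows "\<exists>T' :: 'c alg3. physical_N6 T' \<and> center3 T' = {0} \<and> iso_pair (Lie T') (lie_sigma T') g \<sigma>"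
proof -
  interpret conjugate_lsa g \<sigma> by fact
  have "iso_pair (Lie N) (lie_sigma N) g \<sigma>"
    by (rule iso_pair_sym[OF iso_pair_rep cspace_C b_closed \<sigma>_C _ gr_subset])
      (use lsa_conj[THEN conjunct2, THEN conjunct1] in blast)+
  then show ?thesis using N_physical_N6 N_center by blast
qed

section \<open>Linear compactness passes from the Lie superalgebra to the 3-algebra\<close>

context zero_center_N6
begin

text \<open>
  The topology of the Lie superalgebra is that of a product in which operators converge pointwise, so
  continuity can be tested on components.
\<close>

lemma lie_topology_continuous:
  assumes top: "topspace \<tau> = V"
    and G: "G \<subseteq> {(z, A, \<psi>). z \<in> V \<and> (\<forall>v\<in>V. A v \<in> V) \<and> form \<psi>}"
  shows "topspace (lie_topology T \<tau> G) = G"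
    "continuous_map X (lie_topology T \<tau> G) h \<longleftrightarrow> h \<in> topspace X \<rightarrow> G \<and>
       continuous_map X \<tau> (\<lambda>q. fst (h q)) \<and> (\<forall>v\<in>V. continuous_map X \<tau> (\<lambda>q. fst (snd (h q)) v)) \<and>
       continuous_map X \<tau> (\<lambda>q. unphi (snd (snd (h q))))"
proof -
  let ?P = "prod_topology \<tau> (prod_topology (product_topology (\<lambda>_. \<tau>) V) \<tau>)"
  let ?k = "\<lambda>u :: 'a lie_elem. (fst u, restrict (fst (snd u)) V, unphi (snd (snd u)))"
  have k: "(\<lambda>(z, A, \<psi>). (z, restrict A (tcar T), inv_into (tcar T) (phi T) \<psi>)) = ?k"
    by (auto simp: fun_eq_iff unphi_def)
  have kG: "?k u \<in> topspace ?P" if "u \<in> G" for u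
  proof -
    obtain z A \<psi> where u: "u = (z, A, \<psi>)" by (cases u) auto
    have "z \<in> V" "\<forall>v\<in>V. A v \<in> V" "form \<psi>" using G that unfolding u by auto
    then show ?thesis using top unphi_closed unfolding u form_iff by auto
  qed
  then have kG: "G \<subseteq> ?k -` topspace ?P" by blast
  have lt: "lie_topology T \<tau> G = pullback_topology G ?k ?P"
    unfolding lie_topology_def k ..
  show "topspace (lie_topology T \<tau> G) = G"
    unfolding lt topspace_pullback_topology using kG by blast
  then have top': "topspace (pullback_topology G ?k ?P) = G" using lt by simp
  have "continuous_map X (lie_topology T \<tau> G) h \<longleftrightarrow> h \<in> topspace X \<rightarrow> G \<and> continuous_map X ?P (?k \<circ> h)"
  proof
    assume c: "continuous_map X (lie_topology T \<tau> G) h"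
    have "continuous_map (pullback_topology G ?k ?P) ?P (id \<circ> ?k)"
      by (rule continuous_map_pullback) (rule continuous_map_id)
    then have "continuous_map X ?P (?k \<circ> h)" using continuous_map_compose[OF c[unfolded lt]] by (simp only: id_comp)
    moreover have "h \<in> topspace X \<rightarrow> G" using continuous_map_funspace[OF c] lt top' by simp
    ultimately show "h \<in> topspace X \<rightarrow> G \<and> continuous_map X ?P (?k \<circ> h)" by simp
  next
    assume "h \<in> topspace X \<rightarrow> G \<and> continuous_map X ?P (?k \<circ> h)"
    then show "continuous_map X (lie_topology T \<tau> G) h"
      unfolding lt by (intro continuous_map_pullback') auto
  qed
  also have "continuous_map X ?P (?k \<circ> h) \<longleftrightarrow> continuous_map X \<tau> (\<lambda>q. fst (h q)) \<and>
      continuous_map X (product_topology (\<lambda>_. \<tau>) V) (\<lambda>q. restrict (fst (snd (h q))) V) \<and>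
      continuous_map X \<tau> (\<lambda>q. unphi (snd (snd (h q))))"
    by (simp add: continuous_map_pairwise o_def)
  also have "continuous_map X (product_topology (\<lambda>_. \<tau>) V) (\<lambda>q. restrict (fst (snd (h q))) V) \<longleftrightarrow>
      (\<forall>v\<in>V. continuous_map X \<tau> (\<lambda>q. fst (snd (h q)) v))"
    unfolding continuous_map_componentwise by (auto intro: continuous_map_eq)
  finally show "continuous_map X (lie_topology T \<tau> G) h \<longleftrightarrow> h \<in> topspace X \<rightarrow> G \<and>
       continuous_map X \<tau> (\<lambda>q. fst (h q)) \<and> (\<forall>v\<in>V. continuous_map X \<tau> (\<lambda>q. fst (snd (h q)) v)) \<and>
       continuous_map X \<tau> (\<lambda>q. unphi (snd (snd (h q))))" .
qed

text \<open>
  \<open>T\<close> is a continuous linear retract of the Lie superalgebra, by the inclusion and the projection of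
  degree -1.  The 3-bracket is \<open>[x,y,z] = -[z,y,x] = [[z, \<phi>\<^sub>y], x]\<close>, a composition of continuous maps.
\<close>

theorem lin_compact_descends:
  assumes top: "topspace \<tau> = V" and D: "\<And>A v. A \<in> D \<Longrightarrow> v \<in> V \<Longrightarrow> A v \<in> V"
    and lc: "lin_compact_lsa (lie_with T D) (lie_topology T \<tau> (lcar (lie_with T D)))"
  shows "lin_compact_alg3 T \<tau>"
proof -
  let ?g = "lie_with T D"
  let ?G = "lcar ?g"
  let ?\<sigma> = "lie_topology T \<tau> ?G"
  have G: "(z, A, \<psi>) \<in> ?G \<longleftrightarrow> z \<in> V \<and> A \<in> D \<and> form \<psi>" for z A \<psi>
    by (simp add: lie_with_def form_iff)
  have G': "?G \<subseteq> {(z, A, \<psi>). z \<in> V \<and> (\<forall>v\<in>V. A v \<in> V) \<and> form \<psi>}"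
    using G D by auto
  note cont = lie_topology_continuous[OF top G']
  have lsa: "lie_superalgebra ?g" and lcG: "lin_compact (lie_scale s) ?G ?\<sigma>"
    and brc: "continuous_map (prod_topology ?\<sigma> ?\<sigma>) ?\<sigma> (\<lambda>(x, y). lie_bracket x y)"
    using lc unfolding lin_compact_lsa_def by (simp_all add: lie_with_def)
  have closed: "lie_bracket u v \<in> ?G" if "u \<in> ?G" "v \<in> ?G" for u v
    using lsa[unfolded lie_superalgebra_def, THEN conjunct2, THEN conjunct2, THEN conjunct2, THEN conjunct2,
      THEN conjunct1, rule_format, OF that] by (simp add: lie_with_def)
  have csG: "cspace (lie_scale s) ?G" using lcG unfolding lin_compact_def by blast
  then have "0 \<in> D" using cspaceD(4)[OF csG] unfolding zero_prod_def G by blast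
  then have m1: "(z, 0, 0) \<in> ?G" and p1: "(0, 0, phi T z) \<in> ?G" if "z \<in> V" for z
    using that form_0 form_phi by (simp_all add: G)
  have m1c: "continuous_map X ?\<sigma> (\<lambda>q. (f q, 0, 0))" if "continuous_map X \<tau> f" for X :: "'x topology" and f
  proof (rule cont(2)[THEN iffD2], intro conjI ballI)
    show "(\<lambda>q. (f q, 0, 0)) \<in> topspace X \<rightarrow> ?G" using continuous_map_funspace[OF that] top m1 by auto
    have "continuous_map X \<tau> (\<lambda>q. 0)" using top by simp
    then show "continuous_map X \<tau> (\<lambda>q. fst (snd (f q, 0, 0)) v)"
      "continuous_map X \<tau> (\<lambda>q. unphi (snd (snd (f q, 0, 0))))" for v
      using unphi_phi[OF V_rules(1)] by simp_all
  qed (use that in simp)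
  have p1c: "continuous_map X ?\<sigma> (\<lambda>q. (0, 0, phi T (f q)))" if f: "continuous_map X \<tau> f" for X :: "'x topology" and f
  proof -
    have fV: "f q \<in> V" if "q \<in> topspace X" for q using continuous_map_funspace[OF f] top that by auto
    then have "continuous_map X \<tau> (\<lambda>q. unphi (phi T (f q)))"
      by (intro continuous_map_eq[OF f]) simp
    then show ?thesis unfolding cont(2) using top p1 fV by auto
  qed
  have fstc: "continuous_map ?\<sigma> \<tau> fst" using cont(2)[of ?\<sigma> id] by simp
  obtain \<Lambda> where "compact_by (lie_scale s) ?G ?\<sigma> \<Lambda>" using lin_compact_imp_compact_by[OF lcG] .
  moreover have "linear_map V s (lie_scale s) (\<lambda>z. (z, 0, 0))"
    unfolding linear_map_def by (simp add: scale_m1)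
  ultimately have "compact_by s V \<tau> ((\<lambda>l w. l (w, 0, 0)) ` \<Lambda>)"
    using m1c[OF continuous_map_id[unfolded id_def]] fstc
    by (intro compact_by_retract[OF _ cspace_V top, where p = fst]) auto
  then have "lin_compact s V \<tau>" by (rule compact_by_imp_lin_compact)
  moreover have "continuous_map (prod_topology \<tau> (prod_topology \<tau> \<tau>)) \<tau> (\<lambda>(x, y, z). br x y z)"
  proof -
    let ?X = "prod_topology \<tau> (prod_topology \<tau> \<tau>)"
    have pr: "continuous_map ?X \<tau> fst" "continuous_map ?X \<tau> (\<lambda>q. fst (snd q))" "continuous_map ?X \<tau> (\<lambda>q. snd (snd q))"
      by (rule continuous_map_fst continuous_map_fst_of[OF continuous_map_snd, unfolded o_def]
          continuous_map_snd_of[OF continuous_map_snd, unfolded o_def])+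
    have bc: "continuous_map ?X ?\<sigma> (\<lambda>q. lie_bracket (f q) (h q))"
      if "continuous_map ?X ?\<sigma> f" "continuous_map ?X ?\<sigma> h" for f h
    proof -
      have "continuous_map ?X (prod_topology ?\<sigma> ?\<sigma>) (\<lambda>q. (f q, h q))"
        using that by (simp add: continuous_map_pairwise o_def)
      from continuous_map_compose[OF this brc] show ?thesis by (simp add: o_def)
    qed
    have "continuous_map ?X ?\<sigma> (\<lambda>q. lie_bracket (lie_bracket (snd (snd q), 0, 0) (0, 0, phi T (fst (snd q)))) (fst q, 0, 0))"
      by (intro bc m1c p1c pr)
    from continuous_map_compose[OF this fstc]
    have c: "continuous_map ?X \<tau> (\<lambda>q. fst (lie_bracket (lie_bracket (snd (snd q), 0, 0) (0, 0, phi T (fst (snd q)))) (fst q, 0, 0)))"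
      by (simp add: o_def)
    show ?thesis
    proof (rule continuous_map_eq[OF c])
      fix q assume "q \<in> topspace ?X"
      then obtain x y z where q: "q = (x, y, z)" "x \<in> V" "y \<in> V" "z \<in> V" using top by auto
      have "lie_bracket (z, 0, 0) (0, 0, phi T y) = (0, - Lop T z y, 0)"
        using lie_bracket_generators(4)[OF N6 q(3,3,4)] by (simp add: in_m1_def in_0_def in_1_def)
      moreover have "fst (lie_bracket (0, - Lop T z y, 0) (x, 0, 0)) = - br z y x"
        unfolding Lie.lie_bracket_simp using q by simp
      moreover have "br x y z = - br z y x" using br_antisym q by blast
      ultimately show "fst (lie_bracket (lie_bracket (snd (snd q), 0, 0) (0, 0, phi T (fst (snd q)))) (fst q, 0, 0)) =
          (case q of (x, y, z) \<Rightarrow> br x y z)" unfolding q(1) by simp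
    qed
  qed
  ultimately show ?thesis unfolding lin_compact_alg3_def by blast
qed

end

section \<open>Linearly compact 3-algebras\<close>

locale lin_compact_N6 = zero_center_N6 T for T :: "'a::ab_group_add alg3" +
  fixes \<tau> :: "'a topology"
  assumes lin_compact: "lin_compact_alg3 T \<tau>"
begin

definition dual :: "('a \<Rightarrow> complex) set" where
  "dual = {l. functional s V l \<and> locally_constant \<tau> l}"

definition ker :: "('a \<Rightarrow> complex) set \<Rightarrow> 'a set" where
  "ker F = {z \<in> V. \<forall>l\<in>F. l z = 0}"

lemma compact: "compact_by s V \<tau> dual"
proof -
  have "lin_compact s V \<tau>" using lin_compact unfolding lin_compact_alg3_def ..
  then obtain \<Lambda> where "compact_by s V \<tau> \<Lambda>" by (rule lin_compact_imp_compact_by)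
  then show ?thesis unfolding dual_def by (rule compact_by_dual)
qed

lemma dualD: "l \<in> dual \<Longrightarrow> functional s V l" "l \<in> dual \<Longrightarrow> locally_constant \<tau> l"
  unfolding dual_def by simp_all

lemma dual_simps:
  assumes "l \<in> dual"
  shows "x \<in> V \<Longrightarrow> y \<in> V \<Longrightarrow> l (x + y) = l x + l y" "x \<in> V \<Longrightarrow> l (s c x) = c * l x"
    "l 0 = 0" "x \<in> V \<Longrightarrow> l (- x) = - l x" "x \<in> V \<Longrightarrow> y \<in> V \<Longrightarrow> l (x - y) = l x - l y"
  using linear_mapD[OF dualD(1)[OF assms] cspace_V] by auto

lemma \<tau>_weak: "\<tau> = weak_topology V dual"
  using compact unfolding compact_by_def by blast

lemma topspace_\<tau>: "topspace \<tau> = V"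
  by (subst \<tau>_weak) simp

lemma dual_eqI: "x \<in> V \<Longrightarrow> y \<in> V \<Longrightarrow> (\<And>l. l \<in> dual \<Longrightarrow> l x = l y) \<Longrightarrow> x = y"
  by (rule compact_by_eqI[OF compact])

lemma continuous_iff:
  "continuous_map X \<tau> f \<longleftrightarrow> f \<in> topspace X \<rightarrow> V \<and> (\<forall>l\<in>dual. locally_constant X (\<lambda>q. l (f q)))"
  using continuous_map_weak_topology[of X V dual f] unfolding \<tau>_weak[symmetric] .

lemma continuous_mem: "continuous_map X \<tau> f \<Longrightarrow> q \<in> topspace X \<Longrightarrow> f q \<in> V"
  by (rule funcset_mem[OF continuous_iff[THEN iffD1, THEN conjunct1]])

lemma continuous_locally_constant: "continuous_map X \<tau> f \<Longrightarrow> l \<in> dual \<Longrightarrow> locally_constant X (\<lambda>q. l (f q))"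
  by (rule continuous_iff[THEN iffD1, THEN conjunct2, rule_format])

lemma locally_constant_cong:
  "locally_constant X a \<Longrightarrow> (\<And>q. q \<in> topspace X \<Longrightarrow> a q = b q) \<Longrightarrow> locally_constant X b"
  by (rule continuous_map_eq)

lemma continuous_add:
  assumes "continuous_map X \<tau> f" "continuous_map X \<tau> h"
  shows "continuous_map X \<tau> (\<lambda>q. f q + h q)"
  unfolding continuous_iff
proof (intro conjI ballI)
  show "(\<lambda>q. f q + h q) \<in> topspace X \<rightarrow> V"
    using continuous_mem[OF assms(1)] continuous_mem[OF assms(2)] by (intro funcsetI) simp
  fix l assume l: "l \<in> dual"
  show "locally_constant X (\<lambda>q. l (f q + h q))"
    by (rule locally_constant_cong[OF locally_constant_combine[where f = "(+)", OF
        continuous_locally_constant[OF assms(1) l] continuous_locally_constant[OF assms(2) l]]])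
      (use continuous_mem[OF assms(1)] continuous_mem[OF assms(2)] dual_simps(1)[OF l] in simp)
qed

lemma continuous_uminus:
  assumes "continuous_map X \<tau> f"
  shows "continuous_map X \<tau> (\<lambda>q. - f q)"
  unfolding continuous_iff
proof (intro conjI ballI)
  show "(\<lambda>q. - f q) \<in> topspace X \<rightarrow> V" using continuous_mem[OF assms] by (intro funcsetI) simp
  fix l assume l: "l \<in> dual"
  show "locally_constant X (\<lambda>q. l (- f q))"
    by (rule locally_constant_cong[OF locally_constant_combine[where f = "\<lambda>a _. - a", OF
        continuous_locally_constant[OF assms l] continuous_locally_constant[OF assms l]]])
      (use continuous_mem[OF assms] dual_simps(4)[OF l] in simp)
qed

lemma continuous_diff:
  "continuous_map X \<tau> f \<Longrightarrow> continuous_map X \<tau> h \<Longrightarrow> continuous_map X \<tau> (\<lambda>q. f q - h q)"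
  using continuous_add[OF _ continuous_uminus, of X f h] by simp

lemma continuous_const: "x \<in> V \<Longrightarrow> continuous_map X \<tau> (\<lambda>q. x)"
  using topspace_\<tau> by simp

lemma continuous_br:
  assumes "continuous_map X \<tau> f" "continuous_map X \<tau> h" "continuous_map X \<tau> k"
  shows "continuous_map X \<tau> (\<lambda>q. br (f q) (h q) (k q))"
proof -
  have c: "continuous_map (prod_topology \<tau> (prod_topology \<tau> \<tau>)) \<tau> (\<lambda>(x, y, z). br x y z)"
    using lin_compact unfolding lin_compact_alg3_def ..
  have "continuous_map X (prod_topology \<tau> (prod_topology \<tau> \<tau>)) (\<lambda>q. (f q, h q, k q))"
    using assms by (simp add: continuous_map_pairwise o_def)
  from continuous_map_compose[OF this c] show ?thesis by (simp add: o_def)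
qed

text \<open>
  The conjugation compensates that the bracket is antilinear in the middle argument.
\<close>

lemma dual_br:
  assumes l: "l \<in> dual"
  shows "y \<in> V \<Longrightarrow> z \<in> V \<Longrightarrow> (\<lambda>x. l (br x y z)) \<in> dual"
    "x \<in> V \<Longrightarrow> z \<in> V \<Longrightarrow> (\<lambda>y. cnj (l (br x y z))) \<in> dual"
    "x \<in> V \<Longrightarrow> y \<in> V \<Longrightarrow> (\<lambda>z. l (br x y z)) \<in> dual"
proof -
  have id: "continuous_map \<tau> \<tau> (\<lambda>x. x)" by (rule continuous_map_id[unfolded id_def])
  note lc = continuous_locally_constant[OF continuous_br l]
  show "(\<lambda>x. l (br x y z)) \<in> dual" if "y \<in> V" "z \<in> V"
    unfolding dual_def linear_map_def using lc[OF id continuous_const continuous_const] that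
    by (simp add: dual_simps[OF l])
  show "(\<lambda>z. l (br x y z)) \<in> dual" if "x \<in> V" "y \<in> V"
    unfolding dual_def linear_map_def using lc[OF continuous_const continuous_const id] that
    by (simp add: dual_simps[OF l])
  show "(\<lambda>y. cnj (l (br x y z))) \<in> dual" if "x \<in> V" "z \<in> V"
    unfolding dual_def linear_map_def
    using locally_constant_combine[where f = "\<lambda>a _. cnj a", OF lc[OF continuous_const id continuous_const]
        lc[OF continuous_const id continuous_const], of x z x z] that
    by (simp add: dual_simps[OF l])
qed

lemma ker_mono: "F \<subseteq> F' \<Longrightarrow> ker F' \<subseteq> ker F"
  by (auto simp: ker_def)

lemma openin_0_ker:
  assumes "openin \<tau> U" "0 \<in> U"
  shows "\<exists>F\<subseteq>dual. finite F \<and> ker F \<subseteq> U"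
proof -
  obtain F where F: "F \<subseteq> dual" "finite F" "\<forall>y\<in>V. (\<forall>l\<in>F. l y = l 0) \<longrightarrow> y \<in> U"
    using openin_weak_topology[of V dual U] assms unfolding \<tau>_weak[symmetric] by blast
  have "ker F \<subseteq> U"
  proof
    fix y assume y: "y \<in> ker F"
    have "l y = l 0" if "l \<in> F" for l
      using y that dual_simps(3)[OF subsetD[OF F(1) that]] by (simp add: ker_def)
    then show "y \<in> U" using F(3) y by (simp add: ker_def)
  qed
  then show ?thesis using F(1,2) by blast
qed

lemma openin_prod_0_ker:
  assumes "openin (prod_topology \<tau> \<tau>) U" "(0, 0) \<in> U"
  shows "\<exists>F\<subseteq>dual. finite F \<and> ker F \<times> ker F \<subseteq> U"
proof -
  obtain U1 U2 where U: "openin \<tau> U1" "openin \<tau> U2" "0 \<in> U1" "0 \<in> U2" "U1 \<times> U2 \<subseteq> U"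
    using assms unfolding openin_prod_topology_alt by meson
  obtain F1 F2 where F: "F1 \<subseteq> dual" "finite F1" "ker F1 \<subseteq> U1" "F2 \<subseteq> dual" "finite F2" "ker F2 \<subseteq> U2"
    using openin_0_ker U by meson
  have "ker (F1 \<union> F2) \<subseteq> U1" "ker (F1 \<union> F2) \<subseteq> U2" using F ker_mono by blast+
  then have "ker (F1 \<union> F2) \<times> ker (F1 \<union> F2) \<subseteq> U" using U(5) by blast
  then show ?thesis using F by (intro exI[of _ "F1 \<union> F2"]) simp
qed

lemma continuous_vanishes_near_0:
  assumes "l \<in> dual" "continuous_map (prod_topology \<tau> \<tau>) \<tau> \<beta>" "\<beta> (0, 0) = 0"
  shows "\<exists>F\<subseteq>dual. finite F \<and> (\<forall>y\<in>ker F. \<forall>z\<in>ker F. l (\<beta> (y, z)) = 0)"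
proof -
  have "(0, 0) \<in> topspace (prod_topology \<tau> \<tau>)" using topspace_\<tau> by simp
  then obtain U where U: "openin (prod_topology \<tau> \<tau>) U" "(0, 0) \<in> U" "\<forall>q\<in>U. l (\<beta> (0, 0)) = l (\<beta> q)"
    using continuous_locally_constant[OF assms(2,1)] unfolding locally_constant_iff by meson
  obtain F where F: "F \<subseteq> dual" "finite F" "ker F \<times> ker F \<subseteq> U" using openin_prod_0_ker[OF U(1,2)] by blast
  have "l (\<beta> (y, z)) = 0" if "y \<in> ker F" "z \<in> ker F" for y z
  proof -
    have "(y, z) \<in> U" using F(3) that by blast
    then show ?thesis using U(3) assms(3) dual_simps(3)[OF assms(1)] by metis
  qed
  then show ?thesis using F(1,2) by blast
qed

lemma br_vanishes_near_0:
  assumes "l \<in> dual"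
  shows "\<exists>F\<subseteq>dual. finite F \<and> (\<forall>x\<in>ker F. \<forall>y\<in>ker F. \<forall>z\<in>ker F. l (br x y z) = 0)"
proof -
  let ?P = "prod_topology \<tau> (prod_topology \<tau> \<tau>)"
  have c: "continuous_map ?P \<tau> (\<lambda>(x, y, z). br x y z)"
    using lin_compact unfolding lin_compact_alg3_def ..
  have "(0, 0, 0) \<in> topspace ?P" using topspace_\<tau> by simp
  then obtain U where U: "openin ?P U" "(0, 0, 0) \<in> U"
      "\<forall>q\<in>U. l (case (0, 0, 0) of (x, y, z) \<Rightarrow> br x y z) = l (case q of (x, y, z) \<Rightarrow> br x y z)"
    using continuous_locally_constant[OF c assms] unfolding locally_constant_iff by meson
  obtain U1 U2 where U12: "openin \<tau> U1" "openin (prod_topology \<tau> \<tau>) U2" "0 \<in> U1" "(0, 0) \<in> U2" "U1 \<times> U2 \<subseteq> U"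
    using U(1,2) unfolding openin_prod_topology_alt[of \<tau> "prod_topology \<tau> \<tau>"] by meson
  obtain F1 F2 where F: "F1 \<subseteq> dual" "finite F1" "ker F1 \<subseteq> U1" "F2 \<subseteq> dual" "finite F2" "ker F2 \<times> ker F2 \<subseteq> U2"
    using openin_0_ker[OF U12(1,3)] openin_prod_0_ker[OF U12(2,4)] by meson
  have k: "ker (F1 \<union> F2) \<subseteq> ker F1" "ker (F1 \<union> F2) \<subseteq> ker F2" using ker_mono by blast+
  have "l (br x y z) = 0" if "x \<in> ker (F1 \<union> F2)" "y \<in> ker (F1 \<union> F2)" "z \<in> ker (F1 \<union> F2)" for x y z
  proof -
    have "x \<in> U1" by (rule subsetD[OF F(3) subsetD[OF k(1) that(1)]])
    moreover have "(y, z) \<in> U2"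
      by (rule subsetD[OF F(6)]) (rule SigmaI subsetD[OF k(2) that(2)] subsetD[OF k(2) that(3)])+
    ultimately have "(x, y, z) \<in> U" by (intro subsetD[OF U12(5)] SigmaI)
    from U(3)[rule_format, OF this] show ?thesis using dual_simps(3)[OF assms] by simp
  qed
  then show ?thesis using F by (intro exI[of _ "F1 \<union> F2"]) simp
qed

text \<open>
  A linear condition \<open>R y F\<close> on \<open>y\<close> that holds near 0 with one finite set \<open>F1\<close> and at each point with some
  finite set holds everywhere with one finite set, because a neighbourhood \<open>ker F0\<close> of 0 has finite
  codimension: finitely many vectors have to be treated separately, one for each step of the induction.
\<close>

lemma pointwise_imp_uniform:
  assumes lin: "\<And>y y' c F. y \<in> V \<Longrightarrow> y' \<in> V \<Longrightarrow> R y F \<Longrightarrow> R y' F \<Longrightarrow> R (y + s c y') F"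
    and mono: "\<And>y F F'. R y F \<Longrightarrow> F \<subseteq> F' \<Longrightarrow> R y F'"
    and pt: "\<And>y. y \<in> V \<Longrightarrow> \<exists>F\<subseteq>dual. finite F \<and> R y F"
    and F0: "finite F0" "F0 \<subseteq> dual" and F1: "finite F1" "F1 \<subseteq> dual" and base: "\<And>y. y \<in> ker F0 \<Longrightarrow> R y F1"
  shows "\<exists>F\<subseteq>dual. finite F \<and> (\<forall>y\<in>V. R y F)"
  using F0 F1 base
proof (induction F0 arbitrary: F1 rule: finite_induct)
  case empty
  then show ?case by (intro exI[of _ F1]) (simp add: ker_def)
next
  case (insert m F0)
  have m: "m \<in> dual" and F0: "F0 \<subseteq> dual" using insert.prems(1) by auto
  show ?case
  proof (cases "\<forall>y\<in>ker F0. m y = 0")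
    case True
    then have "R y F1" if "y \<in> ker F0" for y
      using insert.prems(4)[of y] that by (simp add: ker_def)
    then show ?thesis using insert.IH[OF F0 insert.prems(2,3)] by blast
  next
    case False
    then obtain y1 where y1: "y1 \<in> ker F0" "m y1 \<noteq> 0" by blast
    then have y1V: "y1 \<in> V" by (simp add: ker_def)
    obtain Fy where Fy: "Fy \<subseteq> dual" "finite Fy" "R y1 Fy" using pt[OF y1V] by blast
    have "R y (F1 \<union> Fy)" if y: "y \<in> ker F0" for y
    proof -
      have yV: "y \<in> V" using y by (simp add: ker_def)
      let ?c = "m y / m y1"
      let ?y = "y - s ?c y1"
      have "l ?y = 0" if "l \<in> insert m F0" for l
      proof -
        have l: "l \<in> dual" using that m F0 by blast
        have "l ?y = l y - ?c * l y1" using dual_simps(2,5)[OF l] yV y1V by simp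
        then show ?thesis using that y y1 by (cases "l = m") (auto simp: ker_def)
      qed
      then have "?y \<in> ker (insert m F0)" using yV y1V by (simp add: ker_def)
      then have "R ?y (F1 \<union> Fy)" using insert.prems(4) mono by blast
      moreover have "R y1 (F1 \<union> Fy)" using Fy(3) mono by blast
      ultimately have "R (?y + s ?c y1) (F1 \<union> Fy)" using yV y1V by (intro lin) simp_all
      then show ?thesis by simp
    qed
    then show ?thesis using insert.IH[OF F0, of "F1 \<union> Fy"] insert.prems(2,3) Fy by blast
  qed
qed

text \<open>
  Continuity at 0 only bounds \<open>[x,y,z]\<close> when all three arguments are small.  Finite codimension of small
  neighbourhoods removes the restriction on \<open>x\<close> and \<open>y\<close> one after the other, so the operators \<open>L\<^bsub>x,y\<^esub>\<close> are
  equicontinuous.  This is the key to the topological part of (d): it makes the evaluation of operators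
  jointly continuous and carries over to the closure of their span.
\<close>

lemma equicontinuous_br:
  assumes l: "l \<in> dual"
  shows "\<exists>F\<subseteq>dual. finite F \<and> (\<forall>x\<in>V. \<forall>y\<in>V. \<forall>z\<in>ker F. l (br x y z) = 0)"
proof -
  note ls = dual_simps[OF l]
  have kV: "z \<in> V" if "z \<in> ker F" for z F using that by (simp add: ker_def)
  have k1: "l' z = 0" if "z \<in> ker {l'}" for z l' using that by (simp add: ker_def)
  have pair: "continuous_map (prod_topology \<tau> \<tau>) \<tau> fst" "continuous_map (prod_topology \<tau> \<tau>) \<tau> snd"
    by (rule continuous_map_fst continuous_map_snd)+
  have kz: "z \<in> ker F" if "z \<in> ker F'" "F \<subseteq> F'" for z F F' using that ker_mono by blast
  \<comment> \<open>with \<open>x\<close> or \<open>y\<close> fixed, continuity at 0 concerns two arguments only, and the other one becomes arbitrary\<close>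
  have fix1: "\<exists>F\<subseteq>dual. finite F \<and> (\<forall>y\<in>V. \<forall>z\<in>ker F. l (br x y z) = 0)" if x: "x \<in> V" for x
  proof -
    have "continuous_map (prod_topology \<tau> \<tau>) \<tau> (\<lambda>q. br x (fst q) (snd q))"
      by (intro continuous_br continuous_const x pair)
    from continuous_vanishes_near_0[OF l this] obtain F where F: "F \<subseteq> dual" "finite F" "\<forall>y\<in>ker F. \<forall>z\<in>ker F. l (br x y z) = 0"
      using x by auto
    show ?thesis
    proof (rule pointwise_imp_uniform[where R = "\<lambda>y F. \<forall>z\<in>ker F. l (br x y z) = 0"])
      show "\<exists>F\<subseteq>dual. finite F \<and> (\<forall>z\<in>ker F. l (br x y z) = 0)" if y: "y \<in> V" for y
        using dual_br(3)[OF l x y] by (intro exI[of _ "{\<lambda>z. l (br x y z)}"]) (simp add: ker_def)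
      show "\<forall>z\<in>ker F. l (br x (y + s c y') z) = 0"
        if "y \<in> V" "y' \<in> V" "\<forall>z\<in>ker F. l (br x y z) = 0" "\<forall>z\<in>ker F. l (br x y' z) = 0" for y y' c F
        using that x kV by (simp add: ls)
    qed (use F kz in blast)+
  qed
  have fix2: "\<exists>F\<subseteq>dual. finite F \<and> (\<forall>x\<in>V. \<forall>z\<in>ker F. l (br x y z) = 0)" if y: "y \<in> V" for y
  proof -
    have "continuous_map (prod_topology \<tau> \<tau>) \<tau> (\<lambda>q. br (fst q) y (snd q))"
      by (intro continuous_br continuous_const y pair)
    from continuous_vanishes_near_0[OF l this] obtain F where F: "F \<subseteq> dual" "finite F" "\<forall>x\<in>ker F. \<forall>z\<in>ker F. l (br x y z) = 0"
      using y by auto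
    show ?thesis
    proof (rule pointwise_imp_uniform[where R = "\<lambda>x F. \<forall>z\<in>ker F. l (br x y z) = 0"])
      show "\<exists>F\<subseteq>dual. finite F \<and> (\<forall>z\<in>ker F. l (br x y z) = 0)" if x: "x \<in> V" for x
        using dual_br(3)[OF l x y] by (intro exI[of _ "{\<lambda>z. l (br x y z)}"]) (simp add: ker_def)
      show "\<forall>z\<in>ker F. l (br (x + s c x') y z) = 0"
        if "x \<in> V" "x' \<in> V" "\<forall>z\<in>ker F. l (br x y z) = 0" "\<forall>z\<in>ker F. l (br x' y z) = 0" for x x' c F
        using that y kV by (simp add: ls)
    qed (use F kz in blast)+
  qed
  \<comment> \<open>now all three arguments are small; first \<open>y\<close> becomes arbitrary by \<open>fix2\<close>, then \<open>x\<close> by \<open>fix1\<close>\<close>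
  obtain F0 where F0: "F0 \<subseteq> dual" "finite F0" "\<forall>x\<in>ker F0. \<forall>y\<in>ker F0. \<forall>z\<in>ker F0. l (br x y z) = 0"
    using br_vanishes_near_0[OF l] by blast
  have "\<exists>F\<subseteq>dual. finite F \<and> (\<forall>y\<in>V. \<forall>x\<in>ker F0. \<forall>z\<in>ker F. l (br x y z) = 0)"
  proof (rule pointwise_imp_uniform[where R = "\<lambda>y F. \<forall>x\<in>ker F0. \<forall>z\<in>ker F. l (br x y z) = 0"])
    show "\<exists>F\<subseteq>dual. finite F \<and> (\<forall>x\<in>ker F0. \<forall>z\<in>ker F. l (br x y z) = 0)" if y: "y \<in> V" for y
      using fix2[OF y] kV by meson
    show "\<forall>x\<in>ker F0. \<forall>z\<in>ker F. l (br x (y + s c y') z) = 0"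
      if "y \<in> V" "y' \<in> V" "\<forall>x\<in>ker F0. \<forall>z\<in>ker F. l (br x y z) = 0"
        "\<forall>x\<in>ker F0. \<forall>z\<in>ker F. l (br x y' z) = 0" for y y' c F
      using that kV by (simp add: ls)
  qed (use F0 kz in blast)+
  then obtain F2 where F2: "F2 \<subseteq> dual" "finite F2" "\<forall>y\<in>V. \<forall>x\<in>ker F0. \<forall>z\<in>ker F2. l (br x y z) = 0" by blast
  show ?thesis
  proof (rule pointwise_imp_uniform[where R = "\<lambda>x F. \<forall>y\<in>V. \<forall>z\<in>ker F. l (br x y z) = 0"])
    show "\<forall>y\<in>V. \<forall>z\<in>ker F. l (br (x + s c x') y z) = 0"
      if "x \<in> V" "x' \<in> V" "\<forall>y\<in>V. \<forall>z\<in>ker F. l (br x y z) = 0"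
        "\<forall>y\<in>V. \<forall>z\<in>ker F. l (br x' y z) = 0" for x x' c F
      using that kV by (simp add: ls)
    show "\<forall>y\<in>V. \<forall>z\<in>ker F'. l (br x y z) = 0"
      if "\<forall>y\<in>V. \<forall>z\<in>ker F. l (br x y z) = 0" "F \<subseteq> F'" for x F F'
      using that kz by blast
    show "\<forall>y\<in>V. \<forall>z\<in>ker F2. l (br x y z) = 0" if "x \<in> ker F0" for x
      using F2(3) that by blast
  qed (rule fix1 F0(1,2) F2(1,2); assumption?)+
qed

section \<open>Closure of the inner derivations\<close>

abbreviation "E \<equiv> Lspan_closed T \<tau>"

text \<open>
  Pointwise convergence of operators is tested by the maps \<open>A \<mapsto> l (A v)\<close>.
\<close>

lemma product_weak:
  "product_topology (\<lambda>_. \<tau>) V = weak_topology (V \<rightarrow>\<^sub>E V) ((\<lambda>(v, l) A. l (A v)) ` (V \<times> dual))"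
    (is "?P = weak_topology ?X ?\<Lambda>")
proof (rule topology_eqI)
  show "topspace ?P = topspace (weak_topology ?X ?\<Lambda>)" by (simp add: topspace_\<tau>)
  have proj: "continuous_map ?P \<tau> (\<lambda>A. A v)" if "v \<in> V" for v
    using continuous_map_product_projection[OF that, of "\<lambda>_. \<tau>"] .
  show "continuous_map ?P (weak_topology ?X ?\<Lambda>) id"
    unfolding continuous_map_weak_topology
  proof (intro conjI ballI)
    show "id \<in> topspace ?P \<rightarrow> ?X" by (simp add: topspace_\<tau>)
    fix m assume "m \<in> ?\<Lambda>"
    then obtain v l where m: "m = (\<lambda>A. l (A v))" "v \<in> V" "l \<in> dual" by auto
    show "locally_constant ?P (\<lambda>A. m (id A))"
      using continuous_locally_constant[OF proj[OF m(2)] m(3)] by (simp add: m(1))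
  qed
  show "continuous_map (weak_topology ?X ?\<Lambda>) ?P id"
    unfolding continuous_map_componentwise
  proof (intro conjI ballI)
    show "id ` topspace (weak_topology ?X ?\<Lambda>) \<subseteq> extensional V" by (auto simp: PiE_def)
    fix v assume v: "v \<in> V"
    show "continuous_map (weak_topology ?X ?\<Lambda>) \<tau> (\<lambda>A. id A v)"
      unfolding continuous_iff
    proof (intro conjI ballI)
      show "(\<lambda>A. id A v) \<in> topspace (weak_topology ?X ?\<Lambda>) \<rightarrow> V" using v by auto
      fix l assume "l \<in> dual"
      then have "(\<lambda>A. l (A v)) \<in> ?\<Lambda>" using v by force
      from locally_constant_weak_topology[OF this]
      show "locally_constant (weak_topology ?X ?\<Lambda>) (\<lambda>A. l (id A v))" by simp
    qed
  qed
qed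

definition agree :: "('a \<times> ('a \<Rightarrow> complex)) set \<Rightarrow> ('a \<Rightarrow> 'a) \<Rightarrow> ('a \<Rightarrow> 'a) \<Rightarrow> bool" where
  "agree F A B \<longleftrightarrow> (\<forall>v l. (v, l) \<in> F \<longrightarrow> l (A v) = l (B v))"

lemma agreeI: "(\<And>v l. (v, l) \<in> F \<Longrightarrow> l (A v) = l (B v)) \<Longrightarrow> agree F A B"
  unfolding agree_def by (intro allI impI)

lemma agreeD: "agree F A B \<Longrightarrow> (v, l) \<in> F \<Longrightarrow> l (A v) = l (B v)"
  unfolding agree_def by (elim allE impE)

text \<open>
  The closure in concrete terms: finitely many values \<open>l (A v)\<close> of an element of the closure can be matched
  by an element of the span.
\<close>

lemma E_iff:
  "A \<in> E \<longleftrightarrow> (\<forall>z. z \<notin> V \<longrightarrow> A z = 0) \<and> (\<forall>z\<in>V. A z \<in> V) \<and>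
     (\<forall>F\<subseteq>V \<times> dual. finite F \<longrightarrow> (\<exists>B\<in>Lspan T. agree F B A))"
proof -
  let ?r = "\<lambda>A :: 'a \<Rightarrow> 'a. restrict A V"
  let ?e = "\<lambda>(v, l) A. l (A v)"
  have sub: "?r ` Lspan T \<subseteq> (V \<rightarrow>\<^sub>E V)"
    using endoD(6)[OF Lie.D_endo] by (intro image_subsetI) (simp add: PiE_iff)
  have agree: "agree F B A \<longleftrightarrow> (\<forall>m\<in>?e ` F. m (?r B) = m (?r A))" if "F \<subseteq> V \<times> dual" for F B
  proof -
    have V: "v \<in> V" if "(v, l) \<in> F" for v l using that \<open>F \<subseteq> V \<times> dual\<close> by blast
    show ?thesis
    proof
      assume B: "agree F B A"
      show "\<forall>m\<in>?e ` F. m (?r B) = m (?r A)"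
      proof
        fix m assume "m \<in> ?e ` F"
        then obtain v l where vl: "(v, l) \<in> F" and m: "m = (\<lambda>A. l (A v))" by auto
        show "m (?r B) = m (?r A)" unfolding m using agreeD[OF B vl] V[OF vl] by simp
      qed
    next
      assume m: "\<forall>m\<in>?e ` F. m (?r B) = m (?r A)"
      show "agree F B A"
      proof (rule agreeI)
        fix v l assume vl: "(v, l) \<in> F"
        show "l (B v) = l (A v)" using bspec[OF m imageI[OF vl]] V[OF vl] by simp
      qed
    qed
  qed
  have fin: "(\<forall>F\<subseteq>?e ` (V \<times> dual). finite F \<longrightarrow> (\<exists>B\<in>?r ` Lspan T. \<forall>m\<in>F. m B = m (?r A))) \<longleftrightarrow>
      (\<forall>F\<subseteq>V \<times> dual. finite F \<longrightarrow> (\<exists>B\<in>Lspan T. agree F B A))"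
  proof (intro iffI allI impI)
    fix F assume L: "\<forall>F\<subseteq>?e ` (V \<times> dual). finite F \<longrightarrow> (\<exists>B\<in>?r ` Lspan T. \<forall>m\<in>F. m B = m (?r A))"
      and F: "F \<subseteq> V \<times> dual" "finite F"
    have "\<exists>B\<in>?r ` Lspan T. \<forall>m\<in>?e ` F. m B = m (?r A)"
      by (rule L[rule_format]) (rule image_mono[OF F(1)], rule finite_imageI[OF F(2)])
    then show "\<exists>B\<in>Lspan T. agree F B A"
      unfolding agree[OF F(1)] by (elim bexE imageE) (rule bexI, hypsubst)
  next
    fix F assume R: "\<forall>F\<subseteq>V \<times> dual. finite F \<longrightarrow> (\<exists>B\<in>Lspan T. agree F B A)"
      and F: "F \<subseteq> ?e ` (V \<times> dual)" "finite F"
    obtain F' where F': "F' \<subseteq> V \<times> dual" "finite F'" "F = ?e ` F'"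
      using finite_subset_image[OF F(2,1)] by metis
    obtain B where B: "B \<in> Lspan T" "agree F' B A" using R F'(1,2) by meson
    from B(2) have "\<forall>m\<in>F. m (?r B) = m (?r A)" unfolding agree[OF F'(1)] F'(3) .
    then show "\<exists>B\<in>?r ` Lspan T. \<forall>m\<in>F. m B = m (?r A)" by (rule bexI[where x = "?r B"]) (rule imageI[OF B(1)])
  qed
  have "A \<in> E \<longleftrightarrow> (\<forall>z. z \<notin> V \<longrightarrow> A z = 0) \<and> ?r A \<in> (V \<rightarrow>\<^sub>E V) \<and>
      (\<forall>F\<subseteq>?e ` (V \<times> dual). finite F \<longrightarrow> (\<exists>B\<in>?r ` Lspan T. \<forall>m\<in>F. m B = m (?r A)))"
    unfolding Lspan_closed_def product_weak mem_Collect_eq weak_topology_closure_of[OF sub] ..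
  then show ?thesis unfolding fin by (simp add: PiE_iff)
qed

lemma E_approx:
  assumes "A \<in> E" "F \<subseteq> V \<times> dual" "finite F"
  obtains B where "B \<in> Lspan T" "agree F B A"
  using assms(1)[unfolded E_iff, THEN conjunct2, THEN conjunct2, rule_format, OF assms(2,3)] that by blast

lemma E_mem: "A \<in> E \<Longrightarrow> z \<in> V \<Longrightarrow> A z \<in> V" and E_outside: "A \<in> E \<Longrightarrow> z \<notin> V \<Longrightarrow> A z = 0"
  unfolding E_iff by blast+

lemma E_I:
  assumes "\<And>z. z \<notin> V \<Longrightarrow> A z = 0" "\<And>z. z \<in> V \<Longrightarrow> A z \<in> V"
    "\<And>F. F \<subseteq> V \<times> dual \<Longrightarrow> finite F \<Longrightarrow> \<exists>B\<in>Lspan T. agree F B A"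
  shows "A \<in> E"
  unfolding E_iff using assms by blast

lemma Lspan_E: "Lspan T \<subseteq> E"
  using endoD(6,7)[OF Lie.D_endo] by (intro subsetI E_I) (simp_all, blast intro: agreeI)

lemma E_endo:
  assumes "A \<in> E"
  shows "endo A"
  unfolding endo_def linear_map_def
proof (intro conjI ballI allI impI)
  show "A z \<in> V" if "z \<in> V" for z using E_mem[OF assms that] .
  show "A z = 0" if "z \<notin> V" for z using E_outside[OF assms that] .
  show "A (x + y) = A x + A y" if xy: "x \<in> V" "y \<in> V" for x y
  proof (rule dual_eqI)
    fix l assume l: "l \<in> dual"
    have "{(x + y, l), (x, l), (y, l)} \<subseteq> V \<times> dual" using xy l by simp
    then obtain B where B: "B \<in> Lspan T" "agree {(x + y, l), (x, l), (y, l)} B A"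
      by (rule E_approx[OF assms]) simp
    note e = endoD[OF Lie.D_endo[OF B(1)]]
    have "l (A (x + y)) = l (B x + B y)" using agreeD[OF B(2), of "x + y" l] e(1)[OF xy] by simp
    also have "\<dots> = l (A x + A y)"
      using agreeD[OF B(2), of x l] agreeD[OF B(2), of y l] e(6) E_mem[OF assms] xy by (simp add: dual_simps(1)[OF l])
    finally show "l (A (x + y)) = l (A x + A y)" .
  qed (use E_mem[OF assms] xy in simp_all)
  show "A (s c x) = s c (A x)" if x: "x \<in> V" for c x
  proof (rule dual_eqI)
    fix l assume l: "l \<in> dual"
    have "{(s c x, l), (x, l)} \<subseteq> V \<times> dual" using x l by simp
    then obtain B where B: "B \<in> Lspan T" "agree {(s c x, l), (x, l)} B A"
      by (rule E_approx[OF assms]) simp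
    note e = endoD[OF Lie.D_endo[OF B(1)]]
    have "l (A (s c x)) = l (s c (B x))" using agreeD[OF B(2), of "s c x" l] e(2)[OF x] by simp
    also have "\<dots> = l (s c (A x))"
      using agreeD[OF B(2), of x l] e(6) E_mem[OF assms] x by (simp add: dual_simps(2)[OF l])
    finally show "l (A (s c x)) = l (s c (A x))" .
  qed (use E_mem[OF assms] x in simp_all)
qed

text \<open>
  By the zero center the functionals \<open>u \<mapsto> cnj (l [x,u,z])\<close> separate points, so they define the topology.
  Adjoints are only known through their action as middle arguments; this lemma gives access to their
  convergence.
\<close>

lemma compact_by_br:
  "compact_by s V \<tau> {(\<lambda>u. cnj (l (br x u z))) | l x z. l \<in> dual \<and> x \<in> V \<and> z \<in> V}"
proof (rule compact_by_separating[OF compact])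
  fix m assume "m \<in> {(\<lambda>u. cnj (l (br x u z))) | l x z. l \<in> dual \<and> x \<in> V \<and> z \<in> V}"
  then have "m \<in> dual" using dual_br(2) by blast
  then show "functional s V m" "locally_constant \<tau> m" by (rule dualD)+
next
  fix u assume u: "u \<in> V"
    and 0: "\<And>m. m \<in> {(\<lambda>u. cnj (l (br x u z))) | l x z. l \<in> dual \<and> x \<in> V \<and> z \<in> V} \<Longrightarrow> m u = 0"
  show "u = 0"
  proof (rule br_middle_eqI)
    fix x z assume xz: "x \<in> V" "z \<in> V"
    have "br x u z = 0"
    proof (rule dual_eqI)
      fix l assume l: "l \<in> dual"
      have "cnj (l (br x u z)) = 0" by (rule 0[of "\<lambda>u. cnj (l (br x u z))"]) (use l xz in blast)
      then show "l (br x u z) = l 0" using dual_simps(3)[OF l] by simp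
    qed (use u xz in simp_all)
    then show "br x u z = br x 0 z" using xz by simp
  qed (use u in simp_all)
qed

text \<open>
  The adjoint of a limit of operators need not be a limit in any evident way, but its value at \<open>y\<close> is the
  solution \<open>u\<close> of a linear system.  Every finite part of the system is solved by \<open>adj B y\<close> for some \<open>B\<close> in
  the span that is close to \<open>A\<close>, and linear compactness solves the whole system.
\<close>

lemma E_adjoint_exists:
  assumes A: "A \<in> E" and y: "y \<in> V"
  shows "\<exists>u\<in>V. \<forall>x\<in>V. \<forall>z\<in>V. br x u z = br (A x) y z + br x y (A z) - A (br x y z)"
proof -
  let ?R = "\<lambda>A x z. br (A x) y z + br x y (A z) - A (br x y z)"
  let ?h = "\<lambda>(l, x, z). ((\<lambda>u. cnj (l (br x u z))), cnj (l (?R A x z)))"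
  let ?H = "?h ` (dual \<times> V \<times> V)"
  have sol: "finitely_solvable V ?H"
  proof (rule finitely_solvableI)
    fix F assume F: "F \<subseteq> ?H" "finite F"
    obtain I where I: "I \<subseteq> dual \<times> V \<times> V" "finite I" "F = ?h ` I"
      using finite_subset_image[OF F(2,1)] by (elim exE conjE) (rule that)
    let ?S = "(\<lambda>(l, x, z). (x, \<lambda>v. l (br v y z))) ` I \<union> (\<lambda>(l, x, z). (z, \<lambda>v. l (br x y v))) ` I
      \<union> (\<lambda>(l, x, z). (br x y z, l)) ` I"
    have S: "?S \<subseteq> V \<times> dual"
    proof (intro Un_least image_subsetI)
      fix i assume "i \<in> I"
      then obtain l x z where i: "i = (l, x, z)" and l: "l \<in> dual" and xz: "x \<in> V" "z \<in> V"
        using I(1) by auto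
      show "(case i of (l, x, z) \<Rightarrow> (x, \<lambda>v. l (br v y z))) \<in> V \<times> dual"
        "(case i of (l, x, z) \<Rightarrow> (z, \<lambda>v. l (br x y v))) \<in> V \<times> dual"
        "(case i of (l, x, z) \<Rightarrow> (br x y z, l)) \<in> V \<times> dual"
        unfolding i using dual_br(1)[OF l y xz(2)] dual_br(3)[OF l xz(1) y] l xz y by simp_all
    qed
    have Sf: "finite ?S" using I(2) by simp
    obtain B where B: "B \<in> Lspan T" "agree ?S B A" by (rule E_approx[OF A S Sf])
    note D = DerD[OF subsetD[OF Lspan_Der B(1)]]
    have "solves (adj B y) F"
    proof (rule solvesI)
      fix m c assume "(m, c) \<in> F"
      then obtain l x z where m: "(l, x, z) \<in> I" "m = (\<lambda>u. cnj (l (br x u z)))" "c = cnj (l (?R A x z))"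
        unfolding I(3) by auto
      have l: "l \<in> dual" and xz: "x \<in> V" "z \<in> V" using m(1) I(1) by auto
      have "l (br (B x) y z) = l (br (A x) y z)"
        by (rule agreeD[OF B(2), of x "\<lambda>v. l (br v y z)"]) (use m(1) in force)
      moreover have "l (br x y (B z)) = l (br x y (A z))"
        by (rule agreeD[OF B(2), of z "\<lambda>v. l (br x y v)"]) (use m(1) in force)
      moreover have "l (B (br x y z)) = l (A (br x y z))"
        by (rule agreeD[OF B(2)]) (use m(1) in force)
      moreover have "br x (adj B y) z = ?R B x z"
        using adjointD(2)[OF D(2) xz(1) y xz(2)] by simp
      ultimately have "l (br x (adj B y) z) = l (?R A x z)"
        using xz y endoD(6)[OF D(1)] E_mem[OF A] by (simp add: dual_simps[OF l])
      then show "m (adj B y) = c" unfolding m by simp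
    qed
    then show "\<exists>u\<in>V. solves u F" using D(3) by blast
  qed
  have fH: "functional s V m" "locally_constant \<tau> m" if "(m, c) \<in> ?H" for m c
  proof -
    have "m \<in> dual" using that dual_br(2) by auto
    then show "functional s V m" "locally_constant \<tau> m" by (rule dualD)+
  qed
  obtain u where u: "u \<in> V" "solves u ?H" by (rule compact_by_solve[OF compact fH sol])
  have "br x u z = ?R A x z" if xz: "x \<in> V" "z \<in> V" for x z
  proof (rule dual_eqI)
    fix l assume l: "l \<in> dual"
    have "((\<lambda>u. cnj (l (br x u z))), cnj (l (?R A x z))) \<in> ?H" using l xz by force
    from solvesD[OF u(2) this] show "l (br x u z) = l (?R A x z)" by simp
  qed (use u(1) xz y E_mem[OF A] in simp_all)
  then show ?thesis using u(1) by blast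
qed

lemma E_Der: "E \<subseteq> Der"
proof
  fix A assume A: "A \<in> E"
  obtain B where B: "\<And>y. y \<in> V \<Longrightarrow> B y \<in> V"
    "\<And>x y z. x \<in> V \<Longrightarrow> y \<in> V \<Longrightarrow> z \<in> V \<Longrightarrow> br x (B y) z = br (A x) y z + br x y (A z) - A (br x y z)"
    using E_adjoint_exists[OF A] by metis
  show "A \<in> Der"
    by (rule DerI[OF E_endo[OF A], of B]) (simp add: adjoint_pair_def B)
qed

text \<open>
  The bound of \<open>equicontinuous_br\<close> is uniform in \<open>x\<close> and \<open>y\<close>; it extends to linear combinations and then to
  limits.
\<close>

lemma equicontinuous:
  assumes l: "l \<in> dual"
  shows "\<exists>F\<subseteq>dual. finite F \<and> (\<forall>A\<in>E. \<forall>z\<in>ker F. l (A z) = 0)"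
proof -
  obtain F where F: "F \<subseteq> dual" "finite F" "\<forall>x\<in>V. \<forall>y\<in>V. \<forall>z\<in>ker F. l (br x y z) = 0"
    using equicontinuous_br[OF l] by blast
  have B: "l (B z) = 0" if "B \<in> Lspan T" "z \<in> ker F" for B z
    using that(1)
  proof (induction rule: Lspan_induct)
    case (Lop x y)
    then show ?case using F(3) that(2) by (simp add: ker_def)
  next
    case (add A B)
    then show ?case using endoD(6)[OF Lie.D_endo] by (simp add: dual_simps[OF l])
  next
    case (scale c A)
    then show ?case using endoD(6)[OF Lie.D_endo] by (simp add: dual_simps[OF l])
  qed (simp add: dual_simps[OF l])
  have "l (A z) = 0" if A: "A \<in> E" and z: "z \<in> ker F" for A z
  proof -
    have "{(z, l)} \<subseteq> V \<times> dual" using z l by (simp add: ker_def)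
    then obtain C where C: "C \<in> Lspan T" "agree {(z, l)} C A" by (rule E_approx[OF A]) simp
    then show ?thesis using B[OF C(1) z] agreeD[OF C(2), of z l] by simp
  qed
  then show ?thesis using F(1,2) by blast
qed

lemma locally_constant_near:
  assumes f: "continuous_map X \<tau> f" and F: "F \<subseteq> dual" "finite F" and q: "q \<in> topspace X"
  shows "\<exists>U. openin X U \<and> q \<in> U \<and> (\<forall>r\<in>U. f r - f q \<in> ker F)"
proof -
  have lc: "locally_constant X (\<lambda>q. l (f q))" if "l \<in> F" for l
    using continuous_locally_constant[OF f subsetD[OF F(1) that]] .
  have "\<exists>U. openin X U \<and> q \<in> U \<and> (\<forall>r\<in>U. \<forall>l\<in>F. l (f q) = l (f r))"
    by (rule locally_constant_finite[OF F(2) _ q]) (rule lc)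
  then obtain U where U: "openin X U" "q \<in> U" "\<forall>r\<in>U. \<forall>l\<in>F. l (f q) = l (f r)"
    by (elim exE conjE) (rule that)
  have "f r - f q \<in> ker F" if r: "r \<in> U" for r
  proof -
    have m: "f r \<in> V" "f q \<in> V" using continuous_mem[OF f] r U(1) openin_subset q by blast+
    have "l (f r - f q) = 0" if "l \<in> F" for l
      using bspec[OF bspec[OF U(3) r] that] dual_simps(5)[OF subsetD[OF F(1) that] m] by simp
    then show ?thesis using m by (simp add: ker_def)
  qed
  then show ?thesis using U(1,2) by blast
qed

text \<open>
  Pointwise convergence \<open>a q \<rightarrow> a q\<^sub>0\<close> and convergence \<open>f q \<rightarrow> f q\<^sub>0\<close> only give convergence of \<open>a q (f q)\<close>
  because the operators are equicontinuous: \<open>a q (f q - f q\<^sub>0)\<close> is uniformly small.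
\<close>

lemma continuous_eval:
  assumes a: "\<And>q. q \<in> topspace X \<Longrightarrow> a q \<in> E" "\<And>v. v \<in> V \<Longrightarrow> continuous_map X \<tau> (\<lambda>q. a q v)"
    and f: "continuous_map X \<tau> f"
  shows "continuous_map X \<tau> (\<lambda>q. a q (f q))"
  unfolding continuous_iff
proof (intro conjI ballI)
  show "(\<lambda>q. a q (f q)) \<in> topspace X \<rightarrow> V"
    using E_mem[OF a(1) continuous_mem[OF f]] by (intro funcsetI)
  fix l assume l: "l \<in> dual"
  obtain F where F: "F \<subseteq> dual" "finite F" "\<forall>A\<in>E. \<forall>z\<in>ker F. l (A z) = 0" using equicontinuous[OF l] by (elim exE conjE) (rule that)
  show "locally_constant X (\<lambda>q. l (a q (f q)))"
    unfolding locally_constant_iff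
  proof
    fix q assume q: "q \<in> topspace X"
    obtain U where U: "openin X U" "q \<in> U" "\<forall>r\<in>U. f r - f q \<in> ker F"
      using locally_constant_near[OF f F(1,2) q] by (elim exE conjE) (rule that)
    have fq: "f q \<in> V" using continuous_mem[OF f q] .
    obtain W where W: "openin X W" "q \<in> W" "\<forall>r\<in>W. l (a q (f q)) = l (a r (f q))"
      using continuous_locally_constant[OF a(2)[OF fq] l, unfolded locally_constant_iff, rule_format, OF q]
      by (elim exE conjE) (rule that)
    have "l (a q (f q)) = l (a r (f r))" if r: "r \<in> U \<inter> W" for r
    proof -
      have rX: "r \<in> topspace X" using r U(1) openin_subset by blast
      have e: "endo (a r)" by (rule E_endo[OF a(1)[OF rX]])
      have fr: "f r \<in> V" using continuous_mem[OF f rX] .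
      have "l (a r (f r - f q)) = 0" using F(3) U(3) a(1)[OF rX] r by blast
      then have "l (a r (f r)) = l (a r (f q))"
        using endoD(5)[OF e fr fq] endoD(6)[OF e] by (simp add: dual_simps(5)[OF l])
      then show ?thesis using W(3) r by simp
    qed
    then show "\<exists>U. openin X U \<and> q \<in> U \<and> (\<forall>r\<in>U. l (a q (f q)) = l (a r (f r)))"
      using U(1,2) W(1,2) by (intro exI[of _ "U \<inter> W"]) (simp add: openin_Int)
  qed
qed

text \<open>
  Elements of the closure are continuous, by \<open>continuous_eval\<close> for a constant family.
\<close>

lemma dual_comp_E:
  assumes "A \<in> E" "l \<in> dual"
  shows "(\<lambda>v. l (A v)) \<in> dual"
proof -
  have "continuous_map \<tau> \<tau> (\<lambda>v. A v)"
  proof (rule continuous_eval[where a = "\<lambda>_. A"])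
    show "continuous_map \<tau> \<tau> (\<lambda>_. A v)" if "v \<in> V" for v
      by (rule continuous_const[OF E_mem[OF assms(1) that]])
  qed (rule assms(1), rule continuous_map_id[unfolded id_def])
  then have "locally_constant \<tau> (\<lambda>v. l (A v))" by (rule continuous_locally_constant) fact
  then show ?thesis
    unfolding dual_def linear_map_def
    using endoD(1,2,6)[OF E_endo[OF assms(1)]] by (simp add: dual_simps[OF assms(2)])
qed

text \<open>
  The closure is a Lie algebra of derivations.  A commutator \<open>[A,B]\<close> is approximated by commutators
  \<open>[A,B']\<close> with \<open>B'\<close> in the span, which lie in the span by \<open>Der_commutator_Lspan\<close>; only one of the two
  operators has to be approximated.
\<close>

sublocale closed: derivation_algebra T E
proof unfold_locales
  show "vf.subspace E"
  proof (rule vf.subspaceI)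
    show "0 \<in> E" using Lspan_E Lie.D_0 by blast
    show "A + B \<in> E" if AB: "A \<in> E" "B \<in> E" for A B
    proof (rule E_I)
      show "(A + B) z = 0" if z: "z \<notin> V" for z using E_outside[OF AB(1) z] E_outside[OF AB(2) z] by simp
      show "(A + B) z \<in> V" if z: "z \<in> V" for z using E_mem[OF AB(1) z] E_mem[OF AB(2) z] by simp
      fix F assume F: "F \<subseteq> V \<times> dual" "finite F"
      obtain A' where A': "A' \<in> Lspan T" "agree F A' A" by (rule E_approx[OF AB(1) F])
      obtain B' where B': "B' \<in> Lspan T" "agree F B' B" by (rule E_approx[OF AB(2) F])
      have eq: "l ((A' + B') v) = l ((A + B) v)" if vl: "(v, l) \<in> F" for v l
      proof -
        have v: "v \<in> V" and l: "l \<in> dual" using F(1) vl by auto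
        show ?thesis
          using agreeD[OF A'(2) vl] agreeD[OF B'(2) vl] endoD(6)[OF Lie.D_endo[OF A'(1)]] endoD(6)[OF Lie.D_endo[OF B'(1)]]
            E_mem[OF AB(1) v] E_mem[OF AB(2) v] by (simp add: dual_simps(1)[OF l])
      qed
      show "\<exists>D\<in>Lspan T. agree F D (A + B)"
        by (rule bexI[OF _ Lie.D_add[OF A'(1) B'(1)]], rule agreeI, rule eq)
    qed
    show "(\<lambda>z. s c (A z)) \<in> E" if A: "A \<in> E" for c A
    proof (rule E_I)
      show "s c (A z) = 0" if "z \<notin> V" for z using E_outside[OF A that] by simp
      show "s c (A z) \<in> V" if "z \<in> V" for z using E_mem[OF A that] by simp
      fix F assume F: "F \<subseteq> V \<times> dual" "finite F"
      obtain A' where A': "A' \<in> Lspan T" "agree F A' A" by (rule E_approx[OF A F])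
      have eq: "l (s c (A' v)) = l (s c (A v))" if vl: "(v, l) \<in> F" for v l
      proof -
        have v: "v \<in> V" and l: "l \<in> dual" using F(1) vl by auto
        show ?thesis
          using agreeD[OF A'(2) vl] endoD(6)[OF Lie.D_endo[OF A'(1)]] E_mem[OF A v] by (simp add: dual_simps(2)[OF l])
      qed
      show "\<exists>D\<in>Lspan T. agree F D (\<lambda>z. s c (A z))"
        by (rule bexI[OF _ Lie.D_scale[OF A'(1), of c]], rule agreeI, rule eq)
    qed
  qed
  show "E \<subseteq> Der" by (rule E_Der)
  show "Lop T x y \<in> E" if "x \<in> V" "y \<in> V" for x y using Lspan_Lop[OF that] Lspan_E by blast
  show "(A \<circ> B) - (B \<circ> A) \<in> E" if AB: "A \<in> E" "B \<in> E" for A B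
  proof (rule E_I)
    note e = endoD[OF E_endo[OF AB(1)]] endoD[OF E_endo[OF AB(2)]]
    show "((A \<circ> B) - (B \<circ> A)) z = 0" if "z \<notin> V" for z using that by (simp add: e)
    show "((A \<circ> B) - (B \<circ> A)) z \<in> V" if "z \<in> V" for z using that by (simp add: e)
    fix F assume F: "F \<subseteq> V \<times> dual" "finite F"
    \<comment> \<open>the values of \<open>B\<close> that enter \<open>l (A (B v))\<close> and \<open>l (B (A v))\<close>\<close>
    let ?S = "(\<lambda>(v, l). (v, \<lambda>w. l (A w))) ` F \<union> (\<lambda>(v, l). (A v, l)) ` F"
    have S: "?S \<subseteq> V \<times> dual" "finite ?S" using F dual_comp_E[OF AB(1)] e(6) by auto
    obtain B' where B': "B' \<in> Lspan T" "agree ?S B' B" by (rule E_approx[OF AB(2) S])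
    have eq: "l (((A \<circ> B') - (B' \<circ> A)) v) = l (((A \<circ> B) - (B \<circ> A)) v)" if vl: "(v, l) \<in> F" for v l
    proof -
      have l: "l \<in> dual" using F(1) vl by auto
      have "l (A (B' v)) = l (A (B v))" by (rule agreeD[OF B'(2), of v "\<lambda>w. l (A w)"]) (use vl in force)
      moreover have "l (B' (A v)) = l (B (A v))" by (rule agreeD[OF B'(2)]) (use vl in force)
      ultimately show ?thesis
        using endoD(6)[OF Lie.D_endo[OF B'(1)]] by (simp add: dual_simps(5)[OF l] e)
    qed
    have m: "(A \<circ> B') - (B' \<circ> A) \<in> Lspan T"
      using Der_commutator_Lspan[OF subsetD[OF E_Der AB(1)] B'(1)] .
    show "\<exists>D\<in>Lspan T. agree F D ((A \<circ> B) - (B \<circ> A))"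
      by (rule bexI[OF _ m], rule agreeI, rule eq)
  qed
qed

text \<open>
  By \<open>compact_by_br\<close> it suffices that \<open>[x, adj (a q) (f q), z]\<close> depends continuously on \<open>q\<close>.  The adjoint
  identity expresses it by values of \<open>a q\<close>, which are continuous by \<open>continuous_eval\<close>.
\<close>

lemma continuous_adj:
  assumes a: "\<And>q. q \<in> topspace X \<Longrightarrow> a q \<in> E" "\<And>v. v \<in> V \<Longrightarrow> continuous_map X \<tau> (\<lambda>q. a q v)"
    and f: "continuous_map X \<tau> f"
  shows "continuous_map X \<tau> (\<lambda>q. adj (a q) (f q))"
proof -
  let ?M = "{(\<lambda>u. cnj (l (br x u z))) | l x z. l \<in> dual \<and> x \<in> V \<and> z \<in> V}"
  have "\<tau> = weak_topology V ?M" using compact_by_br unfolding compact_by_def by (elim conjE)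
  moreover have "continuous_map X (weak_topology V ?M) (\<lambda>q. adj (a q) (f q))"
    unfolding continuous_map_weak_topology
  proof (intro conjI ballI)
    have D: "a q \<in> Der" if "q \<in> topspace X" for q using a(1)[OF that] E_Der by blast
    show "(\<lambda>q. adj (a q) (f q)) \<in> topspace X \<rightarrow> V" using DerD(3)[OF D] by (intro funcsetI)
    fix m assume "m \<in> ?M"
    then obtain l x z where m: "m = (\<lambda>u. cnj (l (br x u z)))" and l: "l \<in> dual" and xz: "x \<in> V" "z \<in> V"
      unfolding mem_Collect_eq by (elim exE conjE) (rule that)
    have "continuous_map X \<tau> (\<lambda>q. br (a q x) (f q) z + br x (f q) (a q z) - a q (br x (f q) z))"
      by (rule continuous_diff[OF continuous_add[OF continuous_br[OF a(2)[OF xz(1)] f continuous_const[OF xz(2)]]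
              continuous_br[OF continuous_const[OF xz(1)] f a(2)[OF xz(2)]]]
            continuous_eval[OF a(1) a(2) continuous_br[OF continuous_const[OF xz(1)] f continuous_const[OF xz(2)]]]])
    note lc = continuous_locally_constant[OF this l]
    have "locally_constant X (\<lambda>q. cnj (l (br (a q x) (f q) z + br x (f q) (a q z) - a q (br x (f q) z))))"
      by (rule locally_constant_combine[where f = "\<lambda>a _. cnj a", OF lc lc])
    then show "locally_constant X (\<lambda>q. m (adj (a q) (f q)))"
    proof (rule locally_constant_cong)
      fix q assume q: "q \<in> topspace X"
      have "a q (br x (f q) z) = br (a q x) (f q) z - br x (adj (a q) (f q)) z + br x (f q) (a q z)"
        by (rule adjointD(2)[OF DerD(2)[OF D[OF q]] xz(1) continuous_mem[OF f q] xz(2)])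
      then have "br (a q x) (f q) z + br x (f q) (a q z) - a q (br x (f q) z) = br x (adj (a q) (f q)) z" by simp
      then show "cnj (l (br (a q x) (f q) z + br x (f q) (a q z) - a q (br x (f q) z))) = m (adj (a q) (f q))"
        unfolding m by simp
    qed
  qed
  ultimately show ?thesis by simp
qed

end

section \<open>Linear compactness passes from the 3-algebra to the Lie superalgebra\<close>

context zero_center_N6
begin

lemma unphi_form: "form \<psi> \<Longrightarrow> unphi \<psi> \<in> V" "form \<psi> \<Longrightarrow> phi T (unphi \<psi>) = \<psi>"
  unfolding form_iff[symmetric] by (rule unphi_closed phi_unphi; assumption)+

lemma unphi_add:
  assumes "form \<psi>" "form \<eta>"
  shows "unphi (\<psi> + \<eta>) = unphi \<psi> + unphi \<eta>"
proof -
  obtain x where x: "x \<in> V" "\<psi> = phi T x" using assms(1) by (rule formE)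
  obtain y where y: "y \<in> V" "\<eta> = phi T y" using assms(2) by (rule formE)
  have "unphi (phi T (x + y)) = x + y" using x(1) y(1) by simp
  then show ?thesis unfolding x(2) y(2) phi_add[OF x(1) y(1)] using x(1) y(1) by simp
qed

lemma unphi_scale:
  assumes "form \<psi>"
  shows "unphi (\<lambda>v w. s c (\<psi> v w)) = s (cnj c) (unphi \<psi>)"
proof -
  obtain x where x: "x \<in> V" "\<psi> = phi T x" using assms(1) by (rule formE)
  have "unphi (phi T (s (cnj c) x)) = s (cnj c) x" using x(1) by simp
  then show ?thesis unfolding x(2) phi_scale[OF x(1)] using x(1) by simp
qed

end

context lin_compact_N6
begin

abbreviation "LG \<equiv> lcar closed.G"

abbreviation "\<tau>G \<equiv> lie_topology T \<tau> LG"

lemma LG_subset: "LG \<subseteq> {(z, A, \<psi>). z \<in> V \<and> (\<forall>v\<in>V. A v \<in> V) \<and> form \<psi>}"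
  by (rule subsetI, erule closed.lcar_E) (simp add: E_mem)

lemmas topspace_LG = lie_topology_continuous(1)[OF topspace_\<tau> LG_subset]
  and continuous_LG = lie_topology_continuous(2)[OF topspace_\<tau> LG_subset]

text \<open>
  Coordinate functionals on the three components; the conjugation in \<open>at_1\<close> compensates that \<open>x \<mapsto> \<phi>\<^sub>x\<close> is
  antilinear.
\<close>

definition at_m1 :: "('a \<Rightarrow> complex) \<Rightarrow> 'a lie_elem \<Rightarrow> complex" where
  "at_m1 l u = l (fst u)"

definition at_0 :: "'a \<Rightarrow> ('a \<Rightarrow> complex) \<Rightarrow> 'a lie_elem \<Rightarrow> complex" where
  "at_0 v l u = l (fst (snd u) v)"

definition at_1 :: "('a \<Rightarrow> complex) \<Rightarrow> 'a lie_elem \<Rightarrow> complex" where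
  "at_1 l u = cnj (l (unphi (snd (snd u))))"

definition coords :: "('a lie_elem \<Rightarrow> complex) set" where
  "coords = at_m1 ` dual \<union> (\<lambda>(v, l). at_0 v l) ` (V \<times> dual) \<union> at_1 ` dual"

lemma coordsI: "l \<in> dual \<Longrightarrow> at_m1 l \<in> coords" "v \<in> V \<Longrightarrow> l \<in> dual \<Longrightarrow> at_0 v l \<in> coords"
  "l \<in> dual \<Longrightarrow> at_1 l \<in> coords"
  unfolding coords_def by auto

lemma coordsE:
  assumes "m \<in> coords"
  obtains (m1) l where "l \<in> dual" "m = at_m1 l"
    | (zero) v l where "v \<in> V" "l \<in> dual" "m = at_0 v l"
    | (one) l where "l \<in> dual" "m = at_1 l"
  using assms unfolding coords_def by auto

lemma coords_functional:
  assumes "m \<in> coords"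
  shows "functional (lie_scale s) LG m"
  unfolding linear_map_def
proof (intro conjI allI ballI)
  fix x y assume xy: "x \<in> LG" "y \<in> LG"
  obtain z A \<psi> where x: "x = (z, A, \<psi>)" "z \<in> V" "A \<in> E" "form \<psi>" using xy(1) by (rule closed.lcar_E)
  obtain z' A' \<psi>' where y: "y = (z', A', \<psi>')" "z' \<in> V" "A' \<in> E" "form \<psi>'" using xy(2) by (rule closed.lcar_E)
  show "m (x + y) = m x + m y"
    using assms
  proof (cases rule: coordsE)
    case (m1 l)
    then show ?thesis by (simp add: x y at_m1_def dual_simps(1)[OF m1(1)])
  next
    case (zero v l)
    then show ?thesis
      by (simp add: x y at_0_def dual_simps(1)[OF zero(2) E_mem[OF x(3) zero(1)] E_mem[OF y(3) zero(1)]])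
  next
    case (one l)
    then show ?thesis
      by (simp add: x y at_1_def unphi_add dual_simps(1)[OF one(1) unphi_form(1)[OF x(4)] unphi_form(1)[OF y(4)]])
  qed
next
  fix c x assume x: "x \<in> LG"
  obtain z A \<psi> where x: "x = (z, A, \<psi>)" "z \<in> V" "A \<in> E" "form \<psi>" using x by (rule closed.lcar_E)
  show "m (lie_scale s c x) = c * m x"
    using assms
  proof (cases rule: coordsE)
    case (m1 l)
    then show ?thesis by (simp add: x lie_scale_def at_m1_def dual_simps(2)[OF m1(1)])
  next
    case (zero v l)
    then show ?thesis
      by (simp add: x lie_scale_def at_0_def dual_simps(2)[OF zero(2) E_mem[OF x(3) zero(1)]])
  next
    case (one l)
    then show ?thesis
      by (simp add: x lie_scale_def at_1_def unphi_scale dual_simps(2)[OF one(1) unphi_form(1)[OF x(4)]])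
  qed
qed

lemma locally_constant_cnj: "locally_constant X a \<Longrightarrow> locally_constant X (\<lambda>q. cnj (a q))"
  by (rule locally_constant_combine[where f = "\<lambda>a _. cnj a"])

lemma \<tau>G_weak: "\<tau>G = weak_topology LG coords"
proof (rule topology_eqI)
  show "topspace \<tau>G = topspace (weak_topology LG coords)" unfolding topspace_LG by simp
  show "continuous_map \<tau>G (weak_topology LG coords) id"
    unfolding continuous_map_weak_topology
  proof (intro conjI ballI)
    show "id \<in> topspace \<tau>G \<rightarrow> LG" unfolding topspace_LG by simp
    note c = continuous_LG[THEN iffD1, THEN conjunct2, OF continuous_map_id]
    fix m assume "m \<in> coords"
    then show "locally_constant \<tau>G (\<lambda>p. m (id p))"
    proof (cases rule: coordsE)
      case (m1 l)
      show ?thesis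
        using continuous_locally_constant[OF c[THEN conjunct1] m1(1)] unfolding m1(2) at_m1_def by simp
    next
      case (zero v l)
      show ?thesis
        using continuous_locally_constant[OF c[THEN conjunct2, THEN conjunct1, rule_format, OF zero(1)] zero(2)]
        unfolding zero(3) at_0_def by simp
    next
      case (one l)
      show ?thesis
        using locally_constant_cnj[OF continuous_locally_constant[OF c[THEN conjunct2, THEN conjunct2] one(1)]]
        unfolding one(2) at_1_def by simp
    qed
  qed
  let ?W = "weak_topology LG coords"
  have W: "\<exists>z A \<psi>. q = (z, A, \<psi>) \<and> z \<in> V \<and> A \<in> E \<and> form \<psi>" if "q \<in> topspace ?W" for q
    using that by (auto elim: closed.lcar_E)
  show "continuous_map ?W \<tau>G id"
    unfolding continuous_LG
  proof (intro conjI ballI)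
    show "id \<in> topspace ?W \<rightarrow> LG" by simp
    show "continuous_map ?W \<tau> (\<lambda>q. fst (id q))"
      unfolding continuous_iff
    proof (intro conjI ballI)
      show "(\<lambda>q. fst (id q)) \<in> topspace ?W \<rightarrow> V" using W by fastforce
      show "locally_constant ?W (\<lambda>q. l (fst (id q)))" if "l \<in> dual" for l
        using locally_constant_weak_topology[OF coordsI(1)[OF that], of LG] unfolding at_m1_def by simp
    qed
    show "continuous_map ?W \<tau> (\<lambda>q. fst (snd (id q)) v)" if v: "v \<in> V" for v
      unfolding continuous_iff
    proof (intro conjI ballI)
      show "(\<lambda>q. fst (snd (id q)) v) \<in> topspace ?W \<rightarrow> V" using W E_mem v by fastforce
      show "locally_constant ?W (\<lambda>q. l (fst (snd (id q)) v))" if "l \<in> dual" for l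
        using locally_constant_weak_topology[OF coordsI(2)[OF v that], of LG] unfolding at_0_def by simp
    qed
    show "continuous_map ?W \<tau> (\<lambda>q. unphi (snd (snd (id q))))"
      unfolding continuous_iff
    proof (intro conjI ballI)
      show "(\<lambda>q. unphi (snd (snd (id q)))) \<in> topspace ?W \<rightarrow> V" using W unphi_form(1) by fastforce
      show "locally_constant ?W (\<lambda>q. l (unphi (snd (snd (id q)))))" if "l \<in> dual" for l
        using locally_constant_cnj[OF locally_constant_weak_topology[OF coordsI(3)[OF that], of LG]]
        unfolding at_1_def by simp
    qed
  qed
qed

text \<open>
  The equations of \<open>K\<close> that only involve the component \<open>p u\<close> have a solution in \<open>T\<close>.  The map \<open>h\<close> is the
  identity, or complex conjugation for the component of degree 1.
\<close>

lemma solve_along_projection: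
  assumes K: "finitely_solvable U K" and p: "\<And>u. u \<in> U \<Longrightarrow> p u \<in> V" and h: "inj h"
  shows "\<exists>a\<in>V. \<forall>l\<in>dual. \<forall>c. ((\<lambda>u. h (l (p u))), h c) \<in> K \<longrightarrow> l a = c"
proof -
  let ?S = "{(l, c). l \<in> dual \<and> ((\<lambda>u. h (l (p u))), h c) \<in> K}"
  have sol: "finitely_solvable V ?S"
  proof (rule finitely_solvableI)
    fix F assume F: "F \<subseteq> ?S" "finite F"
    let ?F = "(\<lambda>(l, c). ((\<lambda>u. h (l (p u))), h c)) ` F"
    have "?F \<subseteq> K" "finite ?F" using F by auto
    then obtain u where u: "u \<in> U" "solves u ?F" by (rule finitely_solvableD[OF K])
    have "l (p u) = c" if lc: "(l, c) \<in> F" for l c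
    proof -
      have "((\<lambda>u. h (l (p u))), h c) \<in> ?F" using imageI[OF lc, of "\<lambda>(l, c). ((\<lambda>u. h (l (p u))), h c)"] by simp
      then have "h (l (p u)) = h c" by (rule solvesD[OF u(2)])
      then show ?thesis by (rule injD[OF h])
    qed
    then have "solves (p u) F" by (rule solvesI)
    then show "\<exists>x\<in>V. solves x F" using p[OF u(1)] by (rule bexI)
  qed
  have d: "m \<in> dual" if "(m, c) \<in> ?S" for m c using that by simp
  obtain a where a: "a \<in> V" "solves a ?S"
    by (rule compact_by_solve[OF compact dualD(1)[OF d] dualD(2)[OF d] sol])
  have "l a = c" if "l \<in> dual" "((\<lambda>u. h (l (p u))), h c) \<in> K" for l c
    by (rule solvesD[OF a(2)]) (simp add: that)
  then show ?thesis using a(1) by (intro bexI ballI allI impI)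
qed

text \<open>
  A finitely solvable system, extended to prescribe all coordinates, is solved componentwise: for the
  components of degrees -1 and 1, and separately for each value of the operator in degree 0.  The
  operator obtained from these values agrees on finitely many coordinates with an element of the closure,
  so it belongs to the closure.  For the span instead of the closure this last step can fail.
\<close>

lemma compact_LG: "compact_by (lie_scale s) LG \<tau>G coords"
proof (rule compact_byI[OF closed.cspace_G _ \<tau>G_weak])
  show "functional (lie_scale s) LG m" if "m \<in> coords" for m using that by (rule coords_functional)
next
  fix u assume u: "u \<in> LG" and 0: "\<And>m. m \<in> coords \<Longrightarrow> m u = 0"
  obtain z A \<psi> where x: "u = (z, A, \<psi>)" "z \<in> V" "A \<in> E" "form \<psi>" using u by (rule closed.lcar_E)
  have "z = 0"
  proof (rule dual_eqI[OF x(2)])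
    show "l z = l 0" if "l \<in> dual" for l
      using 0[OF coordsI(1)[OF that]] by (simp add: at_m1_def x(1) dual_simps(3)[OF that])
  qed simp
  moreover have "A v = 0" for v
  proof (cases "v \<in> V")
    case True
    show ?thesis
    proof (rule dual_eqI[OF E_mem[OF x(3) True]])
      show "l (A v) = l 0" if "l \<in> dual" for l
        using 0[OF coordsI(2)[OF True that]] by (simp add: at_0_def x(1) dual_simps(3)[OF that])
    qed simp
  qed (rule E_outside[OF x(3)])
  moreover have "unphi \<psi> = 0"
  proof (rule dual_eqI[OF unphi_form(1)[OF x(4)]])
    show "l (unphi \<psi>) = l 0" if "l \<in> dual" for l
      using 0[OF coordsI(3)[OF that]] by (simp add: at_1_def x(1) dual_simps(3)[OF that])
  qed simp
  then have "\<psi> = 0" using unphi_form(2)[OF x(4)] by simp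
  ultimately show "u = 0" unfolding x(1) by (simp add: zero_prod_def fun_eq_iff)
next
  fix H assume H: "H \<subseteq> coords \<times> UNIV" "finitely_solvable LG H"
  have "\<exists>K. H \<subseteq> K \<and> finitely_solvable LG K \<and> coords \<subseteq> fst ` K"
    by (rule finitely_solvable_extend[OF closed.cspace_G _ H]) (rule coords_functional)
  then obtain K where K: "H \<subseteq> K" "finitely_solvable LG K" "coords \<subseteq> fst ` K"
    by (elim exE conjE) (rule that)
  have G: "fst u \<in> V" "v \<in> V \<Longrightarrow> fst (snd u) v \<in> V" "unphi (snd (snd u)) \<in> V" "fst (snd u) \<in> E" if u: "u \<in> LG" for u v
    using u by (auto elim!: closed.lcar_E simp: E_mem unphi_form)
  have id: "inj (\<lambda>c :: complex. c)" "inj cnj" by (simp_all add: inj_def)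
  note abs = at_m1_def[abs_def] at_0_def[abs_def] at_1_def[abs_def]
  have "\<exists>a\<in>V. \<forall>l\<in>dual. \<forall>c. (at_m1 l, c) \<in> K \<longrightarrow> l a = c"
    unfolding abs by (rule solve_along_projection[where p = fst, OF K(2) G(1) id(1)])
  then obtain z where z: "z \<in> V" "\<forall>l\<in>dual. \<forall>c. (at_m1 l, c) \<in> K \<longrightarrow> l z = c"
    by (elim bexE) (rule that)
  have "\<exists>a\<in>V. \<forall>l\<in>dual. \<forall>c. (at_0 v l, c) \<in> K \<longrightarrow> l a = c" if v: "v \<in> V" for v
    unfolding abs by (rule solve_along_projection[where p = "\<lambda>u. fst (snd u) v", OF K(2) G(2)[OF _ v] id(1)])
  then have "\<forall>v\<in>V. \<exists>a. a \<in> V \<and> (\<forall>l\<in>dual. \<forall>c. (at_0 v l, c) \<in> K \<longrightarrow> l a = c)"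
    unfolding Bex_def by (intro ballI)
  from bchoice[OF this] obtain a
    where a: "\<forall>v\<in>V. a v \<in> V \<and> (\<forall>l\<in>dual. \<forall>c. (at_0 v l, c) \<in> K \<longrightarrow> l (a v) = c)"
    by (elim exE) (rule that)
  have "\<exists>a\<in>V. \<forall>l\<in>dual. \<forall>c. (at_1 l, cnj c) \<in> K \<longrightarrow> l a = c"
    unfolding abs by (rule solve_along_projection[where p = "\<lambda>u. unphi (snd (snd u))", OF K(2) G(3) id(2)])
  then obtain x where x: "x \<in> V" "\<forall>l\<in>dual. \<forall>c. (at_1 l, cnj c) \<in> K \<longrightarrow> l x = c"
    by (elim bexE) (rule that)
  let ?A = "\<lambda>v. if v \<in> V then a v else 0"
  have A: "?A \<in> E"
  proof (rule E_I)
    show "?A v = 0" if "v \<notin> V" for v using that by simp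
    show "?A v \<in> V" if "v \<in> V" for v using that a by simp
    fix F assume F: "F \<subseteq> V \<times> dual" "finite F"
    let ?F = "(\<lambda>(v, l). (at_0 v l, l (a v))) ` F"
    have "?F \<subseteq> K"
    proof (rule image_subsetI)
      fix p assume p: "p \<in> F"
      obtain v l where vl: "p = (v, l)" "v \<in> V" "l \<in> dual" using F(1) p by (cases p) auto
      obtain c where c: "(at_0 v l, c) \<in> K" using K(3) coordsI(2)[OF vl(2,3)] by fastforce
      have "l (a v) = c" using a[rule_format, OF vl(2), THEN conjunct2, rule_format, OF vl(3) c] .
      then show "(case p of (v, l) \<Rightarrow> (at_0 v l, l (a v))) \<in> K" using c by (simp add: vl(1))
    qed
    moreover have "finite ?F" using F(2) by simp
    ultimately obtain u where u: "u \<in> LG" "solves u ?F" by (rule finitely_solvableD[OF K(2)])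
    obtain B where B: "B \<in> Lspan T" "agree F B (fst (snd u))" by (rule E_approx[OF G(4)[OF u(1)] F])
    have "l (B v) = l (?A v)" if vl: "(v, l) \<in> F" for v l
    proof -
      have "(at_0 v l, l (a v)) \<in> ?F" using imageI[OF vl, of "\<lambda>(v, l). (at_0 v l, l (a v))"] by simp
      then have "at_0 v l u = l (a v)" by (rule solvesD[OF u(2)])
      then show ?thesis using agreeD[OF B(2) vl] subsetD[OF F(1) vl] by (simp add: at_0_def)
    qed
    then have "agree F B ?A" by (rule agreeI)
    then show "\<exists>B\<in>Lspan T. agree F B ?A" using B(1) by (rule bexI)
  qed
  let ?u = "(z, ?A, phi T x)"
  have "solves ?u H"
  proof (rule solvesI)
    fix m c assume mc: "(m, c) \<in> H"
    then have mK: "(m, c) \<in> K" and "m \<in> coords" using K(1) H(1) by auto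
    from this(2) show "m ?u = c"
    proof (cases rule: coordsE)
      case (m1 l)
      then show ?thesis using z(2)[rule_format, OF m1(1)] mK by (simp add: at_m1_def)
    next
      case (zero v l)
      then show ?thesis
        using a[rule_format, OF zero(1), THEN conjunct2, rule_format, OF zero(2)] mK by (simp add: at_0_def)
    next
      case (one l)
      have "l x = cnj c" by (rule x(2)[rule_format, OF one(1)]) (use mK one(2) in simp)
      then show ?thesis using x(1) one(2) by (simp add: at_1_def)
    qed
  qed
  moreover have "?u \<in> LG" unfolding closed.lcar_G using z(1) A form_phi[OF x(1)] by (intro conjI)
  ultimately show "\<exists>u\<in>LG. solves u H" by (rule bexI)
qed

text \<open>
  The components of a bracket are built from evaluations of operators, the 3-bracket and, in degree 1,
  adjoints: \<open>[A, \<phi>\<^sub>x] = - \<phi>\<^bsub>adj A x\<^esub>\<close>.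
\<close>

lemma continuous_bracket: "continuous_map (prod_topology \<tau>G \<tau>G) \<tau>G (\<lambda>(u, w). lie_bracket u w)"
proof -
  let ?X = "prod_topology \<tau>G \<tau>G"
  define z A x where "z = (\<lambda>q :: 'a lie_elem \<times> 'a lie_elem. fst (fst q))"
    and "A = (\<lambda>q :: 'a lie_elem \<times> 'a lie_elem. fst (snd (fst q)))"
    and "x = (\<lambda>q :: 'a lie_elem \<times> 'a lie_elem. unphi (snd (snd (fst q))))"
  define z' A' x' where "z' = (\<lambda>q :: 'a lie_elem \<times> 'a lie_elem. fst (snd q))"
    and "A' = (\<lambda>q :: 'a lie_elem \<times> 'a lie_elem. fst (snd (snd q)))"
    and "x' = (\<lambda>q :: 'a lie_elem \<times> 'a lie_elem. unphi (snd (snd (snd q))))"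
  note d = continuous_LG[of ?X fst, THEN iffD1, OF continuous_map_fst, THEN conjunct2]
    continuous_LG[of ?X snd, THEN iffD1, OF continuous_map_snd, THEN conjunct2]
  have cz: "continuous_map ?X \<tau> z" "continuous_map ?X \<tau> z'"
    using d[THEN conjunct1] unfolding z_def z'_def .
  have cA: "continuous_map ?X \<tau> (\<lambda>q. A q v)" "continuous_map ?X \<tau> (\<lambda>q. A' q v)" if "v \<in> V" for v
    using d[THEN conjunct2, THEN conjunct1, rule_format, OF that] unfolding A_def A'_def .
  have cx: "continuous_map ?X \<tau> x" "continuous_map ?X \<tau> x'"
    using d[THEN conjunct2, THEN conjunct2] unfolding x_def x'_def .
  have LG: "\<exists>a B y. u = (a, B, phi T y) \<and> a \<in> V \<and> B \<in> E \<and> y \<in> V" if u: "u \<in> LG" for u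
  proof -
    obtain a B \<psi> where x: "u = (a, B, \<psi>)" "a \<in> V" "B \<in> E" "form \<psi>" using u by (rule closed.lcar_E)
    obtain y where "y \<in> V" "\<psi> = phi T y" using x(4) by (rule formE)
    then show ?thesis using x by blast
  qed
  have q: "fst q = (z q, A q, phi T (x q))" "snd q = (z' q, A' q, phi T (x' q))"
    "z q \<in> V" "A q \<in> E" "x q \<in> V" "z' q \<in> V" "A' q \<in> E" "x' q \<in> V" if "q \<in> topspace ?X" for q
    using LG[of "fst q"] LG[of "snd q"] that
    by (auto simp: z_def A_def x_def z'_def A'_def x'_def topspace_LG)
  have E: "A q \<in> E" "A' q \<in> E" if "q \<in> topspace ?X" for q using q(4,7)[OF that] .
  have br: "(case q of (u, w) \<Rightarrow> lie_bracket u w) =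
      (A q (z' q) - A' q (z q), (A q \<circ> A' q) - (A' q \<circ> A q) + phi T (x q) (z' q) + phi T (x' q) (z q),
       phi T (adj (A' q) (x q) - adj (A q) (x' q)))" if qX: "q \<in> topspace ?X" for q
  proof -
    note q = q[OF qX]
    have D: "A q \<in> Der" "A' q \<in> Der" using q(4,7) E_Der by blast+
    have "act01 (A q) (phi T (x' q)) - act01 (A' q) (phi T (x q)) = phi T (adj (A' q) (x q) - adj (A q) (x' q))"
      unfolding act01_phi[OF D(1) q(8)] act01_phi[OF D(2) q(5)] phi_diff[OF DerD(3)[OF D(2)] DerD(3)[OF D(1)]]
      by simp
    then show ?thesis by (simp add: case_prod_beta q(1,2) lie_bracket_def)
  qed
  show ?thesis
    unfolding continuous_LG
  proof (intro conjI ballI)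
    show "(\<lambda>(u, w). lie_bracket u w) \<in> topspace ?X \<rightarrow> LG"
      using closed.bracket_closed by (auto simp: topspace_LG)
    show "continuous_map ?X \<tau> (\<lambda>q. fst (case q of (u, w) \<Rightarrow> lie_bracket u w))"
    proof (rule continuous_map_eq)
      show "continuous_map ?X \<tau> (\<lambda>q. A q (z' q) - A' q (z q))"
        by (rule continuous_diff[OF continuous_eval[OF E(1) cA(1) cz(2)] continuous_eval[OF E(2) cA(2) cz(1)]])
    qed (simp add: br)
    show "continuous_map ?X \<tau> (\<lambda>q. fst (snd (case q of (u, w) \<Rightarrow> lie_bracket u w)) v)" if v: "v \<in> V" for v
    proof (rule continuous_map_eq)
      show "continuous_map ?X \<tau> (\<lambda>q. A q (A' q v) - A' q (A q v) - br (z' q) (x q) v - br (z q) (x' q) v)"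
        by (rule continuous_diff[OF continuous_diff[OF continuous_diff[OF
                continuous_eval[OF E(1) cA(1) cA(2)[OF v]] continuous_eval[OF E(2) cA(2) cA(1)[OF v]]]
              continuous_br[OF cz(2) cx(1) continuous_const[OF v]]]
              continuous_br[OF cz(1) cx(2) continuous_const[OF v]]])
    qed (simp add: br q v)
    show "continuous_map ?X \<tau> (\<lambda>q. unphi (snd (snd (case q of (u, w) \<Rightarrow> lie_bracket u w))))"
    proof (rule continuous_map_eq)
      show "continuous_map ?X \<tau> (\<lambda>q. adj (A' q) (x q) - adj (A q) (x' q))"
        by (rule continuous_diff[OF continuous_adj[OF E(2) cA(2) cx(1)] continuous_adj[OF E(1) cA(1) cx(2)]])
      show "adj (A' q) (x q) - adj (A q) (x' q) = unphi (snd (snd (case q of (u, w) \<Rightarrow> lie_bracket u w)))"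
        if "q \<in> topspace ?X" for q
      proof -
        have "A q \<in> Der" "A' q \<in> Der" using q(4,7)[OF that] E_Der by blast+
        then have "adj (A' q) (x q) - adj (A q) (x' q) \<in> V" using DerD(3) by simp
        then show ?thesis by (simp add: br[OF that])
      qed
    qed
  qed
qed

theorem lin_compact_Lie_closed: "lin_compact_lsa (Lie_closed T \<tau>) (lie_topology T \<tau> (lcar (Lie_closed T \<tau>)))"
proof -
  have "Lie_closed T \<tau> = closed.G" by (simp add: Lie_closed_def)
  then show ?thesis
    using closed.lie_superalgebra_G compact_by_imp_lin_compact[OF compact_LG] continuous_bracket
    by (simp add: lin_compact_lsa_def)
qed

end

section \<open>The correspondence\<close>

theorem theorem2p5:
  fixes T :: "'a::ab_group_add alg3"
  assumes N6: "physical_N6 T"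
    and center: "center3 T = {0}"
  shows "
   \<comment> \<open>(a)\<close>
   (z_graded_lie_superalgebra (Lie T) \<and> consistent_grading (Lie T) \<and> short_grading (Lie T) \<and>
    ideals_meet_ends (Lie T) \<and> ends_generate (Lie T)) \<and>
   \<comment> \<open>(b)\<close>
   (graded_conjugation (Lie T) (lie_sigma T) \<and>
    (\<forall>x\<in>tcar T. \<forall>y\<in>tcar T. \<forall>z\<in>tcar T.
       in_m1 (tbr T x y z) =
         lbr (Lie T) (lbr (Lie T) (in_m1 x) (lie_sigma T (in_m1 y))) (in_m1 z))) \<and>
   \<comment> \<open>(c): well defined and injective on isomorphism classes, then surjective\<close>
   (\<forall>T' :: 'b::ab_group_add alg3.
      physical_N6 T' \<and> center3 T' = {0} \<longrightarrow>
      (iso3 T T' \<longleftrightarrow> iso_pair (Lie T) (lie_sigma T) (Lie T') (lie_sigma T'))) \<and>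
   (\<forall>(g :: 'c::ab_group_add lsa) \<sigma>.
      z_graded_lie_superalgebra g \<and> consistent_grading g \<and> short_grading g \<and>
      ideals_meet_ends g \<and> ends_generate g \<and> graded_conjugation g \<sigma> \<longrightarrow>
      (\<exists>T' :: 'c alg3.
         physical_N6 T' \<and> center3 T' = {0} \<and> iso_pair (Lie T') (lie_sigma T') g \<sigma>)) \<and>
   \<comment> \<open>(d)\<close>
   (simple3 T \<longleftrightarrow> simple_lsa (Lie T)) \<and>
   (fin_dim (tscl T) (tcar T) \<longleftrightarrow> fin_dim (lscl (Lie T)) (lcar (Lie T))) \<and>
   (\<forall>\<tau>. topspace \<tau> = tcar T \<longrightarrow>
      (lin_compact_alg3 T \<tau> \<longleftrightarrow>
       lin_compact_lsa (Lie_closed T \<tau>) (lie_topology T \<tau> (lcar (Lie_closed T \<tau>)))) \<and>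
      (lin_compact_lsa (Lie T) (lie_topology T \<tau> (lcar (Lie T))) \<longrightarrow> lin_compact_alg3 T \<tau>))"
proof -
  interpret zero_center_N6 T using N6 center by unfold_locales
  have a: "z_graded_lie_superalgebra (Lie T) \<and> consistent_grading (Lie T) \<and> short_grading (Lie T) \<and>
      ideals_meet_ends (Lie T) \<and> ends_generate (Lie T)"
    using Lie.lie_superalgebra_G Lie.z_graded_G Lie.consistent_G Lie.short_G ideals_meet_ends_Lie ends_generate_Lie
    unfolding z_graded_lie_superalgebra_def Lie_def by (intro conjI)
  have b: "\<forall>x\<in>V. \<forall>y\<in>V. \<forall>z\<in>V. in_m1 (br x y z) =
      lbr (Lie T) (lbr (Lie T) (in_m1 x) (lie_sigma T (in_m1 y))) (in_m1 z)"
    by (intro ballI) (rule recover_bracket)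
  have c: "iso3 T T' \<longleftrightarrow> iso_pair (Lie T) (lie_sigma T) (Lie T') (lie_sigma T')"
    if T': "physical_N6 T' \<and> center3 T' = {0}" for T' :: "'b alg3"
  proof
    have Z: "zero_center_N6 T'" using T' by (simp add: zero_center_N6_def)
    show "iso3 T T'" if "iso_pair (Lie T) (lie_sigma T) (Lie T') (lie_sigma T')"
      by (rule iso_pair_imp_iso3[OF zero_center_N6_axioms Z that])
    assume "iso3 T T'"
    then obtain f where "bij_betw f (tcar T) (tcar T')" "linear_map (tcar T) (tscl T) (tscl T') f"
      "\<forall>x\<in>tcar T. \<forall>y\<in>tcar T. \<forall>z\<in>tcar T. f (tbr T x y z) = tbr T' (f x) (f y) (f z)"
      unfolding iso3_def by (elim exE conjE) (rule that)
    then have "alg3_iso T T' f"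
      by (intro alg3_iso.intro zero_center_N6_axioms Z alg3_iso_axioms.intro) simp_all
    then show "iso_pair (Lie T) (lie_sigma T) (Lie T') (lie_sigma T')" by (rule alg3_iso.iso_pair_Lie)
  qed
  have c': "\<exists>T' :: 'c alg3. physical_N6 T' \<and> center3 T' = {0} \<and> iso_pair (Lie T') (lie_sigma T') g \<sigma>"
    if g: "z_graded_lie_superalgebra g \<and> consistent_grading g \<and> short_grading g \<and>
      ideals_meet_ends g \<and> ends_generate g \<and> graded_conjugation g \<sigma>" for g :: "'c lsa" and \<sigma>
    by (rule every_pair_is_Lie) (use g in \<open>simp add: conjugate_lsa_def z_graded_lie_superalgebra_def\<close>)
  have d: "lin_compact_alg3 T \<tau> \<longleftrightarrow>
      lin_compact_lsa (Lie_closed T \<tau>) (lie_topology T \<tau> (lcar (Lie_closed T \<tau>)))"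
    "lin_compact_lsa (Lie T) (lie_topology T \<tau> (lcar (Lie T))) \<longrightarrow> lin_compact_alg3 T \<tau>"
    if top: "topspace \<tau> = V" for \<tau>
  proof -
    have V: "A v \<in> V" if A: "A \<in> Lspan_closed T \<tau>" and v: "v \<in> V" for A v
    proof -
      have "restrict A V \<in> topspace (product_topology (\<lambda>_. \<tau>) V)"
        using A[unfolded Lspan_closed_def mem_Collect_eq, THEN conjunct2]
        by (rule subsetD[OF closure_of_subset_topspace])
      then have "restrict A V v \<in> V" using v unfolding topspace_product_topology top by (rule PiE_mem)
      then show ?thesis using v by simp
    qed
    have "lin_compact_alg3 T \<tau>" if "lin_compact_lsa (Lie_closed T \<tau>) (lie_topology T \<tau> (lcar (Lie_closed T \<tau>)))"
      using that unfolding Lie_closed_def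
      by (rule lin_compact_descends[where D = "Lspan_closed T \<tau>", OF top, rotated]) (rule V)
    moreover have "lin_compact_lsa (Lie_closed T \<tau>) (lie_topology T \<tau> (lcar (Lie_closed T \<tau>)))"
      if "lin_compact_alg3 T \<tau>"
    proof -
      interpret lin_compact_N6 T \<tau> using that by unfold_locales
      show ?thesis by (rule lin_compact_Lie_closed)
    qed
    ultimately show "lin_compact_alg3 T \<tau> \<longleftrightarrow>
      lin_compact_lsa (Lie_closed T \<tau>) (lie_topology T \<tau> (lcar (Lie_closed T \<tau>)))" by (intro iffI)
    have "lin_compact_alg3 T \<tau>" if "lin_compact_lsa (Lie T) (lie_topology T \<tau> (lcar (Lie T)))"
      using that unfolding Lie_def
      by (rule lin_compact_descends[where D = "Lspan T", OF top, rotated]) (rule endoD(6)[OF Lie.D_endo])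
    then show "lin_compact_lsa (Lie T) (lie_topology T \<tau> (lcar (Lie T))) \<longrightarrow> lin_compact_alg3 T \<tau>"
      by (rule impI)
  qed
  have c_all: "\<forall>T' :: 'b alg3. physical_N6 T' \<and> center3 T' = {0} \<longrightarrow>
      (iso3 T T' \<longleftrightarrow> iso_pair (Lie T) (lie_sigma T) (Lie T') (lie_sigma T'))"
    by (intro allI impI) (rule c)
  have c'_all: "\<forall>(g :: 'c lsa) \<sigma>. z_graded_lie_superalgebra g \<and> consistent_grading g \<and> short_grading g \<and>
      ideals_meet_ends g \<and> ends_generate g \<and> graded_conjugation g \<sigma> \<longrightarrow>
      (\<exists>T' :: 'c alg3. physical_N6 T' \<and> center3 T' = {0} \<and> iso_pair (Lie T') (lie_sigma T') g \<sigma>)"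
    by (intro allI impI) (rule c')
  have d_all: "\<forall>\<tau>. topspace \<tau> = V \<longrightarrow>
      (lin_compact_alg3 T \<tau> \<longleftrightarrow>
       lin_compact_lsa (Lie_closed T \<tau>) (lie_topology T \<tau> (lcar (Lie_closed T \<tau>)))) \<and>
      (lin_compact_lsa (Lie T) (lie_topology T \<tau> (lcar (Lie T))) \<longrightarrow> lin_compact_alg3 T \<tau>)"
    by (intro allI impI conjI[OF d])
  show ?thesis
    by (rule conjI[OF a conjI[OF conjI[OF graded_conjugation_Lie b] conjI[OF c_all conjI[OF c'_all
            conjI[OF simple_iff conjI[OF fin_dim_iff d_all]]]]]])
qed

end
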